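(* Let $\mu$ be a probability measure with $\mu((0,\infty))=1$, let $\overline\mu(s)=\mu([s,\infty))$, define $\psi_\mu:[0,\infty)\to[0,\infty]$ by $$\psi_\mu(y)=-\int_{[0,y)}W(s)\,d\big(\log\overline\mu(s)\big),$$ let $\varphi_\mu$ be its right-continuous inverse, and $T_\mu=\inf\{t>0:\ X_t\ge\varphi_\mu(L_t)\}$. Then $T_\mu$ is an almost surely finite, minimal stopping time with $X_{T_\mu}\sim\mu$ (it solves problem (S)), and $\sup_{t\le T_\mu}X_t=X_{T_\mu}$.
   Context: $X=(X_t)_{t\ge0}$ is a spectrally negative Lévy process (no positive jumps) without monotone paths, on a filtered probability space $(\Omega,\mathcal F,\mathbf F,P)$ with $\mathbf F$ the completed natural filtration of $X$, $X_0=0$ under $P$. Its Laplace exponent is $\psi(\theta)=t^{-1}\log E[e^{\theta X_t}]$, $\theta\ge0$. Standing assumption: $X$ has unbounded variation and does not drift to $-\infty$. The scale function $W:\mathbb R\to[0,\infty)$ is zero on $(-\infty,0)$, continuous and increasing on $[0,\infty)$, with $\int_0^\infty e^{-\theta x}W(x)dx=1/\psi(\theta)$ for $\theta$ larger than the largest root of $\psi$. $L_t$ is the local time of $X$ at $0$. Problem (S): find an almost surely finite $\mathbf F$-stopping time $T$ with $X_T\sim\mu$ which is minimal, i.e. any stopping time $R\le T$ with $X_R\sim X_T$ satisfies $R=T$ a.s. *)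

theory Defs
  imports "HOL-Probability.Probability"
begin

definition cadlag :: "(real \<Rightarrow> real) \<Rightarrow> bool" where
  "cadlag f \<longleftrightarrow> (\<forall>t\<ge>0. continuous (at_right t) f) \<and> (\<forall>t>0. \<exists>l. (f \<longlongrightarrow> l) (at_left t))"

definition no_positive_jumps :: "(real \<Rightarrow> real) \<Rightarrow> bool" where
  "no_positive_jumps f \<longleftrightarrow> (\<forall>t>0. \<forall>l. (f \<longlongrightarrow> l) (at_left t) \<longrightarrow> f t \<le> l)"

definition infinite_variation_on :: "(real \<Rightarrow> real) \<Rightarrow> real \<Rightarrow> bool" where
  "infinite_variation_on f t \<longleftrightarrow>
     (\<forall>B::real. \<exists>(n::nat) (p::nat \<Rightarrow> real). p 0 = 0 \<and> p n = t \<and> (\<forall>i<n. p i \<le> p (Suc i)) \<and>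
        (\<Sum>i<n. \<bar>f (p (Suc i)) - f (p i)\<bar>) > B)"

definition levy_process :: "'a measure \<Rightarrow> (real \<Rightarrow> 'a \<Rightarrow> real) \<Rightarrow> bool" where
  "levy_process M X \<longleftrightarrow>
     prob_space M \<and>
     (\<forall>t\<ge>0. X t \<in> borel_measurable M) \<and>
     (AE \<omega> in M. X 0 \<omega> = 0) \<and>
     (AE \<omega> in M. cadlag (\<lambda>t. X t \<omega>)) \<and>
     (\<forall>(n::nat) (ts::nat \<Rightarrow> real). 0 \<le> ts 0 \<and> (\<forall>i<n. ts i < ts (Suc i)) \<longrightarrow>
        prob_space.indep_vars M (\<lambda>_. borel) (\<lambda>i \<omega>. X (ts (Suc i)) \<omega> - X (ts i) \<omega>) {..<n}) \<and>
     (\<forall>s t. 0 \<le> s \<longrightarrow> 0 \<le> t \<longrightarrow>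
        distr M borel (\<lambda>\<omega>. X (s + t) \<omega> - X s \<omega>) = distr M borel (X t))"

definition spectrally_negative_levy :: "'a measure \<Rightarrow> (real \<Rightarrow> 'a \<Rightarrow> real) \<Rightarrow> bool" where
  "spectrally_negative_levy M X \<longleftrightarrow>
     levy_process M X \<and>
     (AE \<omega> in M. no_positive_jumps (\<lambda>t. X t \<omega>)) \<and>
     \<not> (AE \<omega> in M. mono_on {0..} (\<lambda>t. X t \<omega>)) \<and>
     \<not> (AE \<omega> in M. antimono_on {0..} (\<lambda>t. X t \<omega>))"

definition unbounded_variation :: "'a measure \<Rightarrow> (real \<Rightarrow> 'a \<Rightarrow> real) \<Rightarrow> bool" where
  "unbounded_variation M X \<longleftrightarrow> (AE \<omega> in M. \<forall>t>0. infinite_variation_on (\<lambda>s. X s \<omega>) t)"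

definition drifts_to_minus_infinity :: "'a measure \<Rightarrow> (real \<Rightarrow> 'a \<Rightarrow> real) \<Rightarrow> bool" where
  "drifts_to_minus_infinity M X \<longleftrightarrow> (AE \<omega> in M. filterlim (\<lambda>t. X t \<omega>) at_bot at_top)"

text \<open>Laplace exponent psi(theta) = log E[exp(theta X_1)] (independent of t for a Levy process).\<close>
definition laplace_exponent :: "'a measure \<Rightarrow> (real \<Rightarrow> 'a \<Rightarrow> real) \<Rightarrow> real \<Rightarrow> real" where
  "laplace_exponent M X \<theta> = ln (integral\<^sup>L M (\<lambda>\<omega>. exp (\<theta> * X 1 \<omega>)))"

definition largest_root :: "'a measure \<Rightarrow> (real \<Rightarrow> 'a \<Rightarrow> real) \<Rightarrow> real" where
  "largest_root M X = Sup {\<theta>. 0 \<le> \<theta> \<and> laplace_exponent M X \<theta> = 0}"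

definition scale_function :: "'a measure \<Rightarrow> (real \<Rightarrow> 'a \<Rightarrow> real) \<Rightarrow> (real \<Rightarrow> real) \<Rightarrow> bool" where
  "scale_function M X W \<longleftrightarrow>
     (\<forall>x<0. W x = 0) \<and> (\<forall>x. 0 \<le> W x) \<and> continuous_on {0..} W \<and> mono_on {0..} W \<and>
     (\<forall>\<theta>>largest_root M X.
        (\<integral>\<^sup>+ x\<in>{0..}. ennreal (exp (- \<theta> * x) * W x) \<partial>lborel) = ennreal (1 / laplace_exponent M X \<theta>))"

text \<open>Local time at 0, normalised as occupation density:
  L_t = lim_{e -> 0+} (1/(2e)) Leb{s in [0,t] : |X_s| < e}, a.s. for all t.\<close>
definition local_time_at_zero :: "'a measure \<Rightarrow> (real \<Rightarrow> 'a \<Rightarrow> real) \<Rightarrow> (real \<Rightarrow> 'a \<Rightarrow> real) \<Rightarrow> bool" where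
  "local_time_at_zero M X L \<longleftrightarrow>
     (AE \<omega> in M. \<forall>t\<ge>0.
        ((\<lambda>e. measure lborel {s\<in>{0..t}. \<bar>X s \<omega>\<bar> < e} / (2 * e)) \<longlongrightarrow> L t \<omega>) (at_right 0))"

definition natural_filtration :: "'a measure \<Rightarrow> (real \<Rightarrow> 'a \<Rightarrow> real) \<Rightarrow> real \<Rightarrow> 'a set set" where
  "natural_filtration M X t =
     sigma_sets (space M) (\<Union>s\<in>{0..t}. {X s -` B \<inter> space M | B. B \<in> sets borel})"

definition completed_filtration :: "'a measure \<Rightarrow> (real \<Rightarrow> 'a \<Rightarrow> real) \<Rightarrow> real \<Rightarrow> 'a set set" where
  "completed_filtration M X t =
     {A. A \<subseteq> space M \<and> (\<exists>B\<in>natural_filtration M X t. \<exists>N\<in>null_sets M. (A - B) \<union> (B - A) \<subseteq> N)}"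

definition is_stopping_time :: "'a measure \<Rightarrow> (real \<Rightarrow> 'a \<Rightarrow> real) \<Rightarrow> ('a \<Rightarrow> ereal) \<Rightarrow> bool" where
  "is_stopping_time M X T \<longleftrightarrow>
     (\<forall>\<omega>\<in>space M. 0 \<le> T \<omega>) \<and>
     (\<forall>t\<ge>0. {\<omega>\<in>space M. T \<omega> \<le> ereal t} \<in> completed_filtration M X t)"

definition stopped :: "(real \<Rightarrow> 'a \<Rightarrow> real) \<Rightarrow> ('a \<Rightarrow> ereal) \<Rightarrow> 'a \<Rightarrow> real" where
  "stopped X T \<omega> = X (real_of_ereal (T \<omega>)) \<omega>"

definition solves_S :: "'a measure \<Rightarrow> (real \<Rightarrow> 'a \<Rightarrow> real) \<Rightarrow> real measure \<Rightarrow> ('a \<Rightarrow> ereal) \<Rightarrow> bool" where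
  "solves_S M X \<mu> T \<longleftrightarrow>
     is_stopping_time M X T \<and>
     (AE \<omega> in M. T \<omega> < \<infinity>) \<and>
     stopped X T \<in> borel_measurable (completion M) \<and>
     distr (completion M) borel (stopped X T) = \<mu> \<and>
     (\<forall>R. is_stopping_time M X R \<and> (AE \<omega> in M. R \<omega> \<le> T \<omega>) \<and>
          distr (completion M) borel (stopped X R) = distr (completion M) borel (stopped X T)
          \<longrightarrow> (AE \<omega> in M. R \<omega> = T \<omega>))"

definition mu_bar :: "real measure \<Rightarrow> real \<Rightarrow> real" where
  "mu_bar \<mu> s = measure \<mu> {s..}"

definition neg_log_mu_bar :: "real measure \<Rightarrow> real \<Rightarrow> ennreal" where
  "neg_log_mu_bar \<mu> s = (if mu_bar \<mu> s > 0 then ennreal (- ln (mu_bar \<mu> s)) else \<top>)"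

text \<open>Lebesgue-Stieltjes measure of the left-continuous nondecreasing function -log mubar:
  the measure of [a,b) is (-log mubar)(b) - (-log mubar)(a).\<close>
definition neg_log_mu_bar_measure :: "real measure \<Rightarrow> real measure" where
  "neg_log_mu_bar_measure \<mu> =
     extend_measure UNIV {(a, b). a < b} (\<lambda>(a, b). {a..<b})
       (\<lambda>(a, b). neg_log_mu_bar \<mu> b - neg_log_mu_bar \<mu> a)"

definition psi_mu :: "(real \<Rightarrow> real) \<Rightarrow> real measure \<Rightarrow> real \<Rightarrow> ennreal" where
  "psi_mu W \<mu> y = (\<integral>\<^sup>+ s\<in>{0..<y}. ennreal (W s) \<partial>neg_log_mu_bar_measure \<mu>)"

definition phi_mu :: "(real \<Rightarrow> real) \<Rightarrow> real measure \<Rightarrow> real \<Rightarrow> ereal" where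
  "phi_mu W \<mu> l = Inf {ereal y | y. 0 \<le> y \<and> psi_mu W \<mu> y > ennreal l}"

definition T_mu :: "(real \<Rightarrow> 'a \<Rightarrow> real) \<Rightarrow> (real \<Rightarrow> real) \<Rightarrow> (real \<Rightarrow> 'a \<Rightarrow> real) \<Rightarrow> real measure \<Rightarrow> 'a \<Rightarrow> ereal" where
  "T_mu X W L \<mu> \<omega> = Inf {ereal t | t. 0 < t \<and> phi_mu W \<mu> (L t \<omega>) \<le> ereal (X t \<omega>)}"

end

theory Submission
  imports Defs "HOL-Complex_Analysis.Complex_Analysis"
begin

text \<open>
  Let \<open>b\<close> be the right-continuous inverse of \<open>\<psi>\<^sub>\<mu>\<close>, so that \<open>T\<^sub>\<mu>\<close> is the first time at which
  \<open>X\<close> exceeds \<open>b(L)\<close>. The process \<open>W(X) - L\<close> is a martingale; this is obtained by approximating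
  the local time by occupation times of small windows around \<open>0\<close>, whose compensators are
  averages of \<open>W\<close>. Optional stopping at the minimum of \<open>T\<^sub>\<mu>\<close> and an inverse local time
  shows that \<open>L\<close> at \<open>T\<^sub>\<mu>\<close> has hazard rate \<open>1 / W(b)\<close>, because \<open>W(X)\<close> vanishes at inverse local
  times and equals \<open>W(b(L))\<close> at the passage, which is continuous in the absence of positive jumps.
  Substituting \<open>s = \<psi>\<^sub>\<mu>(y)\<close> turns the cumulative hazard into the negative logarithm of \<open>\<mu>[y,\<infinity>)\<close>,
  hence \<open>X\<close> at \<open>T\<^sub>\<mu>\<close> has law \<open>\<mu>\<close>. Before \<open>T\<^sub>\<mu>\<close> the process stays strictly below its value
  at \<open>T\<^sub>\<mu>\<close>; this gives the statement on the supremum, and it gives minimality because a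
  random variable dominated by another one with the same law is almost surely equal to it.
\<close>

section \<open>Measures, Laplace transforms and paths without positive jumps\<close>

text \<open>Why \<open>W(X) - L\<close> is a martingale: for fixed \<open>t\<close> both sides of
  the Dynkin identity for \<open>W\<close>, read as measures in the starting point, have Laplace
  transform \<open>exp (t * \<psi> \<theta>) / \<psi> \<theta>\<close>. Passing to the limit needs
  exponential moments of \<open>X\<close>, which exist because a path without positive jumps must
  climb level by level. Local time is given only as a limit of occupation densities, so its
  continuity, adaptedness and positivity right after time 0 have to be derived; continuity comes
  from second moments of increments over fine grids. Two obstacles shape the rest. The barrier is
  only right-continuous and so is not known to be met at the limit of approximate passages; this is
  settled by quasi-left-continuity and by the vanishing of \<open>X\<close> at points of increase of
  \<open>L\<close>. And if the barrier starts at 0, the rate \<open>1 / W(b)\<close> may be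
  unbounded near 0 and positivity of the passage time is in doubt; barriers raised to a positive
  height have positive passage times and survival functions bounded below uniformly. Finally
  \<open>X\<close> and \<open>L\<close> are regular only almost surely, so the argument runs on
  modified versions over the completed measure.\<close>

lemma norm_exp_mult_minus_one_le:
  fixes h :: complex and x r :: real
  assumes "r > 0" "norm h <= r"
  shows "norm (exp (h * x) - 1) <= norm h * (exp (2 * r * \<bar>x\<bar>) / r)"
proof -
  have "norm (exp (h * x) - 1) <= norm (h * x) * exp (norm (h * x))"
    using Taylor_exp_field[of "h * x" 0] by (simp add: mult.commute)
  also have "... <= (norm h * \<bar>x\<bar>) * exp (r * \<bar>x\<bar>)"
    using assms by (auto simp: norm_mult intro!: mult_left_mono mult_right_mono)
  also have "... <= (norm h * (exp (r * \<bar>x\<bar>) / r)) * exp (r * \<bar>x\<bar>)"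
  proof -
    \<comment> \<open>A second exponential absorbs the factor |x|, so the final bound is an
      exponential and its integrability reduces to exponential moments.\<close>
    have "r * \<bar>x\<bar> <= exp (r * \<bar>x\<bar>)"
      using exp_ge_add_one_self[of "r * \<bar>x\<bar>"] by linarith
    then have "\<bar>x\<bar> <= exp (r * \<bar>x\<bar>) / r"
      using assms by (simp add: field_simps)
    then show ?thesis
      by (intro mult_right_mono mult_left_mono) auto
  qed
  also have "... = norm h * (exp (2 * r * \<bar>x\<bar>) / r)"
  proof -
    have "exp (2 * r * \<bar>x\<bar>) = exp (r * \<bar>x\<bar>) * exp (r * \<bar>x\<bar>)"
      by (simp add: exp_add[symmetric])
    then show ?thesis by simp
  qed
  finally show ?thesis .
qed

text \<open>Differentiation under the integral: near \<open>z\<close> all difference quotients are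
  dominated by the single integrable function \<open>D\<close>.\<close>

lemma holomorphic_moment_generating:
  fixes M :: "real measure"
  assumes [measurable_cong]: "sets M = sets borel"
    and int: "\<And>s. \<bar>s\<bar> < 1 ==> integrable M (\<lambda>x. exp (s * x))"
  shows "(\<lambda>z. \<integral>x. exp (z * complex_of_real x) \<partial>M) holomorphic_on {z. \<bar>Re z\<bar> < 1}"
proof (rule holomorphic_onI)
  fix z assume z: "z \<in> {z. \<bar>Re z\<bar> < 1}"
  \<comment> \<open>A third of the distance to the edge of the strip: the exponential bound costs
    \<open>2 * r\<close> in the exponent, and |Re z| + 2 r must stay below 1.\<close>
  define r where "r = (1 - \<bar>Re z\<bar>) / 3"
  have r: "r > 0" "\<bar>Re z\<bar> + 2 * r < 1" using z by (auto simp: r_def field_simps)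
  define D where "D x = (exp ((\<bar>Re z\<bar> + 2 * r) * x) + exp (- (\<bar>Re z\<bar> + 2 * r) * x)) / r" for x
  have D: "integrable M D"
    unfolding D_def using r int[of "\<bar>Re z\<bar> + 2 * r"] int[of "- (\<bar>Re z\<bar> + 2 * r)"]
    by (intro integrable_divide Bochner_Integration.integrable_add) auto
  have intc: "integrable M (\<lambda>x. exp (w * complex_of_real x))" if "\<bar>Re w\<bar> < 1" for w
    by (rule Bochner_Integration.integrable_bound[OF int[OF that]]) auto
  have bound: "norm ((exp (y * complex_of_real x) - exp (z * complex_of_real x)) / (y - z)) <= D x"
    if y: "y \<noteq> z" "norm (y - z) <= r" for x y
  proof -
    have "exp (y * complex_of_real x) - exp (z * complex_of_real x)
      = exp (z * complex_of_real x) * (exp ((y - z) * complex_of_real x) - 1)"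
      by (simp add: algebra_simps exp_add[symmetric])
    then have "norm ((exp (y * complex_of_real x) - exp (z * complex_of_real x)) / (y - z))
       = exp (Re z * x) * (norm (exp ((y - z) * complex_of_real x) - 1) / norm (y - z))"
      by (simp add: norm_mult norm_divide)
    also have "... <= exp (Re z * x) * (exp (2 * r * \<bar>x\<bar>) / r)"
      using norm_exp_mult_minus_one_le[OF r(1) y(2), of x] y
      by (intro mult_left_mono) (auto simp: field_simps)
    also have "... <= exp (\<bar>Re z\<bar> * \<bar>x\<bar>) * (exp (2 * r * \<bar>x\<bar>) / r)"
      using r abs_ge_self[of "Re z * x"]
      by (intro mult_right_mono) (auto simp: abs_mult)
    also have "... = exp ((\<bar>Re z\<bar> + 2 * r) * \<bar>x\<bar>) / r"
      by (simp add: exp_add[symmetric] algebra_simps)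
    also have "... <= D x"
    proof -
    have "exp ((\<bar>Re z\<bar> + 2 * r) * \<bar>x\<bar>) <= exp ((\<bar>Re z\<bar> + 2 * r) * x) + exp (- (\<bar>Re z\<bar> + 2 * r) * x)"
    proof (cases "x >= 0")
      case False
      then have "(\<bar>Re z\<bar> + 2 * r) * \<bar>x\<bar> = - (\<bar>Re z\<bar> + 2 * r) * x" by (simp add: algebra_simps)
      then show ?thesis by (metis add_increasing exp_ge_zero order_refl)
    qed simp
    then show "exp ((\<bar>Re z\<bar> + 2 * r) * \<bar>x\<bar>) / r <= D x"
      using r unfolding D_def by (intro divide_right_mono) auto
    qed
    finally show ?thesis .
  qed
  have "((\<lambda>y. ((\<integral>x. exp (y * complex_of_real x) \<partial>M) - (\<integral>x. exp (z * complex_of_real x) \<partial>M)) / (y - z))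
      \<longlongrightarrow> (\<integral>x. complex_of_real x * exp (z * complex_of_real x) \<partial>M)) (at z)"
    unfolding tendsto_at_iff_sequentially
  proof (intro allI impI, simp only: comp_def)
    fix Y :: "nat => complex" assume Y: "\<forall>i. Y i \<in> UNIV - {z}" "Y \<longlonglongrightarrow> z"
    have ev: "\<forall>\<^sub>F n in sequentially. norm (Y n - z) < r"
      using tendstoD[OF Y(2) r(1)] by (simp add: dist_norm)
    then obtain N where N: "\<And>n. n >= N ==> norm (Y n - z) < r"
      by (auto simp: eventually_sequentially)
    have "(\<lambda>n. \<integral>x. (exp (Y (n + N) * complex_of_real x) - exp (z * complex_of_real x)) / (Y (n + N) - z) \<partial>M)
      \<longlonglongrightarrow> (\<integral>x. complex_of_real x * exp (z * complex_of_real x) \<partial>M)"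
    proof (rule integral_dominated_convergence[where w=D])
      show "AE x in M. (\<lambda>n. (exp (Y (n + N) * complex_of_real x) - exp (z * complex_of_real x)) / (Y (n + N) - z))
         \<longlonglongrightarrow> complex_of_real x * exp (z * complex_of_real x)"
      proof (rule AE_I2)
        fix x
        have "((\<lambda>z. exp (z * complex_of_real x)) has_field_derivative complex_of_real x * exp (z * complex_of_real x)) (at z)"
          by (auto intro!: derivative_eq_intros)
        then have "((\<lambda>y. (exp (y * complex_of_real x) - exp (z * complex_of_real x)) / (y - z)) \<longlongrightarrow> complex_of_real x * exp (z * complex_of_real x)) (at z)"
          by (simp add: has_field_derivative_iff)
        moreover have "(\<lambda>n. Y (n + N)) \<longlonglongrightarrow> z" using Y(2) by (rule LIMSEQ_ignore_initial_segment)
        ultimately show "(\<lambda>n. (exp (Y (n + N) * complex_of_real x) - exp (z * complex_of_real x)) / (Y (n + N) - z))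
         \<longlonglongrightarrow> complex_of_real x * exp (z * complex_of_real x)"
          using Y(1) unfolding tendsto_at_iff_sequentially by (auto simp: comp_def)
      qed
      show "AE x in M. norm ((exp (Y (n + N) * complex_of_real x) - exp (z * complex_of_real x)) / (Y (n + N) - z)) <= D x" for n
        using Y(1) N[of "n + N"] by (intro AE_I2 bound) auto
    qed (use D in auto)
    moreover have "(\<integral>x. (exp (Y (n + N) * complex_of_real x) - exp (z * complex_of_real x)) / (Y (n + N) - z) \<partial>M)
       = ((\<integral>x. exp (Y (n + N) * complex_of_real x) \<partial>M) - (\<integral>x. exp (z * complex_of_real x) \<partial>M)) / (Y (n + N) - z)" for n
    proof -
      have "\<bar>Re (Y (n + N))\<bar> <= \<bar>Re z\<bar> + norm (Y (n + N) - z)"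
        using abs_Re_le_cmod[of "Y (n + N) - z"] by simp
      then have "\<bar>Re (Y (n + N))\<bar> < 1"
        using N[of "n + N"] r by simp
      then show ?thesis using z by (simp add: intc)
    qed
    ultimately have "(\<lambda>n. ((\<integral>x. exp (Y (n + N) * complex_of_real x) \<partial>M) - (\<integral>x. exp (z * complex_of_real x) \<partial>M)) / (Y (n + N) - z))
      \<longlonglongrightarrow> (\<integral>x. complex_of_real x * exp (z * complex_of_real x) \<partial>M)"
      by (simp only:)
    then show "(\<lambda>n. ((\<integral>x. exp (Y n * complex_of_real x) \<partial>M) - (\<integral>x. exp (z * complex_of_real x) \<partial>M)) / (Y n - z))
      \<longlonglongrightarrow> (\<integral>x. complex_of_real x * exp (z * complex_of_real x) \<partial>M)"
      by (rule LIMSEQ_offset)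
  qed
  then have "((\<lambda>z. \<integral>x. exp (z * complex_of_real x) \<partial>M) has_field_derivative (\<integral>x. complex_of_real x * exp (z * complex_of_real x) \<partial>M)) (at z)"
    by (rule has_field_derivative_iff[THEN iffD2])
  then have "(\<lambda>z. \<integral>x. exp (z * complex_of_real x) \<partial>M) field_differentiable at z"
    unfolding field_differentiable_def by (rule exI)
  then show "(\<lambda>z. \<integral>x. exp (z * complex_of_real x) \<partial>M) field_differentiable at z within {z. \<bar>Re z\<bar> < 1}"
    by (rule field_differentiable_at_within)
qed

text \<open>Both transforms are holomorphic on the strip and agree on a real segment, which
  accumulates at 0; analytic continuation carries the equality to the imaginary axis, where the
  transforms are characteristic functions.\<close>

lemma real_distribution_eq_if_moment_generating_eq:
  fixes M N :: "real measure"
  assumes M: "real_distribution M" and N: "real_distribution N"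
    and intM: "\<And>s. \<bar>s\<bar> < 1 ==> integrable M (\<lambda>x. exp (s * x))"
    and intN: "\<And>s. \<bar>s\<bar> < 1 ==> integrable N (\<lambda>x. exp (s * x))"
    and eq: "\<And>s. \<bar>s\<bar> < 1 ==> (\<integral>x. exp (s * x) \<partial>M) = (\<integral>x. exp (s * x) \<partial>N)"
  shows "M = N"
proof (rule Levy_uniqueness[OF M N], rule ext)
  interpret M: real_distribution M by fact
  interpret N: real_distribution N by fact
  fix t :: real
  let ?S = "{z. \<bar>Re z\<bar> < 1}"
  let ?f = "\<lambda>z. (\<integral>x. exp (z * complex_of_real x) \<partial>M) - (\<integral>x. exp (z * complex_of_real x) \<partial>N)"
  have S: "?S = {z. Re z < 1} \<inter> {z. Re z > -1}" by auto
  have "?f (\<i> * t) = 0"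
  proof (rule analytic_continuation[where f = ?f and S = ?S and U = "complex_of_real ` {-1<..<1}" and \<xi> = 0])
    show "?f holomorphic_on ?S"
      by (intro holomorphic_on_diff holomorphic_moment_generating intM intN) auto
    show "open ?S" unfolding S by (intro open_Int open_halfspace_Re_lt open_halfspace_Re_gt)
    show "connected ?S" unfolding S
      by (intro convex_connected convex_Int convex_halfspace_Re_lt convex_halfspace_Re_gt)
    show "0 islimpt complex_of_real ` {-1<..<1}"
    proof (rule islimptI)
      fix T :: "complex set" assume T: "0 \<in> T" "open T"
      then obtain e where e: "e > 0" "ball 0 e \<subseteq> T" by (auto simp: open_contains_ball)
      have "complex_of_real (min e 1 / 2) \<in> T" using e by (intro subsetD[OF e(2)]) (auto simp: dist_norm min_def)
      then show "\<exists>y\<in>complex_of_real ` {-1<..<1}. y \<in> T \<and> y \<noteq> 0"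
        using e by (intro bexI[of _ "complex_of_real (min e 1 / 2)"] conjI imageI) (auto simp: min_def)
    qed
    fix z assume "z \<in> complex_of_real ` {-1<..<1}"
    then obtain s where s: "z = complex_of_real s" "\<bar>s\<bar> < 1" by auto
    have "(\<integral>x. exp (z * complex_of_real x) \<partial>Q) = complex_of_real (\<integral>x. exp (s * x) \<partial>Q)" for Q
      unfolding s(1) integral_complex_of_real[symmetric] by (simp add: exp_of_real[symmetric])
    then show "?f z = 0" using eq[OF s(2)] by simp
  qed (simp_all, force)
  then show "char M t = char N t"
    unfolding char_def by (simp only: mult.assoc of_real_mult right_minus_eq)
qed

text \<open>The measures may have infinite mass. Tilting by \<open>exp (- x) / c\<close> makes them
  probability measures and turns finiteness for all \<theta> > 0 into finite moment generating
  functions on (-1, 1); afterwards the tilt is undone.\<close>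

lemma measure_eq_if_laplace_eq:
  fixes M N :: "real measure"
  assumes sM: "sets M = sets borel" and sN: "sets N = sets borel"
    and fin: "\<And>\<theta>. \<theta> > 0 ==> (\<integral>\<^sup>+x. ennreal (exp (- \<theta> * x)) \<partial>M) < \<infinity>"
    and eq: "\<And>\<theta>. \<theta> > 0 ==> (\<integral>\<^sup>+x. ennreal (exp (- \<theta> * x)) \<partial>M) = (\<integral>\<^sup>+x. ennreal (exp (- \<theta> * x)) \<partial>N)"
  shows "M = N"
proof -
  note [measurable_cong] = sM sN
  define c where "c = enn2real (\<integral>\<^sup>+x. ennreal (exp (- x)) \<partial>M)"
  have c: "(\<integral>\<^sup>+x. ennreal (exp (- x)) \<partial>M) = ennreal c" "(\<integral>\<^sup>+x. ennreal (exp (- x)) \<partial>N) = ennreal c"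
    using fin[of 1] eq[of 1] by (auto simp: c_def)
  have c0: "c >= 0" by (simp add: c_def)
  show ?thesis
  \<comment> \<open>The tilt divides by \<open>c\<close>; if \<open>c = 0\<close>, both measures
    vanish.\<close>
  proof (cases "c = 0")
    case True
    have zero: "emeasure Q A = 0" if "(\<integral>\<^sup>+x. ennreal (exp (- x)) \<partial>Q) = ennreal c" "sets Q = sets borel" for A Q
    proof -
      note [measurable_cong] = that(2)
      have "AE x in Q. ennreal (exp (- x)) = 0"
        using that(1) True nn_integral_0_iff_AE[of "\<lambda>x. ennreal (exp (- x))" Q] by auto
      then have "AE x in Q. x \<notin> space Q" by simp
      then have "emeasure Q (space Q) = 0" using AE_iff_null_sets[OF sets.top, of Q] by (simp add: null_sets_def)
      then show ?thesis using emeasure_space[of Q A] by simp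
    qed
    show ?thesis
      by (rule measure_eqI) (simp_all add: sM sN zero[OF c(1) sM] zero[OF c(2) sN])
  next
    case False
    then have cp: "c > 0" using c0 by simp
    define P where "P Q = density Q (\<lambda>x. ennreal (exp (- x) / c))" for Q :: "real measure"
    have P_int: "(\<integral>\<^sup>+x. ennreal (exp (s * x)) \<partial>P Q) = (\<integral>\<^sup>+x. ennreal (exp (- (1 - s) * x)) \<partial>Q) / ennreal c"
      if "sets Q = sets borel" for Q s
    proof -
      note [measurable_cong] = that
      have "(\<integral>\<^sup>+x. ennreal (exp (s * x)) \<partial>P Q) = (\<integral>\<^sup>+x. ennreal (exp (- x) / c) * ennreal (exp (s * x)) \<partial>Q)"
        unfolding P_def by (subst nn_integral_density) auto
      also have "... = (\<integral>\<^sup>+x. ennreal (exp (- (1 - s) * x)) / ennreal c \<partial>Q)"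
        using cp by (intro nn_integral_cong)
          (auto simp: ennreal_mult[symmetric] divide_ennreal exp_add[symmetric] algebra_simps)
      also have "... = (\<integral>\<^sup>+x. ennreal (exp (- (1 - s) * x)) \<partial>Q) / ennreal c"
        by (intro nn_integral_divide) auto
      finally show ?thesis .
    qed
    have rd: "real_distribution (P Q)"
      if Q: "sets Q = sets borel" "(\<integral>\<^sup>+x. ennreal (exp (- x)) \<partial>Q) = ennreal c" for Q
    proof -
      have "emeasure (P Q) (space (P Q)) = (\<integral>\<^sup>+x. ennreal (exp (0 * x)) \<partial>P Q)"
        by simp
      also have "... = 1" unfolding P_int[OF Q(1)] using Q(2) cp by (simp add: divide_ennreal)
      finally show ?thesis
        using Q(1) by (auto simp: real_distribution_def real_distribution_axioms_def P_def sets_eq_imp_space_eq intro!: prob_spaceI)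
    qed
    have intP: "integrable (P Q) (\<lambda>x. exp (s * x)) \<and>
        (\<integral>x. exp (s * x) \<partial>P Q) = enn2real ((\<integral>\<^sup>+x. ennreal (exp (- (1 - s) * x)) \<partial>M) / ennreal c)"
      if Q: "sets Q = sets borel" "(\<integral>\<^sup>+x. ennreal (exp (- (1 - s) * x)) \<partial>Q) = (\<integral>\<^sup>+x. ennreal (exp (- (1 - s) * x)) \<partial>M)" and s: "\<bar>s\<bar> < 1" for s Q
    proof -
      have [measurable]: "(\<lambda>x. exp (s * x)) \<in> borel_measurable (P Q)" using Q(1) by (simp add: P_def cong: measurable_cong_sets)
      have "(\<integral>\<^sup>+x. ennreal (exp (s * x)) \<partial>P Q) < \<infinity>"
        unfolding P_int[OF Q(1)] Q(2) using fin[of "1 - s"] s cp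
        by (auto simp: ennreal_divide_eq_top_iff top.not_eq_extremum[symmetric])
      then have "integrable (P Q) (\<lambda>x. exp (s * x))" by (intro integrableI_bounded) auto
      then show ?thesis using P_int[OF Q(1), of s] Q(2) by (simp add: integral_eq_nn_integral)
    qed
    have "P M = P N"
    proof (rule real_distribution_eq_if_moment_generating_eq)
      show "real_distribution (P M)" "real_distribution (P N)" using rd sM sN c by auto
      fix s :: real assume s: "\<bar>s\<bar> < 1"
      have e: "(\<integral>\<^sup>+x. ennreal (exp (- (1 - s) * x)) \<partial>N) = (\<integral>\<^sup>+x. ennreal (exp (- (1 - s) * x)) \<partial>M)"
        using eq[of "1 - s"] s by simp
      show "integrable (P M) (\<lambda>x. exp (s * x))" "integrable (P N) (\<lambda>x. exp (s * x))"
        "(\<integral>x. exp (s * x) \<partial>P M) = (\<integral>x. exp (s * x) \<partial>P N)"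
        using intP[OF sM refl s] intP[OF sN e s] by auto
    qed
    have inv: "density (P Q) (\<lambda>x. ennreal (c * exp x)) = Q" if Q: "sets Q = sets borel" for Q
    proof -
      note [measurable_cong] = Q
      have "density (P Q) (\<lambda>x. ennreal (c * exp x)) = density Q (\<lambda>x. ennreal (exp (- x) / c) * ennreal (c * exp x))"
        unfolding P_def by (subst density_density_eq) auto
      also have "... = density Q (\<lambda>x. 1)"
        using cp by (intro density_cong) (auto simp: ennreal_mult[symmetric] exp_minus field_simps)
      also have "... = Q" by (rule density_1)
      finally show ?thesis .
    qed
    then show ?thesis using \<open>P M = P N\<close> sM sN by metis
  qed
qed

section \<open>Convergence of expectations and of paths: analytic tools\<close>

text \<open>The L2 bound gives uniform integrability: truncation at height R changes each
  expectation by at most C / R, uniformly in n, and the truncated functions converge by dominated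
  convergence. Fatou's lemma transfers the bound to the limit.\<close>

lemma (in finite_measure) L2_bounded_imp_integral_convergent:
  fixes f :: "nat => 'a => real"
  assumes f[measurable]: "\<And>n. f n \<in> borel_measurable M" and g[measurable]: "g \<in> borel_measurable M"
    and nonneg: "\<And>n x. x \<in> space M ==> 0 <= f n x"
    and lim: "AE x in M. (\<lambda>n. f n x) \<longlonglongrightarrow> g x"
    and bound: "\<And>n. (\<integral>\<^sup>+x. ennreal ((f n x)\<^sup>2) \<partial>M) <= ennreal C"
  shows "\<And>n. integrable M (f n)" "integrable M g" "(\<lambda>n. \<integral>x. f n x \<partial>M) \<longlonglongrightarrow> (\<integral>x. g x \<partial>M)"
    "(\<integral>\<^sup>+x. ennreal ((g x)\<^sup>2) \<partial>M) <= ennreal C"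
proof -
  have sq: "integrable M h \<and> integrable M (\<lambda>x. (h x)\<^sup>2)"
    if [measurable]: "h \<in> borel_measurable M" and b: "(\<integral>\<^sup>+x. ennreal ((h x)\<^sup>2) \<partial>M) <= ennreal C" for h :: "'a => real"
  proof -
    have i: "integrable M (\<lambda>x. (h x)\<^sup>2)"
      using b by (intro integrableI_bounded) (auto simp: le_less_trans)
    have "integrable M h"
    proof (rule Bochner_Integration.integrable_bound[where f="\<lambda>x. 1 + (h x)\<^sup>2"])
      show "AE x in M. norm (h x) <= norm (1 + (h x)\<^sup>2)"
      proof (rule AE_I2)
        fix x
        have "0 <= (\<bar>h x\<bar> - 1)\<^sup>2" by simp
        then have "2 * \<bar>h x\<bar> <= 1 + (h x)\<^sup>2" by (simp add: power2_eq_square algebra_simps)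
        then show "norm (h x) <= norm (1 + (h x)\<^sup>2)" by simp
      qed
    qed (use i in auto)
    with i show ?thesis by simp
  qed
  show fi: "integrable M (f n)" for n using sq[OF f bound] by simp
  show gb: "(\<integral>\<^sup>+x. ennreal ((g x)\<^sup>2) \<partial>M) <= ennreal C"
  proof -
    have "(\<integral>\<^sup>+x. ennreal ((g x)\<^sup>2) \<partial>M) = (\<integral>\<^sup>+x. liminf (\<lambda>n. ennreal ((f n x)\<^sup>2)) \<partial>M)"
    proof (rule nn_integral_cong_AE)
      show "AE x in M. ennreal ((g x)\<^sup>2) = liminf (\<lambda>n. ennreal ((f n x)\<^sup>2))"
        using lim
      proof eventually_elim
        case (elim x)
        have "(\<lambda>n. ennreal ((f n x)\<^sup>2)) \<longlonglongrightarrow> ennreal ((g x)\<^sup>2)"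
          by (intro tendsto_ennrealI tendsto_power elim)
        then show ?case by (intro lim_imp_Liminf[symmetric]) auto
      qed
    qed
    also have "... <= liminf (\<lambda>n. \<integral>\<^sup>+x. ennreal ((f n x)\<^sup>2) \<partial>M)"
      by (intro nn_integral_liminf) auto
    also have "... <= ennreal C"
      using bound by (intro Liminf_le) auto
    finally show ?thesis .
  qed
  show gi: "integrable M g" using sq[OF g gb] by simp
  \<comment> \<open>\<open>ennreal\<close> sends negative numbers to 0, so \<open>C'\<close>
    expresses the same bound by a nonnegative real.\<close>
  define C' where "C' = max C 0"
  have C': "C' >= 0" "ennreal C = ennreal C'" by (auto simp: C'_def max_def ennreal_neg)
  have trunc: "\<bar>(\<integral>x. h x \<partial>M) - (\<integral>x. min (h x) R \<partial>M)\<bar> <= C' / R"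
    if [measurable]: "h \<in> borel_measurable M" and b: "(\<integral>\<^sup>+x. ennreal ((h x)\<^sup>2) \<partial>M) <= ennreal C" and R: "R > 0" for h :: "'a => real" and R
  proof -
    have i: "integrable M h" "integrable M (\<lambda>x. (h x)\<^sup>2)" using sq[OF that(1) b] by auto
    have im: "integrable M (\<lambda>x. min (h x) R)" using i by auto
    have sqi: "(\<integral>x. (h x)\<^sup>2 \<partial>M) <= C'"
      using b nn_integral_eq_integral[OF i(2)] C' by simp
    have "(\<integral>x. h x \<partial>M) - (\<integral>x. min (h x) R \<partial>M) = (\<integral>x. h x - min (h x) R \<partial>M)"
      using i im by simp
    also have "... <= (\<integral>x. (h x)\<^sup>2 / R \<partial>M)"
    proof (rule integral_mono)
      fix x
      show "h x - min (h x) R <= (h x)\<^sup>2 / R"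
      proof (cases "h x <= R")
        case False
        then have "h x * R <= (h x)\<^sup>2" using R by (simp add: power2_eq_square)
        then have "h x <= (h x)\<^sup>2 / R" using R by (simp add: field_simps)
        then show ?thesis using False R by (simp add: min_def)
      qed (use R in \<open>simp add: min_def\<close>)
    qed (use i im in auto)
    also have "... <= C' / R" using sqi R by (simp add: divide_right_mono)
    finally have "(\<integral>x. h x \<partial>M) - (\<integral>x. min (h x) R \<partial>M) <= C' / R" .
    moreover have "(\<integral>x. min (h x) R \<partial>M) <= (\<integral>x. h x \<partial>M)"
      by (intro integral_mono im i) auto
    ultimately show ?thesis by simp
  qed
  show "(\<lambda>n. \<integral>x. f n x \<partial>M) \<longlonglongrightarrow> (\<integral>x. g x \<partial>M)"
  proof (rule LIMSEQ_I)
    fix e :: real assume e: "e > 0"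
    define R where "R = 3 * C' / e + 1"
    have R: "R > 0" using C' e by (simp add: R_def add_nonneg_pos)
    have CR: "C' / R < e / 3"
      using C' e R unfolding R_def by (simp add: field_simps)
    have "(\<lambda>n. \<integral>x. min (f n x) R \<partial>M) \<longlonglongrightarrow> (\<integral>x. min (g x) R \<partial>M)"
    proof (rule integral_dominated_convergence[where w="\<lambda>_. R"])
      show "AE x in M. (\<lambda>n. min (f n x) R) \<longlonglongrightarrow> min (g x) R"
        using lim by eventually_elim (auto intro!: tendsto_min)
      show "AE x in M. norm (min (f n x) R) <= R" for n
        using nonneg[of _ n] R by (intro AE_I2) (auto simp: min_def)
    qed auto
    from LIMSEQ_D[OF this, of "e / 3"] e obtain N where
      N: "\<And>n. n >= N ==> \<bar>(\<integral>x. min (f n x) R \<partial>M) - (\<integral>x. min (g x) R \<partial>M)\<bar> < e / 3"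
      by auto
    have "norm ((\<integral>x. f n x \<partial>M) - (\<integral>x. g x \<partial>M)) < e" if "n >= N" for n
      using N[OF that] trunc[OF f bound R, of n] trunc[OF g gb R] CR unfolding real_norm_def by linarith
    then show "\<exists>no. \<forall>n\<ge>no. norm ((\<integral>x. f n x \<partial>M) - (\<integral>x. g x \<partial>M)) < e" by blast
  qed
qed

text \<open>Cauchy's equation with a one-sided local bound: after subtraction of the linear part,
  \<open>h\<close> vanishes at rationals and is bounded above on the half-line, so
  \<open>h <= 0\<close> by scaling; then \<open>h t + h (k - t) = 0\<close> forces
  \<open>h t = 0\<close>.\<close>

lemma additive_bounded_above_imp_linear:
  fixes g :: "real => real"
  assumes add: "\<And>s t. 0 <= s ==> 0 <= t ==> g (s + t) = g s + g t"
    and bnd: "\<And>s. 0 <= s ==> s <= d ==> g s <= K" and d: "d > 0" and t: "0 <= t"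
  shows "g t = t * g 1"
proof -
  have g0: "g 0 = 0" using add[of 0 0] by simp
  have mul: "g (real n * s) = real n * g s" if "0 <= s" for n s
    using that by (induction n) (auto simp: g0 algebra_simps add)
  define h where "h s = g s - s * g 1" for s
  have hadd: "h (s + t) = h s + h t" if "0 <= s" "0 <= t" for s t
    using add[OF that] by (simp add: h_def algebra_simps)
  have hmul: "h (real n * s) = real n * h s" if "0 <= s" for n s
    using mul[OF that] by (simp add: h_def algebra_simps)
  have hrat: "h (real m / real n) = 0" if "n > 0" for m n
  proof -
    have "real n * h (real m / real n) = h (real n * (real m / real n))" by (rule hmul[symmetric]) auto
    also have "... = h (real m * 1)" using that by simp
    also have "... = real m * h 1" by (rule hmul) auto
    also have "... = 0" by (simp add: h_def)
    finally show ?thesis using that by simp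
  qed
  obtain n :: nat where n: "n > 0" "1 / real n < d"
    using d by (metis nat_approx_posE of_nat_0_less_iff zero_less_Suc)
  define K' where "K' = K + d * \<bar>g 1\<bar>"
  have small: "h s <= K'" if "0 <= s" "s <= d" for s
  proof -
    have "- (s * g 1) <= s * \<bar>g 1\<bar>" using that(1) by (metis abs_ge_minus_self abs_mult abs_of_nonneg)
    also have "... <= d * \<bar>g 1\<bar>" using that by (intro mult_right_mono) auto
    finally show ?thesis using bnd[OF that] by (simp add: h_def K'_def)
  qed
  have hb: "h s <= K'" if "0 <= s" for s
  proof -
    define m where "m = nat \<lfloor>s * n\<rfloor>"
    have m: "real m <= s * n" "s * n < real m + 1" using that by (auto simp: m_def)
    then have "0 <= s - m / n" "s - m / n <= d"
      using n by (auto simp: field_simps)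
    then have "h (s - m / n) <= K'" by (rule small)
    moreover have "h s = h (m / n) + h (s - m / n)"
      using hadd[of "m / n" "s - m / n"] \<open>0 <= s - m / n\<close> by simp
    ultimately show ?thesis using hrat[OF n(1)] by simp
  qed
  have hneg: "h s <= 0" if "0 <= s" for s
  proof (rule ccontr)
    assume "\<not> h s <= 0"
    then obtain k :: nat where "real k * h s > K'" by (metis not_le reals_Archimedean3)
    moreover have "real k * h s <= K'" using hb[of "real k * s"] hmul[OF that] that by simp
    ultimately show False by simp
  qed
  obtain k :: nat where k: "t <= real k" using real_arch_simple by blast
  have "h (real k / real 1) = h t + h (real k - t)" using hadd[of t "real k - t"] t k by simp
  then have "h t + h (real k - t) = 0" using hrat[of 1 k] by simp
  then have "h t = 0" using hneg[OF t] hneg[of "real k - t"] k by simp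
  then show ?thesis by (simp add: h_def)
qed

text \<open>A compactness argument. Near each point v upward moves are small, since both one-sided
  limits exist and a jump at v can only go down; violating intervals of shrinking length would
  accumulate at some v.\<close>

lemma no_positive_jumps_uniform:
  assumes cad: "cadlag f" and npj: "no_positive_jumps f" and \<delta>: "\<delta> > 0"
  shows "\<exists>\<eta>>0. \<forall>s u. 0 <= s \<and> s <= u \<and> u <= t \<and> u - s < \<eta> --> f u - f s <= \<delta>"
proof -
  have point: "\<exists>r>0. \<forall>s u. 0 <= s \<and> s <= u \<and> \<bar>s - v\<bar> < r \<and> \<bar>u - v\<bar> < r --> f u - f s <= \<delta>" if v: "v >= 0" for v
  proof -
    have "(f \<longlongrightarrow> f v) (at_right v)" using cad v by (auto simp: cadlag_def continuous_within)
    from tendstoD[OF this, of "\<delta> / 2"] \<delta> obtain b where b: "b > v" "\<And>x. v < x ==> x < b ==> dist (f x) (f v) < \<delta> / 2"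
      by (auto simp: eventually_at_right_field)
    have R: "\<bar>f x - f v\<bar> < \<delta> / 2" if "v <= x" "x < b" for x
      using b(2)[of x] that \<delta> by (cases "x = v") (auto simp: dist_real_def)
    show ?thesis
    proof (cases "v = 0")
      case True
      show ?thesis
      proof (intro exI[of _ "b - v"] conjI allI impI)
        fix s u assume "0 <= s \<and> s <= u \<and> \<bar>s - v\<bar> < b - v \<and> \<bar>u - v\<bar> < b - v"
        then show "f u - f s <= \<delta>" using R[of s] R[of u] True by (simp add: abs_if split: if_splits)
      qed (use b in auto)
    next
      case False
      then obtain l where l: "(f \<longlongrightarrow> l) (at_left v)"
        using cad v False unfolding cadlag_def using less_eq_real_def[of 0 v] by blast
      have fl: "f v <= l" using npj l False v by (auto simp: no_positive_jumps_def)
      from tendstoD[OF l, of "\<delta> / 2"] \<delta> obtain a where a: "a < v" "\<And>x. a < x ==> x < v ==> dist (f x) l < \<delta> / 2"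
        by (auto simp: eventually_at_left_field)
      have L: "\<bar>f x - l\<bar> < \<delta> / 2" if "a < x" "x < v" for x
        using a(2)[of x] that by (auto simp: dist_real_def)
      show ?thesis
      proof (intro exI[of _ "min (b - v) (v - a)"] conjI allI impI)
        fix s u assume su: "0 <= s \<and> s <= u \<and> \<bar>s - v\<bar> < min (b - v) (v - a) \<and> \<bar>u - v\<bar> < min (b - v) (v - a)"
        \<comment> \<open>Only the second case sees the jump at \<open>v\<close>, and there
          \<open>f v <= l\<close> has the helpful sign.\<close>
        then consider "u < v" "s < v" | "s < v" "v <= u" | "v <= s" "v <= u" by linarith
        then show "f u - f s <= \<delta>"
        proof cases
          case 1 then show ?thesis using L[of s] L[of u] su by (simp add: abs_if split: if_splits)
        next
          case 2 then show ?thesis using L[of s] R[of u] su fl by (simp add: abs_if split: if_splits)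
        next
          case 3 then show ?thesis using R[of s] R[of u] su by (simp add: abs_if split: if_splits)
        qed
      qed (use a b in auto)
    qed
  qed
  show ?thesis
  proof (rule ccontr)
    assume neg: "\<not> ?thesis"
    have "\<exists>s u. 0 <= s \<and> s <= u \<and> u <= t \<and> u - s < 1 / real (Suc n) \<and> f u - f s > \<delta>" for n
      using neg by (auto simp: not_le dest!: spec[of _ "1 / real (Suc n)"])
    then obtain s u where su: "\<And>n. 0 <= s n" "\<And>n. s n <= u n" "\<And>n. u n <= t" "\<And>n. u n - s n < 1 / real (Suc n)"
      "\<And>n. f (u n) - f (s n) > \<delta>" by metis
    have "\<forall>n. s n \<in> {0..t}" using su(1-3) by (meson atLeastAtMost_iff order_trans)
    with compact_Icc[of 0 t] obtain v \<sigma> where v: "v \<in> {0..t}" "strict_mono \<sigma>" "(s \<circ> \<sigma>) \<longlonglongrightarrow> v"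
      unfolding compact_def by metis
    obtain r where r: "r > 0" "\<And>s u. 0 <= s ==> s <= u ==> \<bar>s - v\<bar> < r ==> \<bar>u - v\<bar> < r ==> f u - f s <= \<delta>"
      using point[of v] v(1) by auto
    have "(\<lambda>n. 1 / real (Suc n)) \<longlonglongrightarrow> 0" by (rule LIMSEQ_Suc[OF lim_1_over_n])
    then have lim0: "(\<lambda>n. 1 / real (Suc (\<sigma> n))) \<longlonglongrightarrow> 0"
      using LIMSEQ_subseq_LIMSEQ[OF _ v(2)] by (fastforce simp: comp_def)
    have "eventually (\<lambda>n. dist (s (\<sigma> n)) v < r / 2 \<and> dist (1 / real (Suc (\<sigma> n))) 0 < r / 2) sequentially"
      using tendstoD[OF v(3), of "r / 2"] tendstoD[OF lim0, of "r / 2"] r(1) by (auto simp: comp_def intro: eventually_conj)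
    then obtain n where n: "dist (s (\<sigma> n)) v < r / 2" "dist (1 / real (Suc (\<sigma> n))) 0 < r / 2"
      by (auto simp: eventually_sequentially)
    have "f (u (\<sigma> n)) - f (s (\<sigma> n)) <= \<delta>"
      using n su(1,2,4)[of "\<sigma> n"] r(1) by (intro r(2)) (auto simp: dist_real_def abs_if split: if_splits)
    with su(5)[of "\<sigma> n"] show False by simp
  qed
qed

section \<open>Spectrally negative Levy processes\<close>

lemma (in prob_space) prob_tendsto_zero_if_eventually_notin:
  assumes [measurable]: "\<And>m. B m \<in> sets M"
    and ev: "AE w in M. eventually (\<lambda>m. w \<notin> B m) sequentially"
  shows "(\<lambda>m. prob (B m)) \<longlonglongrightarrow> 0"
proof -
  have "(\<lambda>m. \<integral>w. (indicator (B m) w :: real) \<partial>M) \<longlonglongrightarrow> (\<integral>w. 0 \<partial>M)"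
  proof (rule integral_dominated_convergence[where w="\<lambda>_. 1"])
    show "AE w in M. (\<lambda>m. indicator (B m) w :: real) \<longlonglongrightarrow> 0"
      using ev by eventually_elim (auto intro!: tendsto_eventually elim: eventually_mono)
  qed (auto simp: indicator_def)
  then show ?thesis by simp
qed

text \<open>Path properties hold for every \<open>w\<close> and not merely almost everywhere;
  \<open>sn_levy_version\<close> supplies such a version on the completed space, with
  \<open>F\<close> the completed natural filtration. Independence appears twice, from the past
  sigma-algebra and along a grid; the estimate of exponential moments uses the second form.\<close>

locale sn_levy = prob_space M for M :: "'a measure" +
  fixes X :: "real => 'a => real" and F :: "real => 'a measure"
  assumes complete: "N \<in> null_sets M ==> A \<subseteq> N ==> A \<in> sets M"
    and space_F: "space (F t) = space M"
    and sets_F: "0 <= t ==> sets (F t) \<subseteq> sets M"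
    and F_mono: "0 <= s ==> s <= t ==> sets (F s) \<subseteq> sets (F t)"
    and F_null: "0 <= t ==> N \<in> null_sets M ==> N \<in> sets (F t)"
    and adapted: "0 <= t ==> X t \<in> borel_measurable (F t)"
    and X_0: "w \<in> space M ==> X 0 w = 0"
    and cadlag_path: "w \<in> space M ==> cadlag (\<lambda>t. X t w)"
    and no_positive_jumps_path: "w \<in> space M ==> no_positive_jumps (\<lambda>t. X t w)"
    and indep_past: "0 <= s ==> s <= t ==> B \<in> sets (F s) ==> C \<in> sets borel ==>
      prob (B \<inter> {w\<in>space M. X t w - X s w \<in> C}) = prob B * prob {w\<in>space M. X t w - X s w \<in> C}"
    and indep_increments: "0 <= ts 0 ==> (\<And>i. i < n ==> ts i < ts (Suc i)) ==>
      indep_vars (\<lambda>_. borel) (\<lambda>i w. X (ts (Suc i)) w - X (ts i) w) {..<n}"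
    and stationary: "0 <= s ==> 0 <= t ==>
      distr M borel (\<lambda>w. X (s + t) w - X s w) = distr M borel (X t)"
begin

lemma measurable_F_imp: "0 <= t ==> f \<in> measurable (F t) N ==> f \<in> measurable M N"
  using sets_F[of t] space_F[of t] by (auto simp: measurable_def)

lemma measurable_F_mono: "0 <= s ==> s <= t ==> f \<in> measurable (F s) N ==> f \<in> measurable (F t) N"
  using F_mono[of s t] space_F[of t] space_F[of s] by (auto simp: measurable_def)

lemma borel_measurable_X: "0 <= t ==> X t \<in> borel_measurable M"
  using measurable_F_imp[OF _ adapted] by auto

lemma right_continuous_X: "w \<in> space M ==> 0 <= t ==> ((\<lambda>s. X s w) \<longlongrightarrow> X t w) (at_right t)"
  using cadlag_path[of w] by (auto simp: cadlag_def continuous_within)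

lemma left_limit_X: "w \<in> space M ==> 0 < t ==> \<exists>l. ((\<lambda>s. X s w) \<longlongrightarrow> l) (at_left t) \<and> X t w <= l"
  using cadlag_path[of w] no_positive_jumps_path[of w] unfolding cadlag_def no_positive_jumps_def by blast

text \<open>Restricted to \<open>B\<close>, the pair of \<open>Y\<close> and the later increment has
  a product law: \<open>indep_past\<close> gives this on rectangles, and Tonelli's theorem produces
  the inner expectation.\<close>

lemma markov:
  assumes s: "0 <= s" "s <= t" and B: "B \<in> sets (F s)" and Y: "Y \<in> borel_measurable (F s)"
    and g[measurable]: "g \<in> borel_measurable (borel \<Otimes>\<^sub>M borel)"
  shows "(\<integral>\<^sup>+w. indicator B w * g (Y w :: real, X t w - X s w) \<partial>M) =
    (\<integral>\<^sup>+w. indicator B w * (\<integral>\<^sup>+w'. g (Y w, X (t - s) w') \<partial>M) \<partial>M)"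
proof -
  have [measurable]: "Y \<in> borel_measurable M" "B \<in> sets M"
    using measurable_F_imp[OF s(1) Y] sets_F[OF s(1)] B by auto
  have [measurable]: "X s \<in> borel_measurable M" "X t \<in> borel_measurable M" "X (t - s) \<in> borel_measurable M"
    using s by (auto intro: borel_measurable_X)
  define \<Delta> where "\<Delta> w = X t w - X s w" for w
  have [measurable]: "\<Delta> \<in> borel_measurable M" by (simp add: \<Delta>_def[abs_def])
  define Q where "Q = distr M borel (X (t - s))"
  have Q: "Q = distr M borel \<Delta>"
    using stationary[of s "t - s"] s by (simp add: Q_def \<Delta>_def[abs_def])
  interpret Q: prob_space Q unfolding Q_def by (rule prob_space_distr) simp
  define P where "P = density M (indicator B)"
  have setsP[measurable_cong]: "sets P = sets M" by (simp add: P_def)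
  have eP: "emeasure P A = emeasure M (A \<inter> B)" if "A \<in> sets M" for A
  proof -
    have "emeasure P A = (\<integral>\<^sup>+w. indicator B w * indicator A w \<partial>M)"
      unfolding P_def using that by (subst emeasure_density) auto
    also have "... = (\<integral>\<^sup>+w. indicator (A \<inter> B) w \<partial>M)"
      by (intro nn_integral_cong) (auto split: split_indicator)
    finally show ?thesis using that by simp
  qed
  interpret P: finite_measure P
    by (rule finite_measureI) (simp add: eP[OF sets.top] sets_eq_imp_space_eq[OF setsP])
  have spP: "space P = space M" by (simp add: P_def)
  interpret PY: finite_measure "distr P borel Y" by (rule P.finite_measure_distr) simp
  have eq: "distr P borel Y \<Otimes>\<^sub>M Q = distr P (borel \<Otimes>\<^sub>M borel) (\<lambda>w. (Y w, \<Delta> w))"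
  proof (rule pair_measure_eqI)
    show "sigma_finite_measure (distr P borel Y)" "sigma_finite_measure Q" by unfold_locales
    show "sets (distr P borel Y \<Otimes>\<^sub>M Q) = sets (distr P (borel \<Otimes>\<^sub>M borel) (\<lambda>w. (Y w, \<Delta> w)))"
      by (simp add: Q_def cong: sets_pair_measure_cong)
    fix A C assume "A \<in> sets (distr P borel Y)" "C \<in> sets Q"
    then have [measurable]: "A \<in> sets borel" "C \<in> sets borel" by (auto simp: Q_def)
    have YA: "Y -` A \<inter> space M \<inter> B \<in> sets (F s)"
      using measurable_sets[OF Y, of A] B by (simp add: space_F)
    have "emeasure (distr P borel Y) A * emeasure Q C
      = emeasure M (Y -` A \<inter> space M \<inter> B) * emeasure M (\<Delta> -` C \<inter> space M)"
      unfolding Q by (simp add: emeasure_distr eP spP)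
    also have "... = ennreal (prob (Y -` A \<inter> space M \<inter> B) * prob {w\<in>space M. X t w - X s w \<in> C})"
      by (simp add: emeasure_eq_measure ennreal_mult vimage_def Int_def conj_commute \<Delta>_def)
    also have "... = ennreal (prob ((Y -` A \<inter> space M \<inter> B) \<inter> {w\<in>space M. X t w - X s w \<in> C}))"
      using indep_past[OF s YA] by simp
    also have "(Y -` A \<inter> space M \<inter> B) \<inter> {w\<in>space M. X t w - X s w \<in> C} = ((\<lambda>w. (Y w, \<Delta> w)) -` (A \<times> C) \<inter> space M) \<inter> B"
      by (auto simp: \<Delta>_def)
    also have "ennreal (prob ...) = emeasure (distr P (borel \<Otimes>\<^sub>M borel) (\<lambda>w. (Y w, \<Delta> w))) (A \<times> C)"
      by (simp add: emeasure_distr eP spP emeasure_eq_measure)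
    finally show "emeasure (distr P borel Y) A * emeasure Q C = emeasure (distr P (borel \<Otimes>\<^sub>M borel) (\<lambda>w. (Y w, \<Delta> w))) (A \<times> C)" .
  qed
  have gQ[measurable]: "g \<in> borel_measurable (distr P borel Y \<Otimes>\<^sub>M Q)"
    by (simp add: Q_def cong: measurable_cong_sets sets_pair_measure_cong)
  have "(\<integral>\<^sup>+w. indicator B w * g (Y w, \<Delta> w) \<partial>M) = (\<integral>\<^sup>+w. g (Y w, \<Delta> w) \<partial>P)"
    unfolding P_def by (subst nn_integral_density) auto
  also have "... = (\<integral>\<^sup>+z. g z \<partial>distr P (borel \<Otimes>\<^sub>M borel) (\<lambda>w. (Y w, \<Delta> w)))"
    by (subst nn_integral_distr) auto
  also have "... = (\<integral>\<^sup>+x. \<integral>\<^sup>+y. g (x, y) \<partial>Q \<partial>distr P borel Y)"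
    unfolding eq[symmetric] by (rule Q.nn_integral_fst[symmetric]) simp
  also have "... = (\<integral>\<^sup>+w. \<integral>\<^sup>+y. g (Y w, y) \<partial>Q \<partial>P)"
  proof (rule nn_integral_distr)
    have "g \<in> borel_measurable (borel \<Otimes>\<^sub>M Q)" by (simp add: Q_def cong: measurable_cong_sets sets_pair_measure_cong)
    from Q.borel_measurable_nn_integral_fst[OF this]
    show "(\<lambda>x. \<integral>\<^sup>+y. g (x, y) \<partial>Q) \<in> borel_measurable (distr P borel Y)" by simp
  qed simp
  also have "... = (\<integral>\<^sup>+w. \<integral>\<^sup>+w'. g (Y w, X (t - s) w') \<partial>M \<partial>P)"
    unfolding Q_def by (subst nn_integral_distr) auto
  also have "... = (\<integral>\<^sup>+w. indicator B w * (\<integral>\<^sup>+w'. g (Y w, X (t - s) w') \<partial>M) \<partial>M)"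
    unfolding P_def by (subst nn_integral_density) auto
  finally show ?thesis by (simp add: \<Delta>_def)
qed

section \<open>Exponential moments of a process without positive jumps\<close>

text \<open>If no step exceeds \<delta>, a rise of n (a + \<delta>) forces n successive rises by a,
  each overshooting by at most \<delta>. After a first crossing the later increments are independent
  of the past, so every rise costs a factor p.\<close>

lemma grid_tail:
  fixes t a \<delta> p :: real and m :: nat
  defines "\<tau> i \<equiv> t * real i / real m"
  assumes t: "t > 0" and m: "m > 0" and a: "a > 0" and \<delta>: "\<delta> >= 0"
    and p: "\<And>i. prob {w\<in>space M. \<exists>j\<in>{i..m}. X (\<tau> j) w - X (\<tau> i) w >= a} <= p"
  shows "i <= m ==> prob {w\<in>space M. (\<exists>j\<in>{i..m}. X (\<tau> j) w - X (\<tau> i) w >= real n * (a + \<delta>)) \<and>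
      (\<forall>j\<in>{i..<m}. X (\<tau> (Suc j)) w - X (\<tau> j) w <= \<delta>)} <= p ^ n"
proof (induction n arbitrary: i)
  case 0
  then show ?case by simp
next
  case (Suc n)
  have \<tau>: "0 <= \<tau> j" for j using t by (simp add: \<tau>_def)
  have [measurable]: "X (\<tau> j) \<in> borel_measurable M" for j using \<tau> by (rule borel_measurable_X)
  define \<xi> where "\<xi> j w = X (\<tau> (Suc j)) w - X (\<tau> j) w" for j w
  have ind: "indep_vars (\<lambda>_. borel) \<xi> {..<m}"
    unfolding \<xi>_def using t m by (intro indep_increments \<tau>) (auto simp: \<tau>_def field_simps)
  have sum\<xi>: "X (\<tau> j) w - X (\<tau> k) w = (\<Sum>l\<in>{k..<j}. \<xi> l w)" if "k <= j" for j k w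
    unfolding \<xi>_def by (rule sum_Suc_diff'[OF that, symmetric])
  \<comment> \<open>\<open>V k\<close> is the task that remains after index \<open>k\<close>, with
    one rise fewer; \<open>A k\<close> says that the first rise by \<open>a\<close> is completed at
    index \<open>k\<close>.\<close>
  define V where "V k = {w\<in>space M. (\<exists>j\<in>{k..m}. X (\<tau> j) w - X (\<tau> k) w >= real n * (a + \<delta>)) \<and> (\<forall>j\<in>{k..<m}. \<xi> j w <= \<delta>)}" for k
  define A where "A k = {w\<in>space M. X (\<tau> k) w - X (\<tau> i) w >= a \<and> (\<forall>j\<in>{i..<k}. X (\<tau> j) w - X (\<tau> i) w < a)}" for k
  have [measurable]: "\<xi> j \<in> borel_measurable M" for j by (simp add: \<xi>_def[abs_def])
  have [measurable]: "V k \<in> sets M" "A k \<in> sets M" for k by (simp_all add: V_def A_def)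
  have indAV: "prob (A k \<inter> V k) = prob (A k) * prob (V k)" if k: "i <= k" "k <= m" for k
  proof -
    let ?P1 = "PiM {..<k} (\<lambda>_. borel :: real measure)" and ?P2 = "PiM {k..<m} (\<lambda>_. borel :: real measure)"
    let ?R1 = "\<lambda>w. \<lambda>l\<in>{..<k}. \<xi> l w" and ?R2 = "\<lambda>w. \<lambda>l\<in>{k..<m}. \<xi> l w"
    have iv: "indep_var ?P1 ?R1 ?P2 ?R2"
      using k by (intro indep_var_restrict[OF ind]) auto
    define S1 where "S1 = {x\<in>space ?P1. (\<Sum>l\<in>{i..<k}. x l) >= a \<and> (\<forall>j\<in>{i..<k}. (\<Sum>l\<in>{i..<j}. x l) < a)}"
    define S2 where "S2 = {x\<in>space ?P2. (\<exists>j\<in>{k..m}. (\<Sum>l\<in>{k..<j}. x l) >= real n * (a + \<delta>)) \<and> (\<forall>j\<in>{k..<m}. x j <= \<delta>)}"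
    have c1: "(\<lambda>x. \<Sum>l\<in>{i..<j}. x l) \<in> borel_measurable ?P1" if "j <= k" for j
      using that by (intro borel_measurable_sum measurable_component_singleton) auto
    have c2: "(\<lambda>x. \<Sum>l\<in>{k..<j}. x l) \<in> borel_measurable ?P2" if "j <= m" for j
      using that by (intro borel_measurable_sum measurable_component_singleton) auto
    have S1: "S1 \<in> sets ?P1"
      unfolding S1_def using c1
      by (intro sets.sets_Collect_conj sets.sets_Collect_finite_All borel_measurable_le borel_measurable_less) auto
    have S2: "S2 \<in> sets ?P2"
      unfolding S2_def using c2
      by (intro sets.sets_Collect_conj sets.sets_Collect_finite_All sets.sets_Collect_finite_Ex borel_measurable_le) auto
    have A1: "A k = ?R1 -` S1 \<inter> space M"
      using k by (auto simp: A_def S1_def sum\<xi> space_PiM intro!: sum.cong)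
    have V2: "V k = ?R2 -` S2 \<inter> space M"
      using k by (auto simp: V_def S2_def sum\<xi> space_PiM)
    have "A k \<inter> V k = (\<lambda>w. (?R1 w, ?R2 w)) -` (S1 \<times> S2) \<inter> space M"
      unfolding A1 V2 by auto
    then have "prob (A k \<inter> V k) = prob (?R1 -` S1 \<inter> space M) * prob (?R2 -` S2 \<inter> space M)"
      using indep_varD[OF iv S1 S2] by simp
    then show ?thesis by (simp add: A1 V2)
  qed
  have p0: "0 <= p" using p[of 0] measure_nonneg order_trans by blast
  have sub: "{w\<in>space M. (\<exists>j\<in>{i..m}. X (\<tau> j) w - X (\<tau> i) w >= real (Suc n) * (a + \<delta>)) \<and>
      (\<forall>j\<in>{i..<m}. X (\<tau> (Suc j)) w - X (\<tau> j) w <= \<delta>)} \<subseteq> (\<Union>k\<in>{i..m}. A k \<inter> V k)"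
  proof safe
    fix w j assume w: "w \<in> space M" and j: "j \<in> {i..m}" "real (Suc n) * (a + \<delta>) <= X (\<tau> j) w - X (\<tau> i) w"
      and small: "\<forall>j\<in>{i..<m}. X (\<tau> (Suc j)) w - X (\<tau> j) w <= \<delta>"
    let ?Q = "\<lambda>k. k >= i \<and> X (\<tau> k) w - X (\<tau> i) w >= a"
    have "a <= real (Suc n) * (a + \<delta>)"
      using a \<delta> by (simp add: algebra_simps add_nonneg_nonneg)
    then have Qj: "?Q j" using j by auto
    \<comment> \<open>Just before the first crossing index the rise is still below \<open>a\<close>,
      so the overshoot at \<open>k\<close> is at most \<delta>.\<close>
    define k where "k = (LEAST k. ?Q k)"
    have k: "?Q k" unfolding k_def using Qj by (rule LeastI)
    have kj: "k <= j" unfolding k_def using Qj by (rule Least_le)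
    have kmin: "X (\<tau> l) w - X (\<tau> i) w < a" if "i <= l" "l < k" for l
      using not_less_Least[of l ?Q] that by (auto simp: k_def)
    have "k \<noteq> i" using k a by auto
    then obtain k' where k': "k = Suc k'" "i <= k'" using k by (cases k) auto
    have "X (\<tau> k) w - X (\<tau> i) w = (X (\<tau> (Suc k')) w - X (\<tau> k') w) + (X (\<tau> k') w - X (\<tau> i) w)"
      by (simp add: k')
    also have "... <= \<delta> + a"
      using kmin[of k'] small k' kj j by (intro add_mono) (auto simp: less_imp_le)
    finally have "X (\<tau> j) w - X (\<tau> k) w >= real n * (a + \<delta>)"
      using j(2) by (simp add: algebra_simps)
    then have "w \<in> V k" using w small kj j k by (auto simp: V_def \<xi>_def)
    moreover have "w \<in> A k" using w k kmin by (auto simp: A_def)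
    ultimately show "w \<in> (\<Union>k\<in>{i..m}. A k \<inter> V k)" using k kj j by auto
  qed
  have "disjoint_family_on A {i..m}"
    unfolding disjoint_family_on_def
  proof (intro ballI impI)
    fix k l assume "k \<in> {i..m}" "l \<in> {i..m}" "k \<noteq> l"
    then show "A k \<inter> A l = {}" by (cases k l rule: linorder_cases) (auto simp: A_def not_le[symmetric])
  qed
  then have "(\<Sum>k\<in>{i..m}. prob (A k)) = prob (\<Union>k\<in>{i..m}. A k)"
    by (intro finite_measure_finite_Union[symmetric]) auto
  also have "... <= prob {w\<in>space M. \<exists>j\<in>{i..m}. X (\<tau> j) w - X (\<tau> i) w >= a}"
    by (intro finite_measure_mono) (auto simp: A_def)
  also have "... <= p" by (rule p)
  finally have sumA: "(\<Sum>k\<in>{i..m}. prob (A k)) <= p" .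
  have "prob {w\<in>space M. (\<exists>j\<in>{i..m}. X (\<tau> j) w - X (\<tau> i) w >= real (Suc n) * (a + \<delta>)) \<and>
      (\<forall>j\<in>{i..<m}. X (\<tau> (Suc j)) w - X (\<tau> j) w <= \<delta>)} <= prob (\<Union>k\<in>{i..m}. A k \<inter> V k)"
    by (intro finite_measure_mono sub) auto
  also have "... <= (\<Sum>k\<in>{i..m}. prob (A k \<inter> V k))"
    by (intro finite_measure_subadditive_finite) auto
  also have "... <= (\<Sum>k\<in>{i..m}. prob (A k) * p ^ n)"
  proof (rule sum_mono)
    fix k assume k: "k \<in> {i..m}"
    then have "prob (V k) <= p ^ n" using Suc.IH[of k] by (simp add: V_def \<xi>_def)
    then show "prob (A k \<inter> V k) <= prob (A k) * p ^ n"
      using k indAV[of k] by (simp add: mult_left_mono)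
  qed
  also have "... = (\<Sum>k\<in>{i..m}. prob (A k)) * p ^ n" by (simp add: sum_distrib_right)
  also have "... <= p * p ^ n" using sumA p0 by (intro mult_right_mono) auto
  finally show ?case by simp
qed

text \<open>Right-continuity at 0. Rational times make the exceptional event measurable, and
  right-continuity at each \<open>s\<close> recovers the bound at all times.\<close>

lemma small_time_oscillation:
  assumes a: "a > 0" and e: "e > 0"
  shows "\<exists>d>0. \<exists>E\<in>sets M. prob E <= e \<and> (\<forall>w\<in>space M - E. \<forall>s. 0 <= s \<and> s < d --> \<bar>X s w\<bar> <= a)"
proof -
  define E where "E n = {w\<in>space M. \<exists>q\<in>\<rat>. 0 < q \<and> q < 1 / real (Suc n) \<and> \<bar>X q w\<bar> > a}" for n
  have E_eq: "E n = (\<Union>q\<in>{q\<in>\<rat>. 0 < q \<and> q < 1 / real (Suc n)}. {w\<in>space M. \<bar>X q w\<bar> > a})" for n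
    by (auto simp: E_def)
  have [measurable]: "E n \<in> sets M" for n
    unfolding E_eq
  proof (rule sets.countable_UN'')
    show "countable {q\<in>\<rat>. 0 < q \<and> q < 1 / real (Suc n)}" using countable_rat by (rule countable_subset[rotated]) auto
    fix q assume "q \<in> {q\<in>\<rat>. 0 < q \<and> q < 1 / real (Suc n)}"
    then have [measurable]: "X q \<in> borel_measurable M" by (auto intro: borel_measurable_X)
    show "{w\<in>space M. \<bar>X q w\<bar> > a} \<in> sets M" by simp
  qed
  have "(\<lambda>n. prob (E n)) \<longlonglongrightarrow> 0"
  proof (rule prob_tendsto_zero_if_eventually_notin)
    show "AE w in M. eventually (\<lambda>n. w \<notin> E n) sequentially"
    proof (rule AE_I2)
      fix w assume w: "w \<in> space M"
      from tendstoD[OF right_continuous_X[OF w, of 0] a] X_0[OF w]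
      obtain b where b: "b > 0" "\<And>s. 0 < s ==> s < b ==> \<bar>X s w\<bar> < a"
        by (auto simp: eventually_at_right_field)
      obtain N where N: "1 / real (Suc N) < b" using b(1) nat_approx_posE by blast
      have "w \<notin> E n" if "n >= N" for n
      proof -
        have "1 / real (Suc n) <= 1 / real (Suc N)" using that by (simp add: frac_le)
        then show ?thesis using N b(2) unfolding E_def by fastforce
      qed
      then show "eventually (\<lambda>n. w \<notin> E n) sequentially" by (auto simp: eventually_sequentially)
    qed
  qed simp
  from LIMSEQ_D[OF this e] obtain n where n: "prob (E n) < e" by auto
  have "\<bar>X s w\<bar> <= a" if w: "w \<in> space M - E n" and s: "0 <= s" "s < 1 / real (Suc n)" for w s
  proof (rule ccontr)
    assume "\<not> \<bar>X s w\<bar> <= a"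
    then have pos: "\<bar>X s w\<bar> - a > 0" by simp
    have "((\<lambda>s. \<bar>X s w\<bar>) \<longlongrightarrow> \<bar>X s w\<bar>) (at_right s)"
      using w s by (intro tendsto_rabs right_continuous_X) auto
    from order_tendstoD(1)[OF this, of a] pos obtain b where b: "b > s" "\<And>u. s < u ==> u < b ==> a < \<bar>X u w\<bar>"
      by (auto simp: eventually_at_right_field)
    obtain q where q: "q \<in> \<rat>" "s < q" "q < min b (1 / real (Suc n))"
      using Rats_dense_in_real[of s "min b (1 / real (Suc n))"] b s by auto
    then show False using b(2)[of q] w s by (auto simp: E_def)
  qed
  then show ?thesis using n by (intro exI[of _ "1 / real (Suc n)"] conjI bexI[of _ "E n"]) auto
qed

text \<open>The grid estimate with \<open>a\<close> and \<delta> both 1/2, so that level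
  \<open>n\<close> takes \<open>n\<close> rises. A rise by 1/2 on the grid has probability at most
  \<open>prob E\<close>, and the probability of a step above 1/2 tends to 0 as the mesh shrinks,
  because there are no upward jumps.\<close>

lemma exp_tail_small_time:
  assumes p: "p > 0"
  shows "\<exists>d>0. \<forall>t n. 0 <= t \<and> t < d --> prob {w\<in>space M. X t w >= real n} <= p ^ n"
proof -
  \<comment> \<open>Two values of size at most 1/5 differ by less than 1/2, which rules out a rise
    by 1/2 outside \<open>E\<close>.\<close>
  obtain d E where d: "d > 0" and E[measurable]: "E \<in> sets M" and pE: "prob E <= p"
    and osc: "\<And>w s. w \<in> space M - E ==> 0 <= s ==> s < d ==> \<bar>X s w\<bar> <= 1 / 5"
    using small_time_oscillation[of "1/5" p] p by (metis divide_pos_pos zero_less_numeral zero_less_one)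
  have "prob {w\<in>space M. X t w >= real n} <= p ^ n" if t: "0 <= t" "t < d" for t n
  proof (cases "t = 0")
    case True
    show ?thesis
    proof (cases n)
      case (Suc k)
      then have "{w\<in>space M. X t w >= real n} = {}" using True by (auto simp: X_0)
      then show ?thesis using p by (simp only: measure_empty zero_le_power less_imp_le)
    qed simp
  next
    case False
    then have t0: "t > 0" using t by simp
    define B where "B m = {w\<in>space M. \<exists>j<m. X (t * real (Suc j) / real m) w - X (t * real j / real m) w > 1 / 2}" for m
    have [measurable]: "X (t * real j / real m) \<in> borel_measurable M" for j m
      using t0 by (intro borel_measurable_X) simp
    have [measurable]: "X t \<in> borel_measurable M" using t0 by (intro borel_measurable_X) simp
    have [measurable]: "B m \<in> sets M" for m unfolding B_def by measurable
    have lim: "(\<lambda>m. prob (B m)) \<longlonglongrightarrow> 0"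
    proof (rule prob_tendsto_zero_if_eventually_notin)
      show "AE w in M. eventually (\<lambda>m. w \<notin> B m) sequentially"
      proof (rule AE_I2)
        fix w assume w: "w \<in> space M"
        obtain \<eta> where \<eta>: "\<eta> > 0" "\<And>s u. 0 <= s ==> s <= u ==> u <= t ==> u - s < \<eta> ==> X u w - X s w <= 1 / 2"
          using no_positive_jumps_uniform[OF cadlag_path[OF w] no_positive_jumps_path[OF w], of "1/2" t] by auto
        obtain N :: nat where N: "t / \<eta> < real N" using reals_Archimedean2 by blast
        have "w \<notin> B m" if m: "m >= Suc N" for m
        proof -
          have "t / \<eta> < real m" using N m by linarith
          then have "t < \<eta> * real m" using \<eta>(1) by (simp add: pos_divide_less_eq mult.commute)
          moreover have "real m > 0" using m by simp
          ultimately have "t / real m < \<eta>" by (simp add: pos_divide_less_eq)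
          have "X (t * real (Suc j) / real m) w - X (t * real j / real m) w <= 1 / 2" if j: "j < m" for j
          proof (rule \<eta>(2))
            have "t * real (Suc j) <= t * real m" using j t0 by (intro mult_left_mono) auto
            then show "t * real (Suc j) / real m <= t" using m by (simp add: pos_divide_le_eq)
            show "t * real (Suc j) / real m - t * real j / real m < \<eta>"
              using \<open>t / real m < \<eta>\<close> by (simp add: diff_divide_distrib[symmetric] algebra_simps)
          qed (use t0 in \<open>auto intro!: divide_right_mono mult_left_mono\<close>)
          then show ?thesis by (fastforce simp: B_def)
        qed
        then show "eventually (\<lambda>m. w \<notin> B m) sequentially" by (auto simp: eventually_sequentially)
      qed
    qed simp
    have le: "prob {w\<in>space M. X t w >= real n} <= p ^ n + prob (B m)" if m: "m > 0" for m
    proof -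
      let ?V = "{w\<in>space M. (\<exists>j\<in>{0..m}. X (t * real j / real m) w - X (t * real 0 / real m) w >= real n * (1 / 2 + 1 / 2)) \<and>
          (\<forall>j\<in>{0..<m}. X (t * real (Suc j) / real m) w - X (t * real j / real m) w <= 1 / 2)}"
      have "prob ?V <= p ^ n"
      proof (rule grid_tail)
        fix i
        have "{w\<in>space M. \<exists>j\<in>{i..m}. 1 / 2 <= X (t * real j / real m) w - X (t * real i / real m) w} \<subseteq> E"
        proof safe
          fix w j assume w: "w \<in> space M" and j: "j \<in> {i..m}" "1 / 2 <= X (t * real j / real m) w - X (t * real i / real m) w"
          have tl: "t * real l / real m < d" if "l <= m" for l
          proof -
            have "t * real l / real m <= t" using that t0 m by (simp add: field_simps)
            then show ?thesis using t by simp
          qed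
          show "w \<in> E"
          proof (rule ccontr)
            assume "w \<notin> E"
            then show False using osc[of w "t * real j / real m"] osc[of w "t * real i / real m"] tl[of i] tl[of j] j w t0
              by (simp add: abs_if split: if_splits)
          qed
        qed
        then have "prob {w\<in>space M. \<exists>j\<in>{i..m}. 1 / 2 <= X (t * real j / real m) w - X (t * real i / real m) w} <= prob E"
          by (intro finite_measure_mono) auto
        then show "prob {w\<in>space M. \<exists>j\<in>{i..m}. 1 / 2 <= X (t * real j / real m) w - X (t * real i / real m) w} <= p"
          using pE by simp
      qed (use t0 m in auto)
      moreover have "{w\<in>space M. X t w >= real n} \<subseteq> ?V \<union> B m"
        using m by (fastforce simp: B_def X_0 not_le intro!: bexI[of _ m])
      then have "prob {w\<in>space M. X t w >= real n} <= prob (?V \<union> B m)"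
        by (rule finite_measure_mono) measurable
      moreover have "prob (?V \<union> B m) <= prob ?V + prob (B m)"
        by (rule measure_Un_le) measurable
      ultimately show ?thesis by linarith
    qed
    have "(\<lambda>m. p ^ n + prob (B m)) \<longlonglongrightarrow> p ^ n + 0" by (intro tendsto_intros lim)
    then have "prob {w\<in>space M. X t w >= real n} <= p ^ n + 0"
      by (rule LIMSEQ_le_const) (use le in \<open>auto intro!: exI[of _ 1]\<close>)
    then show ?thesis by simp
  qed
  then show ?thesis using d by blast
qed

lemma exp_moment_small_time:
  assumes \<theta>: "\<theta> > 0"
  shows "\<exists>d>0. \<exists>C. \<forall>t. 0 <= t \<and> t < d --> (\<integral>\<^sup>+w. ennreal (exp (\<theta> * X t w)) \<partial>M) <= ennreal C"
proof -
  \<comment> \<open>With this decay the series of exp (\<theta> (n + 1)) p^n is exp \<theta> times a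
    geometric series of ratio 1/2, whence the constant 1 + 2 exp \<theta> below.\<close>
  define p where "p = exp (- \<theta>) / 2"
  have "p > 0" by (simp add: p_def)
  from exp_tail_small_time[OF this] obtain d where d: "d > 0"
    and tail: "\<And>t n. 0 <= t ==> t < d ==> prob {w\<in>space M. X t w >= real n} <= p ^ n" by auto
  have "(\<integral>\<^sup>+w. ennreal (exp (\<theta> * X t w)) \<partial>M) <= ennreal (1 + 2 * exp \<theta>)" if t: "0 <= t" "t < d" for t
  proof -
    have [measurable]: "X t \<in> borel_measurable M" using t by (auto intro: borel_measurable_X)
    define A where "A n = {w\<in>space M. X t w >= real n}" for n
    have [measurable]: "A n \<in> sets M" for n by (simp add: A_def)
    have "(\<integral>\<^sup>+w. ennreal (exp (\<theta> * X t w)) \<partial>M) <= (\<integral>\<^sup>+w. 1 + (\<Sum>n. ennreal (exp (\<theta> * real (Suc n))) * indicator (A n) w) \<partial>M)"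
    proof (rule nn_integral_mono)
      fix w assume w: "w \<in> space M"
      show "ennreal (exp (\<theta> * X t w)) <= 1 + (\<Sum>n. ennreal (exp (\<theta> * real (Suc n))) * indicator (A n) w)"
      proof (cases "X t w <= 0")
        case True
        then have "\<theta> * X t w <= 0" using \<theta> by (simp add: mult_nonneg_nonpos)
        then have "ennreal (exp (\<theta> * X t w)) <= 1" by (simp add: ennreal_le_1)
        then show ?thesis by (rule order_trans) simp
      next
        case False
        define n where "n = nat \<lfloor>X t w\<rfloor>"
        have n: "real n <= X t w" "X t w <= real (Suc n)" using False by (auto simp: n_def) linarith
        have "ennreal (exp (\<theta> * X t w)) <= ennreal (exp (\<theta> * real (Suc n))) * indicator (A n) w"
          using n w \<theta> by (auto simp: A_def intro!: ennreal_leI)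
        also have "... <= (\<Sum>n. ennreal (exp (\<theta> * real (Suc n))) * indicator (A n) w)"
          using sum_le_suminf[of "\<lambda>n. ennreal (exp (\<theta> * real (Suc n))) * indicator (A n) w" "{n}"]
          by (simp only: sum.insert sum.empty finite.emptyI finite.insertI empty_iff not_False_eq_True add_0_right summableI zero_le simp_thms)
        finally show ?thesis by (metis add_increasing zero_le)
      qed
    qed
    also have "... = 1 + (\<Sum>n. ennreal (exp (\<theta> * real (Suc n))) * emeasure M (A n))"
      by (subst nn_integral_add) (auto simp: nn_integral_suminf nn_integral_cmult emeasure_space_1)
    also have "(\<Sum>n. ennreal (exp (\<theta> * real (Suc n))) * emeasure M (A n)) <= (\<Sum>n. ennreal (exp \<theta> * (1 / 2) ^ n))"
    proof (rule suminf_le)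
      fix n
      have "exp (\<theta> * real (Suc n)) * prob (A n) <= exp (\<theta> * real (Suc n)) * p ^ n"
        using tail[OF t] by (auto simp: A_def)
      also have "... = exp \<theta> * (1 / 2) ^ n"
        by (simp add: p_def power_divide exp_of_nat_mult[symmetric] algebra_simps exp_add[symmetric])
      finally show "ennreal (exp (\<theta> * real (Suc n))) * emeasure M (A n) <= ennreal (exp \<theta> * (1 / 2) ^ n)"
        by (simp add: emeasure_eq_measure ennreal_mult[symmetric] ennreal_leI)
    qed auto
    also have "(\<Sum>n. ennreal (exp \<theta> * (1 / 2) ^ n)) = ennreal (2 * exp \<theta>)"
      using sums_mult[OF geometric_sums[of "1 / 2 :: real"], of "exp \<theta>"]
      by (intro suminf_ennreal_eq) (auto simp: mult.commute)
    finally show ?thesis by (simp add: ennreal_plus)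
  qed
  then show ?thesis using d by blast
qed

abbreviation "\<psi> \<equiv> laplace_exponent M X"

text \<open>The moment \<open>e t\<close> is multiplicative in t by the Markov property, finite for
  small t and hence for all t. Its logarithm is additive and bounded above near 0, so it is linear,
  and its value at time 1 is \<psi> \<theta> by definition.\<close>

lemma
  assumes \<theta>: "\<theta> >= 0" and t: "t >= 0"
  shows integrable_exp_X: "integrable M (\<lambda>w. exp (\<theta> * X t w))"
    and expectation_exp_X: "expectation (\<lambda>w. exp (\<theta> * X t w)) = exp (t * \<psi> \<theta>)"
    and nn_integral_exp_X: "(\<integral>\<^sup>+w. ennreal (exp (\<theta> * X t w)) \<partial>M) = ennreal (exp (t * \<psi> \<theta>))"
proof -
  define e where "e t = (\<integral>\<^sup>+w. ennreal (exp (\<theta> * X t w)) \<partial>M)" for t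
  have mult: "e (s + t) = e s * e t" if "0 <= s" "0 <= t" for s t
  proof -
    have [measurable]: "X s \<in> borel_measurable M" "X t \<in> borel_measurable M" using that by (auto intro: borel_measurable_X)
    have "e (s + t) = (\<integral>\<^sup>+w. indicator (space M) w * ennreal (exp (\<theta> * (X s w + (X (s + t) w - X s w)))) \<partial>M)"
      unfolding e_def by (intro nn_integral_cong) auto
    also have "... = (\<integral>\<^sup>+w. indicator (space M) w * (\<integral>\<^sup>+w'. ennreal (exp (\<theta> * (X s w + X t w'))) \<partial>M) \<partial>M)"
      using markov[of s "s + t" "space M" "X s" "\<lambda>(x, y). ennreal (exp (\<theta> * (x + y)))"] that adapted[of s]
        sets.top[of "F s"] by (simp add: space_F)
    also have "... = (\<integral>\<^sup>+w. ennreal (exp (\<theta> * X s w)) * e t \<partial>M)"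
      unfolding e_def by (subst nn_integral_cmult[symmetric])
        (auto intro!: nn_integral_cong simp: ennreal_mult[symmetric] exp_add[symmetric] algebra_simps)
    also have "... = e s * e t" by (simp add: nn_integral_multc e_def)
    finally show ?thesis .
  qed
  have pos: "e t \<noteq> 0" if "t >= 0" for t
  proof
    have [measurable]: "X t \<in> borel_measurable M" using that by (auto intro: borel_measurable_X)
    assume "e t = 0"
    then have "AE w in M. ennreal (exp (\<theta> * X t w)) = 0" unfolding e_def by (subst (asm) nn_integral_0_iff_AE) auto
    then have "AE w in M. False" by simp
    then show False by simp
  qed
  obtain d C where d: "d > 0" and C: "\<And>t. 0 <= t ==> t < d ==> e t <= ennreal C"
  proof (cases "\<theta> = 0")
    case True
    then show ?thesis using that[of 1 1] by (simp add: e_def emeasure_space_1)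
  next
    case False
    then have "\<theta> > 0" using \<theta> by simp
    from exp_moment_small_time[OF this] show ?thesis using that unfolding e_def by blast
  qed
  have fin: "e t \<noteq> \<top>" if "t >= 0" for t
  proof -
    obtain n :: nat where n: "t / d < real n" using reals_Archimedean2 by blast
    then have "n > 0" using d that by (metis divide_nonneg_pos gr0I not_less of_nat_0)
    have pw: "e (real k * (t / real n)) = e (t / real n) ^ k" for k
    proof (induction k)
      case (Suc k)
      have "real (Suc k) * (t / real n) = t / real n + real k * (t / real n)" by (simp add: field_simps add_divide_distrib)
      then show ?case using mult[of "t / real n" "real k * (t / real n)"] that Suc by simp
    qed (simp add: e_def X_0 emeasure_space_1 cong: nn_integral_cong)
    have "t / real n < d" using n d \<open>n > 0\<close> by (simp add: field_simps)
    then have "e (t / real n) < \<top>" using C[of "t / real n"] that by (simp add: le_less_trans)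
    then have "e (t / real n) ^ n < \<top>" by (simp add: power_less_top_ennreal)
    then show ?thesis using pw[of n] \<open>n > 0\<close> by simp
  qed
  define g where "g t = ln (enn2real (e t))" for t
  have epos: "enn2real (e t) > 0" if "t >= 0" for t
    using pos[OF that] fin[OF that] by (simp add: enn2real_positive_iff top.not_eq_extremum zero_less_iff_neq_zero)
  have "g t = t * g 1"
  proof (rule additive_bounded_above_imp_linear[where d="d / 2" and K="ln C"])
    show "g (s + t) = g s + g t" if "0 <= s" "0 <= t" for s t
      using mult[OF that] epos[OF that(1)] epos[OF that(2)] by (simp add: g_def enn2real_mult ln_mult)
    show "g s <= ln C" if "0 <= s" "s <= d / 2" for s
    proof -
      have "e s <= ennreal C" using C[of s] that d by simp
      moreover have "C > 0"
      proof (rule ccontr)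
        assume "\<not> C > 0" then show False using \<open>e s <= ennreal C\<close> pos[OF that(1)] by (simp add: ennreal_neg)
      qed
      ultimately have "enn2real (e s) <= C" by (simp add: enn2real_leI)
      then show ?thesis using epos[OF that(1)] by (simp add: g_def)
    qed
  qed (use d t in auto)
  have [measurable]: "X t \<in> borel_measurable M" "X 1 \<in> borel_measurable M" using t by (auto intro: borel_measurable_X)
  have "\<psi> \<theta> = g 1"
    unfolding laplace_exponent_def g_def e_def by (subst integral_eq_nn_integral) auto
  then have "enn2real (e t) = exp (t * \<psi> \<theta>)"
    using \<open>g t = t * g 1\<close> epos[OF t] by (metis exp_ln g_def)
  then show nn: "(\<integral>\<^sup>+w. ennreal (exp (\<theta> * X t w)) \<partial>M) = ennreal (exp (t * \<psi> \<theta>))"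
    using fin[OF t] by (metis e_def ennreal_enn2real top.not_eq_extremum)
  then show "integrable M (\<lambda>w. exp (\<theta> * X t w))"
    by (intro integrableI_bounded) auto
  show "expectation (\<lambda>w. exp (\<theta> * X t w)) = exp (t * \<psi> \<theta>)"
    using nn by (subst integral_eq_nn_integral) auto
qed

end

section \<open>Optional stopping\<close>

text \<open>Strictly above \<open>s\<close> even at dyadic points: for times known through the sets
  S < t, each value of the approximation is then decided by the information at that value.\<close>

definition dyadic_above :: "nat => real => real" where
  "dyadic_above m s = (real (nat \<lfloor>2 ^ m * s\<rfloor>) + 1) / 2 ^ m"

lemma
  assumes "0 <= s"
  shows dyadic_above_gt: "s < dyadic_above m s"
    and dyadic_above_le: "dyadic_above m s <= s + 1 / 2 ^ m"
proof -
  have "0 <= 2 ^ m * s" using assms by simp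
  then have "real (nat \<lfloor>2 ^ m * s\<rfloor>) <= 2 ^ m * s" "2 ^ m * s < real (nat \<lfloor>2 ^ m * s\<rfloor>) + 1"
    by (auto simp: of_nat_nat)
  then show "s < dyadic_above m s" "dyadic_above m s <= s + 1 / 2 ^ m"
    by (auto simp: dyadic_above_def field_simps)
qed

lemma dyadic_above_pos: "0 < dyadic_above m s"
  by (simp add: dyadic_above_def add_nonneg_pos)

lemma filterlim_dyadic_above:
  assumes "0 <= s"
  shows "filterlim (\<lambda>m. dyadic_above m s) (at_right s) sequentially"
proof -
  have "(\<lambda>m. s + (1 / 2) ^ m) \<longlonglongrightarrow> s + 0" by (intro tendsto_intros LIMSEQ_realpow_zero) auto
  then have upper: "(\<lambda>m. s + (1 / 2) ^ m) \<longlonglongrightarrow> s" by simp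
  have "(\<lambda>m. dyadic_above m s) \<longlonglongrightarrow> s"
  proof (rule tendsto_sandwich[where f="\<lambda>_. s" and h="\<lambda>m. s + (1 / 2) ^ m"])
    show "\<forall>\<^sub>F m in sequentially. s <= dyadic_above m s"
      using dyadic_above_gt[OF assms] by (simp add: less_imp_le)
    show "\<forall>\<^sub>F m in sequentially. dyadic_above m s <= s + (1 / 2) ^ m"
      using dyadic_above_le[OF assms] by (simp add: power_one_over)
  qed (use upper in simp_all)
  moreover have "dyadic_above m s \<in> {s<..} \<and> dyadic_above m s \<noteq> s" for m
    using dyadic_above_gt[OF assms, of m] by simp
  ultimately show ?thesis unfolding filterlim_at by simp
qed

context sn_levy
begin

lemma X_dyadic_above: "w \<in> space M ==> 0 <= s ==> (\<lambda>m. X (dyadic_above m s) w) \<longlonglongrightarrow> X s w"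
  by (rule filterlim_compose[OF right_continuous_X filterlim_dyadic_above])

text \<open>Times are frozen at \<open>t\<close> already in the approximation, so only values of
  \<open>X\<close> up to time \<open>t\<close> are read and measurability over \<open>F t\<close>
  survives the limit.\<close>

lemma measurable_X_progressive:
  assumes t: "0 <= t" and S[measurable]: "S \<in> borel_measurable N" and Y: "Y \<in> measurable N (F t)"
  shows "(\<lambda>x. X (min t (max 0 (S x))) (Y x)) \<in> borel_measurable N"
proof (rule borel_measurable_LIMSEQ_real)
  have Ysp: "Y x \<in> space M" if "x \<in> space N" for x
    using measurable_space[OF Y that] by (simp add: space_F)
  show "(\<lambda>x. X (min t (dyadic_above m (max 0 (S x)))) (Y x)) \<in> borel_measurable N" for m
  proof -
    have comp: "(\<lambda>x. X (min t ((real k + 1) / 2 ^ m)) (Y x)) \<in> borel_measurable N" for k :: nat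
    proof -
      have "X (min t ((real k + 1) / 2 ^ m)) \<in> borel_measurable (F t)"
        using t by (intro measurable_F_mono[OF _ _ adapted]) (auto simp: min_def)
      then show ?thesis by (rule measurable_compose[OF Y])
    qed
    have "(\<lambda>x. nat \<lfloor>2 ^ m * max 0 (S x)\<rfloor>) \<in> measurable N (count_space UNIV)" by measurable
    from measurable_compose_countable[where f="\<lambda>k x. X (min t ((real k + 1) / 2 ^ m)) (Y x)", OF comp this]
    show ?thesis unfolding dyadic_above_def .
  qed
  fix x assume x: "x \<in> space N"
  define s where "s = max 0 (S x)"
  have s: "0 <= s" by (simp add: s_def)
  show "(\<lambda>m. X (min t (dyadic_above m (max 0 (S x)))) (Y x)) \<longlonglongrightarrow> X (min t (max 0 (S x))) (Y x)"
    unfolding s_def[symmetric]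
  proof (cases "s < t")
    case True
    then have "\<forall>\<^sub>F m in sequentially. dyadic_above m s < t"
      using filterlim_dyadic_above[OF s] by (auto dest!: filterlim_at[THEN iffD1] order_tendstoD(2))
    then have "\<forall>\<^sub>F m in sequentially. X (min t (dyadic_above m s)) (Y x) = X (dyadic_above m s) (Y x)"
      by eventually_elim (simp add: min_def)
    moreover have "(\<lambda>m. X (dyadic_above m s) (Y x)) \<longlonglongrightarrow> X s (Y x)"
      using X_dyadic_above[OF Ysp[OF x] s] .
    ultimately show "(\<lambda>m. X (min t (dyadic_above m s)) (Y x)) \<longlonglongrightarrow> X (min t s) (Y x)"
      using True by (simp add: tendsto_cong min_def)
  next
    case False
    then have "min t (dyadic_above m s) = t" for m using dyadic_above_gt[OF s, of m] by (simp add: min_def)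
    then show "(\<lambda>m. X (min t (dyadic_above m s)) (Y x)) \<longlonglongrightarrow> X (min t s) (Y x)"
      using False by (simp add: min_def)
  qed
qed

lemma measurable_X_joint:
  assumes S[measurable]: "S \<in> borel_measurable N" and Y[measurable]: "Y \<in> measurable N M"
  shows "(\<lambda>x. X (max 0 (S x)) (Y x)) \<in> borel_measurable N"
proof (rule borel_measurable_LIMSEQ_real)
  fix x assume x: "x \<in> space N"
  show "(\<lambda>m. X (dyadic_above m (max 0 (S x))) (Y x)) \<longlonglongrightarrow> X (max 0 (S x)) (Y x)"
    using measurable_space[OF Y x] by (intro X_dyadic_above) auto
next
  fix m
  have "(\<lambda>x. (\<lambda>k x. X ((real k + 1) / 2 ^ m) (Y x)) (nat \<lfloor>2 ^ m * max 0 (S x)\<rfloor>) x) \<in> borel_measurable N"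
    by (rule measurable_compose_countable) (auto intro!: measurable_compose[OF Y] borel_measurable_X)
  then show "(\<lambda>x. X (dyadic_above m (max 0 (S x))) (Y x)) \<in> borel_measurable N"
    by (simp add: dyadic_above_def)
qed

lemma measurable_X_at:
  assumes [measurable]: "S \<in> borel_measurable M" and "\<And>w. w \<in> space M ==> 0 <= S w"
  shows "(\<lambda>w. X (S w) w) \<in> borel_measurable M"
  using measurable_X_joint[of S M "\<lambda>w. w"] assms by (simp add: max_absorb2 cong: measurable_cong)

section \<open>Optional times and martingales\<close>

text \<open>Strict inequality, unlike in \<open>is_stopping_time\<close>: this is what entry times
  into open sets satisfy, and these are the sets that approximation by \<open>dyadic_above\<close>
  uses.\<close>

definition optional :: "('a => real) => bool" where
  "optional S \<longleftrightarrow> (\<forall>w\<in>space M. 0 <= S w) \<and> (\<forall>t>0. {w\<in>space M. S w < t} \<in> sets (F t))"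

lemma optional_nonneg: "optional S ==> w \<in> space M ==> 0 <= S w"
  by (simp add: optional_def)

lemma optional_measurable: "optional S ==> S \<in> borel_measurable M"
proof (rule borel_measurableI_less)
  fix y assume S: "optional S"
  show "{w\<in>space M. S w < y} \<in> sets M"
  proof (cases "y > 0")
    case True
    then show ?thesis using S sets_F[of y] by (auto simp: optional_def)
  next
    case False
    then have "{w\<in>space M. S w < y} = {}" using S by (auto simp: optional_def not_less intro: order_trans)
    then show ?thesis by (simp only: sets.empty_sets)
  qed
qed

definition mart :: "(real => 'a => real) => bool" where
  "mart Z \<longleftrightarrow> (\<forall>t\<ge>0. integrable M (Z t)) \<and>
    (\<forall>s t B. 0 <= s \<and> s <= t \<and> B \<in> sets (F s) -->
      (\<integral>w. indicator B w * Z t w \<partial>M) = (\<integral>w. indicator B w * Z s w \<partial>M))"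

text \<open>The discretised time takes finitely many values \<open>u j\<close>, and the event
  \<open>B j\<close> of each value lies in \<open>F (u j)\<close>; the martingale property moves
  every term to the last time \<open>u N\<close>.\<close>

lemma optional_stopping_dyadic:
  assumes Z: "mart Z" and S: "optional S" and K: "\<And>w. w \<in> space M ==> S w <= K"
  shows "integrable M (\<lambda>w. Z (dyadic_above m (S w)) w)"
    and "(\<integral>w. Z (dyadic_above m (S w)) w \<partial>M) = (\<integral>w. Z 0 w \<partial>M)"
proof -
  have Zi: "integrable M (Z t)" if "t >= 0" for t using Z that by (simp add: mart_def)
  have Zm: "(\<integral>w. indicator B w * Z t w \<partial>M) = (\<integral>w. indicator B w * Z s w \<partial>M)" if "0 <= s" "s <= t" "B \<in> sets (F s)" for s t B
    using Z that by (simp add: mart_def)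
  define N where "N = nat \<lfloor>2 ^ m * K\<rfloor>"
  define u where "u j = (real j + 1) / 2 ^ m" for j :: nat
  have u: "0 < u j" for j by (simp add: u_def add_nonneg_pos)
  define B where "B j = {w\<in>space M. nat \<lfloor>2 ^ m * S w\<rfloor> = j}" for j
  have B_eq: "B j = {w\<in>space M. S w < u j} - {w\<in>space M. S w < real j / 2 ^ m}" for j
  proof -
    have "nat \<lfloor>2 ^ m * s\<rfloor> = j \<longleftrightarrow> real j / 2 ^ m <= s \<and> s < u j" if "0 <= s" for s
    proof -
      have "0 <= 2 ^ m * s" using that by simp
      then have "nat \<lfloor>2 ^ m * s\<rfloor> = j \<longleftrightarrow> \<lfloor>2 ^ m * s\<rfloor> = int j" by (auto simp: nat_eq_iff)
      also have "... \<longleftrightarrow> real j <= 2 ^ m * s \<and> 2 ^ m * s < real j + 1" by (simp add: floor_eq_iff)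
      also have "... \<longleftrightarrow> real j / 2 ^ m <= s \<and> s < u j" by (simp add: u_def field_simps)
      finally show ?thesis .
    qed
    then have "w \<in> B j \<longleftrightarrow> w \<in> {w\<in>space M. S w < u j} - {w\<in>space M. S w < real j / 2 ^ m}" for w
      unfolding B_def mem_Collect_eq Diff_iff not_less[symmetric] using optional_nonneg[OF S] by (metis not_less)
    then show ?thesis by (rule set_eqI)
  qed
  have BF: "B j \<in> sets (F (u j))" for j
  proof -
    have 1: "{w\<in>space M. S w < u j} \<in> sets (F (u j))" using S u by (simp add: optional_def)
    have 2: "{w\<in>space M. S w < real j / 2 ^ m} \<in> sets (F (u j))"
    proof (cases "j = 0")
      case True
      then have "{w\<in>space M. S w < real j / 2 ^ m} = {}" using optional_nonneg[OF S] by (auto simp: not_less)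
      then show ?thesis by (simp only: sets.empty_sets)
    next
      case False
      then have "{w\<in>space M. S w < real j / 2 ^ m} \<in> sets (F (real j / 2 ^ m))" using S by (simp add: optional_def)
      then show ?thesis using F_mono[of "real j / 2 ^ m" "u j"] by (auto simp: u_def divide_right_mono)
    qed
    show ?thesis unfolding B_eq using 1 2 by (rule sets.Diff)
  qed
  have BM[measurable]: "B j \<in> sets M" for j using BF[of j] sets_F[of "u j"] u[of j] by auto
  have rep: "Z (dyadic_above m (S w)) w = (\<Sum>j\<le>N. indicator (B j) w * Z (u j) w)" if w: "w \<in> space M" for w
  proof -
    define k where "k = nat \<lfloor>2 ^ m * S w\<rfloor>"
    have "2 ^ m * S w <= 2 ^ m * K" using K[OF w] by simp
    then have "k <= N" unfolding k_def N_def by (intro nat_mono floor_mono)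
    moreover have "indicator (B j) w * Z (u j) w = (if j = k then Z (u j) w else 0)" for j
      using w by (auto simp: B_def k_def)
    ultimately have "(\<Sum>j\<le>N. indicator (B j) w * Z (u j) w) = Z (u k) w" by simp
    then show ?thesis by (simp add: dyadic_above_def k_def u_def)
  qed
  have ii: "integrable M (\<lambda>w. indicator (B j) w * Z t w)" if "t >= 0" for j t
    using integrable_mult_indicator[OF BM Zi[OF that]] by simp
  have "integrable M (\<lambda>w. \<Sum>j\<le>N. indicator (B j) w * Z (u j) w)"
    using u by (intro Bochner_Integration.integrable_sum ii) (simp add: less_imp_le)
  then show "integrable M (\<lambda>w. Z (dyadic_above m (S w)) w)"
    by (rule Bochner_Integration.integrable_cong[THEN iffD1, rotated -1]) (auto simp: rep)
  have "(\<integral>w. Z (dyadic_above m (S w)) w \<partial>M) = (\<integral>w. (\<Sum>j\<le>N. indicator (B j) w * Z (u j) w) \<partial>M)"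
    by (intro Bochner_Integration.integral_cong) (auto simp: rep)
  also have "... = (\<Sum>j\<le>N. \<integral>w. indicator (B j) w * Z (u j) w \<partial>M)"
    using u by (intro Bochner_Integration.integral_sum ii) (simp add: less_imp_le)
  also have "... = (\<Sum>j\<le>N. \<integral>w. indicator (B j) w * Z (u N) w \<partial>M)"
    using u BF by (intro sum.cong Zm[symmetric]) (auto simp: less_imp_le u_def divide_right_mono)
  also have "... = (\<integral>w. (\<Sum>j\<le>N. indicator (B j) w * Z (u N) w) \<partial>M)"
    using u by (intro Bochner_Integration.integral_sum[symmetric] ii) (simp add: less_imp_le)
  also have "... = (\<integral>w. indicator (space M) w * Z (u N) w \<partial>M)"
  proof (intro Bochner_Integration.integral_cong refl)
    fix w assume w: "w \<in> space M"
    define k where "k = nat \<lfloor>2 ^ m * S w\<rfloor>"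
    have "2 ^ m * S w <= 2 ^ m * K" using K[OF w] by simp
    then have "k <= N" unfolding k_def N_def by (intro nat_mono floor_mono)
    moreover have "indicator (B j) w * Z (u N) w = (if j = k then Z (u N) w else 0)" for j
      using w by (auto simp: B_def k_def)
    ultimately show "(\<Sum>j\<le>N. indicator (B j) w * Z (u N) w) = indicator (space M) w * Z (u N) w" using w by simp
  qed
  also have "... = (\<integral>w. indicator (space M) w * Z 0 w \<partial>M)"
    using u sets.top[of "F 0"] by (intro Zm) (auto simp: less_imp_le space_F)
  also have "... = (\<integral>w. Z 0 w \<partial>M)"
    by (intro Bochner_Integration.integral_cong) auto
  finally show "(\<integral>w. Z (dyadic_above m (S w)) w \<partial>M) = (\<integral>w. Z 0 w \<partial>M)" .
qed

lemma mart_exp: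
  assumes \<theta>: "\<theta> >= 0"
  shows "mart (\<lambda>t w. exp (\<theta> * X t w - \<psi> \<theta> * t))"
  unfolding mart_def
proof (intro conjI allI impI)
  have int: "integrable M (\<lambda>w. exp (\<theta> * X t w - \<psi> \<theta> * t))" if "t >= 0" for t
    using integrable_exp_X[OF \<theta> that] by (simp add: exp_diff)
  then show "integrable M (\<lambda>w. exp (\<theta> * X t w - \<psi> \<theta> * t))" if "t >= 0" for t using that .
  fix s t B assume st: "0 <= s \<and> s <= t \<and> B \<in> sets (F s)"
  have [measurable]: "B \<in> sets M" "X s \<in> borel_measurable M" "X t \<in> borel_measurable M" "X (t - s) \<in> borel_measurable M"
    using st sets_F[of s] borel_measurable_X[of s] borel_measurable_X[of t] borel_measurable_X[of "t - s"] by auto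
  have "(\<integral>\<^sup>+w. indicator B w * ennreal (exp (\<theta> * X t w - \<psi> \<theta> * t)) \<partial>M)
     = (\<integral>\<^sup>+w. indicator B w * ennreal (exp (\<theta> * (X s w + (X t w - X s w)) - \<psi> \<theta> * t)) \<partial>M)"
    by simp
  also have "... = (\<integral>\<^sup>+w. indicator B w * (\<integral>\<^sup>+w'. ennreal (exp (\<theta> * (X s w + X (t - s) w') - \<psi> \<theta> * t)) \<partial>M) \<partial>M)"
    using markov[of s t B "X s" "\<lambda>(x, y). ennreal (exp (\<theta> * (x + y) - \<psi> \<theta> * t))"] st adapted[of s] by simp
  also have "... = (\<integral>\<^sup>+w. indicator B w * ennreal (exp (\<theta> * X s w - \<psi> \<theta> * s)) \<partial>M)"
  proof (rule nn_integral_cong)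
    fix w
    have "(\<integral>\<^sup>+w'. ennreal (exp (\<theta> * (X s w + X (t - s) w') - \<psi> \<theta> * t)) \<partial>M)
      = (\<integral>\<^sup>+w'. ennreal (exp (\<theta> * X s w - \<psi> \<theta> * t)) * ennreal (exp (\<theta> * X (t - s) w')) \<partial>M)"
      by (intro nn_integral_cong) (auto simp: ennreal_mult[symmetric] exp_add[symmetric] algebra_simps)
    also have "... = ennreal (exp (\<theta> * X s w - \<psi> \<theta> * t)) * ennreal (exp ((t - s) * \<psi> \<theta>))"
      using st \<theta> by (simp add: nn_integral_cmult nn_integral_exp_X)
    also have "... = ennreal (exp (\<theta> * X s w - \<psi> \<theta> * s))"
      by (auto simp: ennreal_mult[symmetric] exp_add[symmetric] algebra_simps)
    finally show "indicator B w * (\<integral>\<^sup>+w'. ennreal (exp (\<theta> * (X s w + X (t - s) w') - \<psi> \<theta> * t)) \<partial>M) =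
      indicator B w * ennreal (exp (\<theta> * X s w - \<psi> \<theta> * s))" by simp
  qed
  finally have *: "(\<integral>\<^sup>+w. indicator B w * ennreal (exp (\<theta> * X t w - \<psi> \<theta> * t)) \<partial>M) =
    (\<integral>\<^sup>+w. indicator B w * ennreal (exp (\<theta> * X s w - \<psi> \<theta> * s)) \<partial>M)" .
  have conv: "(\<integral>w. indicator B w * exp (\<theta> * X r w - \<psi> \<theta> * r) \<partial>M) =
     enn2real (\<integral>\<^sup>+w. indicator B w * ennreal (exp (\<theta> * X r w - \<psi> \<theta> * r)) \<partial>M)" if "X r \<in> borel_measurable M" for r
    using that by (subst integral_eq_nn_integral) (auto intro!: arg_cong[where f=enn2real] nn_integral_cong split: split_indicator)
  show "(\<integral>w. indicator B w * exp (\<theta> * X t w - \<psi> \<theta> * t) \<partial>M) = (\<integral>w. indicator B w * exp (\<theta> * X s w - \<psi> \<theta> * s) \<partial>M)"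
    by (simp add: conv *)
qed

text \<open>The exponential martingale has mean 1, and its time factor is bounded up to time K + 1,
  as \<open>dyadic_above\<close> exceeds \<open>S\<close> by at most 1.\<close>

lemma exp_moment_dyadic_bound:
  assumes \<theta>: "\<theta> >= 0" and S: "optional S" and K: "\<And>w. w \<in> space M ==> S w <= K"
  shows "(\<integral>\<^sup>+w. ennreal (exp (\<theta> * X (dyadic_above m (S w)) w)) \<partial>M) <= ennreal (exp (\<bar>\<psi> \<theta>\<bar> * (K + 1)))"
proof -
  note os = optional_stopping_dyadic[OF mart_exp[OF \<theta>] S K, of m]
  have K0: "0 <= K" using K optional_nonneg[OF S] not_empty by (metis all_not_in_conv order_trans)
  have le: "exp (\<theta> * X (dyadic_above m (S w)) w) \<le>
    exp (\<bar>\<psi> \<theta>\<bar> * (K + 1)) * exp (\<theta> * X (dyadic_above m (S w)) w - \<psi> \<theta> * dyadic_above m (S w))" if w: "w \<in> space M" for w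
  proof -
    have "dyadic_above m (S w) <= S w + 1 / 2 ^ m" using dyadic_above_le optional_nonneg[OF S w] by simp
    also have "... <= K + 1" using K[OF w] by (simp add: add_mono)
    finally have "\<bar>\<psi> \<theta>\<bar> * dyadic_above m (S w) <= \<bar>\<psi> \<theta>\<bar> * (K + 1)" by (intro mult_left_mono) auto
    moreover have "\<psi> \<theta> * dyadic_above m (S w) <= \<bar>\<psi> \<theta>\<bar> * dyadic_above m (S w)"
      using dyadic_above_pos[of m "S w"] by (intro mult_right_mono) auto
    ultimately show ?thesis by (simp add: exp_add[symmetric])
  qed
  have "(\<integral>\<^sup>+w. ennreal (exp (\<theta> * X (dyadic_above m (S w)) w)) \<partial>M) \<le>
    (\<integral>\<^sup>+w. ennreal (exp (\<bar>\<psi> \<theta>\<bar> * (K + 1)) * exp (\<theta> * X (dyadic_above m (S w)) w - \<psi> \<theta> * dyadic_above m (S w))) \<partial>M)"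
    by (intro nn_integral_mono ennreal_leI le)
  also have "... = ennreal (\<integral>w. exp (\<bar>\<psi> \<theta>\<bar> * (K + 1)) * exp (\<theta> * X (dyadic_above m (S w)) w - \<psi> \<theta> * dyadic_above m (S w)) \<partial>M)"
    using os(1) by (intro nn_integral_eq_integral) auto
  also have "(\<integral>w. exp (\<bar>\<psi> \<theta>\<bar> * (K + 1)) * exp (\<theta> * X (dyadic_above m (S w)) w - \<psi> \<theta> * dyadic_above m (S w)) \<partial>M) = exp (\<bar>\<psi> \<theta>\<bar> * (K + 1)) * 1"
  proof -
    have "(\<integral>w. exp (\<theta> * X 0 w - \<psi> \<theta> * 0) \<partial>M) = (\<integral>w. 1 \<partial>M)"
      by (intro Bochner_Integration.integral_cong) (auto simp: X_0)
    then show ?thesis using os(2) by (simp add: prob_space)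
  qed
  finally show ?thesis by simp
qed

lemma measurable_X_dyadic: "S \<in> borel_measurable M ==> (\<lambda>w. X (dyadic_above m (S w)) w) \<in> borel_measurable M"
  by (intro measurable_X_at) (auto simp: dyadic_above_def[abs_def] add_nonneg_nonneg)

text \<open>Passing from dyadic times to \<open>S\<close> needs uniform integrability; the square of
  the martingale at \<theta> is controlled by the moment at twice \<theta>. The second-moment bound
  depends on \<open>S\<close> only through \<open>K\<close>, and
  \<open>quasi_left_continuity\<close> uses it for a whole sequence of times.\<close>

lemma optional_stopping_exp:
  assumes \<theta>: "\<theta> >= 0" and S: "optional S" and K: "\<And>w. w \<in> space M ==> S w <= K"
  shows "integrable M (\<lambda>w. exp (\<theta> * X (S w) w - \<psi> \<theta> * S w))"
    and "(\<integral>w. exp (\<theta> * X (S w) w - \<psi> \<theta> * S w) \<partial>M) = 1"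
    and "(\<integral>\<^sup>+w. ennreal ((exp (\<theta> * X (S w) w - \<psi> \<theta> * S w))\<^sup>2) \<partial>M) <= ennreal (exp (2 * \<bar>\<psi> \<theta>\<bar> * (K + 1)) * exp (\<bar>\<psi> (2 * \<theta>)\<bar> * (K + 1)))"
proof -
  have [measurable]: "S \<in> borel_measurable M" using S by (rule optional_measurable)
  have K0: "0 <= K" using K optional_nonneg[OF S] not_empty by (metis all_not_in_conv order_trans)
  define f where "f m w = exp (\<theta> * X (dyadic_above m (S w)) w - \<psi> \<theta> * dyadic_above m (S w))" for m w
  define g where "g w = exp (\<theta> * X (S w) w - \<psi> \<theta> * S w)" for w
  have [measurable]: "(\<lambda>w. X (dyadic_above m (S w)) w) \<in> borel_measurable M" for m by (rule measurable_X_dyadic) simp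
  have [measurable]: "(\<lambda>w. X (S w) w) \<in> borel_measurable M" using S by (intro measurable_X_at) (auto simp: optional_nonneg)
  have [measurable]: "f m \<in> borel_measurable M" for m
  proof -
    have "(\<lambda>w. dyadic_above m (S w)) \<in> borel_measurable M" by (simp add: dyadic_above_def)
    then show ?thesis unfolding f_def[abs_def] by measurable
  qed
  have [measurable]: "g \<in> borel_measurable M" unfolding g_def[abs_def] by measurable
  have lim: "AE w in M. (\<lambda>m. f m w) \<longlonglongrightarrow> g w"
  proof (rule AE_I2)
    fix w assume w: "w \<in> space M"
    have "(\<lambda>m. dyadic_above m (S w)) \<longlonglongrightarrow> S w"
      using filterlim_dyadic_above[OF optional_nonneg[OF S w]] by (auto simp: filterlim_at)
    then show "(\<lambda>m. f m w) \<longlonglongrightarrow> g w"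
      unfolding f_def g_def using optional_nonneg[OF S w] w
      by (intro tendsto_intros X_dyadic_above)
  qed
  have bound: "(\<integral>\<^sup>+w. ennreal ((f m w)\<^sup>2) \<partial>M) <= ennreal (exp (2 * \<bar>\<psi> \<theta>\<bar> * (K + 1)) * exp (\<bar>\<psi> (2 * \<theta>)\<bar> * (K + 1)))" for m
  proof -
    have "(\<integral>\<^sup>+w. ennreal ((f m w)\<^sup>2) \<partial>M) <= (\<integral>\<^sup>+w. ennreal (exp (2 * \<bar>\<psi> \<theta>\<bar> * (K + 1))) * ennreal (exp (2 * \<theta> * X (dyadic_above m (S w)) w)) \<partial>M)"
    proof (rule nn_integral_mono)
      fix w assume w: "w \<in> space M"
      have "dyadic_above m (S w) <= S w + 1 / 2 ^ m" using dyadic_above_le optional_nonneg[OF S w] by simp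
      also have "... <= K + 1" using K[OF w] by (simp add: add_mono)
      finally have "\<bar>\<psi> \<theta>\<bar> * dyadic_above m (S w) <= \<bar>\<psi> \<theta>\<bar> * (K + 1)" by (intro mult_left_mono) auto
      moreover have "- (\<psi> \<theta> * dyadic_above m (S w)) <= \<bar>\<psi> \<theta>\<bar> * dyadic_above m (S w)"
        using dyadic_above_pos[of m "S w"] mult_right_mono[of "- \<psi> \<theta>" "\<bar>\<psi> \<theta>\<bar>" "dyadic_above m (S w)"] by auto
      ultimately have "- (\<psi> \<theta> * dyadic_above m (S w)) <= \<bar>\<psi> \<theta>\<bar> * (K + 1)" by linarith
      then have "(f m w)\<^sup>2 <= exp (2 * \<bar>\<psi> \<theta>\<bar> * (K + 1)) * exp (2 * \<theta> * X (dyadic_above m (S w)) w)"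
        by (simp add: f_def power2_eq_square exp_add[symmetric] mult.commute)
      then show "ennreal ((f m w)\<^sup>2) <= ennreal (exp (2 * \<bar>\<psi> \<theta>\<bar> * (K + 1))) * ennreal (exp (2 * \<theta> * X (dyadic_above m (S w)) w))"
        by (simp add: ennreal_mult[symmetric] ennreal_leI)
    qed
    also have "... = ennreal (exp (2 * \<bar>\<psi> \<theta>\<bar> * (K + 1))) * (\<integral>\<^sup>+w. ennreal (exp (2 * \<theta> * X (dyadic_above m (S w)) w)) \<partial>M)"
      by (intro nn_integral_cmult) simp
    also have "... <= ennreal (exp (2 * \<bar>\<psi> \<theta>\<bar> * (K + 1))) * ennreal (exp (\<bar>\<psi> (2 * \<theta>)\<bar> * (K + 1)))"
      using \<theta> exp_moment_dyadic_bound[OF _ S K, of "2 * \<theta>"] by (intro mult_left_mono) auto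
    finally show ?thesis by (simp add: ennreal_mult)
  qed
  note UI = L2_bounded_imp_integral_convergent[of f g "exp (2 * \<bar>\<psi> \<theta>\<bar> * (K + 1)) * exp (\<bar>\<psi> (2 * \<theta>)\<bar> * (K + 1))", OF _ _ _ lim bound]
  have fint: "(\<integral>w. f m w \<partial>M) = 1" for m
  proof -
    have "(\<integral>w. exp (\<theta> * X 0 w - \<psi> \<theta> * 0) \<partial>M) = (\<integral>w. 1 \<partial>M)"
      by (intro Bochner_Integration.integral_cong) (auto simp: X_0)
    then show ?thesis using optional_stopping_dyadic(2)[OF mart_exp[OF \<theta>] S K, of m] by (simp add: f_def prob_space)
  qed
  show "integrable M (\<lambda>w. exp (\<theta> * X (S w) w - \<psi> \<theta> * S w))"
    using UI(2) by (simp add: f_def g_def[abs_def])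
  show "(\<integral>\<^sup>+w. ennreal ((exp (\<theta> * X (S w) w - \<psi> \<theta> * S w))\<^sup>2) \<partial>M) <= ennreal (exp (2 * \<bar>\<psi> \<theta>\<bar> * (K + 1)) * exp (\<bar>\<psi> (2 * \<theta>)\<bar> * (K + 1)))"
    using UI(4) by (simp add: f_def g_def[abs_def])
  have "(\<lambda>m. \<integral>w. f m w \<partial>M) \<longlonglongrightarrow> (\<integral>w. g w \<partial>M)" using UI(3) by (simp add: f_def)
  then have "(\<integral>w. g w \<partial>M) = 1" using fint by (simp add: LIMSEQ_const_iff)
  then show "(\<integral>w. exp (\<theta> * X (S w) w - \<psi> \<theta> * S w) \<partial>M) = 1" by (simp add: g_def)
qed

text \<open>Exponential growth of \<open>V\<close> gives a second-moment bound at dyadic times, and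
  monotonicity of \<open>A\<close> gives domination by \<open>A (K + 1)\<close>. It is applied to
  averages of \<open>W\<close> with occupation times and to \<open>W\<close> with the local
  time.\<close>

lemma optional_stopping_compensated:
  assumes V: "continuous_on UNIV V" "\<And>x. 0 <= V x" "\<And>x. V x <= C * exp x"
    and A_mono: "\<And>w s t. w \<in> space M ==> 0 <= s ==> s <= t ==> A s w <= A t w"
    and A_right: "\<And>w t. w \<in> space M ==> 0 <= t ==> ((\<lambda>s. A s w) \<longlongrightarrow> A t w) (at_right t)"
    and A_0: "\<And>w. w \<in> space M ==> A 0 w = 0"
    and A_int: "\<And>t. 0 <= t ==> integrable M (A t)"
    and mart: "mart (\<lambda>t w. V (X t w) - A t w)"
    and S: "optional S" and K: "\<And>w. w \<in> space M ==> S w <= K"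
  shows "integrable M (\<lambda>w. V (X (S w) w))" "integrable M (\<lambda>w. A (S w) w)"
    "(\<integral>w. V (X (S w) w) \<partial>M) = V 0 + (\<integral>w. A (S w) w \<partial>M)"
proof -
  have [measurable]: "V \<in> borel_measurable borel" using V(1) by (rule borel_measurable_continuous_onI)
  have [measurable]: "S \<in> borel_measurable M" using S by (rule optional_measurable)
  have K0: "0 <= K" using K optional_nonneg[OF S] not_empty by (metis all_not_in_conv order_trans)
  define f where "f m w = V (X (dyadic_above m (S w)) w)" for m w
  define g where "g w = V (X (S w) w)" for w
  define h where "h m w = A (dyadic_above m (S w)) w" for m w
  have [measurable]: "(\<lambda>w. X (dyadic_above m (S w)) w) \<in> borel_measurable M" for m by (rule measurable_X_dyadic) simp
  have [measurable]: "(\<lambda>w. X (S w) w) \<in> borel_measurable M" using S by (intro measurable_X_at) (auto simp: optional_nonneg)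
  have [measurable]: "f m \<in> borel_measurable M" for m unfolding f_def[abs_def] by measurable
  have [measurable]: "g \<in> borel_measurable M" unfolding g_def[abs_def] by measurable
  have [measurable]: "A t \<in> borel_measurable M" if "0 <= t" for t using A_int[OF that] by auto
  have hm[measurable]: "h m \<in> borel_measurable M" for m
  proof -
    have "(\<lambda>w. (\<lambda>k w. A ((real k + 1) / 2 ^ m) w) (nat \<lfloor>2 ^ m * S w\<rfloor>) w) \<in> borel_measurable M"
      by (rule measurable_compose_countable) auto
    then show ?thesis by (simp add: h_def[abs_def] dyadic_above_def)
  qed
  have flim: "AE w in M. (\<lambda>m. f m w) \<longlonglongrightarrow> g w"
  proof (rule AE_I2)
    fix w assume w: "w \<in> space M"
    have "isCont V (X (S w) w)" using V(1) by (simp add: continuous_on_eq_continuous_at)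
    then show "(\<lambda>m. f m w) \<longlonglongrightarrow> g w" unfolding f_def g_def
      using X_dyadic_above[OF w optional_nonneg[OF S w]] by (rule isCont_tendsto_compose)
  qed
  have hlim: "(\<lambda>m. h m w) \<longlonglongrightarrow> A (S w) w" if w: "w \<in> space M" for w
    unfolding h_def by (rule filterlim_compose[OF A_right filterlim_dyadic_above]) (use w S optional_nonneg in auto)
  have ASm[measurable]: "(\<lambda>w. A (S w) w) \<in> borel_measurable M"
    by (rule borel_measurable_LIMSEQ_real[OF hlim hm])
  have dle: "dyadic_above m (S w) <= K + 1" if w: "w \<in> space M" for w m
  proof -
    have "dyadic_above m (S w) <= S w + 1 / 2 ^ m" using dyadic_above_le optional_nonneg[OF S w] by simp
    also have "... <= K + 1" using K[OF w] by (simp add: add_mono)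
    finally show ?thesis .
  qed
  have hb: "0 <= h m w" "h m w <= A (K + 1) w" if w: "w \<in> space M" for m w
    using A_mono[OF w, of 0 "dyadic_above m (S w)"] A_mono[OF w, of "dyadic_above m (S w)" "K + 1"] dle[OF w, of m]
      dyadic_above_pos[of m "S w"] A_0[OF w] by (auto simp: h_def)
  have hint: "(\<lambda>m. \<integral>w. h m w \<partial>M) \<longlonglongrightarrow> (\<integral>w. A (S w) w \<partial>M)"
    by (rule integral_dominated_convergence[where w="A (K + 1)"]) (use hlim hb A_int K0 in auto)
  show "integrable M (\<lambda>w. A (S w) w)"
    by (rule integrable_dominated_convergence[where w="A (K + 1)" and s=h]) (use hlim hb A_int K0 in auto)
  have hi: "integrable M (h m)" for m
  proof (rule Bochner_Integration.integrable_bound)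
    show "integrable M (A (K + 1))" using A_int K0 by simp
    show "AE w in M. norm (h m w) <= norm (A (K + 1) w)" using hb[of _ m] by (intro AE_I2) fastforce
  qed simp
  have bound: "(\<integral>\<^sup>+w. ennreal ((f m w)\<^sup>2) \<partial>M) <= ennreal (C\<^sup>2 * exp (\<bar>\<psi> 2\<bar> * (K + 1)))" for m
  proof -
    have "(\<integral>\<^sup>+w. ennreal ((f m w)\<^sup>2) \<partial>M) <= (\<integral>\<^sup>+w. ennreal (C\<^sup>2) * ennreal (exp (2 * X (dyadic_above m (S w)) w)) \<partial>M)"
    proof (rule nn_integral_mono)
      fix w
      have "(f m w)\<^sup>2 <= (C * exp (X (dyadic_above m (S w)) w))\<^sup>2" unfolding f_def by (intro power_mono V)
      also have "... = C\<^sup>2 * exp (2 * X (dyadic_above m (S w)) w)" by (simp add: power_mult_distrib exp_double)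
      finally show "ennreal ((f m w)\<^sup>2) <= ennreal (C\<^sup>2) * ennreal (exp (2 * X (dyadic_above m (S w)) w))"
        by (simp add: ennreal_mult[symmetric] ennreal_leI)
    qed
    also have "... = ennreal (C\<^sup>2) * (\<integral>\<^sup>+w. ennreal (exp (2 * X (dyadic_above m (S w)) w)) \<partial>M)"
      by (intro nn_integral_cmult) simp
    also have "... <= ennreal (C\<^sup>2) * ennreal (exp (\<bar>\<psi> 2\<bar> * (K + 1)))"
      using exp_moment_dyadic_bound[OF _ S K, of 2] by (intro mult_left_mono) auto
    finally show ?thesis by (simp add: ennreal_mult)
  qed
  note UI = L2_bounded_imp_integral_convergent[of f g "C\<^sup>2 * exp (\<bar>\<psi> 2\<bar> * (K + 1))", OF _ _ _ flim bound]
  have fi: "integrable M (f m)" for m using UI(1) V(2) by (simp add: f_def[abs_def])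
  show "integrable M (\<lambda>w. V (X (S w) w))" using UI(2) V(2) by (simp add: f_def g_def[abs_def])
  have gint: "(\<lambda>m. \<integral>w. f m w \<partial>M) \<longlonglongrightarrow> (\<integral>w. g w \<partial>M)" using UI(3) V(2) by (simp add: f_def)
  have "(\<integral>w. f m w \<partial>M) - (\<integral>w. h m w \<partial>M) = V 0" for m
  proof -
    have "(\<integral>w. f m w \<partial>M) - (\<integral>w. h m w \<partial>M) = (\<integral>w. f m w - h m w \<partial>M)" using fi hi by simp
    also have "... = (\<integral>w. V (X 0 w) - A 0 w \<partial>M)"
      using optional_stopping_dyadic(2)[OF mart S K, of m] by (simp add: f_def h_def)
    also have "... = (\<integral>w. V 0 \<partial>M)" by (intro Bochner_Integration.integral_cong) (auto simp: X_0 A_0)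
    finally show ?thesis by (simp add: prob_space)
  qed
  then have "(\<lambda>m. V 0) \<longlonglongrightarrow> (\<integral>w. g w \<partial>M) - (\<integral>w. A (S w) w \<partial>M)"
    using tendsto_diff[OF gint hint] by simp
  then have "V 0 = (\<integral>w. g w \<partial>M) - (\<integral>w. A (S w) w \<partial>M)" by (simp add: LIMSEQ_const_iff)
  then show "(\<integral>w. V (X (S w) w) \<partial>M) = V 0 + (\<integral>w. A (S w) w \<partial>M)" by (simp add: g_def)
qed

end

section \<open>Exit times, drift and the scale function\<close>

lemma nn_integral_exp_atLeast:
  fixes \<theta> a :: real
  assumes "\<theta> > 0"
  shows "(\<integral>\<^sup>+x. ennreal (exp (- \<theta> * x)) * indicator {a..} x \<partial>lborel) = ennreal (exp (- \<theta> * a) / \<theta>)"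
proof -
  have "((\<lambda>x. exp (- \<theta> * x)) \<longlongrightarrow> 0) at_top"
    using assms by (intro filterlim_compose[OF exp_at_bot] filterlim_tendsto_neg_mult_at_bot[OF tendsto_const _ filterlim_ident]) auto
  then have "((\<lambda>x. - (exp (- \<theta> * x) / \<theta>)) \<longlongrightarrow> - (0 / \<theta>)) at_top"
    using assms by (intro tendsto_minus tendsto_divide tendsto_const) auto
  then have lim: "((\<lambda>x. - (exp (- \<theta> * x) / \<theta>)) \<longlongrightarrow> 0) at_top" by simp
  have "(\<integral>\<^sup>+x. ennreal (exp (- \<theta> * x)) * indicator {a..} x \<partial>lborel) = ennreal (0 - (- (exp (- \<theta> * a) / \<theta>)))"
    by (rule nn_integral_FTC_atLeast[OF _ _ _ lim]) (use assms in \<open>auto intro!: derivative_eq_intros\<close>)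
  then show ?thesis by simp
qed

context sn_levy
begin

section \<open>Entry times into open sets\<close>

text \<open>By right-continuity an exceedance of \<open>c\<close> persists to a rational time
  shortly afterwards, which makes H < t a countable union. At \<open>H\<close> itself only the
  closed inequality survives, as a limit from the right.\<close>

lemma hitting_open:
  fixes D :: "real => 'a => real" and c q :: real
  defines "H w \<equiv> Inf {ereal t | t. q <= t \<and> D t w > c}"
  assumes q: "0 <= q" and D: "\<And>t. 0 <= t ==> D t \<in> borel_measurable (F t)"
    and D_right: "\<And>w t. w \<in> space M ==> 0 <= t ==> ((\<lambda>s. D s w) \<longlongrightarrow> D t w) (at_right t)"
  shows "\<And>t. {w\<in>space M. H w < ereal t} \<in> sets (F (max 0 t))"
    and "\<And>w. ereal q <= H w"
    and "\<And>w h. w \<in> space M ==> H w = ereal h ==> c <= D h w"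
    and "\<And>w t. q <= t ==> ereal t < H w ==> D t w <= c"
proof -
  have less_iff: "H w < ereal t \<longleftrightarrow> (\<exists>s. q <= s \<and> s < t \<and> D s w > c)" for w t
    unfolding H_def Inf_less_iff by auto
  show "{w\<in>space M. H w < ereal t} \<in> sets (F (max 0 t))" for t
  proof -
    have "{w\<in>space M. H w < ereal t} = (\<Union>r\<in>{r\<in>\<rat>. q <= r \<and> r < t}. {w\<in>space (F (max 0 t)). D r w > c})"
    proof (safe, goal_cases)
      case (1 w)
      then obtain s where s: "q <= s" "s < t" "D s w > c" by (auto simp: less_iff)
      from order_tendstoD(1)[OF D_right[OF 1(1), of s] s(3)] s q
      obtain b where b: "b > s" "\<And>u. s < u ==> u < b ==> c < D u w"
        by (auto simp: eventually_at_right_field)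
      obtain r where "r \<in> \<rat>" "s < r" "r < min b t"
        using Rats_dense_in_real[of s "min b t"] b s by auto
      then show ?case using s b(2)[of r] 1(1) by (auto simp: space_F)
    qed (auto simp: space_F less_iff)
    also have "... \<in> sets (F (max 0 t))"
    proof (rule sets.countable_UN'')
      show "countable {r\<in>\<rat>. q <= r \<and> r < t}" using countable_rat by (rule countable_subset[rotated]) auto
      fix r assume r: "r \<in> {r\<in>\<rat>. q <= r \<and> r < t}"
      then have [measurable]: "D r \<in> borel_measurable (F (max 0 t))"
        using q by (intro measurable_F_mono[OF _ _ D]) auto
      show "{w\<in>space (F (max 0 t)). D r w > c} \<in> sets (F (max 0 t))" by measurable
    qed
    finally show ?thesis .
  qed
  show ge: "ereal q <= H w" for w unfolding H_def by (auto intro!: Inf_greatest)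
  show before: "D t w <= c" if "q <= t" "ereal t < H w" for t w
  proof (rule ccontr)
    assume "\<not> D t w <= c"
    then have "H w <= ereal t" unfolding H_def using that by (intro Inf_lower) auto
    then show False using that by simp
  qed
  show "c <= D h w" if w: "w \<in> space M" and h: "H w = ereal h" for w h
  proof (rule ccontr)
    assume "\<not> c <= D h w"
    have hq: "q <= h" using ge[of w] h by simp
    from order_tendstoD(2)[OF D_right[OF w, of h], of c] \<open>\<not> c <= D h w\<close> hq q
    obtain b where b: "b > h" "\<And>u. h < u ==> u < b ==> D u w < c"
      by (auto simp: eventually_at_right_field)
    have "H w < ereal b" using h b by simp
    then obtain s where s: "q <= s" "s < b" "D s w > c" by (auto simp: less_iff)
    have "h <= s" using h s unfolding H_def by (metis (mono_tags, lifting) Inf_lower ereal_less_eq(3) mem_Collect_eq)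
    then show False using b(2)[of s] s \<open>\<not> c <= D h w\<close> by (cases "s = h") auto
  qed
qed

text \<open>Truncation makes the time bounded and real-valued, the value infinity included, so that
  optional stopping applies.\<close>

definition cap :: "('a => ereal) => real => 'a => real" where
  "cap R K w = real_of_ereal (min (R w) (ereal K))"

lemma cap_eq: "0 <= R w ==> ereal (cap R K w) = min (R w) (ereal K)"
  unfolding cap_def by (cases "R w") (auto simp: min_def)

lemma cap_le: "0 <= R w ==> cap R K w <= K"
  using cap_eq[of R w K] by (metis ereal_less_eq(3) min.cobounded2)

lemma cap_less: "R w = ereal r ==> r <= K ==> cap R K w = r"
  by (simp add: cap_def min_def)

lemma optional_cap:
  assumes R: "\<And>w. w \<in> space M ==> 0 <= R w" "\<And>t. 0 < t ==> {w\<in>space M. R w < ereal t} \<in> sets (F t)" and K: "0 <= K"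
  shows "optional (cap R K)"
  unfolding optional_def
proof (intro conjI ballI allI impI)
  fix w assume "w \<in> space M"
  then have "ereal 0 <= ereal (cap R K w)" using R(1) K by (simp add: cap_eq flip: zero_ereal_def)
  then show "0 <= cap R K w" by simp
next
  fix t :: real assume t: "0 < t"
  have "cap R K w < t \<longleftrightarrow> R w < ereal t \<or> K < t" if "w \<in> space M" for w
  proof -
    have "cap R K w < t \<longleftrightarrow> ereal (cap R K w) < ereal t" by simp
    also have "... \<longleftrightarrow> R w < ereal t \<or> K < t" using R(1)[OF that] by (simp add: cap_eq min_less_iff_disj)
    finally show ?thesis .
  qed
  then have "{w\<in>space M. cap R K w < t} = (if K < t then space M else {w\<in>space M. R w < ereal t})" by auto
  then show "{w\<in>space M. cap R K w < t} \<in> sets (F t)"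
    using R(2)[OF t] sets.top[of "F t"] by (auto simp: space_F)
qed

section \<open>Sign and growth of the Laplace exponent\<close>

text \<open>If \<open>X\<close> exceeds -K at some time after n, the exponential martingale is at
  that passage at least exp (- \<theta> K - \<psi> \<theta> n), which grows with n as \<psi>
  \<theta> < 0, while its mean is 1. So such late exceedances have probability tending to 0.\<close>

lemma drift_if_psi_neg:
  assumes \<theta>: "\<theta> > 0" and neg: "\<psi> \<theta> < 0"
  shows "AE w in M. filterlim (\<lambda>t. X t w) at_bot at_top"
proof -
  define H where "H K n w = Inf {ereal t | t. real n <= t \<and> X t w > - real K}" for K n :: nat and w
  have H_less: "{w\<in>space M. H K n w < ereal t} \<in> sets (F (max 0 t))"
    and H_ge: "ereal (real n) <= H K n w"
    and H_val: "w \<in> space M ==> H K n w = ereal h ==> - real K <= X h w"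
    and H_before: "real n <= s ==> ereal s < H K n w ==> X s w <= - real K" for K n t w h s
    using hitting_open[where q="real n" and D=X and c="- real K", OF _ adapted right_continuous_X] unfolding H_def by auto
  have H0: "0 <= H K n w" for K n w
    using H_ge[of n K w] by (metis ereal_less_eq(5) of_nat_0_le_iff order_trans)
  have H_meas[measurable]: "{w\<in>space M. H K n w < ereal t} \<in> sets M" for K n t
    using H_less[of K n t] sets_F[of "max 0 t"] by auto
  have bound: "prob {w\<in>space M. H K n w < ereal (real m)} <= exp (\<theta> * real K + \<psi> \<theta> * real n)" for K n m
  proof -
    define S where "S = cap (H K n) (real m)"
    have S: "optional S" unfolding S_def
    proof (rule optional_cap)
      show "{w\<in>space M. H K n w < ereal t} \<in> sets (F t)" if "0 < t" for t
        using H_less[of K n t] that by (simp add: max_def)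
    qed (use H0 in auto)
    have SK: "S w <= real m" for w unfolding S_def using H0 by (rule cap_le)
    let ?A = "{w\<in>space M. H K n w < ereal (real m)}"
    have "(\<integral>w. indicator ?A w * exp (- \<theta> * real K - \<psi> \<theta> * real n) \<partial>M) <= (\<integral>w. exp (\<theta> * X (S w) w - \<psi> \<theta> * S w) \<partial>M)"
    proof (rule integral_mono)
      show "integrable M (\<lambda>w. indicator ?A w * exp (- \<theta> * real K - \<psi> \<theta> * real n))"
        by (intro integrable_mult_left integrable_real_indicator) (auto simp: emeasure_eq_measure)
      show "integrable M (\<lambda>w. exp (\<theta> * X (S w) w - \<psi> \<theta> * S w))"
        using optional_stopping_exp(1)[OF _ S SK] \<theta> by simp
      fix w assume w: "w \<in> space M"
      show "indicator ?A w * exp (- \<theta> * real K - \<psi> \<theta> * real n) <= exp (\<theta> * X (S w) w - \<psi> \<theta> * S w)"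
      proof (cases "w \<in> ?A")
        case True
        then obtain h where h: "H K n w = ereal h" "h < real m"
          using H0[of K n w] by (cases "H K n w") auto
        then have Sh: "S w = h" unfolding S_def by (intro cap_less) auto
        have hn: "real n <= h" using H_ge[of n K w] h by simp
        have "\<theta> * (- real K) <= \<theta> * X h w" using H_val[OF w h(1)] \<theta> by (intro mult_left_mono) auto
        moreover have "(- \<psi> \<theta>) * real n <= (- \<psi> \<theta>) * h" using hn neg by (intro mult_left_mono) auto
        ultimately show ?thesis using True by (simp add: Sh)
      qed simp
    qed
    also have "... = 1" using optional_stopping_exp(2)[OF _ S SK] \<theta> by simp
    finally have "prob ?A * exp (- \<theta> * real K - \<psi> \<theta> * real n) <= 1" by simp
    then have "prob ?A <= 1 / exp (- \<theta> * real K - \<psi> \<theta> * real n)" by (simp add: field_simps)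
    also have "... = exp (\<theta> * real K + \<psi> \<theta> * real n)" by (simp add: exp_minus[symmetric] inverse_eq_divide[symmetric])
    finally show ?thesis .
  qed
  define E where "E K n = {w\<in>space M. H K n w < \<infinity>}" for K n
  have E_eq: "E K n = (\<Union>m. {w\<in>space M. H K n w < ereal (real m)})" for K n
  proof (safe, goal_cases)
    case (1 w)
    then obtain h where h: "H K n w = ereal h" using H0[of K n w] by (cases "H K n w") (auto simp: E_def)
    obtain m :: nat where "h < real m" using reals_Archimedean2 by blast
    then show ?case using 1 h by (auto simp: E_def)
  qed (auto simp: E_def)
  have [measurable]: "E K n \<in> sets M" for K n unfolding E_eq by measurable
  have E_bound: "prob (E K n) <= exp (\<theta> * real K + \<psi> \<theta> * real n)" for K n
  proof -
    have "(\<lambda>m. prob {w\<in>space M. H K n w < ereal (real m)}) \<longlonglongrightarrow> prob (E K n)"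
      unfolding E_eq by (intro finite_Lim_measure_incseq) (auto simp: incseq_def intro: less_le_trans)
    then show ?thesis by (rule LIMSEQ_le_const2) (use bound in auto)
  qed
  have "AE w in M. \<exists>n. w \<notin> E K n" for K
  proof -
    have le: "prob (\<Inter>n. E K n) <= exp (\<theta> * real K) * exp (\<psi> \<theta>) ^ n" for n
    proof -
      have "prob (\<Inter>n. E K n) <= prob (E K n)" by (intro finite_measure_mono) auto
      also have "... <= exp (\<theta> * real K) * exp (\<psi> \<theta>) ^ n"
        using E_bound[of K n] by (simp add: exp_add exp_of_nat_mult[symmetric] mult.commute)
      finally show ?thesis .
    qed
    have "(\<lambda>n. exp (\<theta> * real K) * exp (\<psi> \<theta>) ^ n) \<longlonglongrightarrow> exp (\<theta> * real K) * 0"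
      using neg by (intro tendsto_intros LIMSEQ_realpow_zero) auto
    then have "prob (\<Inter>n. E K n) <= exp (\<theta> * real K) * 0"
      by (rule LIMSEQ_le_const) (use le in auto)
    then have "prob (\<Inter>n. E K n) = 0" using measure_nonneg[of M "\<Inter>n. E K n"] by linarith
    then have "AE w in M. w \<notin> (\<Inter>n. E K n)"
      by (intro AE_not_in) (auto simp: null_sets_def emeasure_eq_measure)
    then show ?thesis by eventually_elim auto
  qed
  then have "AE w in M. \<forall>K. \<exists>n. w \<notin> E K n" by (simp add: AE_all_countable)
  then show ?thesis
    using AE_space
  proof eventually_elim
    case (elim w)
    show ?case unfolding filterlim_at_bot eventually_at_top_linorder
    proof
      fix Z :: real
      obtain K :: nat where K: "- Z <= real K" using real_arch_simple by blast
      obtain n where "w \<notin> E K n" using elim by blast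
      then have "H K n w = \<infinity>" using elim by (auto simp: E_def)
      then have "X t w <= Z" if "real n <= t" for t
        using H_before[OF that, of K w] K by simp
      then show "\<exists>N. \<forall>t\<ge>N. X t w <= Z" by blast
    qed
  qed
qed

text \<open>Without drift to minus infinity, \<psi> (\<theta> / 2) >= 0. If also \<psi> \<theta> <=
  0, the mean square of exp (\<theta> X_t / 2) - 1 is at most 0, so \<open>X\<close> vanishes and
  its paths are monotone, which is excluded.\<close>

lemma psi_pos:
  assumes nd: "\<not> drifts_to_minus_infinity M X" and na: "\<not> (AE w in M. antimono_on {0..} (\<lambda>t. X t w))"
    and \<theta>: "\<theta> > 0"
  shows "\<psi> \<theta> > 0"
proof (rule ccontr)
  assume "\<not> \<psi> \<theta> > 0"
  have "\<not> \<psi> (\<theta> / 2) < 0"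
    using nd drift_if_psi_neg[of "\<theta> / 2"] \<theta> by (auto simp: drifts_to_minus_infinity_def)
  have zero: "AE w in M. X t w = 0" if t: "t >= 0" for t
  proof -
    have [measurable]: "X t \<in> borel_measurable M" using t by (rule borel_measurable_X)
    have i1: "integrable M (\<lambda>w. exp (\<theta> * X t w))" and i2: "integrable M (\<lambda>w. exp (\<theta> / 2 * X t w))"
      using integrable_exp_X[of \<theta> t] integrable_exp_X[of "\<theta> / 2" t] \<theta> t by auto
    have sq: "(exp (\<theta> / 2 * X t w) - 1)\<^sup>2 = exp (\<theta> * X t w) - 2 * exp (\<theta> / 2 * X t w) + 1" for w
      by (simp add: power2_eq_square algebra_simps exp_add[symmetric])
    have "(\<integral>w. (exp (\<theta> / 2 * X t w) - 1)\<^sup>2 \<partial>M) = exp (t * \<psi> \<theta>) - 2 * exp (t * \<psi> (\<theta> / 2)) + 1"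
      unfolding sq using i1 i2 expectation_exp_X[of \<theta> t] expectation_exp_X[of "\<theta> / 2" t] \<theta> t by (simp add: prob_space)
    also have "... <= 0"
    proof -
      have "t * \<psi> \<theta> <= 0" using \<open>\<not> \<psi> \<theta> > 0\<close> t by (simp add: mult_nonneg_nonpos)
      then have "exp (t * \<psi> \<theta>) <= 1" by simp
      moreover have "0 <= t * \<psi> (\<theta> / 2)" using \<open>\<not> \<psi> (\<theta> / 2) < 0\<close> t by simp
      then have "1 <= exp (t * \<psi> (\<theta> / 2))" by simp
      ultimately show ?thesis by linarith
    qed
    finally have "(\<integral>w. (exp (\<theta> / 2 * X t w) - 1)\<^sup>2 \<partial>M) = 0"
      by (intro antisym) (auto intro: Bochner_Integration.integral_nonneg)
    moreover have "integrable M (\<lambda>w. (exp (\<theta> / 2 * X t w) - 1)\<^sup>2)" unfolding sq using i1 i2 by auto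
    ultimately have "AE w in M. (exp (\<theta> / 2 * X t w) - 1)\<^sup>2 = 0"
      by (subst (asm) integral_nonneg_eq_0_iff_AE) auto
    then show ?thesis by eventually_elim (use \<theta> in auto)
  qed
  have "AE w in M. \<forall>m k. X ((real (k::nat) + 1) / 2 ^ (m::nat)) w = 0"
    unfolding AE_all_countable by (intro allI zero) auto
  then have "AE w in M. antimono_on {0..} (\<lambda>t. X t w)"
    using AE_space
  proof eventually_elim
    case (elim w)
    have "X t w = 0" if "t >= 0" for t
    proof -
      have "(\<lambda>m. 0) \<longlonglongrightarrow> X t w" using X_dyadic_above[OF elim(2) that] elim(1) by (simp add: dyadic_above_def)
      then show ?thesis by (simp add: LIMSEQ_const_iff)
    qed
    then show ?case by (auto simp: monotone_on_def)
  qed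
  then show False using na by simp
qed

text \<open>Chernoff's bound with exponent n tending to infinity gives X_t <= d t almost surely, and
  likewise for increments; so d t - X_t is increasing and \<open>X\<close> is a difference of
  monotone functions.\<close>

lemma bounded_variation_if_psi_linear:
  assumes lin: "\<And>\<theta>. \<theta> > 0 ==> \<psi> \<theta> <= d * \<theta>"
  shows "AE w in M. \<not> infinite_variation_on (\<lambda>s. X s w) 1"
proof -
  have AE1: "AE w in M. X t w <= d * t" if t: "t >= 0" for t
  proof -
    have [measurable]: "X t \<in> borel_measurable M" using t by (rule borel_measurable_X)
    have "prob {w\<in>space M. X t w - d * t >= \<eta>} = 0" if \<eta>: "\<eta> > 0" for \<eta>
    proof -
      have le: "prob {w\<in>space M. X t w - d * t >= \<eta>} <= exp (- \<eta>) ^ n" if n: "n > 0" for n :: nat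
      proof -
        let ?A = "{w\<in>space M. X t w - d * t >= \<eta>}"
        have i: "integrable M (\<lambda>w. exp (real n * X t w))" by (rule integrable_exp_X) (use t in auto)
        have "(\<integral>w. indicator ?A w * exp (real n * (d * t + \<eta>)) \<partial>M) <= (\<integral>w. exp (real n * X t w) \<partial>M)"
        proof (rule integral_mono[OF _ i])
          fix w show "indicator ?A w * exp (real n * (d * t + \<eta>)) <= exp (real n * X t w)"
            by (auto simp: indicator_def intro!: mult_left_mono)
          show "integrable M (\<lambda>w. indicator ?A w * exp (real n * (d * t + \<eta>)))"
            by (intro integrable_mult_left integrable_real_indicator) (auto simp: emeasure_eq_measure)
        qed
        also have "... = exp (t * \<psi> (real n))" by (rule expectation_exp_X) (use t in auto)
        also have "... <= exp (t * (d * real n))" using lin[of "real n"] n t by (auto intro!: mult_left_mono)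
        finally have "prob ?A * exp (real n * (d * t + \<eta>)) <= exp (t * (d * real n))" by simp
        then have "prob ?A <= exp (t * (d * real n)) / exp (real n * (d * t + \<eta>))" by (simp add: field_simps)
        also have "... = exp (- \<eta>) ^ n"
          by (simp add: exp_diff[symmetric] exp_of_nat_mult[symmetric] algebra_simps)
        finally show ?thesis .
      qed
      have "(\<lambda>n. exp (- \<eta>) ^ n) \<longlonglongrightarrow> 0" using \<eta> by (intro LIMSEQ_realpow_zero) auto
      then have "prob {w\<in>space M. X t w - d * t >= \<eta>} <= 0"
        by (rule LIMSEQ_le_const) (use le in \<open>auto intro!: exI[of _ 1]\<close>)
      then show ?thesis using measure_nonneg[of M] by (simp add: order_antisym)
    qed
    then have "AE w in M. \<forall>k. \<not> (X t w - d * t >= 1 / real (Suc k))"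
      unfolding AE_all_countable by (auto intro!: AE_I[OF _ _ ] simp: AE_iff_measurable[OF _ refl] emeasure_eq_measure)
    then show ?thesis
    proof eventually_elim
      case (elim w)
      show ?case
      proof (rule ccontr)
        assume "\<not> X t w <= d * t"
        then obtain k where "1 / real (Suc k) < X t w - d * t" using nat_approx_posE[of "X t w - d * t"] by auto
        then show False using elim[rule_format, of k] by simp
      qed
    qed
  qed
  have AE2: "AE w in M. X t w - X s w <= d * (t - s)" if st: "0 <= s" "s <= t" for s t
  proof -
    have [measurable]: "X t \<in> borel_measurable M" "X s \<in> borel_measurable M" "X (t - s) \<in> borel_measurable M"
      using st by (auto intro: borel_measurable_X)
    have "AE x in distr M borel (X (t - s)). x <= d * (t - s)"
      using AE1[of "t - s"] st by (subst AE_distr_iff) auto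
    then have "AE x in distr M borel (\<lambda>w. X t w - X s w). x <= d * (t - s)"
      using stationary[of s "t - s"] st by (simp only: add_diff_cancel_left' diff_add_cancel add_diff_eq diff_ge_0_iff_ge)
    then show ?thesis by (subst (asm) AE_distr_iff) auto
  qed
  have "AE w in M. \<forall>m k l. k <= l -->
    X ((real (l::nat) + 1) / 2 ^ (m::nat)) w - X ((real (k::nat) + 1) / 2 ^ m) w <= d * ((real l + 1) / 2 ^ m - (real k + 1) / 2 ^ m)"
  proof (unfold AE_all_countable, intro allI)
    fix m k l :: nat
    show "AE w in M. k <= l --> X ((real l + 1) / 2 ^ m) w - X ((real k + 1) / 2 ^ m) w <= d * ((real l + 1) / 2 ^ m - (real k + 1) / 2 ^ m)"
    proof (cases "k <= l")
      case True
      then have "AE w in M. X ((real l + 1) / 2 ^ m) w - X ((real k + 1) / 2 ^ m) w <= d * ((real l + 1) / 2 ^ m - (real k + 1) / 2 ^ m)"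
        by (intro AE2) (auto simp: divide_right_mono)
      then show ?thesis by eventually_elim simp
    qed simp
  qed
  then show ?thesis
    using AE_space
  proof eventually_elim
    case (elim w)
    have incr: "X t w - X s w <= d * (t - s)" if "0 <= s" "s <= t" for s t
    proof (rule LIMSEQ_le)
      have lim: "(\<lambda>m. dyadic_above m r) \<longlonglongrightarrow> r" if "0 <= r" for r
        using filterlim_dyadic_above[OF that] by (simp add: filterlim_at)
      show "(\<lambda>m. X (dyadic_above m t) w - X (dyadic_above m s) w) \<longlonglongrightarrow> X t w - X s w"
        using that elim(2) by (intro tendsto_diff X_dyadic_above) auto
      show "(\<lambda>m. d * (dyadic_above m t - dyadic_above m s)) \<longlonglongrightarrow> d * (t - s)"
        using that by (intro tendsto_intros lim) auto
      have "nat \<lfloor>2 ^ m * s\<rfloor> <= nat \<lfloor>2 ^ m * t\<rfloor>" for m :: nat using that by (intro nat_mono floor_mono) simp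
      then show "\<exists>N. \<forall>m\<ge>N. X (dyadic_above m t) w - X (dyadic_above m s) w <= d * (dyadic_above m t - dyadic_above m s)"
        using elim(1) unfolding dyadic_above_def by blast
    qed
    show ?case
    proof
      assume "infinite_variation_on (\<lambda>s. X s w) 1"
      then obtain n and p :: "nat => real" where p: "p 0 = 0" "p n = 1" "\<And>i. i < n ==> p i <= p (Suc i)"
        and big: "(\<Sum>i<n. \<bar>X (p (Suc i)) w - X (p i) w\<bar>) > 2 * \<bar>d\<bar> - (X 1 w - X 0 w)"
        unfolding infinite_variation_on_def by (elim allE[of _ "2 * \<bar>d\<bar> - (X 1 w - X 0 w)"]) auto
      have p0: "0 <= p i" if "i <= n" for i using that p(1,3) by (induction i) (auto intro: order_trans)
      \<comment> \<open>An increment z over a step of length h satisfies z <= |d| h, hence |z| <= 2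
        |d| h - z, and the right-hand sides telescope.\<close>
      have "(\<Sum>i<n. \<bar>X (p (Suc i)) w - X (p i) w\<bar>) <= (\<Sum>i<n. 2 * \<bar>d\<bar> * (p (Suc i) - p i) - (X (p (Suc i)) w - X (p i) w))"
      proof (rule sum_mono)
        fix i assume i: "i \<in> {..<n}"
        have a: "X (p (Suc i)) w - X (p i) w <= d * (p (Suc i) - p i)" using i p(3)[of i] p0[of i] by (intro incr) auto
        have b: "d * (p (Suc i) - p i) <= \<bar>d\<bar> * (p (Suc i) - p i)" "0 <= \<bar>d\<bar> * (p (Suc i) - p i)"
          using i p(3)[of i] by (auto intro: mult_right_mono)
        show "\<bar>X (p (Suc i)) w - X (p i) w\<bar> <= 2 * \<bar>d\<bar> * (p (Suc i) - p i) - (X (p (Suc i)) w - X (p i) w)"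
          using a b unfolding abs_le_iff by (simp add: algebra_simps)
      qed
      also have "... = 2 * \<bar>d\<bar> * (\<Sum>i<n. p (Suc i) - p i) - (\<Sum>i<n. X (p (Suc i)) w - X (p i) w)"
        by (simp only: sum_subtractf sum_distrib_left right_diff_distrib)
      also have "... = 2 * \<bar>d\<bar> - (X 1 w - X 0 w)"
        using sum_lessThan_telescope[of "\<lambda>i. X (p i) w" n] sum_lessThan_telescope[of p n] p by simp
      finally show False using big by simp
    qed
  qed
qed

end

section \<open>The scale function\<close>

text \<open>\<open>W_nonpos\<close> includes x = 0: under unbounded variation the scale function
  starts at 0, which makes \<open>W\<close> continuous on the whole line. The Laplace identity is
  available for all \<theta> > 0 because the largest root of \<psi> is 0.\<close>

locale sn_levy_scale = sn_levy +
  fixes W :: "real => real"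
  assumes psi_positive: "\<theta> > 0 ==> laplace_exponent M X \<theta> > 0"
    and W_nonpos: "x <= 0 ==> W x = 0"
    and W_cont: "continuous_on UNIV W"
    and W_mono: "x <= y ==> W x <= W y"
    and W_laplace: "\<theta> > 0 ==> (\<integral>\<^sup>+x. ennreal (exp (- \<theta> * x)) * ennreal (W x) \<partial>lborel) = ennreal (1 / laplace_exponent M X \<theta>)"
begin

lemma W_nonneg: "0 <= W x"
  using W_mono[of "min x 0" x] W_nonpos[of "min x 0"] by simp

lemma W_measurable[measurable]: "W \<in> borel_measurable borel"
  using W_cont by (rule borel_measurable_continuous_onI)

text \<open>As \<open>W\<close> is increasing, W x exp (- x) is at most the integral of exp (- y) W
  y over y >= x, hence at most the Laplace transform at 1.\<close>

lemma W_le_exp: "W x <= (1 / \<psi> 1) * exp x"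
proof -
  have "ennreal (W x * exp (- x)) = (\<integral>\<^sup>+y. ennreal (W x) * (ennreal (exp (- 1 * y)) * indicator {x..} y) \<partial>lborel)"
    using nn_integral_exp_atLeast[of 1 x] by (simp add: nn_integral_cmult ennreal_mult W_nonneg)
  also have "... <= (\<integral>\<^sup>+y. ennreal (exp (- 1 * y)) * ennreal (W y) \<partial>lborel)"
    by (intro nn_integral_mono) (auto simp: ennreal_mult[symmetric] W_nonneg W_mono intro!: ennreal_leI split: split_indicator)
  also have "... = ennreal (1 / \<psi> 1)" by (rule W_laplace) simp
  finally have "W x * exp (- x) <= 1 / \<psi> 1"
    using psi_positive[of 1] by (subst (asm) ennreal_le_iff) auto
  then show ?thesis by (simp add: exp_minus field_simps)
qed

end

text \<open>The substantial point is W 0 = 0: otherwise the Laplace transform of \<open>W\<close> is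
  at least W 0 / \<theta>, so \<psi> grows at most linearly and the variation over [0, 1] is
  finite.\<close>

lemma (in sn_levy) sn_levy_scale_if_scale_function:
  assumes nd: "\<not> drifts_to_minus_infinity M X" and na: "\<not> (AE w in M. antimono_on {0..} (\<lambda>t. X t w))"
    and uv: "unbounded_variation M X" and sc: "scale_function M X W"
  shows "sn_levy_scale M X F W"
proof -
  note pos = psi_pos[OF nd na]
  have "\<psi> 0 = 0" by (simp add: laplace_exponent_def prob_space)
  then have "{\<theta>. 0 <= \<theta> \<and> \<psi> \<theta> = 0} = {0}" using pos by (auto simp: less_le)
  then have root: "largest_root M X = 0" by (simp add: largest_root_def)
  have neg: "W x = 0" if "x < 0" for x using sc that by (simp add: scale_function_def)
  have nonneg: "0 <= W x" for x using sc by (simp add: scale_function_def)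
  have mono0: "W x <= W y" if "0 <= x" "x <= y" for x y
    using sc that by (auto simp: scale_function_def monotone_on_def)
  have mono: "W x <= W y" if "x <= y" for x y
    using mono0[of x y] neg[of x] nonneg[of y] that by (cases "x < 0") auto
  have lap: "(\<integral>\<^sup>+x. ennreal (exp (- \<theta> * x)) * ennreal (W x) \<partial>lborel) = ennreal (1 / \<psi> \<theta>)" if "\<theta> > 0" for \<theta>
  proof -
    have "(\<integral>\<^sup>+x\<in>{0..}. ennreal (exp (- \<theta> * x) * W x) \<partial>lborel) = ennreal (1 / \<psi> \<theta>)"
      using sc root that by (simp add: scale_function_def)
    moreover have "(\<integral>\<^sup>+x\<in>{0..}. ennreal (exp (- \<theta> * x) * W x) \<partial>lborel) = (\<integral>\<^sup>+x. ennreal (exp (- \<theta> * x)) * ennreal (W x) \<partial>lborel)"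
      using neg nonneg by (intro nn_integral_cong) (auto simp: ennreal_mult split: split_indicator)
    ultimately show ?thesis by simp
  qed
  have "W 0 = 0"
  proof (rule ccontr)
    assume "W 0 \<noteq> 0"
    then have W0: "W 0 > 0" using nonneg[of 0] by simp
    have "\<psi> \<theta> <= (1 / W 0) * \<theta>" if \<theta>: "\<theta> > 0" for \<theta>
    proof -
      have "ennreal (W 0 * (1 / \<theta>)) = (\<integral>\<^sup>+y. ennreal (W 0) * (ennreal (exp (- \<theta> * y)) * indicator {0..} y) \<partial>lborel)"
        using nn_integral_exp_atLeast[OF \<theta>, of 0] W0 \<theta> by (simp add: nn_integral_cmult ennreal_mult[symmetric])
      also have "... <= (\<integral>\<^sup>+y. ennreal (exp (- \<theta> * y)) * ennreal (W y) \<partial>lborel)"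
        by (intro nn_integral_mono) (auto simp: ennreal_mult[symmetric] nonneg mono intro!: ennreal_leI split: split_indicator)
      also have "... = ennreal (1 / \<psi> \<theta>)" by (rule lap[OF \<theta>])
      finally have "W 0 * (1 / \<theta>) <= 1 / \<psi> \<theta>"
        using pos[OF \<theta>] by (subst (asm) ennreal_le_iff) auto
      then show ?thesis using pos[OF \<theta>] W0 \<theta> by (simp add: field_simps)
    qed
    then have "AE w in M. \<not> infinite_variation_on (\<lambda>s. X s w) 1" by (rule bounded_variation_if_psi_linear)
    moreover have "AE w in M. \<forall>t>0. infinite_variation_on (\<lambda>s. X s w) t" using uv by (simp add: unbounded_variation_def)
    ultimately have "AE w in M. False" by eventually_elim auto
    then show False by simp
  qed
  have cont: "continuous_on UNIV W"
  proof -
    have "continuous_on ({..0} \<union> {0..}) W"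
    proof (rule continuous_on_closed_Un)
      show "continuous_on {0..} W" using sc by (simp add: scale_function_def)
      have "continuous_on {..0} (\<lambda>_. 0 :: real)" by simp
      then show "continuous_on {..0} W"
        by (rule continuous_on_eq) (use neg \<open>W 0 = 0\<close> in \<open>auto simp: le_less\<close>)
    qed auto
    moreover have "{..0} \<union> {0..} = (UNIV :: real set)" by auto
    ultimately show ?thesis by simp
  qed
  show ?thesis
    by unfold_locales (use pos neg \<open>W 0 = 0\<close> cont mono lap in \<open>auto simp: le_less\<close>)
qed

section \<open>Occupation times of small windows\<close>

lemma nn_integral_lborel_shift:
  fixes a :: real
  assumes [measurable]: "f \<in> borel_measurable borel"
  shows "(\<integral>\<^sup>+x. f (a + x) \<partial>lborel) = (\<integral>\<^sup>+x. f x \<partial>lborel)"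
  using nn_integral_real_affine[of f 1 a] by simp

lemma nn_integral_lborel_reflect:
  fixes a :: real
  assumes [measurable]: "f \<in> borel_measurable borel"
  shows "(\<integral>\<^sup>+x. f (a - x) \<partial>lborel) = (\<integral>\<^sup>+x. f x \<partial>lborel)"
  using nn_integral_real_affine[of f "-1" a] by simp

context sn_levy
begin

lemma X_le_at_left:
  assumes w: "w \<in> space M" and h: "0 < h" and le: "\<And>s. q <= s ==> s < h ==> X s w <= c" and q: "q < h"
  shows "X h w <= c"
proof -
  obtain l where l: "((\<lambda>s. X s w) \<longlongrightarrow> l) (at_left h)" "X h w <= l" using left_limit_X[OF w h] by auto
  have "\<forall>\<^sub>F s in at_left h. X s w <= c"
    unfolding eventually_at_left_field using le q by (intro exI[of _ q]) auto
  then have "l <= c" using l(1) by (intro tendsto_upperbound) auto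
  then show ?thesis using l(2) by simp
qed

lemma borel_measurable_path: "w \<in> space M ==> (\<lambda>s. X (max 0 s) w) \<in> borel_measurable borel"
  using measurable_X_joint[of "\<lambda>s. s" borel "\<lambda>_. w"] by simp

declare measurable_X_joint[measurable (raw)]

end

context sn_levy_scale
begin

sublocale lborel_M: pair_sigma_finite lborel M ..

section \<open>Dynkin's formula for the scale function\<close>

text \<open>An identity between two measures in x, tested against \<open>f\<close>. Both have
  Laplace transform exp (t \<psi> \<theta>) / \<psi> \<theta>; on the right this is 1 / \<psi>
  \<theta> from \<open>W\<close> plus the integral of exp (s \<psi> \<theta>) over [0, t] from the
  laws of - X_s.\<close>

lemma dynkin_measure:
  assumes t: "0 <= t" and f[measurable]: "f \<in> borel_measurable borel"
  shows "(\<integral>\<^sup>+x. f x * (\<integral>\<^sup>+w. ennreal (W (x + X t w)) \<partial>M) \<partial>lborel) =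
    (\<integral>\<^sup>+x. f x * ennreal (W x) \<partial>lborel) + (\<integral>\<^sup>+s. indicator {0..t} s * (\<integral>\<^sup>+w. f (- X (max 0 s) w) \<partial>M) \<partial>lborel)"
proof -
  have [measurable]: "X t \<in> borel_measurable M" using t by (rule borel_measurable_X)
  define m1 where "m1 = density lborel (\<lambda>x. \<integral>\<^sup>+w. ennreal (W (x + X t w)) \<partial>M)"
  \<comment> \<open>One weighted product space carries both summands of the right-hand side:
    positive first coordinates are positions weighted by \<open>W\<close>, the others are minus a
    time in [0, t].\<close>
  define dens :: "real \<times> 'a => ennreal" where
    "dens = (\<lambda>z. if fst z > 0 then ennreal (W (fst z)) else indicator {0..t} (- fst z))"
  define \<phi> where "\<phi> = (\<lambda>z. if fst z > 0 then fst z else - X (max 0 (- fst z)) (snd z))"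
  have [measurable]: "(\<lambda>z. X (max 0 (- fst z)) (snd z)) \<in> borel_measurable (borel \<Otimes>\<^sub>M M)"
    by (rule measurable_X_joint) auto
  have [measurable]: "dens \<in> borel_measurable (lborel \<Otimes>\<^sub>M M)" "\<phi> \<in> borel_measurable (lborel \<Otimes>\<^sub>M M)"
    unfolding dens_def \<phi>_def by measurable
  define m2 where "m2 = distr (density (lborel \<Otimes>\<^sub>M M) dens) borel \<phi>"
  have int1: "(\<integral>\<^sup>+x. g x \<partial>m1) = (\<integral>\<^sup>+x. g x * (\<integral>\<^sup>+w. ennreal (W (x + X t w)) \<partial>M) \<partial>lborel)"
    if [measurable]: "g \<in> borel_measurable borel" for g
    unfolding m1_def by (subst nn_integral_density) (auto simp: mult.commute)
  have int2: "(\<integral>\<^sup>+x. g x \<partial>m2) = (\<integral>\<^sup>+x. g x * ennreal (W x) \<partial>lborel) +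
      (\<integral>\<^sup>+s. indicator {0..t} s * (\<integral>\<^sup>+w. g (- X (max 0 s) w) \<partial>M) \<partial>lborel)"
    if [measurable]: "g \<in> borel_measurable borel" for g
  proof -
    have "(\<integral>\<^sup>+x. g x \<partial>m2) = (\<integral>\<^sup>+z. dens z * g (\<phi> z) \<partial>(lborel \<Otimes>\<^sub>M M))"
      unfolding m2_def by (subst nn_integral_distr) (auto simp: nn_integral_density)
    also have "... = (\<integral>\<^sup>+s. \<integral>\<^sup>+w. dens (s, w) * g (\<phi> (s, w)) \<partial>M \<partial>lborel)"
      by (rule nn_integral_fst[symmetric]) measurable
    also have "... = (\<integral>\<^sup>+s. g s * ennreal (W s) + indicator {0..t} (0 - s) * (\<integral>\<^sup>+w. g (- X (max 0 (0 - s)) w) \<partial>M) \<partial>lborel)"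
    proof (rule nn_integral_cong_AE)
      have "AE s in lborel. s \<noteq> (0::real)" by (rule AE_lborel_singleton)
      then show "AE s in lborel. (\<integral>\<^sup>+w. dens (s, w) * g (\<phi> (s, w)) \<partial>M) =
        g s * ennreal (W s) + indicator {0..t} (0 - s) * (\<integral>\<^sup>+w. g (- X (max 0 (0 - s)) w) \<partial>M)"
      proof eventually_elim
        case (elim s)
        have [measurable]: "X (max 0 (- s)) \<in> borel_measurable M" by (rule borel_measurable_X) simp
        show ?case
        proof (cases "s > 0")
          case True
          then show ?thesis by (auto simp: dens_def \<phi>_def emeasure_space_1 mult.commute)
        next
          case False
          then have "(\<integral>\<^sup>+w. dens (s, w) * g (\<phi> (s, w)) \<partial>M) = (\<integral>\<^sup>+w. indicator {0..t} (- s) * g (- X (max 0 (- s)) w) \<partial>M)"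
            by (simp only: dens_def \<phi>_def fst_conv snd_conv if_False)
          also have "... = indicator {0..t} (- s) * (\<integral>\<^sup>+w. g (- X (max 0 (- s)) w) \<partial>M)"
            by (rule nn_integral_cmult) measurable
          finally show ?thesis using False by (simp add: W_nonpos)
        qed
      qed
    qed
    also have "... = (\<integral>\<^sup>+s. g s * ennreal (W s) \<partial>lborel) + (\<integral>\<^sup>+s. indicator {0..t} (0 - s) * (\<integral>\<^sup>+w. g (- X (max 0 (0 - s)) w) \<partial>M) \<partial>lborel)"
      by (rule nn_integral_add) measurable
    also have "(\<integral>\<^sup>+s. indicator {0..t} (0 - s) * (\<integral>\<^sup>+w. g (- X (max 0 (0 - s)) w) \<partial>M) \<partial>lborel) =
      (\<integral>\<^sup>+s. indicator {0..t} s * (\<integral>\<^sup>+w. g (- X (max 0 s) w) \<partial>M) \<partial>lborel)"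
      by (rule nn_integral_lborel_reflect[of "\<lambda>s. indicator {0..t} s * (\<integral>\<^sup>+w. g (- X (max 0 s) w) \<partial>M)"]) measurable
    finally show ?thesis .
  qed
  have lap1: "(\<integral>\<^sup>+x. ennreal (exp (- \<theta> * x)) \<partial>m1) = ennreal (exp (t * \<psi> \<theta>) / \<psi> \<theta>)" if \<theta>: "\<theta> > 0" for \<theta>
  proof -
    have "(\<integral>\<^sup>+x. ennreal (exp (- \<theta> * x)) \<partial>m1) = (\<integral>\<^sup>+x. \<integral>\<^sup>+w. ennreal (exp (- \<theta> * x)) * ennreal (W (x + X t w)) \<partial>M \<partial>lborel)"
      by (subst int1) (auto simp: nn_integral_cmult)
    also have "... = (\<integral>\<^sup>+w. \<integral>\<^sup>+x. ennreal (exp (- \<theta> * x)) * ennreal (W (x + X t w)) \<partial>lborel \<partial>M)"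
      by (rule lborel_M.Fubini'[symmetric]) measurable
    also have "... = (\<integral>\<^sup>+w. ennreal (exp (\<theta> * X t w)) * ennreal (1 / \<psi> \<theta>) \<partial>M)"
    proof (rule nn_integral_cong)
      fix w
      have "(\<integral>\<^sup>+x. ennreal (exp (- \<theta> * x)) * ennreal (W (x + X t w)) \<partial>lborel) =
        (\<integral>\<^sup>+x. ennreal (exp (- \<theta> * (X t w + x - X t w))) * ennreal (W (X t w + x)) \<partial>lborel)"
        by (simp add: add.commute)
      also have "... = (\<integral>\<^sup>+x. ennreal (exp (- \<theta> * (x - X t w))) * ennreal (W x) \<partial>lborel)"
        by (rule nn_integral_lborel_shift[of "\<lambda>x. ennreal (exp (- \<theta> * (x - X t w))) * ennreal (W x)"]) measurable
      also have "... = (\<integral>\<^sup>+x. ennreal (exp (\<theta> * X t w)) * (ennreal (exp (- \<theta> * x)) * ennreal (W x)) \<partial>lborel)"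
      proof (rule nn_integral_cong)
        fix x
        have "exp (- \<theta> * (x - X t w)) = exp (\<theta> * X t w) * exp (- \<theta> * x)"
          by (simp add: exp_add[symmetric] algebra_simps)
        then show "ennreal (exp (- \<theta> * (x - X t w))) * ennreal (W x) = ennreal (exp (\<theta> * X t w)) * (ennreal (exp (- \<theta> * x)) * ennreal (W x))"
          by (simp only: ennreal_mult exp_ge_zero mult.assoc)
      qed
      also have "... = ennreal (exp (\<theta> * X t w)) * (\<integral>\<^sup>+x. ennreal (exp (- \<theta> * x)) * ennreal (W x) \<partial>lborel)"
        by (rule nn_integral_cmult) measurable
      also have "... = ennreal (exp (\<theta> * X t w)) * ennreal (1 / \<psi> \<theta>)"
        by (simp only: W_laplace[OF \<theta>])
      finally show "(\<integral>\<^sup>+x. ennreal (exp (- \<theta> * x)) * ennreal (W (x + X t w)) \<partial>lborel) = ennreal (exp (\<theta> * X t w)) * ennreal (1 / \<psi> \<theta>)" .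
    qed
    also have "... = ennreal (exp (t * \<psi> \<theta>)) * ennreal (1 / \<psi> \<theta>)"
      using \<theta> t by (subst nn_integral_multc) (auto simp: nn_integral_exp_X)
    also have "... = ennreal (exp (t * \<psi> \<theta>) / \<psi> \<theta>)"
      using psi_positive[OF \<theta>] by (simp add: ennreal_mult[symmetric])
    finally show ?thesis .
  qed
  have lap2: "(\<integral>\<^sup>+x. ennreal (exp (- \<theta> * x)) \<partial>m2) = ennreal (exp (t * \<psi> \<theta>) / \<psi> \<theta>)" if \<theta>: "\<theta> > 0" for \<theta>
  proof -
    have p: "\<psi> \<theta> > 0" by (rule psi_positive[OF \<theta>])
    have "(\<integral>\<^sup>+s. indicator {0..t} s * (\<integral>\<^sup>+w. ennreal (exp (- \<theta> * (- X (max 0 s) w))) \<partial>M) \<partial>lborel) =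
      (\<integral>\<^sup>+s. ennreal (exp (s * \<psi> \<theta>)) * indicator {0..t} s \<partial>lborel)"
      using \<theta> by (intro nn_integral_cong) (auto simp: nn_integral_exp_X split: split_indicator)
    also have "... = ennreal (exp (t * \<psi> \<theta>) / \<psi> \<theta> - exp (0 * \<psi> \<theta>) / \<psi> \<theta>)"
      using t p by (intro nn_integral_FTC_Icc) (auto intro!: derivative_eq_intros)
    finally have occ: "(\<integral>\<^sup>+s. indicator {0..t} s * (\<integral>\<^sup>+w. ennreal (exp (- \<theta> * (- X (max 0 s) w))) \<partial>M) \<partial>lborel) =
      ennreal (exp (t * \<psi> \<theta>) / \<psi> \<theta> - exp (0 * \<psi> \<theta>) / \<psi> \<theta>)" .
    have "(\<lambda>x. ennreal (exp (- \<theta> * x))) \<in> borel_measurable borel" by measurable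
    from int2[OF this] have "(\<integral>\<^sup>+x. ennreal (exp (- \<theta> * x)) \<partial>m2) = ennreal (1 / \<psi> \<theta>) + ennreal (exp (t * \<psi> \<theta>) / \<psi> \<theta> - 1 / \<psi> \<theta>)"
      by (simp only: occ W_laplace[OF \<theta>] mult_zero_left exp_zero)
    also have "... = ennreal (exp (t * \<psi> \<theta>) / \<psi> \<theta>)"
      using p t by (subst ennreal_plus[symmetric]) (auto simp: divide_right_mono)
    finally show ?thesis .
  qed
  have "m1 = m2"
  proof (rule measure_eq_if_laplace_eq)
    show "sets m1 = sets borel" "sets m2 = sets borel" by (simp_all add: m1_def m2_def)
    show "(\<integral>\<^sup>+x. ennreal (exp (- \<theta> * x)) \<partial>m1) < \<infinity>" if "\<theta> > 0" for \<theta> unfolding lap1[OF that] by simp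
    show "(\<integral>\<^sup>+x. ennreal (exp (- \<theta> * x)) \<partial>m1) = (\<integral>\<^sup>+x. ennreal (exp (- \<theta> * x)) \<partial>m2)" if "\<theta> > 0" for \<theta>
      unfolding lap1[OF that] lap2[OF that] ..
  qed
  then show ?thesis using int1[OF f] int2[OF f] by simp
qed

text \<open>The convolution of \<open>k\<close> with \<open>W\<close>; in the sense of
  \<open>dynkin\<close>, the generator of the process maps it to \<open>k\<close>.\<close>

definition smear :: "(real => ennreal) => real => ennreal" where
  "smear k x = (\<integral>\<^sup>+y. k y * ennreal (W (x - y)) \<partial>lborel)"

lemma smear_measurable:
  assumes [measurable]: "k \<in> borel_measurable borel" shows "smear k \<in> borel_measurable borel"
  unfolding smear_def[abs_def] by measurable

text \<open>The measure identity with f y = k (x - y); reflection of the integration variable turns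
  both integrals against \<open>W\<close> into values of \<open>smear\<close>.\<close>

lemma dynkin:
  assumes t: "0 <= t" and k[measurable]: "k \<in> borel_measurable borel"
  shows "(\<integral>\<^sup>+w. smear k (x + X t w) \<partial>M) =
    smear k x + (\<integral>\<^sup>+s. indicator {0..t} s * (\<integral>\<^sup>+w. k (x + X (max 0 s) w) \<partial>M) \<partial>lborel)"
proof -
  have [measurable]: "X t \<in> borel_measurable M" using t by (rule borel_measurable_X)
  note [measurable] = smear_measurable[OF k]
  have flip: "(\<integral>\<^sup>+y. k (x - y) * ennreal (W (y + a)) \<partial>lborel) = smear k (x + a)" for a
    using nn_integral_lborel_reflect[of "\<lambda>y. k y * ennreal (W (x + a - y))" x] by (simp add: smear_def add.commute)
  have "(\<integral>\<^sup>+w. smear k (x + X t w) \<partial>M) = (\<integral>\<^sup>+w. \<integral>\<^sup>+y. k (x - y) * ennreal (W (y + X t w)) \<partial>lborel \<partial>M)"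
    by (simp add: flip)
  also have "... = (\<integral>\<^sup>+y. \<integral>\<^sup>+w. k (x - y) * ennreal (W (y + X t w)) \<partial>M \<partial>lborel)"
    by (rule lborel_M.Fubini') measurable
  also have "... = (\<integral>\<^sup>+y. k (x - y) * (\<integral>\<^sup>+w. ennreal (W (y + X t w)) \<partial>M) \<partial>lborel)"
    by (intro nn_integral_cong) (simp add: nn_integral_cmult)
  also have "... = (\<integral>\<^sup>+y. k (x - y) * ennreal (W y) \<partial>lborel) +
     (\<integral>\<^sup>+s. indicator {0..t} s * (\<integral>\<^sup>+w. k (x - (- X (max 0 s) w)) \<partial>M) \<partial>lborel)"
    by (rule dynkin_measure[OF t]) measurable
  also have "(\<integral>\<^sup>+y. k (x - y) * ennreal (W y) \<partial>lborel) = smear k x" using flip[of 0] by simp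
  finally show ?thesis by simp
qed

text \<open>The Markov property at time \<open>s\<close>, integrated over the elapsed time r = u -
  s.\<close>

lemma occupation_past:
  assumes s: "0 <= s" "s <= t" and B: "B \<in> sets (F s)" and k[measurable]: "k \<in> borel_measurable borel"
  shows "(\<integral>\<^sup>+w. indicator B w * (\<integral>\<^sup>+r. indicator {0..t - s} r * (\<integral>\<^sup>+w'. k (X s w + X (max 0 r) w') \<partial>M) \<partial>lborel) \<partial>M) =
    (\<integral>\<^sup>+u. indicator {s..t} u * (\<integral>\<^sup>+w. indicator B w * k (X (max 0 u) w) \<partial>M) \<partial>lborel)"
proof -
  have t: "0 <= t" using s by simp
  have [measurable]: "X t \<in> borel_measurable M" "X s \<in> borel_measurable M" "B \<in> sets M"
    using s t B sets_F[of s] by (auto intro: borel_measurable_X)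
  have Xr[measurable]: "X (max 0 r) \<in> borel_measurable M" for r by (rule borel_measurable_X) simp
  have "(\<integral>\<^sup>+w. indicator B w *
      (\<integral>\<^sup>+r. indicator {0..t - s} r * (\<integral>\<^sup>+w'. k (X s w + X (max 0 r) w') \<partial>M) \<partial>lborel) \<partial>M)
    = (\<integral>\<^sup>+w. \<integral>\<^sup>+r. indicator B w * (indicator {0..t - s} r * (\<integral>\<^sup>+w'. k (X s w + X (max 0 r) w') \<partial>M)) \<partial>lborel \<partial>M)"
    by (intro nn_integral_cong nn_integral_cmult[symmetric]) measurable
  also have "... = (\<integral>\<^sup>+r. \<integral>\<^sup>+w. indicator B w * (indicator {0..t - s} r * (\<integral>\<^sup>+w'. k (X s w + X (max 0 r) w') \<partial>M)) \<partial>M \<partial>lborel)"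
    by (rule lborel_M.Fubini') measurable
  also have "... = (\<integral>\<^sup>+r. indicator {s..t} (s + r) * (\<integral>\<^sup>+w. indicator B w * k (X (max 0 (s + r)) w) \<partial>M) \<partial>lborel)"
  proof (rule nn_integral_cong)
    fix r :: real
    show "(\<integral>\<^sup>+w. indicator B w * (indicator {0..t - s} r * (\<integral>\<^sup>+w'. k (X s w + X (max 0 r) w') \<partial>M)) \<partial>M) =
      indicator {s..t} (s + r) * (\<integral>\<^sup>+w. indicator B w * k (X (max 0 (s + r)) w) \<partial>M)"
    proof (cases "r \<in> {0..t - s}")
      case True
      then have r: "0 <= r" "s + r \<in> {s..t}" by auto
      have "(\<integral>\<^sup>+w. indicator B w * (\<integral>\<^sup>+w'. k (X s w + X r w') \<partial>M) \<partial>M) =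
        (\<integral>\<^sup>+w. indicator B w * k (X s w + (X (s + r) w - X s w)) \<partial>M)"
        using markov[OF s(1) _ B adapted[OF s(1)], of "s + r" "\<lambda>(x, y). k (x + y)"] r by simp
      then show ?thesis using True r s by (simp add: max_absorb2)
    qed auto
  qed
  also have "... = (\<integral>\<^sup>+u. indicator {s..t} u * (\<integral>\<^sup>+w. indicator B w * k (X (max 0 u) w) \<partial>M) \<partial>lborel)"
    by (rule nn_integral_lborel_shift[of "\<lambda>u. indicator {s..t} u * (\<integral>\<^sup>+w. indicator B w * k (X (max 0 u) w) \<partial>M)"]) measurable
  finally show ?thesis .
qed

lemma dynkin_past:
  assumes s: "0 <= s" "s <= t" and B: "B \<in> sets (F s)" and k[measurable]: "k \<in> borel_measurable borel"
  shows "(\<integral>\<^sup>+w. indicator B w * smear k (X t w) \<partial>M) = (\<integral>\<^sup>+w. indicator B w * smear k (X s w) \<partial>M) +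
    (\<integral>\<^sup>+u. indicator {s..t} u * (\<integral>\<^sup>+w. indicator B w * k (X (max 0 u) w) \<partial>M) \<partial>lborel)"
proof -
  have t: "0 <= t" using s by simp
  have [measurable]: "X t \<in> borel_measurable M" "X s \<in> borel_measurable M" "X (t - s) \<in> borel_measurable M" "B \<in> sets M"
    using s t B sets_F[of s] by (auto intro: borel_measurable_X)
  note [measurable] = smear_measurable[OF k]
  have Xr[measurable]: "X (max 0 r) \<in> borel_measurable M" for r by (rule borel_measurable_X) simp
  have "(\<integral>\<^sup>+w. indicator B w * smear k (X t w) \<partial>M) = (\<integral>\<^sup>+w. indicator B w * smear k (X s w + (X t w - X s w)) \<partial>M)"
    by simp
  also have "... = (\<integral>\<^sup>+w. indicator B w * (\<integral>\<^sup>+w'. smear k (X s w + X (t - s) w') \<partial>M) \<partial>M)"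
    using markov[OF s B adapted[OF s(1)], of "\<lambda>(x, y). smear k (x + y)"] by simp
  also have "... = (\<integral>\<^sup>+w. indicator B w * smear k (X s w) + indicator B w *
      (\<integral>\<^sup>+r. indicator {0..t - s} r * (\<integral>\<^sup>+w'. k (X s w + X (max 0 r) w') \<partial>M) \<partial>lborel) \<partial>M)"
    using s by (simp add: dynkin distrib_left)
  also have "... = (\<integral>\<^sup>+w. indicator B w * smear k (X s w) \<partial>M) + (\<integral>\<^sup>+w. indicator B w *
      (\<integral>\<^sup>+r. indicator {0..t - s} r * (\<integral>\<^sup>+w'. k (X s w + X (max 0 r) w') \<partial>M) \<partial>lborel) \<partial>M)"
    by (rule nn_integral_add) measurable
  finally show ?thesis by (simp only: occupation_past[OF s B k])
qed

section \<open>Windows around 0 and their occupation times\<close>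

text \<open>The uniform density on (-e, e): its integral along the path is the occupation quotient
  whose limit defines the local time.\<close>

definition window :: "real => real => ennreal" where
  "window e x = ennreal (1 / (2 * e)) * indicator {-e<..<e} x"

lemma window_measurable[measurable]: "window e \<in> borel_measurable borel"
  unfolding window_def[abs_def] by measurable

lemma nn_integral_window: "e > 0 ==> (\<integral>\<^sup>+y. window e y \<partial>lborel) = 1"
  unfolding window_def by (subst nn_integral_cmult_indicator) (auto simp: ennreal_mult[symmetric])

lemma
  assumes "e > 0"
  shows smear_window_le: "smear (window e) x <= ennreal (W (x + e))"
    and smear_window_ge: "ennreal (W (x - e)) <= smear (window e) x"
proof -
  have "smear (window e) x <= (\<integral>\<^sup>+y. window e y * ennreal (W (x + e)) \<partial>lborel)"
    unfolding smear_def by (intro nn_integral_mono)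
      (auto simp: window_def W_mono intro!: mult_left_mono ennreal_leI split: split_indicator)
  then show "smear (window e) x <= ennreal (W (x + e))"
    using assms by (simp add: nn_integral_multc nn_integral_window)
  have "(\<integral>\<^sup>+y. window e y * ennreal (W (x - e)) \<partial>lborel) <= smear (window e) x"
    unfolding smear_def by (intro nn_integral_mono)
      (auto simp: window_def W_mono intro!: mult_left_mono ennreal_leI split: split_indicator)
  then show "ennreal (W (x - e)) <= smear (window e) x"
    using assms by (simp add: nn_integral_multc nn_integral_window)
qed

definition W_avg :: "real => real => real" where
  "W_avg e x = enn2real (smear (window e) x)"

lemma smear_window_eq: "e > 0 ==> smear (window e) x = ennreal (W_avg e x)"
  unfolding W_avg_def by (rule ennreal_enn2real[symmetric], rule le_less_trans[OF smear_window_le]) auto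

lemma W_avg_nonneg: "0 <= W_avg e x"
  by (simp add: W_avg_def)

lemma W_avg_le: "e > 0 ==> W_avg e x <= W (x + e)"
  using smear_window_le[of e x] by (simp add: smear_window_eq W_nonneg)

lemma W_avg_ge: "e > 0 ==> W (x - e) <= W_avg e x"
  using smear_window_ge[of e x] by (simp add: smear_window_eq W_avg_nonneg)

lemma W_avg_measurable[measurable]: "W_avg e \<in> borel_measurable borel"
  unfolding W_avg_def[abs_def] using smear_measurable[of "window e"] by simp

lemma W_avg_le_exp: "e > 0 ==> W_avg e x <= (exp e / \<psi> 1) * exp x"
  using W_avg_le[of e x] W_le_exp[of "x + e"] by (simp add: exp_add mult.commute)

lemma W_isCont: "isCont W x"
  using W_cont by (simp add: continuous_on_eq_continuous_at)

lemma W_avg_continuous: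
  assumes e: "e > 0"
  shows "continuous_on UNIV (W_avg e)"
proof -
  have int: "W_avg e x = (\<integral>y. 1 / (2 * e) * indicator {-e<..<e} y * W (x - y) \<partial>lborel)" for x
    unfolding W_avg_def smear_def window_def using e
    by (subst integral_eq_nn_integral) (auto simp: W_nonneg ennreal_mult[symmetric] intro!: arg_cong[where f=enn2real] nn_integral_cong split: split_indicator)
  have "isCont (W_avg e) x" for x
    unfolding continuous_at_sequentially
  proof (intro allI impI)
    fix u assume u: "u \<longlonglongrightarrow> x"
    then obtain B where B: "\<And>n. u n <= B" using convergent_imp_Bseq[of u]
      by (metis Bseq_def abs_le_D1 convergentI real_norm_def)
    have "(\<lambda>n. \<integral>y. 1 / (2 * e) * indicator {-e<..<e} y * W (u n - y) \<partial>lborel) \<longlonglongrightarrow>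
      (\<integral>y. 1 / (2 * e) * indicator {-e<..<e} y * W (x - y) \<partial>lborel)"
    proof (rule integral_dominated_convergence[where w="\<lambda>y. 1 / (2 * e) * W (B + e) * indicator {-e<..<e} y"])
      show "integrable lborel (\<lambda>y. 1 / (2 * e) * W (B + e) * indicator {-e<..<e} y)"
        using e by (intro integrable_mult_right integrable_real_indicator) auto
      show "AE y in lborel. (\<lambda>n. 1 / (2 * e) * indicator {-e<..<e} y * W (u n - y)) \<longlonglongrightarrow> 1 / (2 * e) * indicator {-e<..<e} y * W (x - y)"
        by (intro AE_I2 tendsto_mult tendsto_const isCont_tendsto_compose[OF W_isCont] tendsto_diff u)
      show "AE y in lborel. norm (1 / (2 * e) * indicator {-e<..<e} y * W (u n - y)) <= 1 / (2 * e) * W (B + e) * indicator {-e<..<e} y" for n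
      proof (rule AE_I2)
        fix y
        have "W (u n - y) <= W (B + e)" if "-e < y" using B[of n] that by (intro W_mono) auto
        then show "norm (1 / (2 * e) * indicator {-e<..<e} y * W (u n - y)) <= 1 / (2 * e) * W (B + e) * indicator {-e<..<e} y"
          using e by (auto simp: W_nonneg divide_right_mono split: split_indicator)
      qed
    qed measurable
    then show "(W_avg e \<circ> u) \<longlonglongrightarrow> W_avg e x" by (simp add: int comp_def)
  qed
  then show ?thesis by (simp add: continuous_on_eq_continuous_at)
qed

definition occ :: "real => real => 'a => real" where
  "occ e t w = measure lborel {s\<in>{0..t}. \<bar>X s w\<bar> < e} / (2 * e)"

lemma occ_set: "{s\<in>{0..t}. \<bar>X s w\<bar> < e} = {s. 0 <= s \<and> s <= t \<and> \<bar>X (max 0 s) w\<bar> < e}"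
  by (auto simp: max_def)

lemma occ_set_measurable: "w \<in> space M ==> {s\<in>{0..t}. \<bar>X s w\<bar> < e} \<in> sets lborel"
proof -
  assume "w \<in> space M"
  then have [measurable]: "(\<lambda>s. X (max 0 s) w) \<in> borel_measurable borel" by (rule borel_measurable_path)
  show ?thesis unfolding occ_set by measurable
qed

lemma occ_set_finite: "w \<in> space M ==> emeasure lborel {s\<in>{0..t}. \<bar>X s w\<bar> < e} < \<infinity>"
proof -
  assume "w \<in> space M"
  have "emeasure lborel {s\<in>{0..t}. \<bar>X s w\<bar> < e} <= emeasure lborel {0..t}" by (intro emeasure_mono) auto
  also have "... < \<infinity>" by (simp add: emeasure_lborel_Icc_eq)
  finally show ?thesis .
qed

lemma ennreal_occ_diff:
  assumes w: "w \<in> space M" and e: "e > 0" and s: "0 <= s" "s <= t"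
  shows "ennreal (occ e t w - occ e s w) = (\<integral>\<^sup>+u. indicator {s..t} u * window e (X (max 0 u) w) \<partial>lborel)"
    and "occ e s w <= occ e t w"
proof -
  have [measurable]: "(\<lambda>s. X (max 0 s) w) \<in> borel_measurable borel" using w by (rule borel_measurable_path)
  let ?A = "\<lambda>t. {s\<in>{0..t}. \<bar>X s w\<bar> < e}"
  have sub: "?A s \<subseteq> ?A t" using s by auto
  have m: "?A s \<in> fmeasurable lborel" "?A t \<in> fmeasurable lborel"
    using occ_set_measurable[OF w] occ_set_finite[OF w] by (auto simp: fmeasurable_def)
  have "measure lborel (?A s) <= measure lborel (?A t)" using m sub by (intro measure_mono_fmeasurable) (auto dest: fmeasurableD)
  then show "occ e s w <= occ e t w" using e by (simp add: occ_def divide_right_mono)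
  have d: "measure lborel (?A t - ?A s) = measure lborel (?A t) - measure lborel (?A s)"
    using occ_set_finite[OF w, of t e] occ_set_measurable[OF w] sub by (intro measure_Diff) (simp_all only: less_top infinity_ennreal_def not_False_eq_True simp_thms)
  have fin: "emeasure lborel (?A t - ?A s) < \<infinity>"
    using fmeasurable.Diff[OF m(2,1)] by (simp add: fmeasurable_def)
  have "(\<integral>\<^sup>+u. indicator {s..t} u * window e (X (max 0 u) w) \<partial>lborel) = (\<integral>\<^sup>+u. ennreal (1 / (2 * e)) * indicator (?A t - ?A s) u \<partial>lborel)"
  proof (rule nn_integral_cong_AE)
    \<comment> \<open>The time \<open>s\<close> belongs to {s..t} but never to the difference of the
      two occupation sets; a single point is negligible.\<close>
    have "AE u in lborel. u \<noteq> s" by (rule AE_lborel_singleton)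
    then show "AE u in lborel. indicator {s..t} u * window e (X (max 0 u) w) = ennreal (1 / (2 * e)) * indicator (?A t - ?A s) u"
      by eventually_elim (use s in \<open>auto simp: window_def max_def abs_less_iff split: split_indicator\<close>)
  qed
  also have "... = ennreal (1 / (2 * e)) * emeasure lborel (?A t - ?A s)"
    using occ_set_measurable[OF w] by (intro nn_integral_cmult_indicator) auto
  also have "... = ennreal (occ e t w - occ e s w)"
  proof -
    have "emeasure lborel (?A t - ?A s) = ennreal (measure lborel (?A t) - measure lborel (?A s))"
      unfolding d[symmetric] using fin by (intro emeasure_eq_ennreal_measure) simp
    then have "ennreal (1 / (2 * e)) * emeasure lborel (?A t - ?A s) = ennreal (1 / (2 * e) * (measure lborel (?A t) - measure lborel (?A s)))"
      using e \<open>measure lborel (?A s) <= measure lborel (?A t)\<close> by (simp only: ennreal_mult[symmetric] diff_ge_0_iff_ge less_imp_le zero_less_divide_1_iff zero_less_mult_iff zero_less_numeral simp_thms)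
    also have "1 / (2 * e) * (measure lborel (?A t) - measure lborel (?A s)) = occ e t w - occ e s w"
      by (simp add: occ_def diff_divide_distrib)
    finally show ?thesis .
  qed
  finally show "ennreal (occ e t w - occ e s w) = (\<integral>\<^sup>+u. indicator {s..t} u * window e (X (max 0 u) w) \<partial>lborel)" by simp
qed

lemma occ_0: "occ e 0 w = 0"
proof -
  have "measure lborel {s\<in>{0..0}. \<bar>X s w\<bar> < e} = 0"
  proof -
    have "{s\<in>{0..0}. \<bar>X s w\<bar> < e} \<subseteq> {0}" by auto
    then have "emeasure lborel {s\<in>{0..0}. \<bar>X s w\<bar> < e} = 0"
      by (rule emeasure_lborel_countable[OF countable_subset]) simp
    then show ?thesis by (simp only: measure_def enn2real_0)
  qed
  then show ?thesis by (simp add: occ_def)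
qed

lemma occ_nonneg: "e > 0 ==> 0 <= occ e t w"
  by (simp add: occ_def)

lemma ennreal_occ: "w \<in> space M ==> e > 0 ==> 0 <= t ==>
    ennreal (occ e t w) = (\<integral>\<^sup>+u. indicator {0..t} u * window e (X (max 0 u) w) \<partial>lborel)"
  using ennreal_occ_diff(1)[of w e 0 t] by (simp add: occ_0)

text \<open>Freezing the time at \<open>t\<close> inside the integral leaves its value unchanged and
  makes the integrand jointly measurable over \<open>F t\<close>.\<close>

lemma occ_adapted:
  assumes e: "e > 0" and t: "0 <= t"
  shows "occ e t \<in> borel_measurable (F t)"
proof -
  interpret Ft: sigma_finite_measure lborel by (rule lborel.sigma_finite_measure_axioms)
  have [measurable]: "(\<lambda>z. X (min t (max 0 (snd z))) (fst z)) \<in> borel_measurable (F t \<Otimes>\<^sub>M borel)"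
    by (rule measurable_X_progressive[OF t]) auto
  have "(\<lambda>w. enn2real (\<integral>\<^sup>+u. indicator {0..t} u * window e (X (min t (max 0 u)) w) \<partial>lborel)) \<in> borel_measurable (F t)"
    by measurable
  also have "?this \<longleftrightarrow> ?thesis"
  proof (rule measurable_cong)
    fix w assume "w \<in> space (F t)"
    then have w: "w \<in> space M" by (simp add: space_F)
    have "(\<integral>\<^sup>+u. indicator {0..t} u * window e (X (min t (max 0 u)) w) \<partial>lborel) = ennreal (occ e t w)"
      unfolding ennreal_occ[OF w e t] by (intro nn_integral_cong) (auto simp: min_def split: split_indicator)
    then show "enn2real (\<integral>\<^sup>+u. indicator {0..t} u * window e (X (min t (max 0 u)) w) \<partial>lborel) = occ e t w"
      using occ_nonneg[OF e] by simp
  qed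
  finally show ?thesis .
qed

lemma occ_measurable: "e > 0 ==> 0 <= t ==> occ e t \<in> borel_measurable M"
  using measurable_F_imp[OF _ occ_adapted] by auto

lemma occ_diff_le:
  assumes w: "w \<in> space M" and e: "e > 0" and s: "0 <= s" "s <= t"
  shows "occ e t w - occ e s w <= (t - s) / (2 * e)"
proof -
  have "ennreal (occ e t w - occ e s w) <= (\<integral>\<^sup>+u. ennreal (1 / (2 * e)) * indicator {s..t} u \<partial>lborel)"
    unfolding ennreal_occ_diff(1)[OF assms] by (intro nn_integral_mono) (auto simp: window_def split: split_indicator)
  also have "... = ennreal ((t - s) / (2 * e))"
    using s e by (simp add: nn_integral_cmult_indicator ennreal_mult[symmetric])
  finally show ?thesis using s e by (subst (asm) ennreal_le_iff) auto
qed

lemma occ_bounded: "w \<in> space M ==> e > 0 ==> 0 <= t ==> \<bar>occ e t w\<bar> <= t / (2 * e)"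
  using occ_diff_le[of w e 0 t] occ_nonneg[of e t w] by (simp add: occ_0)

lemma occ_integrable: "e > 0 ==> 0 <= t ==> integrable M (occ e t)"
  by (rule integrable_const_bound[of _ "t / (2 * e)"]) (auto simp: occ_bounded occ_measurable)

lemma W_avg_integrable:
  assumes "e > 0" "0 <= t" shows "integrable M (\<lambda>w. W_avg e (X t w))"
proof (rule Bochner_Integration.integrable_bound)
  have [measurable]: "X t \<in> borel_measurable M" using assms by (auto intro: borel_measurable_X)
  show "integrable M (\<lambda>w. (exp e / \<psi> 1) * exp (1 * X t w))" using assms by (intro integrable_mult_right integrable_exp_X) auto
  show "(\<lambda>w. W_avg e (X t w)) \<in> borel_measurable M" by measurable
  show "AE w in M. norm (W_avg e (X t w)) <= norm ((exp e / \<psi> 1) * exp (1 * X t w))"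
    using W_avg_le_exp[OF assms(1)] W_avg_nonneg psi_positive[of 1] by (intro AE_I2) (simp add: abs_of_nonneg)
qed

text \<open>\<open>dynkin_past\<close> for the window equates the increase of the mean of
  \<open>W_avg\<close> on \<open>B\<close> with the mean occupation gained on \<open>B\<close>. All
  terms are finite, so the identity of extended integrals can be rearranged.\<close>

lemma occ_martingale:
  assumes e: "e > 0" and s: "0 <= s" "s <= t" and B: "B \<in> sets (F s)"
  shows "(\<integral>w. indicator B w * (W_avg e (X t w) - occ e t w) \<partial>M) = (\<integral>w. indicator B w * (W_avg e (X s w) - occ e s w) \<partial>M)"
proof -
  have t: "0 <= t" using s by simp
  have [measurable]: "X t \<in> borel_measurable M" "X s \<in> borel_measurable M" "B \<in> sets M"
    using s t B sets_F[of s] by (auto intro: borel_measurable_X)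
  note [measurable] = occ_measurable[OF e s(1)] occ_measurable[OF e t]
  have Xr[measurable]: "X (max 0 r) \<in> borel_measurable M" for r by (rule borel_measurable_X) simp
  have "(\<integral>\<^sup>+u. indicator {s..t} u * (\<integral>\<^sup>+w. indicator B w * window e (X (max 0 u) w) \<partial>M) \<partial>lborel)
    = (\<integral>\<^sup>+u. (\<integral>\<^sup>+w. indicator {s..t} u * (indicator B w * window e (X (max 0 u) w)) \<partial>M) \<partial>lborel)"
    by (intro nn_integral_cong nn_integral_cmult[symmetric]) measurable
  also have "... = (\<integral>\<^sup>+w. \<integral>\<^sup>+u. indicator {s..t} u * (indicator B w * window e (X (max 0 u) w)) \<partial>lborel \<partial>M)"
    by (rule lborel_M.Fubini'[symmetric]) measurable
  also have "... = (\<integral>\<^sup>+w. ennreal (indicator B w * (occ e t w - occ e s w)) \<partial>M)"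
    by (intro nn_integral_cong) (auto simp: ennreal_occ_diff(1)[OF _ e s] split: split_indicator)
  finally have o: "(\<integral>\<^sup>+u. indicator {s..t} u * (\<integral>\<^sup>+w. indicator B w * window e (X (max 0 u) w) \<partial>M) \<partial>lborel)
    = (\<integral>\<^sup>+w. ennreal (indicator B w * (occ e t w - occ e s w)) \<partial>M)" .
  have sm: "(\<integral>\<^sup>+w. indicator B w * smear (window e) (X r w) \<partial>M) = (\<integral>\<^sup>+w. ennreal (indicator B w * W_avg e (X r w)) \<partial>M)" for r
    by (intro nn_integral_cong) (auto simp: smear_window_eq[OF e] split: split_indicator)
  have it: "integrable M (\<lambda>w. indicator B w * W_avg e (X r w))" if "0 <= r" for r
    using integrable_mult_indicator[OF \<open>B \<in> sets M\<close> W_avg_integrable[OF e that]] by simp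
  have io: "integrable M (\<lambda>w. indicator B w * occ e r w)" if "0 <= r" for r
    using integrable_mult_indicator[OF \<open>B \<in> sets M\<close> occ_integrable[OF e that]] by simp
  have iod: "integrable M (\<lambda>w. indicator B w * (occ e t w - occ e s w))"
    using Bochner_Integration.integrable_diff[OF io[OF t] io[OF s(1)]] by (simp add: right_diff_distrib)
  have nno: "AE w in M. 0 <= indicator B w * (occ e t w - occ e s w)"
    using ennreal_occ_diff(2)[OF _ e s] by (intro AE_I2) (auto split: split_indicator)
  have "ennreal (\<integral>w. indicator B w * W_avg e (X t w) \<partial>M) = ennreal (\<integral>w. indicator B w * W_avg e (X s w) \<partial>M) + ennreal (\<integral>w. indicator B w * (occ e t w - occ e s w) \<partial>M)"
    using dynkin_past[OF s B, of "window e"] unfolding o sm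
    by (simp add: nn_integral_eq_integral[OF it[OF t]] nn_integral_eq_integral[OF it[OF s(1)]] nn_integral_eq_integral[OF iod nno] W_avg_nonneg)
  also have "... = ennreal ((\<integral>w. indicator B w * W_avg e (X s w) \<partial>M) + (\<integral>w. indicator B w * (occ e t w - occ e s w) \<partial>M))"
    using nno by (intro ennreal_plus[symmetric] integral_nonneg_AE) (auto simp: W_avg_nonneg)
  finally have "(\<integral>w. indicator B w * W_avg e (X t w) \<partial>M) = (\<integral>w. indicator B w * W_avg e (X s w) \<partial>M) + (\<integral>w. indicator B w * (occ e t w - occ e s w) \<partial>M)"
    using nno by (subst (asm) ennreal_inj) (auto intro!: integral_nonneg_AE add_nonneg_nonneg simp: W_avg_nonneg)
  then show ?thesis
    using it[OF t] it[OF s(1)] io[OF t] io[OF s(1)] by (simp add: right_diff_distrib)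
qed

lemma mart_W_avg_occ: "e > 0 ==> mart (\<lambda>t w. W_avg e (X t w) - occ e t w)"
  unfolding mart_def by (auto intro!: Bochner_Integration.integrable_diff W_avg_integrable occ_integrable occ_martingale)

text \<open>Let \<open>S\<close> be the first exceedance of x0 / 2, capped at 1. If W x0 = 0, then
  \<open>W_avg e\<close> vanishes at X_S, so by optional stopping the mean occupation of (-e, e) up
  to \<open>S\<close> is 0; but \<open>X\<close> starts at 0 and stays within \<open>e\<close> for a
  while.\<close>

lemma W_pos:
  assumes x0: "x0 > 0"
  shows "W x0 > 0"
proof (rule ccontr)
  assume "\<not> W x0 > 0"
  then have W0: "W x0 = 0" using W_nonneg[of x0] by simp
  \<comment> \<open>Small enough that x0 / 2 + e <= x0, where \<open>W\<close> is assumed to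
    vanish.\<close>
  define e where "e = x0 / 4"
  have e: "e > 0" using x0 by (simp add: e_def)
  define H where "H w = Inf {ereal t | t. 0 <= t \<and> X t w > x0 / 2}" for w
  have H_less: "{w\<in>space M. H w < ereal t} \<in> sets (F (max 0 t))"
    and H_ge: "ereal 0 <= H w"
    and H_val: "w \<in> space M ==> H w = ereal h ==> x0 / 2 <= X h w"
    and H_before: "0 <= s ==> ereal s < H w ==> X s w <= x0 / 2" for t w h s
    using hitting_open[where q="0" and D=X and c="x0 / 2", OF _ adapted right_continuous_X] unfolding H_def by auto
  have H0: "0 <= H w" for w using H_ge by (simp add: zero_ereal_def)
  define S where "S = cap H 1"
  have S: "optional S" unfolding S_def
  proof (rule optional_cap)
    show "{w\<in>space M. H w < ereal t} \<in> sets (F t)" if "0 < t" for t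
      using H_less[of t] that by (simp add: max_def)
  qed (use H0 in auto)
  have SK: "S w <= 1" for w unfolding S_def using H0 by (rule cap_le)
  have Spos: "0 < S w" if w: "w \<in> space M" for w
  proof -
    have "H w \<noteq> ereal 0" using H_val[OF w, of 0] X_0[OF w] x0 by auto
    then have "0 < H w" using H0[of w] by (simp add: zero_ereal_def less_le)
    then have "ereal 0 < ereal (S w)" unfolding S_def by (subst cap_eq) (auto simp: zero_ereal_def)
    then show ?thesis by simp
  qed
  have SH: "ereal (S w) <= H w" for w unfolding S_def by (subst cap_eq[OF H0]) simp
  have XS: "X (S w) w <= x0 / 2" if w: "w \<in> space M" for w
  proof (rule X_le_at_left[OF w Spos[OF w], of 0])
    fix s assume "0 <= s" "s < S w"
    then have "ereal s < H w" using SH[of w] by (metis ereal_less(2) less_ereal.simps(1) less_le_trans)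
    then show "X s w <= x0 / 2" using H_before \<open>0 <= s\<close> by simp
  qed (rule Spos[OF w])
  have occ_right: "((\<lambda>s. occ e s w) \<longlongrightarrow> occ e t w) (at_right t)" if w: "w \<in> space M" and t: "0 <= t" for w t
  proof (rule tendsto_sandwich[where f="\<lambda>_. occ e t w" and h="\<lambda>s. occ e t w + (s - t) / (2 * e)"])
    show "\<forall>\<^sub>F s in at_right t. occ e t w <= occ e s w"
      by (rule eventually_at_right_less[THEN eventually_mono]) (use ennreal_occ_diff(2)[OF w e t] in auto)
    show "\<forall>\<^sub>F s in at_right t. occ e s w <= occ e t w + (s - t) / (2 * e)"
      by (rule eventually_at_right_less[THEN eventually_mono]) (use occ_diff_le[OF w e t] in \<open>auto simp: diff_le_eq add.commute\<close>)
    show "((\<lambda>s. occ e t w + (s - t) / (2 * e)) \<longlongrightarrow> occ e t w) (at_right t)"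
    proof -
      have "((\<lambda>s. occ e t w + (s - t) / (2 * e)) \<longlongrightarrow> occ e t w + (t - t) / (2 * e)) (at_right t)"
        using e by (intro tendsto_intros) auto
      then show ?thesis by simp
    qed
  qed simp
  have wb: "W_avg e x <= (exp e / \<psi> 1) * exp x" for x by (rule W_avg_le_exp[OF e])
  note os = optional_stopping_compensated[where V="W_avg e" and A="occ e", OF W_avg_continuous[OF e] W_avg_nonneg wb
      ennreal_occ_diff(2)[OF _ e] occ_right occ_0 occ_integrable[OF e] mart_W_avg_occ[OF e] S SK]
  have "W_avg e (X (S w) w) = 0" if "w \<in> space M" for w
  proof -
    have "W_avg e (X (S w) w) <= W (X (S w) w + e)" by (rule W_avg_le[OF e])
    also have "... <= W x0" using XS[OF that] x0 by (intro W_mono) (auto simp: e_def)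
    finally show ?thesis using W0 W_avg_nonneg[of e] by (simp add: order_antisym)
  qed
  then have "(\<integral>w. W_avg e (X (S w) w) \<partial>M) = (\<integral>w. 0 \<partial>M)" by (intro Bochner_Integration.integral_cong) auto
  then have "(\<integral>w. occ e (S w) w \<partial>M) <= 0" using os(3) W_avg_nonneg[of e 0] by simp
  moreover have "0 <= (\<integral>w. occ e (S w) w \<partial>M)" by (intro Bochner_Integration.integral_nonneg occ_nonneg e)
  ultimately have "(\<integral>w. occ e (S w) w \<partial>M) = 0" by simp
  then have "AE w in M. occ e (S w) w = 0"
    using integral_nonneg_eq_0_iff_AE[OF os(2)] occ_nonneg[OF e] by auto
  then have "AE w in M. False"
    using AE_space
  proof eventually_elim
    case (elim w)
    from tendstoD[OF right_continuous_X[OF elim(2), of 0] e] X_0[OF elim(2)]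
    obtain b where b: "b > 0" "\<And>s. 0 < s ==> s < b ==> \<bar>X s w\<bar> < e"
      by (auto simp: eventually_at_right_field)
    define c where "c = min b (S w) / 2"
    have c: "0 < c" "c < b" "c <= S w" using b Spos[OF elim(2)] by (auto simp: c_def)
    have "{s\<in>{0..c}. \<bar>X s w\<bar> < e} = {0..c}"
      using b(2) c X_0[OF elim(2)] e by (auto simp: le_less)
    then have "occ e c w = c / (2 * e)" using c by (simp add: occ_def)
    then have "occ e c w > 0" using c e by simp
    moreover have "occ e c w <= occ e (S w) w" using c by (intro ennreal_occ_diff(2)[OF elim(2) e]) auto
    ultimately show False using elim(1) by simp
  qed
  then show False by simp
qed

end

section \<open>Local time at zero\<close>

lemma borel_measurable_indicator_atLeast[measurable (raw)]:
  fixes f g :: "_ => real"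
  assumes [measurable]: "f \<in> borel_measurable N" "g \<in> borel_measurable N"
  shows "(\<lambda>x. indicator {f x..} (g x) :: ennreal) \<in> borel_measurable N"
proof -
  have "(\<lambda>x. indicator {f x..} (g x) :: ennreal) = (\<lambda>x. if f x <= g x then 1 else 0)"
    by (auto simp: indicator_def)
  then show ?thesis by simp
qed

text \<open>The square is split along the diagonal into two triangles of equal weight; the order of
  u and v is what later allows conditioning at the earlier time.\<close>

lemma nn_integral_square_le:
  fixes f :: "real => ennreal"
  assumes [measurable]: "f \<in> borel_measurable borel"
  shows "(\<integral>\<^sup>+u. f u \<partial>lborel) * (\<integral>\<^sup>+u. f u \<partial>lborel) \<le>
    2 * (\<integral>\<^sup>+u. \<integral>\<^sup>+v. indicator {u..} v * (f u * f v) \<partial>lborel \<partial>lborel)"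
proof -
  have "(\<integral>\<^sup>+u. f u \<partial>lborel) * (\<integral>\<^sup>+u. f u \<partial>lborel) = (\<integral>\<^sup>+u. \<integral>\<^sup>+v. f u * f v \<partial>lborel \<partial>lborel)"
    by (simp add: nn_integral_cmult nn_integral_multc)
  also have "... <= (\<integral>\<^sup>+u. \<integral>\<^sup>+v. indicator {u..} v * (f u * f v) + indicator {v..} u * (f u * f v) \<partial>lborel \<partial>lborel)"
    by (intro nn_integral_mono) (auto split: split_indicator)
  also have "... = (\<integral>\<^sup>+u. (\<integral>\<^sup>+v. indicator {u..} v * (f u * f v) \<partial>lborel) + (\<integral>\<^sup>+v. indicator {v..} u * (f u * f v) \<partial>lborel) \<partial>lborel)"
    by (intro nn_integral_cong nn_integral_add) measurable
  also have "... = (\<integral>\<^sup>+u. \<integral>\<^sup>+v. indicator {u..} v * (f u * f v) \<partial>lborel \<partial>lborel) + (\<integral>\<^sup>+u. \<integral>\<^sup>+v. indicator {v..} u * (f u * f v) \<partial>lborel \<partial>lborel)"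
    by (rule nn_integral_add) measurable
  also have "(\<integral>\<^sup>+u. \<integral>\<^sup>+v. indicator {v..} u * (f u * f v) \<partial>lborel \<partial>lborel) = (\<integral>\<^sup>+v. \<integral>\<^sup>+u. indicator {v..} u * (f u * f v) \<partial>lborel \<partial>lborel)"
    by (rule lborel_pair.Fubini') measurable
  also have "... = (\<integral>\<^sup>+u. \<integral>\<^sup>+v. indicator {u..} v * (f u * f v) \<partial>lborel \<partial>lborel)"
    by (simp only: mult.commute[of "f _" "f _"])
  finally show ?thesis by (simp add: mult_2)
qed

context sn_levy_scale
begin

section \<open>Expected occupation and second moments, uniformly in the window\<close>

text \<open>The Green function of a window up to time \<open>h\<close>: mean occupation density for
  the process started from \<open>x\<close>.\<close>

definition green :: "real => real => real => ennreal" where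
  "green a h x = (\<integral>\<^sup>+r. indicator {0..h} r * (\<integral>\<^sup>+w. window a (x + X (max 0 r) w) \<partial>M) \<partial>lborel)"

lemma smear_plus_green:
  "0 <= h ==> smear (window a) x + green a h x = (\<integral>\<^sup>+w. smear (window a) (x + X h w) \<partial>M)"
  unfolding green_def by (rule dynkin[symmetric]) simp_all

lemma green_mono: "h <= h' ==> green a h x <= green a h' x"
  unfolding green_def by (intro nn_integral_mono mult_right_mono) (auto split: split_indicator)

text \<open>Dynkin's formula bounds the mean occupation by the mean of W (x + X_h + a), and |x| + a
  <= 2 explains the factor exp 2. The bound is uniform in the width \<open>a\<close>.\<close>

lemma green_bound:
  assumes a: "0 < a" "a <= 1" and x: "\<bar>x\<bar> <= a" and h: "0 <= h"
  shows "green a h x <= ennreal (exp 2 / \<psi> 1 * exp (h * \<psi> 1))"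
proof -
  have [measurable]: "X h \<in> borel_measurable M" using h by (rule borel_measurable_X)
  have "green a h x <= smear (window a) x + green a h x" by (rule add_increasing) auto
  also have "... = (\<integral>\<^sup>+w. smear (window a) (x + X h w) \<partial>M)" using smear_plus_green[OF h] .
  also have "... <= (\<integral>\<^sup>+w. ennreal (exp 2 / \<psi> 1) * ennreal (exp (1 * X h w)) \<partial>M)"
  proof (rule nn_integral_mono)
    fix w
    have "smear (window a) (x + X h w) <= ennreal (W (x + X h w + a))" by (rule smear_window_le[OF a(1)])
    also have "... <= ennreal (1 / \<psi> 1 * exp (2 + X h w))"
    proof (rule ennreal_leI)
      have "W (x + X h w + a) <= W (2 + X h w)" using a x by (intro W_mono) auto
      also have "... <= 1 / \<psi> 1 * exp (2 + X h w)" by (rule W_le_exp)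
      finally show "W (x + X h w + a) <= 1 / \<psi> 1 * exp (2 + X h w)" .
    qed
    also have "... = ennreal (exp 2 / \<psi> 1) * ennreal (exp (1 * X h w))"
      using psi_positive[of 1] by (simp add: ennreal_mult[symmetric] exp_add)
    finally show "smear (window a) (x + X h w) <= ennreal (exp 2 / \<psi> 1) * ennreal (exp (1 * X h w))" .
  qed
  also have "... = ennreal (exp 2 / \<psi> 1) * (\<integral>\<^sup>+w. ennreal (exp (1 * X h w)) \<partial>M)" by (rule nn_integral_cmult) measurable
  also have "(\<integral>\<^sup>+w. ennreal (exp (1 * X h w)) \<partial>M) = ennreal (exp (h * \<psi> 1))" by (rule nn_integral_exp_X) (use h in auto)
  finally show ?thesis using psi_positive[of 1] by (simp add: ennreal_mult[symmetric])
qed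

text \<open>By Dynkin's formula the mean occupation is the mean increase of
  \<open>smear (window a)\<close>. For short times this is controlled by uniform continuity of
  \<open>W\<close> for small displacements and by exponential growth for large ones, uniformly in
  the width \<open>a\<close>.\<close>

lemma green_small:
  assumes e: "e > 0"
  shows "\<exists>d>0. \<forall>h a x. 0 <= h \<and> h < d \<and> 0 < a \<and> a <= 1 \<and> \<bar>x\<bar> <= a --> green a h x <= ennreal e"
proof -
  \<comment> \<open>Arguments v with |v| <= 2 are displaced by at most 1 to the right, hence the end
    point 3; a displacement to the left is handled by monotonicity.\<close>
  have "uniformly_continuous_on {-2..3} W"
    by (rule compact_uniformly_continuous[OF continuous_on_subset[OF W_cont]]) auto
  then obtain \<delta>' where \<delta>': "\<delta>' > 0" "\<And>u v. u \<in> {-2..3} ==> v \<in> {-2..3} ==> dist v u < \<delta>' ==> dist (W v) (W u) < e / 2"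
    unfolding uniformly_continuous_on_def using e by (metis half_gt_zero)
  define \<delta> where "\<delta> = min \<delta>' 1"
  have \<delta>: "0 < \<delta>" "\<delta> <= 1" using \<delta>'(1) by (auto simp: \<delta>_def)
  \<comment> \<open>\<open>q\<close> is nonnegative, is at least a fixed multiple of exp z for z >=
    \<delta>, and has a mean that involves only exponential moments of orders 1, 2 and 3; this mean
    \<open>Q h\<close> tends to Q 0 = 0.\<close>
  define q where "q z = exp z * (exp z - 1)\<^sup>2" for z :: real
  define C where "C = exp 2 / \<psi> 1 / (exp \<delta> - 1)\<^sup>2"
  have C: "0 <= C" using psi_positive[of 1] by (simp add: C_def)
  have q0: "0 <= q z" for z by (simp add: q_def)
  have Wz: "W (v + z) <= W v + (e / 2 + C * q z)" if v: "\<bar>v\<bar> <= 2" for v z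
  proof (cases "z < \<delta>")
    case True
    have "W (v + z) <= W v + e / 2"
    proof (cases "z <= 0")
      case True then show ?thesis using W_mono[of "v + z" v] e by simp
    next
      case False
      then have "dist (W (v + z)) (W v) < e / 2"
        using v True \<delta> by (intro \<delta>'(2)) (auto simp: dist_real_def \<delta>_def)
      then show ?thesis unfolding dist_real_def by linarith
    qed
    then show ?thesis using mult_nonneg_nonneg[OF C q0[of z]] by simp
  next
    case False
    have "W (v + z) <= W (2 + z)" using v by (intro W_mono) auto
    also have "... <= 1 / \<psi> 1 * exp (2 + z)" by (rule W_le_exp)
    also have "... = exp 2 / \<psi> 1 * exp z * 1" by (simp add: exp_add)
    also have "... <= exp 2 / \<psi> 1 * exp z * ((exp z - 1)\<^sup>2 / (exp \<delta> - 1)\<^sup>2)"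
    proof (rule mult_left_mono)
      have "(exp \<delta> - 1)\<^sup>2 <= (exp z - 1)\<^sup>2" using False \<delta> by (intro power_mono) auto
      then show "1 <= (exp z - 1)\<^sup>2 / (exp \<delta> - 1)\<^sup>2" using \<delta> by simp
      show "0 <= exp 2 / \<psi> 1 * exp z" using psi_positive[of 1] by simp
    qed
    also have "... = C * q z" by (simp add: C_def q_def)
    finally show ?thesis using W_nonneg[of v] e by simp
  qed
  have sm: "smear (window a) (x + z) <= smear (window a) x + ennreal (e / 2 + C * q z)"
    if a: "0 < a" "a <= 1" and x: "\<bar>x\<bar> <= a" for a x z
  proof -
    have "smear (window a) (x + z) <= (\<integral>\<^sup>+y. window a y * ennreal (W (x - y)) + window a y * ennreal (e / 2 + C * q z) \<partial>lborel)"
      unfolding smear_def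
    proof (rule nn_integral_mono)
      fix y
      have "ennreal (W (x + z - y)) <= ennreal (W (x - y)) + ennreal (e / 2 + C * q z)" if "\<bar>y\<bar> < a"
      proof -
        have "W (x - y + z) <= W (x - y) + (e / 2 + C * q z)" using that a x by (intro Wz) auto
        then have "ennreal (W (x - y + z)) <= ennreal (W (x - y) + (e / 2 + C * q z))" by (rule ennreal_leI)
        also have "... = ennreal (W (x - y)) + ennreal (e / 2 + C * q z)"
          using e C q0[of z] W_nonneg by (intro ennreal_plus) auto
        finally show ?thesis by (simp add: algebra_simps)
      qed
      then show "window a y * ennreal (W (x + z - y)) <= window a y * ennreal (W (x - y)) + window a y * ennreal (e / 2 + C * q z)"
        unfolding distrib_left[symmetric] by (auto simp: window_def abs_less_iff intro!: mult_left_mono split: split_indicator)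
    qed
    also have "... = smear (window a) x + ennreal (e / 2 + C * q z)"
      using a by (simp add: nn_integral_add nn_integral_multc nn_integral_window smear_def)
    finally show ?thesis .
  qed
  define Q where "Q h = exp (h * \<psi> 3) - 2 * exp (h * \<psi> 2) + exp (h * \<psi> 1)" for h
  have Eq: "(\<integral>\<^sup>+w. ennreal (e / 2 + C * q (X h w)) \<partial>M) = ennreal (e / 2 + C * Q h)" if h: "0 <= h" for h
  proof -
    have q_eq: "q z = exp (3 * z) - 2 * exp (2 * z) + exp (1 * z)" for z
      by (simp add: q_def power2_eq_square algebra_simps exp_add[symmetric])
    have i: "integrable M (\<lambda>w. exp (3 * X h w))" "integrable M (\<lambda>w. exp (2 * X h w))" "integrable M (\<lambda>w. exp (1 * X h w))"
      using integrable_exp_X[of 3 h] integrable_exp_X[of 2 h] integrable_exp_X[of 1 h] h by auto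
    have iq: "integrable M (\<lambda>w. q (X h w))" unfolding q_eq by (intro Bochner_Integration.integrable_add Bochner_Integration.integrable_diff integrable_mult_right i)
    have "(\<integral>w. q (X h w) \<partial>M) = Q h"
      unfolding q_eq Q_def using i expectation_exp_X[of 3 h] expectation_exp_X[of 2 h] expectation_exp_X[of 1 h] h by simp
    then have "(\<integral>w. e / 2 + C * q (X h w) \<partial>M) = e / 2 + C * Q h" using iq by (simp add: prob_space)
    moreover have "(\<integral>\<^sup>+w. ennreal (e / 2 + C * q (X h w)) \<partial>M) = ennreal (\<integral>w. e / 2 + C * q (X h w) \<partial>M)"
      using iq e C q0 by (intro nn_integral_eq_integral) auto
    ultimately show ?thesis by simp
  qed
  have "((\<lambda>h. C * Q h) \<longlongrightarrow> C * Q 0) (at 0)"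
    unfolding Q_def by (intro tendsto_intros)
  then have "((\<lambda>h. C * Q h) \<longlongrightarrow> 0) (at 0)" by (simp add: Q_def)
  from tendstoD[OF this, of "e / 2"] e obtain d where d: "d > 0" "\<And>h. h \<noteq> 0 ==> \<bar>h\<bar> < d ==> \<bar>C * Q h\<bar> < e / 2"
    by (auto simp: eventually_at dist_real_def)
  have "green a h x <= ennreal e" if h: "0 <= h" "h < d" and a: "0 < a" "a <= 1" and x: "\<bar>x\<bar> <= a" for h a x
  proof -
    have [measurable]: "X h \<in> borel_measurable M" using h(1) by (rule borel_measurable_X)
    have "smear (window a) x + green a h x = (\<integral>\<^sup>+w. smear (window a) (x + X h w) \<partial>M)" by (rule smear_plus_green[OF h(1)])
    also have "... <= (\<integral>\<^sup>+w. smear (window a) x + ennreal (e / 2 + C * q (X h w)) \<partial>M)"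
      by (intro nn_integral_mono sm a x)
    also have "... = smear (window a) x + ennreal (e / 2 + C * Q h)"
      unfolding Eq[OF h(1), symmetric] by (subst nn_integral_add) (auto simp: q_def emeasure_space_1)
    also have "... <= smear (window a) x + ennreal e"
    proof (intro add_left_mono ennreal_leI)
      have "C * Q h <= e / 2" using d(2)[of h] h e by (cases "h = 0") (auto simp: Q_def abs_less_iff)
      then show "e / 2 + C * Q h <= e" by simp
    qed
    finally show ?thesis using smear_window_eq[OF a(1), of x] by (simp add: ennreal_add_left_cancel_le)
  qed
  then show ?thesis using d(1) by blast
qed

lemma nn_integral_occ:
  assumes a: "a > 0" and t: "0 <= t"
  shows "(\<integral>\<^sup>+w. ennreal (occ a t w) \<partial>M) = green a t 0"
proof -
  have [measurable]: "X (max 0 r) \<in> borel_measurable M" for r by (rule borel_measurable_X) simp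
  have "(\<integral>\<^sup>+w. ennreal (occ a t w) \<partial>M) = (\<integral>\<^sup>+w. \<integral>\<^sup>+u. indicator {0..t} u * window a (X (max 0 u) w) \<partial>lborel \<partial>M)"
    by (intro nn_integral_cong ennreal_occ a t)
  also have "... = (\<integral>\<^sup>+u. \<integral>\<^sup>+w. indicator {0..t} u * window a (X (max 0 u) w) \<partial>M \<partial>lborel)"
    by (rule lborel_M.Fubini') measurable
  also have "... = green a t 0" unfolding green_def
    by (intro nn_integral_cong) (simp add: nn_integral_cmult)
  finally show ?thesis .
qed

text \<open>The square is at most twice an integral over ordered times u <= v. At time u the path is
  in the window, so the mean later occupation is at most \<open>g\<close>; the remaining integral
  over u is the first moment.\<close>

lemma occ_second_moment:
  assumes a: "a > 0" and s: "0 <= s" "s <= t" and g: "\<And>x. \<bar>x\<bar> <= a ==> green a (t - s) x <= g"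
  shows "(\<integral>\<^sup>+w. ennreal ((occ a t w - occ a s w)\<^sup>2) \<partial>M) <= 2 * g * (\<integral>\<^sup>+w. ennreal (occ a t w - occ a s w) \<partial>M)"
proof -
  have Xr[measurable]: "X (max 0 r) \<in> borel_measurable M" for r by (rule borel_measurable_X) simp
  define G where "G u w = indicator {s..t} u * window a (X (max 0 u) w)" for u w
  have [measurable (raw)]: "(\<lambda>x. G (f x) (g x)) \<in> borel_measurable N"
    if [measurable]: "f \<in> borel_measurable N" "g \<in> measurable N M" for f g N
    unfolding G_def by measurable
  have sq: "ennreal ((occ a t w - occ a s w)\<^sup>2) <= 2 * (\<integral>\<^sup>+u. \<integral>\<^sup>+v. indicator {u..} v * (G u w * G v w) \<partial>lborel \<partial>lborel)"
    if w: "w \<in> space M" for w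
  proof -
    have "ennreal ((occ a t w - occ a s w)\<^sup>2) = (\<integral>\<^sup>+u. G u w \<partial>lborel) * (\<integral>\<^sup>+u. G u w \<partial>lborel)"
      using ennreal_occ_diff[OF w a s] by (simp add: G_def power2_eq_square ennreal_mult)
    also have "... <= 2 * (\<integral>\<^sup>+u. \<integral>\<^sup>+v. indicator {u..} v * (G u w * G v w) \<partial>lborel \<partial>lborel)"
      using w by (intro nn_integral_square_le) measurable
    finally show ?thesis .
  qed
  have "(\<integral>\<^sup>+w. ennreal ((occ a t w - occ a s w)\<^sup>2) \<partial>M) \<le>
    (\<integral>\<^sup>+w. 2 * (\<integral>\<^sup>+u. \<integral>\<^sup>+v. indicator {u..} v * (G u w * G v w) \<partial>lborel \<partial>lborel) \<partial>M)"
    by (intro nn_integral_mono sq)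
  also have "... = 2 * (\<integral>\<^sup>+w. \<integral>\<^sup>+u. \<integral>\<^sup>+v. indicator {u..} v * (G u w * G v w) \<partial>lborel \<partial>lborel \<partial>M)"
    by (rule nn_integral_cmult) measurable
  also have "(\<integral>\<^sup>+w. \<integral>\<^sup>+u. \<integral>\<^sup>+v. indicator {u..} v * (G u w * G v w) \<partial>lborel \<partial>lborel \<partial>M) =
    (\<integral>\<^sup>+u. \<integral>\<^sup>+w. \<integral>\<^sup>+v. indicator {u..} v * (G u w * G v w) \<partial>lborel \<partial>M \<partial>lborel)"
    by (rule lborel_M.Fubini') measurable
  also have "... <= (\<integral>\<^sup>+u. g * (\<integral>\<^sup>+w. G u w \<partial>M) \<partial>lborel)"
  proof (rule nn_integral_mono)
    fix u :: real
    show "(\<integral>\<^sup>+w. \<integral>\<^sup>+v. indicator {u..} v * (G u w * G v w) \<partial>lborel \<partial>M) <= g * (\<integral>\<^sup>+w. G u w \<partial>M)"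
    proof (cases "u \<in> {s..t}")
      case False
      then show ?thesis by (simp add: G_def)
    next
      case True
      then have u: "0 <= u" "s <= u" "u <= t" using s by auto
      define B where "B = {w\<in>space (F u). \<bar>X u w\<bar> < a}"
      have B: "B \<in> sets (F u)" unfolding B_def using adapted[OF u(1)] by measurable
      then have [measurable]: "B \<in> sets M" using sets_F[OF u(1)] by auto
      have [measurable]: "X u \<in> borel_measurable M" using u(1) by (rule borel_measurable_X)
      define c where "c = ennreal (1 / (2 * a))"
      have Gu: "G u w = c * indicator B w" if "w \<in> space M" for w
        using True u that by (auto simp: G_def window_def B_def c_def space_F max_def abs_less_iff split: split_indicator)
      have "(\<integral>\<^sup>+w. \<integral>\<^sup>+v. indicator {u..} v * (G u w * G v w) \<partial>lborel \<partial>M) =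
        (\<integral>\<^sup>+v. \<integral>\<^sup>+w. indicator {u..} v * (G u w * G v w) \<partial>M \<partial>lborel)"
        by (rule lborel_M.Fubini') measurable
      also have "... = (\<integral>\<^sup>+v. c * (indicator {u..t} v * (\<integral>\<^sup>+w. indicator B w * window a (X (max 0 v) w) \<partial>M)) \<partial>lborel)"
      proof (rule nn_integral_cong)
        fix v :: real
        have "(\<integral>\<^sup>+w. indicator {u..} v * (G u w * G v w) \<partial>M) = (\<integral>\<^sup>+w. (c * indicator {u..t} v) * (indicator B w * window a (X (max 0 v) w)) \<partial>M)"
          using u by (intro nn_integral_cong) (auto simp: Gu G_def[of v] mult_ac split: split_indicator)
        also have "... = (c * indicator {u..t} v) * (\<integral>\<^sup>+w. indicator B w * window a (X (max 0 v) w) \<partial>M)"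
          by (rule nn_integral_cmult) measurable
        finally show "(\<integral>\<^sup>+w. indicator {u..} v * (G u w * G v w) \<partial>M) = c * (indicator {u..t} v * (\<integral>\<^sup>+w. indicator B w * window a (X (max 0 v) w) \<partial>M))"
          by (simp add: mult.assoc)
      qed
      also have "... = c * (\<integral>\<^sup>+v. indicator {u..t} v * (\<integral>\<^sup>+w. indicator B w * window a (X (max 0 v) w) \<partial>M) \<partial>lborel)"
        by (rule nn_integral_cmult) measurable
      also have "... = c * (\<integral>\<^sup>+w. indicator B w * green a (t - u) (X u w) \<partial>M)"
        unfolding green_def by (subst occupation_past[OF u(1,3) B]) simp_all
      also have "... <= c * (\<integral>\<^sup>+w. indicator B w * g \<partial>M)"
      proof (rule mult_left_mono[OF nn_integral_mono])
        fix w
        have "green a (t - u) (X u w) <= g" if "w \<in> B"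
          using green_mono[of "t - u" "t - s" a "X u w"] g[of "X u w"] that u by (auto simp: B_def intro: order_trans)
        then show "indicator B w * green a (t - u) (X u w) <= indicator B w * g" by (auto split: split_indicator)
      qed simp
      also have "... = g * (\<integral>\<^sup>+w. c * indicator B w \<partial>M)"
        by (simp add: nn_integral_multc nn_integral_cmult mult_ac)
      also have "(\<integral>\<^sup>+w. c * indicator B w \<partial>M) = (\<integral>\<^sup>+w. G u w \<partial>M)" by (intro nn_integral_cong) (simp add: Gu)
      finally show ?thesis .
    qed
  qed
  also have "... = g * (\<integral>\<^sup>+u. \<integral>\<^sup>+w. G u w \<partial>M \<partial>lborel)" by (rule nn_integral_cmult) measurable
  also have "(\<integral>\<^sup>+u. \<integral>\<^sup>+w. G u w \<partial>M \<partial>lborel) = (\<integral>\<^sup>+w. \<integral>\<^sup>+u. G u w \<partial>lborel \<partial>M)"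
    by (rule lborel_M.Fubini'[symmetric]) measurable
  also have "... = (\<integral>\<^sup>+w. ennreal (occ a t w - occ a s w) \<partial>M)"
    by (intro nn_integral_cong) (simp add: ennreal_occ_diff(1)[OF _ a s] G_def)
  finally show ?thesis by (simp add: mult.assoc mult_left_mono)
qed

definition occ_const :: "real => real" where
  "occ_const t = exp 2 / \<psi> 1 * exp (t * \<psi> 1)"

lemma occ_const_nonneg: "0 <= occ_const t"
  using psi_positive[of 1] by (simp add: occ_const_def)

lemma occ_first_moment_bound:
  assumes "0 < a" "a <= 1" "0 <= t"
  shows "(\<integral>\<^sup>+w. ennreal (occ a t w) \<partial>M) <= ennreal (occ_const t)"
  using green_bound[of a 0 t] assms by (simp add: nn_integral_occ occ_const_def)

lemma occ_L2_bound:
  assumes a: "0 < a" "a <= 1" and t: "0 <= t"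
  shows "(\<integral>\<^sup>+w. ennreal ((occ a t w)\<^sup>2) \<partial>M) <= ennreal (2 * (occ_const t)\<^sup>2)"
proof -
  have "(\<integral>\<^sup>+w. ennreal ((occ a t w - occ a 0 w)\<^sup>2) \<partial>M) <= 2 * ennreal (occ_const t) * (\<integral>\<^sup>+w. ennreal (occ a t w - occ a 0 w) \<partial>M)"
    using green_bound[OF a] t by (intro occ_second_moment a) (auto simp: occ_const_def)
  also have "... <= 2 * ennreal (occ_const t) * ennreal (occ_const t)"
    using occ_first_moment_bound[OF assms] by (intro mult_left_mono) (auto simp: occ_0)
  also have "... = ennreal (2 * (occ_const t)\<^sup>2)"
    using occ_const_nonneg[of t] by (simp add: power2_eq_square ennreal_mult mult.assoc)
  finally show ?thesis by (simp add: occ_0)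
qed

text \<open>\<open>F t\<close> contains all null sets and the measure is complete, so membership in
  \<open>F t\<close> is insensitive to changes on null sets.\<close>

lemma sets_F_AE_eq:
  assumes t: "0 <= t" and B: "B \<in> sets (F t)" and A: "A \<subseteq> space M" and ae: "AE w in M. w \<in> A \<longleftrightarrow> w \<in> B"
  shows "A \<in> sets (F t)"
proof -
  obtain N where N: "\<And>w. w \<in> space M - N ==> w \<in> A \<longleftrightarrow> w \<in> B" "N \<in> null_sets M" using ae by (rule AE_E3) blast
  have null: "C \<in> sets (F t)" if "C \<subseteq> N" for C
    using F_null[OF t null_sets_subset[OF N(2) complete[OF N(2) that] that]] .
  have "B \<subseteq> space M" using sets.sets_into_space[OF B] by (simp add: space_F)
  then have "A = (B - N) \<union> (A \<inter> N)" using N(1) A by blast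
  then show ?thesis using B null[of N] null[of "A \<inter> N"] by (metis Int_lower2 order_refl sets.Diff sets.Un)
qed

lemma measurable_F_AE_eq:
  fixes f g :: "'a => real"
  assumes t: "0 <= t" and g: "g \<in> borel_measurable (F t)" and ae: "AE w in M. f w = g w"
  shows "f \<in> borel_measurable (F t)"
proof (rule measurableI)
  fix A :: "real set" assume A: "A \<in> sets borel"
  show "f -` A \<inter> space (F t) \<in> sets (F t)"
    by (rule sets_F_AE_eq[OF t measurable_sets[OF g A]]) (use ae in \<open>auto simp: space_F elim: eventually_mono\<close>)
qed simp

section \<open>Local time as a limit of occupation densities\<close>

context
  fixes L
  assumes lt: "local_time_at_zero M X L"
begin

lemma local_time_limit: "AE w in M. \<forall>t\<ge>0. (\<lambda>n. occ (1 / real (Suc n)) t w) \<longlonglongrightarrow> L t w"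
proof -
  have r: "filterlim (\<lambda>n. 1 / real (Suc n)) (at_right 0) sequentially"
    unfolding filterlim_at
  proof
    show "(\<lambda>n. 1 / real (Suc n)) \<longlonglongrightarrow> 0" by (rule LIMSEQ_Suc[OF lim_1_over_n])
  qed simp
  show ?thesis
    using lt unfolding local_time_at_zero_def
  proof eventually_elim
    case (elim w)
    then show ?case unfolding occ_def using filterlim_compose[OF _ r] by blast
  qed
qed

lemma local_time_adapted:
  assumes t: "0 <= t" shows "L t \<in> borel_measurable (F t)"
proof (rule measurable_F_AE_eq[OF t])
  show "(\<lambda>w. lim (\<lambda>n. occ (1 / real (Suc n)) t w)) \<in> borel_measurable (F t)"
    by (intro borel_measurable_lim_metric occ_adapted t) simp
  show "AE w in M. L t w = lim (\<lambda>n. occ (1 / real (Suc n)) t w)"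
    using local_time_limit by eventually_elim (use t in \<open>auto simp: limI\<close>)
qed

lemma local_time_measurable: "0 <= t ==> L t \<in> borel_measurable M"
  using measurable_F_imp[OF _ local_time_adapted] by auto

lemma local_time_mono_AE: "AE w in M. \<forall>s t. 0 <= s \<and> s <= t --> L s w <= L t w"
  using local_time_limit AE_space
proof eventually_elim
  case (elim w)
  show ?case
  proof (intro allI impI)
    fix s t :: real assume st: "0 <= s \<and> s <= t"
    show "L s w <= L t w"
      by (rule LIMSEQ_le[of "\<lambda>n. occ (1 / real (Suc n)) s w" _ "\<lambda>n. occ (1 / real (Suc n)) t w"])
        (use elim st ennreal_occ_diff(2)[OF elim(2)] in auto)
  qed
qed

text \<open>The mean square of each increment of \<open>occ\<close> is at most 2 e times its mean;
  the means telescope to at most \<open>occ_const K\<close>, and Fatou's lemma passes to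
  \<open>L\<close>.\<close>

lemma local_time_increments:
  fixes K :: real and N :: nat
  assumes K: "0 <= K" and N: "N > 0" and e: "e >= 0"
    and small: "\<And>a x. 0 < a ==> a <= 1 ==> \<bar>x\<bar> <= a ==> green a (K / N) x <= ennreal e"
  shows "(\<integral>\<^sup>+w. (\<Sum>i<N. ennreal ((L (K * Suc i / N) w - L (K * i / N) w)\<^sup>2)) \<partial>M) <= ennreal (2 * e * occ_const K)"
proof -
  define \<tau> where "\<tau> i = K * real i / real N" for i
  have \<tau>0: "0 <= \<tau> i" for i using K by (simp add: \<tau>_def)
  have \<tau>S: "\<tau> i <= \<tau> (Suc i)" for i using K by (simp add: \<tau>_def divide_right_mono mult_left_mono)
  have \<tau>d: "\<tau> (Suc i) - \<tau> i = K / N" for i by (simp add: \<tau>_def diff_divide_distrib[symmetric] algebra_simps)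
  define a where "a n = 1 / real (Suc n)" for n
  have a: "0 < a n" "a n <= 1" for n by (auto simp: a_def)
  have [measurable]: "occ (a n) (\<tau> i) \<in> borel_measurable M" for n i by (rule occ_measurable[OF a(1) \<tau>0])
  have bound: "(\<integral>\<^sup>+w. (\<Sum>i<N. ennreal ((occ (a n) (\<tau> (Suc i)) w - occ (a n) (\<tau> i) w)\<^sup>2)) \<partial>M) <= ennreal (2 * e * occ_const K)" for n
  proof -
    have "(\<integral>\<^sup>+w. (\<Sum>i<N. ennreal ((occ (a n) (\<tau> (Suc i)) w - occ (a n) (\<tau> i) w)\<^sup>2)) \<partial>M)
      = (\<Sum>i<N. \<integral>\<^sup>+w. ennreal ((occ (a n) (\<tau> (Suc i)) w - occ (a n) (\<tau> i) w)\<^sup>2) \<partial>M)"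
      by (rule nn_integral_sum) measurable
    also have "... <= (\<Sum>i<N. 2 * ennreal e * (\<integral>\<^sup>+w. ennreal (occ (a n) (\<tau> (Suc i)) w - occ (a n) (\<tau> i) w) \<partial>M))"
      using small[OF a] by (intro sum_mono occ_second_moment a \<tau>0 \<tau>S) (auto simp: \<tau>d)
    also have "... = 2 * ennreal e * (\<integral>\<^sup>+w. (\<Sum>i<N. ennreal (occ (a n) (\<tau> (Suc i)) w - occ (a n) (\<tau> i) w)) \<partial>M)"
      by (subst nn_integral_sum) (auto simp: sum_distrib_left)
    also have "(\<integral>\<^sup>+w. (\<Sum>i<N. ennreal (occ (a n) (\<tau> (Suc i)) w - occ (a n) (\<tau> i) w)) \<partial>M) = (\<integral>\<^sup>+w. ennreal (occ (a n) K w) \<partial>M)"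
    proof (rule nn_integral_cong)
      fix w assume w: "w \<in> space M"
      have "(\<Sum>i<N. ennreal (occ (a n) (\<tau> (Suc i)) w - occ (a n) (\<tau> i) w)) = ennreal (\<Sum>i<N. occ (a n) (\<tau> (Suc i)) w - occ (a n) (\<tau> i) w)"
        using ennreal_occ_diff(2)[OF w a(1) \<tau>0 \<tau>S] by (intro sum_ennreal) simp
      also have "(\<Sum>i<N. occ (a n) (\<tau> (Suc i)) w - occ (a n) (\<tau> i) w) = occ (a n) (\<tau> N) w - occ (a n) (\<tau> 0) w"
        by (rule sum_lessThan_telescope)
      also have "... = occ (a n) K w" using N by (simp add: \<tau>_def occ_0)
      finally show "(\<Sum>i<N. ennreal (occ (a n) (\<tau> (Suc i)) w - occ (a n) (\<tau> i) w)) = ennreal (occ (a n) K w)" .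
    qed
    also have "2 * ennreal e * ... <= 2 * ennreal e * ennreal (occ_const K)"
      using a K by (intro mult_left_mono occ_first_moment_bound) auto
    also have "... = ennreal (2 * e * occ_const K)"
      using e occ_const_nonneg[of K] by (simp add: ennreal_mult)
    finally show ?thesis .
  qed
  have "(\<integral>\<^sup>+w. (\<Sum>i<N. ennreal ((L (\<tau> (Suc i)) w - L (\<tau> i) w)\<^sup>2)) \<partial>M) =
    (\<integral>\<^sup>+w. liminf (\<lambda>n. \<Sum>i<N. ennreal ((occ (a n) (\<tau> (Suc i)) w - occ (a n) (\<tau> i) w)\<^sup>2)) \<partial>M)"
  proof (rule nn_integral_cong_AE)
    show "AE w in M. (\<Sum>i<N. ennreal ((L (\<tau> (Suc i)) w - L (\<tau> i) w)\<^sup>2)) =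
      liminf (\<lambda>n. \<Sum>i<N. ennreal ((occ (a n) (\<tau> (Suc i)) w - occ (a n) (\<tau> i) w)\<^sup>2))"
      using local_time_limit
    proof eventually_elim
      case (elim w)
      have l: "(\<lambda>n. occ (a n) (\<tau> i) w) \<longlonglongrightarrow> L (\<tau> i) w" for i using elim \<tau>0[of i] by (simp add: a_def)
      have "(\<lambda>n. \<Sum>i<N. ennreal ((occ (a n) (\<tau> (Suc i)) w - occ (a n) (\<tau> i) w)\<^sup>2)) \<longlonglongrightarrow> (\<Sum>i<N. ennreal ((L (\<tau> (Suc i)) w - L (\<tau> i) w)\<^sup>2))"
        by (intro tendsto_sum tendsto_ennrealI tendsto_power tendsto_diff l)
      then show ?case by (intro lim_imp_Liminf[symmetric]) auto
    qed
  qed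
  also have "... <= liminf (\<lambda>n. \<integral>\<^sup>+w. (\<Sum>i<N. ennreal ((occ (a n) (\<tau> (Suc i)) w - occ (a n) (\<tau> i) w)\<^sup>2)) \<partial>M)"
    by (intro nn_integral_liminf) measurable
  also have "... <= ennreal (2 * e * occ_const K)" using bound by (intro Liminf_le) auto
  finally show ?thesis by (simp add: \<tau>_def)
qed

text \<open>If every grid had an increment of at least J, the sum of squares would always be at
  least J^2, while on fine grids its expectation is as small as desired.\<close>

lemma local_time_grid:
  assumes K: "0 < K" and J: "0 < J"
  shows "AE w in M. \<exists>N>0. \<forall>i<N. L (K * real (Suc i) / real N) w - L (K * real i / real N) w < J"
proof -
  define V where "V N = {w\<in>space M. \<exists>i<N. L (K * real (Suc i) / real N) w - L (K * real i / real N) w >= J}" for N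
  have [measurable]: "L (K * real i / real N) \<in> borel_measurable M" for i N using K by (intro local_time_measurable) auto
  have [measurable]: "V N \<in> sets M" for N unfolding V_def by measurable
  have le: "prob (\<Inter>N\<in>{0<..}. V N) <= 2 * e * occ_const K / J\<^sup>2" if e: "e > 0" for e
  proof -
    obtain d where d: "d > 0" "\<And>h a x. 0 <= h ==> h < d ==> 0 < a ==> a <= 1 ==> \<bar>x\<bar> <= a ==> green a h x <= ennreal e"
      using green_small[OF e] by blast
    obtain N :: nat where N: "K / d < real N" using reals_Archimedean2 by blast
    have "0 < K / d" using K d by simp
    then have N0: "N > 0" using N by (metis gr0I less_trans of_nat_0 less_irrefl)
    have KN: "K / N < d" using N N0 d by (simp add: field_simps)
    have "ennreal (J\<^sup>2 * prob (V N)) = (\<integral>\<^sup>+w. ennreal (J\<^sup>2) * indicator (V N) w \<partial>M)"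
      by (subst nn_integral_cmult_indicator) (auto simp: emeasure_eq_measure ennreal_mult)
    also have "... <= (\<integral>\<^sup>+w. (\<Sum>i<N. ennreal ((L (K * Suc i / N) w - L (K * i / N) w)\<^sup>2)) \<partial>M)"
    proof (rule nn_integral_mono)
      fix w
      show "ennreal (J\<^sup>2) * indicator (V N) w <= (\<Sum>i<N. ennreal ((L (K * Suc i / N) w - L (K * i / N) w)\<^sup>2))"
      proof (cases "w \<in> V N")
        case True
        then obtain i where i: "i < N" "L (K * real (Suc i) / real N) w - L (K * real i / real N) w >= J" by (auto simp: V_def)
        have "ennreal (J\<^sup>2) <= ennreal ((L (K * Suc i / N) w - L (K * i / N) w)\<^sup>2)"
          using i J by (intro ennreal_leI power_mono) auto
        also have "... <= (\<Sum>i<N. ennreal ((L (K * Suc i / N) w - L (K * i / N) w)\<^sup>2))"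
          using i by (intro member_le_sum) auto
        finally show ?thesis using True by simp
      qed simp
    qed
    also have "... <= ennreal (2 * e * occ_const K)"
      using K N0 e KN d by (intro local_time_increments) auto
    finally have "J\<^sup>2 * prob (V N) <= 2 * e * occ_const K"
      using e occ_const_nonneg[of K] by (subst (asm) ennreal_le_iff) auto
    then have "prob (V N) <= 2 * e * occ_const K / J\<^sup>2" using J by (simp add: field_simps)
    moreover have "prob (\<Inter>N\<in>{0<..}. V N) <= prob (V N)" using N0 by (intro finite_measure_mono) auto
    ultimately show ?thesis by simp
  qed
  have "prob (\<Inter>N\<in>{0<..}. V N) <= 0 + y" if y: "y > 0" for y
  proof -
    define q where "q = occ_const K + 1"
    have q: "q > 0" using occ_const_nonneg[of K] by (simp add: q_def)
    \<comment> \<open>Makes the bound equal to \<open>y\<close> times occ_const K / (occ_const K +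
      1), which is at most \<open>y\<close>; the summand 1 avoids division by 0.\<close>
    define e where "e = y * J\<^sup>2 / (2 * q)"
    have "e > 0" using y J q by (simp add: e_def)
    have "2 * e * occ_const K / J\<^sup>2 = y * (occ_const K / q)"
      using J q by (simp add: e_def)
    also have "... = y * (occ_const K / (occ_const K + 1))" by (simp add: q_def)
    also have "... <= y * 1" using y occ_const_nonneg[of K] by (intro mult_left_mono) (auto simp: divide_le_eq_1)
    finally show ?thesis using le[OF \<open>e > 0\<close>] by simp
  qed
  then have "prob (\<Inter>N\<in>{0<..}. V N) <= 0" by (rule field_le_epsilon)
  then have "prob (\<Inter>N\<in>{0<..}. V N) = 0" using measure_nonneg[of M "\<Inter>N\<in>{0<..}. V N"] by linarith
  then have "(\<Inter>N\<in>{0<..}. V N) \<in> null_sets M"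
    by (auto simp: null_sets_def emeasure_eq_measure intro!: sets.countable_INT'')
  then have "AE w in M. w \<notin> (\<Inter>N\<in>{0<..}. V N)" by (rule AE_not_in)
  then show ?thesis using AE_space
    by eventually_elim (auto simp: V_def not_le)
qed

text \<open>Monotonicity upgrades the grid statement: an interval no longer than one mesh is covered
  by at most two cells, so the increment over it is at most twice the grid bound.\<close>

lemma local_time_continuous_AE: "AE w in M. continuous_on {0..} (\<lambda>t. L t w)"
proof -
  have "AE w in M. \<forall>k j. \<exists>N>0. \<forall>i<N. L (real (Suc k) * real (Suc i) / real N) w - L (real (Suc k) * real i / real N) w < 1 / real (Suc j)"
    unfolding AE_all_countable by (intro allI local_time_grid) auto
  then show ?thesis using local_time_mono_AE
  proof eventually_elim
    case (elim w)
    have mono: "L s w <= L t w" if "0 <= s" "s <= t" for s t using elim(2) that by blast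
    have close: "L (s + r) w - L s w <= 2 * J"
      if K: "K > 0" and N: "N > 0" "\<And>i. i < N ==> L (K * real (Suc i) / real N) w - L (K * real i / real N) w < J"
      and s: "0 <= s" "0 <= r" "r <= K / real N" "s + r < K" for K J s r and N :: nat
    proof -
      define i where "i = nat \<lfloor>s * real N / K\<rfloor>"
      have i: "real i <= s * real N / K" "s * real N / K < real i + 1" using s K by (auto simp: i_def)
      have s1: "K * real i / real N <= s" "s < K * real (Suc i) / real N"
        using i K N(1) by (auto simp: field_simps)
      have J: "0 <= J"
        using N(2)[of 0] N(1) mono[of "K * real 0 / real N" "K * real (Suc 0) / real N"] K by (simp add: divide_right_mono)
      have iN: "i < N"
      proof -
        have "s * real N / K < real N" using s K N(1) by (simp add: field_simps)
        then show ?thesis using i by linarith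
      qed
      have "s + r <= K * real (Suc (Suc i)) / real N"
        using s1(2) s(3) N(1) by (simp add: field_simps)
      show ?thesis
      proof (cases "Suc i < N")
        case True
        have "L (s + r) w <= L (K * real (Suc (Suc i)) / real N) w"
          using \<open>s + r <= K * real (Suc (Suc i)) / real N\<close> s by (intro mono) auto
        moreover have "L (K * real i / real N) w <= L s w" using s1 K by (intro mono) auto
        ultimately show ?thesis using N(2)[OF True] N(2)[OF iN] by linarith
      next
        case False
        then have "Suc i = N" using iN by simp
        then have "L (s + r) w <= L (K * real (Suc i) / real N) w"
          using s N(1) K by (intro mono) auto
        moreover have "L (K * real i / real N) w <= L s w" using s1 K by (intro mono) auto
        ultimately show ?thesis using N(2)[OF iN] J by linarith
      qed
    qed
    show ?case
      unfolding continuous_on_iff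
    proof (intro ballI allI impI)
      fix t e :: real assume t: "t \<in> {0..}" and e: "0 < e"
      obtain j where j: "1 / real (Suc j) < e / 2" using e nat_approx_posE[of "e / 2"] by auto
      obtain k :: nat where k: "t + 2 < real k" using reals_Archimedean2 by blast
      define K where "K = real (Suc k)"
      obtain N where N: "N > 0" "\<And>i. i < N ==> L (K * real (Suc i) / real N) w - L (K * real i / real N) w < 1 / real (Suc j)"
        using elim(1) unfolding K_def by blast
      have K0: "K > 0" by (simp add: K_def)
      define d where "d = min 1 (K / real N)"
      have d: "0 < d" using K0 N by (simp add: d_def)
      have "dist (L s w) (L t w) < e" if s: "s \<in> {0..}" "dist s t < d" for s
      proof (cases "s <= t")
        case True
        have "L (s + (t - s)) w - L s w <= 2 * (1 / real (Suc j))"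
          using s True t k by (intro close[OF K0 N]) (auto simp: dist_real_def d_def K_def)
        then show ?thesis using mono[of s t] s True j by (simp add: dist_real_def)
      next
        case False
        have "L (t + (s - t)) w - L t w <= 2 * (1 / real (Suc j))"
          using s False t k by (intro close[OF K0 N]) (auto simp: dist_real_def d_def K_def)
        then show ?thesis using mono[of t s] t False j by (simp add: dist_real_def)
      qed
      then show "\<exists>d>0. \<forall>s\<in>{0..}. dist s t < d --> dist (L s w) (L t w) < e" using d by blast
    qed
  qed
qed

lemma W_avg_tendsto: "(\<lambda>n. W_avg (1 / real (Suc n)) x) \<longlonglongrightarrow> W x"
proof (rule tendsto_sandwich[where f="\<lambda>n. W (x - 1 / real (Suc n))" and h="\<lambda>n. W (x + 1 / real (Suc n))"])
  have l: "(\<lambda>n. 1 / real (Suc n)) \<longlonglongrightarrow> 0" by (rule LIMSEQ_Suc[OF lim_1_over_n])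
  have "(\<lambda>n. W (x - 1 / real (Suc n))) \<longlonglongrightarrow> W (x - 0)" by (intro isCont_tendsto_compose[OF W_isCont] tendsto_diff tendsto_const l)
  then show "(\<lambda>n. W (x - 1 / real (Suc n))) \<longlonglongrightarrow> W x" by simp
  have "(\<lambda>n. W (x + 1 / real (Suc n))) \<longlonglongrightarrow> W (x + 0)" by (intro isCont_tendsto_compose[OF W_isCont] tendsto_add tendsto_const l)
  then show "(\<lambda>n. W (x + 1 / real (Suc n))) \<longlonglongrightarrow> W x" by simp
qed (auto intro!: always_eventually W_avg_ge W_avg_le)

text \<open>Second moments of \<open>occ\<close> are bounded uniformly in the width, so expectations
  over \<open>B\<close> converge along with the almost sure limit.\<close>

lemma local_time_integral_limit:
  assumes t: "0 <= t" and [measurable]: "B \<in> sets M"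
  shows "integrable M (\<lambda>w. indicator B w * L t w)"
    and "(\<lambda>n. \<integral>w. indicator B w * occ (1 / real (Suc n)) t w \<partial>M) \<longlonglongrightarrow> (\<integral>w. indicator B w * L t w \<partial>M)"
proof -
  have [measurable]: "occ (1 / real (Suc n)) t \<in> borel_measurable M" for n by (rule occ_measurable) (use t in auto)
  have [measurable]: "L t \<in> borel_measurable M" using t by (rule local_time_measurable)
  have lim: "AE w in M. (\<lambda>n. indicator B w * occ (1 / real (Suc n)) t w) \<longlonglongrightarrow> indicator B w * L t w"
    using local_time_limit by eventually_elim (use t in \<open>auto intro!: tendsto_mult\<close>)
  have bound: "(\<integral>\<^sup>+w. ennreal ((indicator B w * occ (1 / real (Suc n)) t w)\<^sup>2) \<partial>M) <= ennreal (2 * (occ_const t)\<^sup>2)" for n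
  proof -
    have "(\<integral>\<^sup>+w. ennreal ((indicator B w * occ (1 / real (Suc n)) t w)\<^sup>2) \<partial>M) <= (\<integral>\<^sup>+w. ennreal ((occ (1 / real (Suc n)) t w)\<^sup>2) \<partial>M)"
      by (intro nn_integral_mono ennreal_leI) (auto split: split_indicator)
    also have "... <= ennreal (2 * (occ_const t)\<^sup>2)" by (rule occ_L2_bound) (use t in auto)
    finally show ?thesis .
  qed
  have nonneg: "0 <= indicator B w * occ (1 / real (Suc n)) t w" for n w by (intro mult_nonneg_nonneg occ_nonneg) auto
  have m1: "(\<lambda>w. indicator B w * occ (1 / real (Suc n)) t w) \<in> borel_measurable M" for n by measurable
  have m2: "(\<lambda>w. indicator B w * L t w) \<in> borel_measurable M" by measurable
  note UI = L2_bounded_imp_integral_convergent[where f="\<lambda>n w. indicator B w * occ (1 / real (Suc n)) t w" and g="\<lambda>w. indicator B w * L t w",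
    OF m1 m2 nonneg lim bound]
  show "integrable M (\<lambda>w. indicator B w * L t w)" by (rule UI(2))
  show "(\<lambda>n. \<integral>w. indicator B w * occ (1 / real (Suc n)) t w \<partial>M) \<longlonglongrightarrow> (\<integral>w. indicator B w * L t w \<partial>M)"
    by (rule UI(3))
qed

lemma W_integral_limit:
  assumes t: "0 <= t" and [measurable]: "B \<in> sets M"
  shows "integrable M (\<lambda>w. indicator B w * W (X t w))"
    and "(\<lambda>n. \<integral>w. indicator B w * W_avg (1 / real (Suc n)) (X t w) \<partial>M) \<longlonglongrightarrow> (\<integral>w. indicator B w * W (X t w) \<partial>M)"
proof -
  have [measurable]: "X t \<in> borel_measurable M" using t by (rule borel_measurable_X)
  have i: "integrable M (\<lambda>w. exp 1 / \<psi> 1 * exp (1 * X t w))" by (intro integrable_mult_right integrable_exp_X) (use t in auto)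
  have b: "norm (indicator B w * W_avg (1 / real (Suc n)) (X t w)) <= exp 1 / \<psi> 1 * exp (1 * X t w)" for n w
  proof -
    have "norm (indicator B w * W_avg (1 / real (Suc n)) (X t w)) <= W_avg (1 / real (Suc n)) (X t w)"
      using W_avg_nonneg by (auto split: split_indicator)
    also have "... <= exp (1 / real (Suc n)) / \<psi> 1 * exp (X t w)" by (rule W_avg_le_exp) simp
    also have "... <= exp 1 / \<psi> 1 * exp (X t w)"
      using psi_positive[of 1] by (intro mult_right_mono divide_right_mono) auto
    finally show ?thesis by simp
  qed
  have l: "(\<lambda>n. indicator B w * W_avg (1 / real (Suc n)) (X t w)) \<longlonglongrightarrow> indicator B w * W (X t w)" for w
    by (intro tendsto_mult tendsto_const W_avg_tendsto)
  show "integrable M (\<lambda>w. indicator B w * W (X t w))"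
    by (rule integrable_dominated_convergence[OF _ _ i, where s="\<lambda>n w. indicator B w * W_avg (1 / real (Suc n)) (X t w)"]) (use l b in auto)
  show "(\<lambda>n. \<integral>w. indicator B w * W_avg (1 / real (Suc n)) (X t w) \<partial>M) \<longlonglongrightarrow> (\<integral>w. indicator B w * W (X t w) \<partial>M)"
    by (rule integral_dominated_convergence[OF _ _ i]) (use l b in auto)
qed

lemma local_time_martingale:
  assumes s: "0 <= s" "s <= t" and B: "B \<in> sets (F s)"
  shows "(\<integral>w. indicator B w * (W (X t w) - L t w) \<partial>M) = (\<integral>w. indicator B w * (W (X s w) - L s w) \<partial>M)"
proof -
  have BM: "B \<in> sets M" using B sets_F[OF s(1)] by auto
  have t: "0 <= t" using s by simp
  define a where "a n = 1 / real (Suc n)" for n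
  have a: "0 < a n" for n by (simp add: a_def)
  have split: "(\<integral>w. indicator B w * (W_avg (a n) (X r w) - occ (a n) r w) \<partial>M) =
    (\<integral>w. indicator B w * W_avg (a n) (X r w) \<partial>M) - (\<integral>w. indicator B w * occ (a n) r w \<partial>M)" if r: "0 <= r" for n r
    using integrable_mult_indicator[OF BM W_avg_integrable[OF a r]] integrable_mult_indicator[OF BM occ_integrable[OF a r]]
    by (simp add: right_diff_distrib)
  have lim: "(\<lambda>n. \<integral>w. indicator B w * (W_avg (a n) (X r w) - occ (a n) r w) \<partial>M) \<longlonglongrightarrow> (\<integral>w. indicator B w * (W (X r w) - L r w) \<partial>M)" if r: "0 <= r" for r
  proof -
    have "(\<integral>w. indicator B w * (W (X r w) - L r w) \<partial>M) = (\<integral>w. indicator B w * W (X r w) \<partial>M) - (\<integral>w. indicator B w * L r w \<partial>M)"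
      using local_time_integral_limit(1)[OF r BM] W_integral_limit(1)[OF r BM] by (simp add: right_diff_distrib)
    then show ?thesis unfolding split[OF r]
      using tendsto_diff[OF W_integral_limit(2)[OF r BM] local_time_integral_limit(2)[OF r BM]] by (simp only: a_def)
  qed
  have "(\<lambda>n. \<integral>w. indicator B w * (W_avg (a n) (X t w) - occ (a n) t w) \<partial>M) \<longlonglongrightarrow> (\<integral>w. indicator B w * (W (X s w) - L s w) \<partial>M)"
    using lim[OF s(1)] unfolding occ_martingale[OF a s B] .
  then show ?thesis using lim[OF t] LIMSEQ_unique by blast
qed

text \<open>While |X| >= a, windows narrower than \<open>a\<close> gain no occupation, so the
  approximations at s and t eventually coincide.\<close>

lemma local_time_support_AE:
  "AE w in M. \<forall>s t a. 0 <= s \<and> s <= t \<and> 0 < a \<and> (\<forall>u\<in>{s<..t}. a <= \<bar>X u w\<bar>) --> L s w = L t w"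
  using local_time_limit AE_space
proof eventually_elim
  case (elim w)
  show ?case
  proof (intro allI impI, elim conjE)
    fix s t a :: real assume st: "0 <= s" "s <= t" "0 < a" and far: "\<forall>u\<in>{s<..t}. a <= \<bar>X u w\<bar>"
    obtain n0 where n0: "1 / real (Suc n0) < a" using st(3) nat_approx_posE by blast
    have same: "occ (1 / real (Suc n)) s w = occ (1 / real (Suc n)) t w" if n: "n >= n0" for n
    proof -
      have "1 / real (Suc n) <= 1 / real (Suc n0)" using n by (simp add: frac_le)
      then have lt: "1 / real (Suc n) < a" using n0 by simp
      have "{u\<in>{0..s}. \<bar>X u w\<bar> < 1 / real (Suc n)} = {u\<in>{0..t}. \<bar>X u w\<bar> < 1 / real (Suc n)}"
      proof (safe, goal_cases)
        case (2 u)
        show ?case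
        proof (rule ccontr)
          assume "\<not> u \<in> {0..s}"
          then have "a <= \<bar>X u w\<bar>" using far 2 by auto
          then show False using 2 lt by linarith
        qed
      qed (use st in auto)
      then show ?thesis by (simp only: occ_def)
    qed
    have "(\<lambda>n. occ (1 / real (Suc n)) t w) \<longlonglongrightarrow> L s w"
    proof (rule Lim_transform_eventually)
      show "(\<lambda>n. occ (1 / real (Suc n)) s w) \<longlonglongrightarrow> L s w" using elim(1) st by blast
      show "\<forall>\<^sub>F n in sequentially. occ (1 / real (Suc n)) s w = occ (1 / real (Suc n)) t w"
        unfolding eventually_sequentially by (intro exI[of _ n0] allI impI) (rule same)
    qed
    moreover have "(\<lambda>n. occ (1 / real (Suc n)) t w) \<longlonglongrightarrow> L t w" using elim(1) st by auto
    ultimately show "L s w = L t w" by (rule LIMSEQ_unique)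
  qed
qed

end

end

section \<open>A regular version of the local time\<close>

text \<open>As for \<open>X\<close>, path properties hold for every \<open>w\<close>. Inside this
  locale the local time is known only through these properties, no longer through occupation
  densities.\<close>

locale sn_levy_local_time = sn_levy_scale +
  fixes L :: "real => 'a => real"
  assumes L_adapted: "0 <= t ==> L t \<in> borel_measurable (F t)"
    and L_0: "w \<in> space M ==> L 0 w = 0"
    and L_mono: "w \<in> space M ==> 0 <= s ==> s <= t ==> L s w <= L t w"
    and L_cont: "w \<in> space M ==> continuous_on {0..} (\<lambda>t. L t w)"
    and L_integrable: "0 <= t ==> integrable M (L t)"
    and L_martingale: "mart (\<lambda>t w. W (X t w) - L t w)"
    and L_support: "w \<in> space M ==> 0 <= s ==> s <= t ==> 0 < a ==> (\<And>u. s < u ==> u <= t ==> a <= \<bar>X u w\<bar>) ==> L s w = L t w"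

text \<open>All almost sure properties are collected outside one null set, on which the version is
  put to 0; completeness keeps it adapted.\<close>

lemma (in sn_levy_scale) local_time_version:
  assumes lt: "local_time_at_zero M X L"
  shows "\<exists>L'. sn_levy_local_time M X F W L' \<and> (AE w in M. \<forall>t\<ge>0. L' t w = L t w)"
proof -
  define good where "good w \<longleftrightarrow> (\<forall>t\<ge>0. (\<lambda>n. occ (1 / real (Suc n)) t w) \<longlonglongrightarrow> L t w) \<and> (\<forall>s t. 0 <= s \<and> s <= t --> L s w <= L t w) \<and>
    continuous_on {0..} (\<lambda>t. L t w) \<and> (\<forall>s t a. 0 <= s \<and> s <= t \<and> 0 < a \<and> (\<forall>u\<in>{s<..t}. a <= \<bar>X u w\<bar>) --> L s w = L t w)" for w
  have "AE w in M. good w"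
    using local_time_limit[OF lt] local_time_mono_AE[OF lt] local_time_continuous_AE[OF lt] local_time_support_AE[OF lt]
    unfolding good_def by eventually_elim blast
  then obtain N where good: "\<And>w. w \<in> space M - N ==> good w" and N: "N \<in> null_sets M"
    by (rule AE_E3) blast
  note good = good[unfolded good_def]
  define L' where "L' t w = (if w \<in> N then 0 else L t w)" for t w
  have ae: "AE w in M. \<forall>t. L' t w = L t w"
    using AE_not_in[OF N] by eventually_elim (simp add: L'_def)
  have adapted': "L' t \<in> borel_measurable (F t)" if t: "0 <= t" for t
    using ae by (intro measurable_F_AE_eq[OF t local_time_adapted[OF lt t]]) (auto elim: eventually_mono)
  have L'M: "L' t \<in> borel_measurable M" if t: "0 <= t" for t
    using measurable_F_imp[OF t adapted'[OF t]] .
  have int: "integrable M (L' t)" if t: "0 <= t" for t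
  proof -
    have "integrable M (\<lambda>w. indicator (space M) w * L t w)" by (rule local_time_integral_limit(1)[OF lt t]) simp
    also have "integrable M (\<lambda>w. indicator (space M) w * L t w) \<longleftrightarrow> integrable M (L' t)"
    proof (rule integrable_cong_AE)
      show "AE w in M. indicator (space M) w * L t w = L' t w" using ae AE_space by eventually_elim simp
    qed (use local_time_measurable[OF lt t] L'M[OF t] in auto)
    finally show ?thesis .
  qed
  have Wint: "integrable M (\<lambda>w. W (X t w))" if t: "0 <= t" for t
  proof -
    have "integrable M (\<lambda>w. indicator (space M) w * W (X t w))" by (rule W_integral_limit(1)[OF lt t]) simp
    also have "integrable M (\<lambda>w. indicator (space M) w * W (X t w)) \<longleftrightarrow> integrable M (\<lambda>w. W (X t w))"
      by (rule Bochner_Integration.integrable_cong) auto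
    finally show ?thesis .
  qed
  have "sn_levy_local_time M X F W L'"
  proof (unfold_locales, goal_cases)
    case (1 t) then show ?case by (rule adapted')
  next
    case (2 w)
    show ?case
    proof (cases "w \<in> N")
      case False
      then have "(\<lambda>n. occ (1 / real (Suc n)) 0 w) \<longlonglongrightarrow> L 0 w" using good[of w] 2 by auto
      then show ?thesis using False by (simp add: occ_0 L'_def LIMSEQ_const_iff)
    qed (simp add: L'_def)
  next
    case (3 w s t) then show ?case using good[of w] by (cases "w \<in> N") (auto simp: L'_def)
  next
    case (4 w) then show ?case using good[of w] by (cases "w \<in> N") (auto simp: L'_def)
  next
    case (5 t) then show ?case by (rule int)
  next
    case 6
    show ?case unfolding mart_def
    proof (intro conjI allI impI)
      show "integrable M (\<lambda>w. W (X t w) - L' t w)" if "0 <= t" for t using int[OF that] Wint[OF that] by simp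
      fix s t B assume st: "0 <= s \<and> s <= t \<and> B \<in> sets (F s)"
      have BM[measurable]: "B \<in> sets M" using st sets_F[of s] by auto
      have eq: "(\<integral>w. indicator B w * (W (X r w) - L' r w) \<partial>M) = (\<integral>w. indicator B w * (W (X r w) - L r w) \<partial>M)" if r: "0 <= r" for r
      proof (rule integral_cong_AE)
        have [measurable]: "X r \<in> borel_measurable M" "L' r \<in> borel_measurable M" "L r \<in> borel_measurable M"
          using r borel_measurable_X[OF r] L'M[OF r] local_time_measurable[OF lt r] by auto
        show "(\<lambda>w. indicator B w * (W (X r w) - L' r w)) \<in> borel_measurable M" "(\<lambda>w. indicator B w * (W (X r w) - L r w)) \<in> borel_measurable M"
          by measurable
        show "AE w in M. indicator B w * (W (X r w) - L' r w) = indicator B w * (W (X r w) - L r w)"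
          using ae by eventually_elim simp
      qed
      show "(\<integral>w. indicator B w * (W (X t w) - L' t w) \<partial>M) = (\<integral>w. indicator B w * (W (X s w) - L' s w) \<partial>M)"
        using st local_time_martingale[OF lt, of s t B] by (simp add: eq)
    qed
  next
    case (7 w s t a)
    show ?case
    proof (cases "w \<in> N")
      case False
      then have "L s w = L t w" using good[of w] 7 by (metis Diff_iff greaterThanAtMost_iff)
      then show ?thesis using False by (simp add: L'_def)
    qed (simp add: L'_def)
  qed
  then show ?thesis using ae by (intro exI[of _ L'] conjI) (auto elim: eventually_mono)
qed

section \<open>First passage over a barrier driven by the local time\<close>

context sn_levy_local_time
begin

lemma measurable_M_AE_eq:
  fixes f g :: "'a => real"
  assumes g: "g \<in> borel_measurable M" and ae: "AE w in M. f w = g w"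
  shows "f \<in> borel_measurable M"
proof (rule measurableI)
  interpret cm: complete_measure M by standard (rule complete)
  fix A :: "real set" assume A: "A \<in> sets borel"
  show "f -` A \<inter> space M \<in> sets M"
    by (rule cm.in_sets_AE[OF _ measurable_sets[OF g A]]) (use ae in eventually_elim, auto)
qed simp

lemma L_nonneg: "w \<in> space M ==> 0 <= t ==> 0 <= L t w"
  using L_mono[of w 0 t] L_0[of w] by simp

lemma L_right: "w \<in> space M ==> 0 <= t ==> ((\<lambda>s. L s w) \<longlongrightarrow> L t w) (at_right t)"
  using L_cont[of w] by (auto simp: continuous_on_def intro: tendsto_within_subset)

lemma L_isCont: "w \<in> space M ==> 0 < t ==> isCont (\<lambda>s. L s w) t"
  using continuous_on_interior[OF L_cont[of w], of t] by (simp add: interior_real_atLeast)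

lemma L_left: "w \<in> space M ==> 0 < t ==> ((\<lambda>s. L s w) \<longlongrightarrow> L t w) (at_left t)"
  using L_isCont[of w t] unfolding isCont_def by (rule tendsto_within_subset) auto

lemma optional_stopping_L:
  assumes S: "optional S" and K: "\<And>w. w \<in> space M ==> S w <= K"
  shows "integrable M (\<lambda>w. W (X (S w) w))" "integrable M (\<lambda>w. L (S w) w)"
    "(\<integral>w. W (X (S w) w) \<partial>M) = (\<integral>w. L (S w) w \<partial>M)"
  using optional_stopping_compensated[where V=W and A=L, OF W_cont W_nonneg W_le_exp L_mono L_right L_0 L_integrable L_martingale S K]
  by (auto simp: W_nonpos)

text \<open>With a nonzero left limit, |X| would be at least |l| / 2 just before \<open>h\<close>,
  so the local time would be constant there and, by continuity, up to \<open>h\<close>.\<close>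

lemma left_limit_zero_if_increase:
  assumes w: "w \<in> space M" and h: "0 < h" and inc: "\<And>s. 0 <= s ==> s < h ==> L s w < L h w"
    and l: "((\<lambda>s. X s w) \<longlongrightarrow> l) (at_left h)"
  shows "l = 0"
proof (rule ccontr)
  assume "l \<noteq> 0"
  from tendstoD[OF l, of "\<bar>l\<bar> / 2"] \<open>l \<noteq> 0\<close> obtain a where a: "a < h" "\<And>u. a < u ==> u < h ==> \<bar>X u w - l\<bar> < \<bar>l\<bar> / 2"
    by (auto simp: eventually_at_left_field dist_real_def)
  define s where "s = (max a 0 + h) / 2"
  have s: "0 <= s" "s < h" "a < s" using a h by (auto simp: s_def)
  have const: "L s w = L u w" if "s < u" "u < h" for u
  proof (rule L_support[OF w, where a="\<bar>l\<bar> / 2"])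
    fix v assume "s < v" "v <= u"
    then have "\<bar>X v w - l\<bar> < \<bar>l\<bar> / 2" using that s by (intro a(2)) auto
    then show "\<bar>l\<bar> / 2 <= \<bar>X v w\<bar>" by linarith
  qed (use s that \<open>l \<noteq> 0\<close> in auto)
  have "((\<lambda>u. L u w) \<longlongrightarrow> L s w) (at_left h)"
    by (rule tendsto_eventually) (use const s in \<open>auto simp: eventually_at_left_field intro!: exI[of _ s]\<close>)
  then have "L h w = L s w" using L_left[OF w h] tendsto_unique[of "at_left h"] by (metis trivial_limit_at_left_real)
  then show False using inc[OF s(1,2)] by simp
qed

text \<open>Let \<open>S\<close> be the first time of positive local time, capped at 1. Then L_S =
  0, so W(X_S) has mean 0 and X_S <= 0. As \<psi> 1 > 0, the variable exp (X_S - \<psi> 1 S) is at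
  most 1 and has mean 1, which forces S = 0.\<close>

lemma L_pos: "AE w in M. \<forall>t>0. L t w > 0"
proof -
  define \<zeta> where "\<zeta> w = Inf {ereal t | t. 0 <= t \<and> L t w > 0}" for w
  have Z_less: "{w\<in>space M. \<zeta> w < ereal t} \<in> sets (F (max 0 t))"
    and Z_ge: "ereal 0 <= \<zeta> w"
    and Z_before: "0 <= s ==> ereal s < \<zeta> w ==> L s w <= 0" for t w s
    using hitting_open[where q="0" and D=L and c="0", OF _ L_adapted L_right] unfolding \<zeta>_def by auto
  have Z0: "0 <= \<zeta> w" for w using Z_ge by (simp add: zero_ereal_def)
  define S where "S = cap \<zeta> 1"
  have S: "optional S" unfolding S_def
  proof (rule optional_cap)
    show "{w\<in>space M. \<zeta> w < ereal t} \<in> sets (F t)" if "0 < t" for t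
      using Z_less[of t] that by (simp add: max_def)
  qed (use Z0 in auto)
  have SK: "S w <= 1" for w unfolding S_def using Z0 by (rule cap_le)
  have SZ: "ereal (S w) <= \<zeta> w" for w unfolding S_def by (subst cap_eq[OF Z0]) simp
  have [measurable]: "S \<in> borel_measurable M" using S by (rule optional_measurable)
  have [measurable]: "(\<lambda>w. X (S w) w) \<in> borel_measurable M" using S by (intro measurable_X_at) (auto simp: optional_nonneg)
  have LS: "L (S w) w = 0" if w: "w \<in> space M" for w
  proof (cases "S w = 0")
    case True then show ?thesis using L_0[OF w] by simp
  next
    case False
    then have pos: "0 < S w" using optional_nonneg[OF S w] by simp
    have "\<forall>\<^sub>F s in at_left (S w). L s w <= 0"
      unfolding eventually_at_left_field
    proof (intro exI[of _ 0] conjI allI impI pos)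
      fix s assume "0 < s" "s < S w"
      then have "ereal s < \<zeta> w" using SZ[of w] by (metis less_ereal.simps(1) less_le_trans)
      then show "L s w <= 0" using Z_before \<open>0 < s\<close> by simp
    qed
    then have "L (S w) w <= 0" using L_left[OF w pos] by (intro tendsto_upperbound) auto
    then show ?thesis using L_nonneg[OF w] pos by (simp add: order_antisym)
  qed
  have "(\<integral>w. L (S w) w \<partial>M) = (\<integral>w. 0 \<partial>M)" by (intro Bochner_Integration.integral_cong) (auto simp: LS)
  then have "(\<integral>w. W (X (S w) w) \<partial>M) = 0" using optional_stopping_L(3)[OF S SK] by simp
  then have "AE w in M. W (X (S w) w) = 0"
    using integral_nonneg_eq_0_iff_AE[OF optional_stopping_L(1)[OF S SK]] W_nonneg by auto
  then have neg: "AE w in M. X (S w) w <= 0"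
    by eventually_elim (use W_pos in \<open>force simp: not_le[symmetric]\<close>)
  have i: "integrable M (\<lambda>w. exp (1 * X (S w) w - \<psi> 1 * S w))" "(\<integral>w. exp (1 * X (S w) w - \<psi> 1 * S w) \<partial>M) = 1"
    using optional_stopping_exp[OF _ S SK, of 1] by auto
  have p1: "\<psi> 1 > 0" by (rule psi_positive) simp
  have le1: "AE w in M. 0 <= 1 - exp (1 * X (S w) w - \<psi> 1 * S w)"
    using neg AE_space
  proof eventually_elim
    case (elim w)
    have "0 <= \<psi> 1 * S w" using p1 optional_nonneg[OF S elim(2)] by simp
    then show ?case using elim(1) by simp
  qed
  have "(\<integral>w. 1 - exp (1 * X (S w) w - \<psi> 1 * S w) \<partial>M) = 0" using i by (simp add: prob_space)
  then have "AE w in M. 1 - exp (1 * X (S w) w - \<psi> 1 * S w) = 0"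
    using integral_nonneg_eq_0_iff_AE[OF _ le1] i(1) by auto
  then have "AE w in M. S w = 0"
    using neg AE_space
  proof eventually_elim
    case (elim w)
    then have "X (S w) w - \<psi> 1 * S w = 0" by simp
    then have "\<psi> 1 * S w <= 0" using elim(2) by simp
    then show ?case using p1 optional_nonneg[OF S elim(3)] by (simp add: mult_le_0_iff)
  qed
  then show ?thesis using AE_space
  proof eventually_elim
    case (elim w)
    have "min (\<zeta> w) (ereal 1) = ereal 0" using elim(1) cap_eq[where R=\<zeta> and w=w and K=1, OF Z0] by (simp add: S_def)
    then have z: "\<zeta> w = 0" by (auto simp: min_def zero_ereal_def split: if_splits)
    show ?case
    proof (intro allI impI)
      fix t :: real assume t: "0 < t"
      then have "\<zeta> w < ereal t" by (simp add: z)
      then obtain s where "0 <= s" "s < t" "L s w > 0" unfolding \<zeta>_def Inf_less_iff by auto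
      then show "L t w > 0" using L_mono[OF elim(2), of s t] by simp
    qed
  qed
qed

section \<open>Barriers driven by the local time\<close>

text \<open>Strict positivity is imposed for l > 0 only: the barrier built from \<mu> may start at
  0.\<close>

definition barrier :: "(real => real) => bool" where
  "barrier b \<longleftrightarrow> (\<forall>l l'. 0 <= l \<and> l <= l' --> b l <= b l') \<and> (\<forall>l\<ge>0. (b \<longlongrightarrow> b l) (at_right l)) \<and>
    (\<forall>l>0. 0 < b l) \<and> 0 <= b 0"

definition gap :: "(real => real) => real => 'a => real" where
  "gap b t w = X t w - b (L t w)"

definition passage :: "(real => real) => 'a => ereal" where
  "passage b w = Inf {ereal t | t. 0 < t \<and> b (L t w) <= X t w}"

text \<open>The search starts at a time q > 0, when the local time and hence the barrier are almost
  surely positive; \<open>passage\<close> is recovered through rational q.\<close>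

definition passage_from :: "(real => real) => real => 'a => ereal" where
  "passage_from b q w = Inf {ereal t | t. q <= t \<and> b (L t w) <= X t w}"

context
  fixes b assumes b: "barrier b"
begin

lemma b_mono: "0 <= l ==> l <= l' ==> b l <= b l'" using b by (auto simp: barrier_def)
lemma b_right: "0 <= l ==> (b \<longlongrightarrow> b l) (at_right l)" using b by (auto simp: barrier_def)
lemma b_pos: "0 < l ==> 0 < b l" using b by (auto simp: barrier_def)

lemma b_measurable: "(\<lambda>l. b (max 0 l)) \<in> borel_measurable borel"
  by (rule borel_measurable_mono) (auto intro!: monoI b_mono)

lemma gap_adapted: "0 <= t ==> gap b t \<in> borel_measurable (F t)"
proof -
  assume t: "0 <= t"
  have "(\<lambda>w. X t w - b (max 0 (L t w))) \<in> borel_measurable (F t)"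
    using adapted[OF t] measurable_compose[OF L_adapted[OF t] b_measurable] by simp
  then show ?thesis
    by (rule measurable_cong[THEN iffD1, rotated]) (use t in \<open>simp add: gap_def space_F L_nonneg max_absorb2\<close>)
qed

text \<open>\<open>L\<close> is increasing, so to the right of t it approaches L_t from above, which
  is the side on which \<open>b\<close> is continuous.\<close>

lemma b_L_right: "w \<in> space M ==> 0 <= t ==> ((\<lambda>s. b (L s w)) \<longlongrightarrow> b (L t w)) (at_right t)"
proof (rule tendstoI)
  fix e :: real assume w: "w \<in> space M" and t: "0 <= t" and e: "0 < e"
  from tendstoD[OF b_right[OF L_nonneg[OF w t]] e] obtain a where a: "a > L t w" "\<And>l. L t w < l ==> l < a ==> dist (b l) (b (L t w)) < e"
    by (auto simp: eventually_at_right_field)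
  have "\<forall>\<^sub>F s in at_right t. L s w < a" using order_tendstoD(2)[OF L_right[OF w t] a(1)] .
  moreover have "\<forall>\<^sub>F s in at_right t. t < s" by (rule eventually_at_right_less)
  ultimately show "\<forall>\<^sub>F s in at_right t. dist (b (L s w)) (b (L t w)) < e"
  proof eventually_elim
    case (elim s)
    have "L t w <= L s w" using elim t by (intro L_mono[OF w]) auto
    then show ?case using a(2)[of "L s w"] elim e by (cases "L s w = L t w") auto
  qed
qed

lemma gap_right: "w \<in> space M ==> 0 <= t ==> ((\<lambda>s. gap b s w) \<longlongrightarrow> gap b t w) (at_right t)"
  unfolding gap_def by (intro tendsto_diff right_continuous_X b_L_right)

section \<open>Approximating the passage from below\<close>

text \<open>The condition on the gap is open, so \<open>hitting_open\<close> applies; as the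
  tolerance shrinks these times increase to the candidate \<open>near_sup\<close> for the
  passage.\<close>

definition near :: "real => nat => 'a => ereal" where
  "near q n w = Inf {ereal t | t. q <= t \<and> gap b t w > - (1 / real (Suc n))}"

definition near_sup :: "real => 'a => ereal" where
  "near_sup q w = (SUP n. near q n w)"

lemma
  assumes q: "0 < q"
  shows near_less: "\<And>t. {w\<in>space M. near q n w < ereal t} \<in> sets (F (max 0 t))"
    and near_ge: "\<And>w. ereal q <= near q n w"
    and near_value: "\<And>w h. w \<in> space M ==> near q n w = ereal h ==> - (1 / real (Suc n)) <= gap b h w"
  using hitting_open[where q=q and D="gap b" and c="- (1 / real (Suc n))", OF _ gap_adapted gap_right] q
  unfolding near_def by auto

lemma near_incseq: "incseq (\<lambda>n. near q n w)"
proof (rule incseq_SucI)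
  fix n
  have "1 / real (Suc (Suc n)) <= 1 / real (Suc n)" by (simp add: frac_le)
  then show "near q n w <= near q (Suc n) w" unfolding near_def by (intro Inf_superset_mono) force
qed

lemma near_le_sup: "near q n w <= near_sup q w"
  unfolding near_sup_def by (rule SUP_upper) simp

lemma near_sup_le_passage: "near_sup q w <= passage_from b q w"
  unfolding near_sup_def
proof (rule SUP_least)
  fix n
  have "0 < 1 / real (Suc n)" by simp
  then have "- (1 / real (Suc n)) < gap b t w" if "b (L t w) <= X t w" for t
    using that unfolding gap_def by linarith
  then show "near q n w <= passage_from b q w"
    unfolding near_def passage_from_def by (intro Inf_superset_mono) blast
qed

lemma near_sup_less:
  assumes q: "0 < q" and t: "0 < t"
  shows "{w\<in>space M. near_sup q w < ereal t} \<in> sets (F t)"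
proof -
  have "{w\<in>space M. near_sup q w < ereal t} = (\<Union>r\<in>{r\<in>\<rat>. 0 < r \<and> r < t}. (\<Inter>n. {w\<in>space M. near q n w < ereal r}))"
  proof (safe, goal_cases)
    case (1 w)
    have "ereal q <= near_sup q w" using near_ge[OF q, of 0 w] near_le_sup[of q 0 w] by (rule order_trans)
    then obtain h where h: "near_sup q w = ereal h" "q <= h" using 1 by (cases "near_sup q w") auto
    obtain r where r: "r \<in> \<rat>" "h < r" "r < t" using Rats_dense_in_real[of h t] 1 h by auto
    have "near q n w < ereal r" for n using near_le_sup[of q n w] h r by (metis less_ereal.simps(1) le_less_trans)
    then show ?case using r h q 1 by auto
  next
    case (2 w r) then show ?case by auto
  next
    case (3 w r)
    then have "near_sup q w <= ereal r" unfolding near_sup_def by (intro SUP_least) (auto intro: less_imp_le)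
    then show ?case using 3 by (metis less_ereal.simps(1) le_less_trans)
  qed
  also have "... \<in> sets (F t)"
  proof (rule sets.countable_UN'')
    show "countable {r\<in>\<rat>. 0 < r \<and> r < t}" using countable_rat by (rule countable_subset[rotated]) auto
    fix r assume r: "r \<in> {r\<in>\<rat>. 0 < r \<and> r < t}"
    have "{w\<in>space M. near q n w < ereal r} \<in> sets (F t)" for n
      using near_less[OF q, of n r] r F_mono[of r t] by (auto simp: max_def)
    then show "(\<Inter>n. {w\<in>space M. near q n w < ereal r}) \<in> sets (F t)" by auto
  qed
  finally show ?thesis .
qed

text \<open>Along the increasing times \<open>X\<close> has a limit, which is at least the value at
  the limiting time because jumps are downward. The exponential martingale has mean 1 at all these
  times, so both sides have the same mean and agree almost surely.\<close>

lemma quasi_left_continuity: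
  fixes K :: nat
  assumes q: "0 < q"
  shows "AE w in M. (\<lambda>n. X (cap (near q n) (real K) w) w) \<longlonglongrightarrow> X (cap (near_sup q) (real K) w) w"
proof -
  define s where "s n = cap (near q n) (real K)" for n
  define s' where "s' = cap (near_sup q) (real K)"
  have q0: "0 <= ereal q" using q by (simp add: zero_ereal_def)
  have n0: "0 <= near q n w" for n w using near_ge[OF q, of n w] q0 by (rule order_trans[rotated])
  have sup0: "0 <= near_sup q w" for w using n0[of 0 w] near_le_sup[of q 0 w] by (rule order_trans)
  have s: "optional (s n)" for n unfolding s_def
  proof (rule optional_cap)
    show "{w\<in>space M. near q n w < ereal t} \<in> sets (F t)" if "0 < t" for t
      using near_less[OF q, of n t] that by (simp add: max_def)
  qed (use n0 in auto)
  have s': "optional s'" unfolding s'_def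
    by (rule optional_cap) (use sup0 near_sup_less[OF q] in auto)
  have sK: "s n w <= real K" for n w unfolding s_def using n0 by (rule cap_le)
  have s'K: "s' w <= real K" for w unfolding s'_def using sup0 by (rule cap_le)
  have es: "ereal (s n w) = min (near q n w) (ereal (real K))" for n w unfolding s_def by (rule cap_eq[where R="near q n", OF n0])
  have es': "ereal (s' w) = min (near_sup q w) (ereal (real K))" for w unfolding s'_def by (rule cap_eq[where R="near_sup q", OF sup0])
  have mono: "s m w <= s n w" if "m <= n" for m n w
  proof -
    have "ereal (s m w) <= ereal (s n w)" unfolding es using near_incseq[of q w] that by (intro min.mono) (auto simp: incseq_def)
    then show ?thesis by simp
  qed
  have le': "s n w <= s' w" for n w
  proof -
    have "ereal (s n w) <= ereal (s' w)" unfolding es es' by (intro min.mono near_le_sup) simp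
    then show ?thesis by simp
  qed
  have lim: "(\<lambda>n. s n w) \<longlonglongrightarrow> s' w" for w
  proof -
    have "(\<lambda>n. min (near q n w) (ereal (real K))) \<longlonglongrightarrow> min (near_sup q w) (ereal (real K))"
      unfolding near_sup_def by (intro tendsto_min tendsto_const LIMSEQ_SUP near_incseq)
    then have "(\<lambda>n. ereal (s n w)) \<longlonglongrightarrow> ereal (s' w)" by (simp only: es es')
    then show ?thesis by simp
  qed
  have conv: "\<exists>y. (\<lambda>n. X (s n w) w) \<longlonglongrightarrow> y \<and> X (s' w) w <= y" if w: "w \<in> space M" for w
  proof (cases "\<exists>n. s n w = s' w")
    case True
    then obtain n where n: "s n w = s' w" by blast
    have same: "s m w = s' w" if "m >= n" for m using mono[OF that, of w] le'[of m w] n by simp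
    have "(\<lambda>m. X (s m w) w) \<longlonglongrightarrow> X (s' w) w"
      by (rule tendsto_eventually, unfold eventually_sequentially) (intro exI[of _ n], simp add: same)
    then show ?thesis by blast
  next
    case False
    then have less: "s n w < s' w" for n using le'[of n w] by (simp add: less_le)
    have pos: "0 < s' w" using optional_nonneg[OF s w, of 0] less[of 0] by simp
    obtain l where l: "((\<lambda>s. X s w) \<longlongrightarrow> l) (at_left (s' w))" "X (s' w) w <= l" using left_limit_X[OF w pos] by auto
    have "s n w \<in> {..<s' w} \<and> s n w \<noteq> s' w" for n using less[of n] by simp
    then have "filterlim (\<lambda>n. s n w) (at_left (s' w)) sequentially" unfolding filterlim_at using lim by simp
    then have "(\<lambda>n. X (s n w) w) \<longlonglongrightarrow> l" by (rule filterlim_compose[OF l(1)])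
    then show ?thesis using l(2) by blast
  qed
  define Y where "Y w = lim (\<lambda>n. X (s n w) w)" for w
  have Y: "(\<lambda>n. X (s n w) w) \<longlonglongrightarrow> Y w" "X (s' w) w <= Y w" if "w \<in> space M" for w
    using conv[OF that] by (auto simp: Y_def limI)
  have [measurable]: "s n \<in> borel_measurable M" for n using s by (rule optional_measurable)
  have [measurable]: "s' \<in> borel_measurable M" using s' by (rule optional_measurable)
  have [measurable]: "(\<lambda>w. X (s n w) w) \<in> borel_measurable M" for n using s by (intro measurable_X_at) (auto simp: optional_nonneg)
  have [measurable]: "(\<lambda>w. X (s' w) w) \<in> borel_measurable M" using s' by (intro measurable_X_at) (auto simp: optional_nonneg)
  have [measurable]: "Y \<in> borel_measurable M" by (rule borel_measurable_LIMSEQ_real[OF Y(1)]) auto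
  define f where "f n w = exp (1 * X (s n w) w - \<psi> 1 * s n w)" for n w
  define g where "g w = exp (1 * Y w - \<psi> 1 * s' w)" for w
  define g' where "g' w = exp (1 * X (s' w) w - \<psi> 1 * s' w)" for w
  have fm: "f n \<in> borel_measurable M" for n unfolding f_def[abs_def] by measurable
  have gm: "g \<in> borel_measurable M" unfolding g_def[abs_def] by measurable
  have fl: "AE w in M. (\<lambda>n. f n w) \<longlonglongrightarrow> g w"
    unfolding f_def g_def by (intro AE_I2 tendsto_intros Y lim)
  have f0: "0 <= f n w" for n w by (simp add: f_def)
  have fb: "(\<integral>\<^sup>+w. ennreal ((f n w)\<^sup>2) \<partial>M) <= ennreal (exp (2 * \<bar>\<psi> 1\<bar> * (real K + 1)) * exp (\<bar>\<psi> (2 * 1)\<bar> * (real K + 1)))" for n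
    unfolding f_def by (rule optional_stopping_exp(3)[OF _ s sK]) simp
  note UI = L2_bounded_imp_integral_convergent[OF fm gm f0 fl fb]
  have "(\<integral>w. f n w \<partial>M) = 1" for n unfolding f_def by (rule optional_stopping_exp(2)[OF _ s sK]) simp
  then have g1: "(\<integral>w. g w \<partial>M) = 1" using UI(3) by (simp add: LIMSEQ_const_iff)
  have g': "integrable M g'" "(\<integral>w. g' w \<partial>M) = 1"
    unfolding g'_def using optional_stopping_exp(1,2)[OF _ s' s'K, of 1] by auto
  have nn: "AE w in M. 0 <= g w - g' w" using Y(2) by (intro AE_I2) (simp add: g_def g'_def)
  have "(\<integral>w. g w - g' w \<partial>M) = 0" using UI(2) g' g1 by simp
  then have "AE w in M. g w - g' w = 0"
    using integral_nonneg_eq_0_iff_AE[OF _ nn] UI(2) g'(1) by auto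
  then show ?thesis using AE_space
  proof eventually_elim
    case (elim w)
    then have "Y w = X (s' w) w" by (simp add: g_def g'_def)
    then show ?case using Y(1)[OF elim(2)] by (simp add: s_def s'_def)
  qed
qed

text \<open>Since \<open>b\<close> is only right-continuous, the approximate inequalities could lose
  a jump of \<open>b\<close> in the limit. Either L at \<open>u n\<close> is eventually equal to L
  at \<open>h\<close>, and no limit of \<open>b\<close> is taken; or \<open>L\<close> increases up
  to \<open>h\<close> from the left, so that \<open>X (u n)\<close> tends to 0 although it is at
  least b (L_q) - 1 / (n + 1).\<close>

lemma near_sup_attained:
  assumes q: "0 < q"
  shows "AE w in M. \<forall>h. near_sup q w = ereal h --> 0 <= gap b h w"
proof -
  have "AE w in M. \<forall>K::nat. (\<lambda>n. X (cap (near q n) (real K) w) w) \<longlonglongrightarrow> X (cap (near_sup q) (real K) w) w"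
    unfolding AE_all_countable using quasi_left_continuity[OF q] by blast
  then show ?thesis using L_pos AE_space
  proof eventually_elim
    case (elim w)
    note w = elim(3)
    show ?case
    proof (intro allI impI)
      fix h assume h: "near_sup q w = ereal h"
      obtain K :: nat where K: "h <= real K" using real_arch_simple by blast
      have "\<exists>u. near q n w = ereal u \<and> q <= u \<and> u <= h" for n
        using near_ge[OF q, of n w] near_le_sup[of q n w] h by (cases "near q n w") auto
      then obtain u where u: "\<And>n. near q n w = ereal (u n)" "\<And>n. q <= u n" "\<And>n. u n <= h" by metis
      have hq: "q <= h" using u[of 0] by simp
      have Xlim: "(\<lambda>n. X (u n) w) \<longlonglongrightarrow> X h w"
      proof -
        have "cap (near q n) (real K) w = u n" for n using u(1,3)[of n] K by (intro cap_less) auto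
        moreover have "cap (near_sup q) (real K) w = h" using h K by (intro cap_less) auto
        ultimately show ?thesis using elim(1)[rule_format, of K] by simp
      qed
      have ulim: "u \<longlonglongrightarrow> h"
      proof -
        have "(\<lambda>n. near q n w) \<longlonglongrightarrow> near_sup q w" unfolding near_sup_def by (intro LIMSEQ_SUP near_incseq)
        then show ?thesis by (simp add: u(1) h)
      qed
      have umono: "u m <= u n" if "m <= n" for m n
        using near_incseq[of q w] that by (auto simp: incseq_def u(1))
      have gapu: "b (L (u n) w) - 1 / real (Suc n) <= X (u n) w" for n
        using near_value[OF q w u(1)[of n]] by (simp add: gap_def)
      have zlim: "(\<lambda>n. 1 / real (Suc n)) \<longlonglongrightarrow> 0" by (rule LIMSEQ_Suc[OF lim_1_over_n])
      have stationary_case: "b (L h w) <= X h w" if N: "\<And>n. n >= N ==> L (u n) w = L h w" for N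
      proof (rule LIMSEQ_le)
        show "(\<lambda>n. b (L h w) - 1 / real (Suc n)) \<longlonglongrightarrow> b (L h w)"
          using tendsto_diff[OF tendsto_const zlim, of "b (L h w)"] by simp
        show "\<exists>N. \<forall>n\<ge>N. b (L h w) - 1 / real (Suc n) <= X (u n) w" using gapu N by metis
      qed (rule Xlim)
      have "b (L h w) <= X h w"
      proof (cases "\<exists>s. 0 <= s \<and> s < h \<and> L s w = L h w")
        case True
        then obtain s where s: "0 <= s" "s < h" "L s w = L h w" by blast
        from order_tendstoD(1)[OF ulim s(2)] obtain N where N: "\<And>n. n >= N ==> s < u n" by (auto simp: eventually_sequentially)
        show ?thesis
        proof (rule stationary_case)
          fix n assume "n >= N"
          then have "s <= u n" using N[of n] by simp
          then have "L s w <= L (u n) w" by (rule L_mono[OF w s(1)])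
          moreover have "L (u n) w <= L h w" by (rule L_mono[OF w _ u(3)]) (use u(2)[of n] q in simp)
          ultimately show "L (u n) w = L h w" using s(3) by simp
        qed
      next
        case False
        have inc: "L s w < L h w" if "0 <= s" "s < h" for s
          using False that L_mono[OF w, of s h] by (metis less_eq_real_def)
        show ?thesis
        proof (cases "\<exists>n. u n = h")
          case True
          then obtain N where N: "u N = h" by blast
          show ?thesis by (rule stationary_case[of N]) (use umono u(3) N in \<open>metis order_antisym\<close>)
        next
          case nh: False
          then have less: "u n < h" for n using u(3)[of n] by (simp add: less_le)
          obtain l where l: "((\<lambda>s. X s w) \<longlongrightarrow> l) (at_left h)" using left_limit_X[OF w, of h] hq q by auto
          have "u n \<in> {..<h} \<and> u n \<noteq> h" for n using less[of n] by simp
          then have "filterlim u (at_left h) sequentially" unfolding filterlim_at using ulim by simp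
          then have "(\<lambda>n. X (u n) w) \<longlonglongrightarrow> l" by (rule filterlim_compose[OF l])
          moreover have "l = 0" by (rule left_limit_zero_if_increase[OF w _ inc l]) (use hq q in auto)
          ultimately have X0: "(\<lambda>n. X (u n) w) \<longlonglongrightarrow> 0" by simp
          \<comment> \<open>This contradicts the positivity of the barrier from time q > 0
            on.\<close>
          have "b (L q w) <= 0"
          proof (rule LIMSEQ_le)
            show "(\<lambda>n. b (L q w) - 1 / real (Suc n)) \<longlonglongrightarrow> b (L q w)"
              using tendsto_diff[OF tendsto_const zlim, of "b (L q w)"] by simp
            have "b (L q w) <= b (L (u n) w)" for n
              using u(2)[of n] q by (intro b_mono L_nonneg[OF w] L_mono[OF w]) auto
            then show "\<exists>N. \<forall>n\<ge>N. b (L q w) - 1 / real (Suc n) <= X (u n) w" using gapu by (meson diff_right_mono order_trans)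
          qed (rule X0)
          moreover have "0 < b (L q w)" using elim(2) q by (intro b_pos) auto
          ultimately show ?thesis by simp
        qed
      qed
      then show "0 <= gap b h w" by (simp add: gap_def)
    qed
  qed
qed

lemma passage_from_eq_near_sup:
  assumes q: "0 < q"
  shows "AE w in M. passage_from b q w = near_sup q w \<and> (\<forall>h. passage_from b q w = ereal h --> b (L h w) <= X h w)"
  using near_sup_attained[OF q]
proof eventually_elim
  case (elim w)
  have ge: "ereal q <= near_sup q w" using near_ge[OF q, of 0 w] near_le_sup[of q 0 w] by (rule order_trans)
  have "passage_from b q w <= near_sup q w"
  proof (cases "near_sup q w")
    case (real h)
    then have "b (L h w) <= X h w" "q <= h" using elim ge by (auto simp: gap_def)
    then show ?thesis unfolding real passage_from_def by (intro Inf_lower) auto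
  qed (use ge in auto)
  then have eq: "passage_from b q w = near_sup q w" using near_sup_le_passage by (rule order_antisym)
  then show ?case using elim by (auto simp: gap_def)
qed

text \<open>Up to a null set the event says that all \<open>near\<close> times lie strictly before
  \<open>t\<close>, or that the barrier is met at \<open>t\<close> itself: if some
  \<open>near\<close> time is at least \<open>t\<close>, then \<open>near_sup\<close> equals
  \<open>t\<close> and is attained. Both alternatives are decided by \<open>F t\<close>.\<close>

lemma passage_from_le_sets:
  assumes q: "0 < q" "q <= t"
  shows "{w\<in>space M. passage_from b q w <= ereal t} \<in> sets (F t)"
proof (rule sets_F_AE_eq)
  show "(\<Inter>n. {w\<in>space M. near q n w < ereal t}) \<union> {w\<in>space (F t). 0 <= gap b t w} \<in> sets (F t)"
  proof (rule sets.Un)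
    have "{w\<in>space M. near q n w < ereal t} \<in> sets (F t)" for n
      using near_less[OF q(1), of n t] q by (simp add: max_def)
    then show "(\<Inter>n. {w\<in>space M. near q n w < ereal t}) \<in> sets (F t)" by auto
    have "0 <= t" using q by simp
    note [measurable] = gap_adapted[OF this]
    show "{w\<in>space (F t). 0 <= gap b t w} \<in> sets (F t)" by measurable
  qed
  show "AE w in M. w \<in> {w\<in>space M. passage_from b q w <= ereal t} \<longleftrightarrow>
    w \<in> (\<Inter>n. {w\<in>space M. near q n w < ereal t}) \<union> {w\<in>space (F t). 0 <= gap b t w}"
    using passage_from_eq_near_sup[OF q(1)] near_sup_attained[OF q(1)] AE_space
  proof eventually_elim
    case (elim w)
    have "passage_from b q w <= ereal t \<longleftrightarrow> (\<forall>n. near q n w < ereal t) \<or> 0 <= gap b t w"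
    proof
      assume le: "passage_from b q w <= ereal t"
      show "(\<forall>n. near q n w < ereal t) \<or> 0 <= gap b t w"
      proof (cases "\<forall>n. near q n w < ereal t")
        case False
        then obtain n where "ereal t <= near q n w" by (auto simp: not_less)
        then have "near_sup q w = ereal t"
          using near_le_sup[of q n w] le elim(1) by (metis order_antisym order_trans)
        then show ?thesis using elim(2) by auto
      qed simp
    next
      assume "(\<forall>n. near q n w < ereal t) \<or> 0 <= gap b t w"
      then show "passage_from b q w <= ereal t"
      proof
        assume "\<forall>n. near q n w < ereal t"
        then have "near_sup q w <= ereal t" unfolding near_sup_def by (intro SUP_least) (auto intro: less_imp_le)
        then show ?thesis using elim(1) by simp
      next
        assume "0 <= gap b t w"
        then show ?thesis unfolding passage_from_def using q by (intro Inf_lower) (auto simp: gap_def)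
      qed
    qed
    then show ?case using elim(3) by (auto simp: space_F)
  qed
qed (use q in auto)

section \<open>The passage time searched from time 0\<close>

lemma passage_nonneg: "0 <= passage b w"
  unfolding passage_def by (rule Inf_greatest) (auto simp: zero_ereal_def[symmetric])

lemma passage_before: "0 < t ==> ereal t < passage b w ==> X t w < b (L t w)"
  unfolding passage_def by (metis (mono_tags, lifting) Inf_lower linorder_not_le mem_Collect_eq)

lemma passage_le_passage_from: "0 < q ==> passage b w <= passage_from b q w"
  unfolding passage_def passage_from_def by (rule Inf_superset_mono) auto

lemma passage_from_eq:
  assumes q: "0 < q" "ereal q <= passage b w"
  shows "passage_from b q w = passage b w"
proof (rule antisym[OF _ passage_le_passage_from[OF q(1)]])
  show "passage_from b q w <= passage b w"
    unfolding passage_def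
  proof (rule Inf_greatest, safe)
    fix t assume t: "0 < t" "b (L t w) <= X t w"
    then have "passage b w <= ereal t" unfolding passage_def by (intro Inf_lower) auto
    then have "q <= t" using q(2) by (metis ereal_less_eq(3) order_trans)
    then show "passage_from b q w <= ereal t" unfolding passage_from_def using t by (intro Inf_lower) auto
  qed
qed

text \<open>If the passage time is 0, some crossing lies before \<open>t\<close> and after a
  rational q; otherwise every rational q before the passage time yields the same passage.\<close>

lemma passage_le_iff:
  assumes t: "0 < t"
  shows "passage b w <= ereal t \<longleftrightarrow> (\<exists>q\<in>\<rat>. 0 < q \<and> q < t \<and> passage_from b q w <= ereal t)"
proof
  assume le: "passage b w <= ereal t"
  then obtain h where h: "passage b w = ereal h" "0 <= h" "h <= t"
    using passage_nonneg[of w] by (cases "passage b w") auto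
  show "\<exists>q\<in>\<rat>. 0 < q \<and> q < t \<and> passage_from b q w <= ereal t"
  proof (cases "h = 0")
    case True
    then have "passage b w < ereal t" using h t by simp
    then obtain s where s: "0 < s" "s < t" "b (L s w) <= X s w" unfolding passage_def Inf_less_iff by auto
    obtain q where q: "q \<in> \<rat>" "0 < q" "q < s" using Rats_dense_in_real[OF s(1)] by auto
    have "passage_from b q w <= ereal s" unfolding passage_from_def using q s by (intro Inf_lower) auto
    also have "... <= ereal t" using s by simp
    finally show ?thesis using q s by auto
  next
    case False
    then obtain q where q: "q \<in> \<rat>" "0 < q" "q < h" using Rats_dense_in_real[of 0 h] h by auto
    then show ?thesis using passage_from_eq[of q w] h le by auto
  qed
next
  assume "\<exists>q\<in>\<rat>. 0 < q \<and> q < t \<and> passage_from b q w <= ereal t"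
  then show "passage b w <= ereal t" using passage_le_passage_from order_trans by blast
qed

lemma passage_le_sets:
  assumes t: "0 < t" shows "{w\<in>space M. passage b w <= ereal t} \<in> sets (F t)"
proof -
  have "{w\<in>space M. passage b w <= ereal t} = (\<Union>q\<in>{q\<in>\<rat>. 0 < q \<and> q < t}. {w\<in>space M. passage_from b q w <= ereal t})"
    by (auto simp: passage_le_iff[OF t])
  also have "... \<in> sets (F t)"
  proof (rule sets.countable_UN'')
    show "countable {q\<in>\<rat>. 0 < q \<and> q < t}" using countable_rat by (rule countable_subset[rotated]) auto
  qed (auto intro!: passage_from_le_sets)
  finally show ?thesis .
qed

lemma passage_less_sets:
  assumes t: "0 < t" shows "{w\<in>space M. passage b w < ereal t} \<in> sets (F t)"
proof -
  have "{w\<in>space M. passage b w < ereal t} = (\<Union>q\<in>{q\<in>\<rat>. 0 < q \<and> q < t}. {w\<in>space M. passage b w <= ereal q})"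
  proof (safe, goal_cases)
    case (1 w)
    then obtain h where h: "passage b w = ereal h" "0 <= h" "h < t"
      using passage_nonneg[of w] by (cases "passage b w") auto
    then obtain q where "q \<in> \<rat>" "h < q" "q < t" using Rats_dense_in_real[of h t] by auto
    then show ?case using 1 h by auto
  next
    case (2 w q) then show ?case by (metis le_less_trans less_ereal.simps(1))
  qed
  also have "... \<in> sets (F t)"
  proof (rule sets.countable_UN'')
    show "countable {q\<in>\<rat>. 0 < q \<and> q < t}" using countable_rat by (rule countable_subset[rotated]) auto
    fix q assume q: "q \<in> {q\<in>\<rat>. 0 < q \<and> q < t}"
    then show "{w\<in>space M. passage b w <= ereal q} \<in> sets (F t)"
      using passage_le_sets[of q] F_mono[of q t] by auto
  qed
  finally show ?thesis .
qed

text \<open>The barrier is reached because \<open>near_sup\<close> attains it. It is not exceeded: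
  before \<open>h\<close> the path lies below b (L_s) <= b (L_h), and there is no upward jump at
  \<open>h\<close>.\<close>

lemma passage_value: "AE w in M. \<forall>h. passage b w = ereal h --> 0 < h --> X h w = b (L h w)"
proof -
  have "AE w in M. \<forall>q\<in>{q\<in>\<rat>. 0 < q}. passage_from b q w = near_sup q w \<and> (\<forall>h. passage_from b q w = ereal h --> b (L h w) <= X h w)"
  proof (subst AE_ball_countable)
    show "countable {q::real. q\<in>\<rat> \<and> 0 < q}" using countable_rat by (rule countable_subset[rotated]) auto
  qed (use passage_from_eq_near_sup in auto)
  then show ?thesis using AE_space
  proof eventually_elim
    case (elim w)
    show ?case
    proof (intro allI impI)
      fix h assume h: "passage b w = ereal h" "0 < h"
      obtain q where q: "q \<in> \<rat>" "0 < q" "q < h" using Rats_dense_in_real[OF h(2)] by auto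
      then have "passage_from b q w = ereal h" using passage_from_eq[of q w] h by simp
      then have ge: "b (L h w) <= X h w" using elim(1) q by auto
      have "X h w <= b (L h w)"
      proof (rule X_le_at_left[OF elim(2) h(2), of "h / 2"])
        fix s assume s: "h / 2 <= s" "s < h"
        then have "X s w < b (L s w)" using h by (intro passage_before) auto
        also have "... <= b (L h w)" using s h by (intro b_mono L_nonneg[OF elim(2)] L_mono[OF elim(2)]) auto
        finally show "X s w <= b (L h w)" by simp
      qed (use h in simp)
      with ge show "X h w = b (L h w)" by simp
    qed
  qed
qed

end

end

section \<open>The law of the local time at first passage\<close>

text \<open>On n equal pieces the differences of \<open>c\<close> telescope against the step length
  and the quadratic terms add up to order 1 / n, so the total error K / n vanishes.\<close>

lemma telescoping_increase:
  fixes \<Phi> c :: "real => real"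
  assumes sr: "s < r" and step: "\<And>u v. s <= u ==> u < v ==> v <= r ==> \<Phi> u - \<Phi> v <= E * ((v - u) * (c u - c v) + (v - u)\<^sup>2 * k)"
  shows "\<Phi> s <= \<Phi> r"
proof -
  define K where "K = E * ((r - s) * (c s - c r) + (r - s)\<^sup>2 * k)"
  have le: "\<Phi> s - \<Phi> r <= K / real n" if n: "n > 0" for n :: nat
  proof -
    define h where "h = (r - s) / real n"
    have h: "h > 0" using sr n by (simp add: h_def)
    define x where "x i = s + real i * h" for i
    have x0: "x 0 = s" and xn: "x n = r" using n by (auto simp: x_def h_def)
    have xd: "x (Suc i) - x i = h" for i by (simp add: x_def algebra_simps)
    have xle: "x (Suc i) <= r" if "i < n" for i
    proof -
      have "real (Suc i) * h <= real n * h" using that h by (intro mult_right_mono) auto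
      then show ?thesis using n by (simp add: x_def h_def)
    qed
    have "\<Phi> s - \<Phi> r = - (\<Sum>i<n. \<Phi> (x (Suc i)) - \<Phi> (x i))"
      using sum_lessThan_telescope[of "\<lambda>i. \<Phi> (x i)" n] by (simp add: x0 xn)
    also have "... = (\<Sum>i<n. \<Phi> (x i) - \<Phi> (x (Suc i)))" by (simp add: sum_negf[symmetric])
    also have "... <= (\<Sum>i<n. E * (h * (c (x i) - c (x (Suc i))) + h\<^sup>2 * k))"
    proof (rule sum_mono)
      fix i assume i: "i \<in> {..<n}"
      have "s <= x i" using h by (simp add: x_def)
      then show "\<Phi> (x i) - \<Phi> (x (Suc i)) <= E * (h * (c (x i) - c (x (Suc i))) + h\<^sup>2 * k)"
        using step[of "x i" "x (Suc i)"] xd[of i] xle[of i] i h by simp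
    qed
    also have "... = E * (h * (\<Sum>i<n. c (x i) - c (x (Suc i))) + real n * (h\<^sup>2 * k))"
      by (simp add: sum_distrib_left[symmetric] sum.distrib)
    also have "(\<Sum>i<n. c (x i) - c (x (Suc i))) = c s - c r"
      using sum_lessThan_telescope'[of "\<lambda>i. c (x i)" n] by (simp add: x0 xn)
    also have "E * (h * (c s - c r) + real n * (h\<^sup>2 * k)) = K / real n"
      using n by (simp add: h_def K_def power2_eq_square field_simps)
    finally show ?thesis .
  qed
  have "(\<lambda>n. K * (1 / real n)) \<longlonglongrightarrow> K * 0" by (intro tendsto_mult tendsto_const lim_1_over_n)
  then have "\<Phi> s - \<Phi> r <= K * 0"
    by (rule LIMSEQ_le_const) (use le in \<open>auto intro!: exI[of _ 1]\<close>)
  then show ?thesis by simp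
qed

text \<open>The product (1 - h c)(1 + h c') falls short of 1 by at most h (c - c') + h^2 d^2. This
  turns a multiplicative one-step estimate into the additive form that
  \<open>telescoping_increase\<close> takes.\<close>

lemma exponential_step:
  fixes x y h :: real
  assumes x: "0 <= x" "x <= 1" "0 <= y" and le: "cx <= C" and c: "0 <= c'" "c' <= c" "c <= d" and h: "0 < h"
    and prod: "0 <= 1 - h * c ==> x * ((1 - h * c) * (1 + h * c')) <= y * exp (cy - cx)"
  shows "x * exp cx - y * exp cy <= exp C * (h * (c - c') + h\<^sup>2 * d\<^sup>2)"
proof -
  define q where "q = h * (c - c') + h\<^sup>2 * d\<^sup>2"
  have q: "0 <= q" using h c by (simp add: q_def)
  have "x * ((1 - h * c) * (1 + h * c')) <= y * exp (cy - cx)"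
  \<comment> \<open>The step may be long compared with 1 / c; then the product is nonpositive and
    the bound is immediate, so \<open>prod\<close> is assumed for the other case alone.\<close>
  proof (cases "0 <= 1 - h * c")
    case False
    then have "(1 - h * c) * (1 + h * c') <= 0" using h c by (intro mult_nonpos_nonneg) auto
    then have "x * ((1 - h * c) * (1 + h * c')) <= 0" using x by (simp add: mult_nonneg_nonpos)
    also have "0 <= y * exp (cy - cx)" using x by simp
    finally show ?thesis .
  qed (rule prod)
  moreover have "1 - q <= (1 - h * c) * (1 + h * c')"
  proof -
    have "c * c' <= d * d" using c by (intro mult_mono) auto
    then have "h\<^sup>2 * (c * c') <= h\<^sup>2 * (d * d)" by (intro mult_left_mono) auto
    then show ?thesis by (simp add: q_def algebra_simps power2_eq_square)
  qed
  from mult_left_mono[OF this x(1)] have "x * (1 - q) <= x * ((1 - h * c) * (1 + h * c'))" .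
  ultimately have "exp cx * (x * (1 - q)) <= exp cx * (y * exp (cy - cx))" by (intro mult_left_mono) auto
  then have "x * exp cx - y * exp cy <= (exp cx * x) * q" by (simp add: exp_diff algebra_simps)
  also have "... <= exp C * q"
  proof (rule mult_right_mono[OF _ q])
    have "exp cx * x <= exp C * 1" using le x by (intro mult_mono) auto
    then show "exp cx * x <= exp C" by simp
  qed
  finally show ?thesis by (simp add: q_def)
qed

text \<open>\<open>C\<close> is the integral from 0 of the decreasing rate \<open>c\<close>, encoded
  by rectangle bounds. The rate may be unbounded at 0, and the limit of \<open>C\<close> there
  expresses its integrability.\<close>

definition hazard :: "(real => real) => (real => real) => bool" where
  "hazard c C \<longleftrightarrow> (\<forall>s>0. 0 <= c s) \<and> (\<forall>s r. 0 < s \<and> s <= r --> c r <= c s) \<and>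
    (\<forall>s r. 0 < s \<and> s < r --> (r - s) * c r <= C r - C s \<and> C r - C s <= (r - s) * c s) \<and> (C \<longlongrightarrow> 0) (at_right 0)"

context
  fixes c C G :: "real => real" and R :: real
  assumes hz: "hazard c C"
    and G01: "\<And>s. 0 < s ==> s <= R ==> 0 <= G s \<and> G s <= 1"
    and G_lim: "(G \<longlongrightarrow> 1) (at_right 0)"
begin

lemma hazard_C_mono: "0 < s ==> s <= r ==> C s <= C r"
proof (cases "s = r")
  case False
  assume s: "0 < s" "s <= r"
  then have "0 <= (r - s) * c r" using hz by (auto simp: hazard_def)
  moreover have "(r - s) * c r <= C r - C s" using hz s False by (auto simp: hazard_def)
  ultimately show ?thesis by linarith
qed simp

lemma weighted_limit: "((\<lambda>s. G s * exp (C s)) \<longlongrightarrow> 1 * exp 0) (at_right 0)"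
  using hz by (intro tendsto_mult tendsto_exp G_lim) (auto simp: hazard_def)

text \<open>G exp(C) is nondecreasing and tends to 1 at 0. The one-step estimate combines the bound
  on \<open>G\<close> with 1 + x <= exp x applied to the increment of \<open>C\<close>.\<close>

lemma exp_le_survival:
  assumes dec: "\<And>s r. 0 < s ==> s < r ==> r <= R ==> G s - G r <= (r - s) * c s * G s" and r: "0 < r" "r <= R"
  shows "exp (- C r) <= G r"
proof -
  have "G s * exp (C s) <= G r * exp (C r)" if s: "0 < s" "s < r" for s
  proof (rule telescoping_increase[OF s(2), where E="exp (C r)" and c=c and k="(c s)\<^sup>2"])
    fix u v assume uv: "s <= u" "u < v" "v <= r"
    have u0: "0 < u" using uv s by simp
    have cu: "0 <= c v" "c v <= c u" "c u <= c s" using hz uv u0 s by (auto simp: hazard_def)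
    have Gu: "0 <= G u" "G u <= 1" "0 <= G v" using G01[of u] G01[of v] uv u0 r by auto
    show "G u * exp (C u) - G v * exp (C v) <= exp (C r) * ((v - u) * (c u - c v) + (v - u)\<^sup>2 * (c s)\<^sup>2)"
    proof (rule exponential_step[OF Gu _ cu])
      assume 1: "0 <= 1 - (v - u) * c u"
      have "(v - u) * c v <= C v - C u" using hz uv u0 by (auto simp: hazard_def)
      then have "1 + (v - u) * c v <= exp (C v - C u)" using exp_ge_add_one_self[of "C v - C u"] by linarith
      moreover have "G u * (1 - (v - u) * c u) <= G v" using dec[of u v] uv u0 r by (simp add: algebra_simps)
      ultimately have "(G u * (1 - (v - u) * c u)) * (1 + (v - u) * c v) <= G v * exp (C v - C u)"
        using Gu cu uv by (intro mult_mono) auto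
      then show "G u * ((1 - (v - u) * c u) * (1 + (v - u) * c v)) <= G v * exp (C v - C u)" by (simp add: mult.assoc)
    qed (use uv hazard_C_mono[OF u0, of r] in auto)
  qed
  then have "\<forall>\<^sub>F s in at_right 0. G s * exp (C s) <= G r * exp (C r)"
    unfolding eventually_at_right_field using r by (intro exI[of _ r]) auto
  then have "1 * exp 0 <= G r * exp (C r)" using weighted_limit by (intro tendsto_upperbound[where F="at_right (0::real)"]) auto
  then show ?thesis by (simp add: exp_minus field_simps)
qed

text \<open>The mirror image, with G exp(C) nonincreasing. The two bounds are kept apart because
  \<open>passage_pos\<close> compares raised barriers with the original rate from one side
  only.\<close>

lemma survival_le_exp:
  assumes inc: "\<And>s r. 0 < s ==> s < r ==> r <= R ==> (r - s) * c r * G r <= G s - G r" and r: "0 < r" "r <= R"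
  shows "G r <= exp (- C r)"
proof -
  have "- (G s * exp (C s)) <= - (G r * exp (C r))" if s: "0 < s" "s < r" for s
  proof (rule telescoping_increase[OF s(2), where E="exp (C r)" and c=c and k="(c s)\<^sup>2"])
    fix u v assume uv: "s <= u" "u < v" "v <= r"
    have u0: "0 < u" "0 < v" using uv s by auto
    have cu: "0 <= c v" "c v <= c u" "c u <= c s" using hz uv u0 s by (auto simp: hazard_def)
    have Gu: "0 <= G v" "G v <= 1" "0 <= G u" using G01[of u] G01[of v] uv u0 r by auto
    have "G v * exp (C v) - G u * exp (C u) <= exp (C r) * ((v - u) * (c u - c v) + (v - u)\<^sup>2 * (c s)\<^sup>2)"
    proof (rule exponential_step[OF Gu _ cu])
      assume 1: "0 <= 1 - (v - u) * c u"
      have "C v - C u <= (v - u) * c u" using hz uv u0 by (auto simp: hazard_def)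
      then have "1 - (v - u) * c u <= exp (C u - C v)" using exp_ge_add_one_self[of "C u - C v"] by linarith
      moreover have "G v * (1 + (v - u) * c v) <= G u" using inc[of u v] uv u0 r by (simp add: algebra_simps)
      ultimately have "(G v * (1 + (v - u) * c v)) * (1 - (v - u) * c u) <= G u * exp (C u - C v)"
        using Gu 1 by (intro mult_mono) auto
      then show "G v * ((1 - (v - u) * c u) * (1 + (v - u) * c v)) <= G u * exp (C u - C v)" by (simp add: mult_ac)
    qed (use uv hazard_C_mono[OF u0(2), of r] in auto)
    then show "- (G u * exp (C u)) - - (G v * exp (C v)) <= exp (C r) * ((v - u) * (c u - c v) + (v - u)\<^sup>2 * (c s)\<^sup>2)" by simp
  qed
  then have "\<forall>\<^sub>F s in at_right 0. G r * exp (C r) <= G s * exp (C s)"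
    unfolding eventually_at_right_field using r by (intro exI[of _ r]) auto
  then have "G r * exp (C r) <= 1 * exp 0" using weighted_limit by (intro tendsto_lowerbound[where F="at_right (0::real)"]) auto
  then show ?thesis by (simp add: exp_minus field_simps)
qed

end

context sn_levy_local_time
begin

section \<open>Inverse local time and the combined stopping time\<close>

text \<open>The first time at which \<open>L\<close> reaches \<open>r\<close>, not exceeds it: all
  earlier times have smaller local time, so it is a point of increase from the left.\<close>

definition inv_L :: "real => 'a => ereal" where
  "inv_L r w = Inf {ereal t | t. 0 <= t \<and> r <= L t w}"

lemma inv_L_nonneg: "0 <= inv_L r w"
  unfolding inv_L_def by (rule Inf_greatest) (auto simp: zero_ereal_def[symmetric])

lemma inv_L_before: "0 <= t ==> ereal t < inv_L r w ==> L t w < r"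
  unfolding inv_L_def by (metis (mono_tags, lifting) Inf_lower linorder_not_le mem_Collect_eq)

lemma inv_L_less_iff: "inv_L r w < ereal t \<longleftrightarrow> (\<exists>s. 0 <= s \<and> s < t \<and> r <= L s w)"
  unfolding inv_L_def Inf_less_iff by auto

lemma inv_L_mono: "r <= r' ==> inv_L r w <= inv_L r' w"
  unfolding inv_L_def by (rule Inf_superset_mono) auto

lemma inv_L_value:
  assumes w: "w \<in> space M" and r: "0 < r" and h: "inv_L r w = ereal h"
  shows "0 < h" "L h w = r"
proof -
  have h0: "0 <= h" using inv_L_nonneg[of r w] h by simp
  have "\<forall>\<^sub>F t in at_right h. r <= L t w"
  proof (rule eventually_mono[OF eventually_at_right_less])
    fix t assume "h < t"
    then have "inv_L r w < ereal t" using h by simp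
    then obtain s where "0 <= s" "s < t" "r <= L s w" by (auto simp: inv_L_less_iff)
    then show "r <= L t w" using L_mono[OF w, of s t] by simp
  qed
  then have ge: "r <= L h w" using L_right[OF w h0] by (intro tendsto_lowerbound) auto
  then show pos: "0 < h" using h0 L_0[OF w] r by (cases "h = 0") auto
  have "\<forall>\<^sub>F t in at_left h. L t w <= r"
    unfolding eventually_at_left_field
  proof (intro exI[of _ 0] conjI allI impI pos)
    fix t assume "0 < t" "t < h"
    then show "L t w <= r" using inv_L_before[of t r w] h by auto
  qed
  then have "L h w <= r" using L_left[OF w pos] by (intro tendsto_upperbound) auto
  with ge show "L h w = r" by simp
qed

text \<open>At a point of increase from the left the left limit of \<open>X\<close> is 0, and a jump
  can only go down. Hence \<open>W(X)\<close> vanishes at inverse local times.\<close>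

lemma inv_L_X:
  assumes w: "w \<in> space M" and r: "0 < r" and h: "inv_L r w = ereal h"
  shows "X h w <= 0"
proof -
  note v = inv_L_value[OF assms]
  obtain l where l: "((\<lambda>s. X s w) \<longlongrightarrow> l) (at_left h)" "X h w <= l" using left_limit_X[OF w v(1)] by auto
  have "l = 0"
    by (rule left_limit_zero_if_increase[OF w v(1) _ l(1)]) (use inv_L_before[of _ r w] h v(2) in auto)
  then show ?thesis using l(2) by simp
qed

lemma inv_L_less_sets:
  assumes t: "0 < t" shows "{w\<in>space M. inv_L r w < ereal t} \<in> sets (F t)"
proof -
  have "{w\<in>space M. inv_L r w < ereal t} = (\<Union>q\<in>{q\<in>\<rat>. 0 <= q \<and> q < t}. {w\<in>space (F t). r <= L q w})"
  proof (safe, goal_cases)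
    case (1 w)
    then obtain s where s: "0 <= s" "s < t" "r <= L s w" by (auto simp: inv_L_less_iff)
    obtain q where q: "q \<in> \<rat>" "s < q" "q < t" using Rats_dense_in_real[OF s(2)] by auto
    then show ?case using s L_mono[OF 1(1), of s q] 1 by (auto simp: space_F)
  qed (auto simp: space_F inv_L_less_iff)
  also have "... \<in> sets (F t)"
  proof (rule sets.countable_UN'')
    show "countable {q\<in>\<rat>. 0 <= q \<and> q < t}" using countable_rat by (rule countable_subset[rotated]) auto
    fix q assume q: "q \<in> {q\<in>\<rat>. 0 <= q \<and> q < t}"
    then have [measurable]: "L q \<in> borel_measurable (F t)" by (intro measurable_F_mono[OF _ _ L_adapted]) auto
    show "{w\<in>space (F t). r <= L q w} \<in> sets (F t)" by measurable
  qed
  finally show ?thesis .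
qed

context
  fixes b assumes b: "barrier b"
begin

definition stop :: "real => 'a => ereal" where
  "stop r w = min (passage b w) (inv_L r w)"

lemma stop_nonneg: "0 <= stop r w"
  unfolding stop_def using passage_nonneg[OF b] inv_L_nonneg by simp

lemma stop_less_sets: "0 < t ==> {w\<in>space M. stop r w < ereal t} \<in> sets (F t)"
proof -
  assume t: "0 < t"
  have "{w\<in>space M. stop r w < ereal t} = {w\<in>space M. passage b w < ereal t} \<union> {w\<in>space M. inv_L r w < ereal t}"
    by (auto simp: stop_def min_less_iff_disj)
  then show ?thesis using passage_less_sets[OF b t] inv_L_less_sets[OF t] by simp
qed

lemma stop_X_le:
  assumes w: "w \<in> space M" and r: "0 < r" and s: "0 <= s" "ereal s <= stop r w"
  shows "X s w <= b r"
proof (cases "s = 0")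
  case True then show ?thesis using X_0[OF w] b_pos[OF b r] by simp
next
  case False
  then have s0: "0 < s" using s by simp
  show ?thesis
  proof (rule X_le_at_left[OF w s0, of "s / 2"])
    fix u assume u: "s / 2 <= u" "u < s"
    then have "ereal u < stop r w" using s(2) by (metis less_ereal.simps(1) less_le_trans)
    then have lt: "ereal u < passage b w" "ereal u < inv_L r w" by (auto simp: stop_def)
    have u0: "0 < u" using u s0 by simp
    have "X u w < b (L u w)" by (rule passage_before[OF b u0 lt(1)])
    also have "... <= b r" using inv_L_before[OF _ lt(2)] u0 by (intro b_mono[OF b] L_nonneg[OF w]) auto
    finally show "X u w <= b r" by simp
  qed (use s0 in simp)
qed

lemma stop_L_le:
  assumes w: "w \<in> space M" and r: "0 < r" and s: "0 <= s" "ereal s <= stop r w"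
  shows "L s w <= r"
proof (cases "s = 0")
  case True then show ?thesis using L_0[OF w] r by simp
next
  case False
  then have s0: "0 < s" using s by simp
  have "\<forall>\<^sub>F u in at_left s. L u w <= r"
    unfolding eventually_at_left_field
  proof (intro exI[of _ 0] conjI allI impI s0)
    fix u assume u: "0 < u" "u < s"
    then have "ereal u < stop r w" using s(2) by (metis less_ereal.simps(1) less_le_trans)
    then have "ereal u < inv_L r w" by (auto simp: stop_def)
    then show "L u w <= r" using inv_L_before[of u r w] u by simp
  qed
  then show ?thesis using L_left[OF w s0] by (intro tendsto_upperbound) auto
qed

lemma optional_cap_stop: "0 <= K ==> optional (cap (stop r) K)"
  by (rule optional_cap) (auto simp: stop_nonneg stop_less_sets)

lemma cap_stop_le: "ereal (cap (stop r) K w) <= stop r w"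
  using cap_eq[where R="stop r" and w=w and K=K, OF stop_nonneg] by simp

text \<open>Up to \<open>stop r\<close> the process is at most \<open>b r\<close>. Where
  \<open>stop r\<close> is infinite, the exponential martingale at time n is at most exp (\<theta> b
  r - \<psi> \<theta> n). Letting n grow bounds the probability of a finite stop below by exp (-
  \<theta> b r), and then \<theta> tends to 0.\<close>

lemma stop_finite:
  assumes r: "0 < r"
  shows "AE w in M. stop r w < \<infinity>"
proof -
  define A where "A = {w\<in>space M. stop r w < \<infinity>}"
  have A_eq: "A = (\<Union>n. {w\<in>space M. stop r w < ereal (real (Suc n))})"
  proof (safe, goal_cases)
    case (1 w)
    then obtain h where h: "stop r w = ereal h" using stop_nonneg[of r w] by (cases "stop r w") (auto simp: A_def)
    obtain n :: nat where "h < real n" using reals_Archimedean2 by blast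
    then have "stop r w < ereal (real (Suc n))" by (simp add: h)
    then show ?case using 1 by (auto simp: A_def)
  qed (auto simp: A_def)
  have [measurable]: "A \<in> sets M"
    unfolding A_eq
  proof (rule sets.countable_UN, safe)
    fix n
    show "{w\<in>space M. stop r w < ereal (real (Suc n))} \<in> sets M"
      by (rule subsetD[OF sets_F stop_less_sets]) auto
  qed
  have key: "exp (- \<theta> * b r) <= prob A" if \<theta>: "\<theta> > 0" for \<theta>
  proof -
    have p: "\<psi> \<theta> > 0" by (rule psi_positive[OF \<theta>])
    have le: "exp (- \<theta> * b r) <= prob A + exp (- \<psi> \<theta>) ^ n" for n :: nat
    proof -
      define S where "S = cap (stop r) (real n)"
      have S: "optional S" unfolding S_def by (rule optional_cap_stop) simp
      have SK: "S w <= real n" for w unfolding S_def by (rule cap_le[where R="stop r", OF stop_nonneg])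
      have "1 = (\<integral>w. exp (\<theta> * X (S w) w - \<psi> \<theta> * S w) \<partial>M)"
        using optional_stopping_exp(2)[OF _ S SK, of \<theta>] \<theta> by simp
      also have "... <= (\<integral>w. exp (\<theta> * b r) * (indicator A w + exp (- \<psi> \<theta>) ^ n) \<partial>M)"
      proof (rule integral_mono)
        show "integrable M (\<lambda>w. exp (\<theta> * X (S w) w - \<psi> \<theta> * S w))"
          using optional_stopping_exp(1)[OF _ S SK, of \<theta>] \<theta> by simp
        show "integrable M (\<lambda>w. exp (\<theta> * b r) * (indicator A w + exp (- \<psi> \<theta>) ^ n))"
          by (intro integrable_mult_right Bochner_Integration.integrable_add integrable_real_indicator) (auto simp: emeasure_eq_measure)
        fix w assume w: "w \<in> space M"
        have S0: "0 <= S w" using S w by (rule optional_nonneg)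
        have "X (S w) w <= b r" using cap_stop_le S0 unfolding S_def by (intro stop_X_le[OF w r])
        then have "exp (\<theta> * X (S w) w) <= exp (\<theta> * b r)" using \<theta> by simp
        moreover have "exp (- (\<psi> \<theta> * S w)) <= indicator A w + exp (- \<psi> \<theta>) ^ n"
        proof (cases "w \<in> A")
          case True
          have "exp (- (\<psi> \<theta> * S w)) <= 1" using p S0 by simp
          then show ?thesis using True by (simp add: add_increasing2)
        next
          case False
          then have "stop r w = \<infinity>" using w by (auto simp: A_def)
          then have "S w = real n" by (simp add: S_def cap_def)
          then show ?thesis using False by (simp add: exp_of_nat_mult[symmetric] mult.commute)
        qed
        ultimately have "exp (\<theta> * X (S w) w) * exp (- (\<psi> \<theta> * S w)) <= exp (\<theta> * b r) * (indicator A w + exp (- \<psi> \<theta>) ^ n)"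
          by (intro mult_mono) auto
        then show "exp (\<theta> * X (S w) w - \<psi> \<theta> * S w) <= exp (\<theta> * b r) * (indicator A w + exp (- \<psi> \<theta>) ^ n)"
          by (simp add: exp_diff exp_minus divide_inverse)
      qed
      also have "... = exp (\<theta> * b r) * (prob A + exp (- \<psi> \<theta>) ^ n)"
        by (simp add: prob_space emeasure_eq_measure)
      finally have "1 <= exp (\<theta> * b r) * (prob A + exp (- \<psi> \<theta>) ^ n)" .
      then have "exp (- \<theta> * b r) * 1 <= exp (- \<theta> * b r) * (exp (\<theta> * b r) * (prob A + exp (- \<psi> \<theta>) ^ n))"
        by (intro mult_left_mono) auto
      then show ?thesis by (simp add: mult.assoc[symmetric] exp_add[symmetric])
    qed
    have "(\<lambda>n. prob A + exp (- \<psi> \<theta>) ^ n) \<longlonglongrightarrow> prob A + 0"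
      using p by (intro tendsto_add tendsto_const LIMSEQ_realpow_zero) auto
    then have "exp (- \<theta> * b r) <= prob A + 0" by (rule LIMSEQ_le_const) (use le in auto)
    then show ?thesis by simp
  qed
  have "(\<lambda>n. exp (- (1 / real (Suc n)) * b r)) \<longlonglongrightarrow> exp (- 0 * b r)"
    by (intro tendsto_exp tendsto_mult tendsto_minus tendsto_const LIMSEQ_Suc[OF lim_1_over_n])
  moreover have "exp (- (1 / real (Suc n)) * b r) <= prob A" for n by (rule key) simp
  ultimately have "exp (- 0 * b r) <= prob A" by (intro LIMSEQ_le_const2) blast+
  then have "prob A = 1" using prob_le_1[of A] by simp
  then have "AE w in M. w \<in> A" using prob_eq_1[of A] by simp
  then show ?thesis by eventually_elim (simp add: A_def)
qed

definition \<tau> :: "real => 'a => real" where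
  "\<tau> r w = real_of_ereal (stop r w)"

lemma tau_nonneg: "0 <= \<tau> r w"
  unfolding \<tau>_def using stop_nonneg by (rule real_of_ereal_pos)

lemma tau_eq: "stop r w < \<infinity> ==> stop r w = ereal (\<tau> r w)"
  unfolding \<tau>_def using stop_nonneg[of r w] by (cases "stop r w") auto

text \<open>The capped times are eventually equal to \<tau>, and L <= r together with W(X) <= W (b
  r) dominates the passage to the limit.\<close>

lemma stop_expectation:
  assumes r: "0 < r"
  shows "integrable M (\<lambda>w. L (\<tau> r w) w)" "integrable M (\<lambda>w. W (X (\<tau> r w) w))"
    "(\<integral>w. W (X (\<tau> r w) w) \<partial>M) = (\<integral>w. L (\<tau> r w) w \<partial>M)"
proof -
  define S where "S n = cap (stop r) (real n)" for n
  have S: "optional (S n)" for n unfolding S_def by (rule optional_cap_stop) simp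
  have SK: "S n w <= real n" for n w unfolding S_def by (rule cap_le[where R="stop r", OF stop_nonneg])
  note os = optional_stopping_L[OF S SK]
  have ev: "AE w in M. \<forall>\<^sub>F n in sequentially. S n w = \<tau> r w"
    using stop_finite[OF r]
  proof eventually_elim
    case (elim w)
    obtain N :: nat where N: "\<tau> r w <= real N" using real_arch_simple by blast
    have "S n w = \<tau> r w" if "n >= N" for n
      unfolding S_def using N that tau_eq[OF elim] by (intro cap_less[where R="stop r"]) auto
    then show ?case by (auto simp: eventually_sequentially)
  qed
  have ST[measurable]: "\<tau> r \<in> borel_measurable M"
  proof -
    have "(\<lambda>w. lim (\<lambda>n. S n w)) \<in> borel_measurable M"
      using S by (intro borel_measurable_lim_metric optional_measurable)
    moreover have "AE w in M. \<tau> r w = lim (\<lambda>n. S n w)"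
      using ev
    proof eventually_elim
      case (elim w)
      then have "(\<lambda>n. S n w) \<longlonglongrightarrow> \<tau> r w" by (rule tendsto_eventually)
      then show ?case by (simp add: limI)
    qed
    ultimately show ?thesis by (rule measurable_M_AE_eq)
  qed
  have XT[measurable]: "(\<lambda>w. X (\<tau> r w) w) \<in> borel_measurable M" by (rule measurable_X_at) (auto simp: tau_nonneg)
  have evL: "AE w in M. (\<lambda>n. L (S n w) w) \<longlonglongrightarrow> L (\<tau> r w) w"
    using ev by eventually_elim (auto intro!: tendsto_eventually elim: eventually_mono)
  have evW: "AE w in M. (\<lambda>n. W (X (S n w) w)) \<longlonglongrightarrow> W (X (\<tau> r w) w)"
    using ev by eventually_elim (auto intro!: tendsto_eventually elim: eventually_mono)
  have LT[measurable]: "(\<lambda>w. L (\<tau> r w) w) \<in> borel_measurable M"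
  proof -
    have "(\<lambda>w. lim (\<lambda>n. L (S n w) w)) \<in> borel_measurable M"
      using os(2) by (intro borel_measurable_lim_metric) auto
    moreover have "AE w in M. L (\<tau> r w) w = lim (\<lambda>n. L (S n w) w)"
      using evL by eventually_elim (simp add: limI)
    ultimately show ?thesis by (rule measurable_M_AE_eq)
  qed
  have Lb: "AE w in M. norm (L (S n w) w) <= r" for n
  proof (rule AE_I2)
    fix w assume w: "w \<in> space M"
    have S0: "0 <= S n w" using S w by (rule optional_nonneg)
    show "norm (L (S n w) w) <= r" using stop_L_le[OF w r S0] cap_stop_le L_nonneg[OF w S0] by (simp add: S_def)
  qed
  have Wb: "AE w in M. norm (W (X (S n w) w)) <= W (b r)" for n
  proof (rule AE_I2)
    fix w assume w: "w \<in> space M"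
    have S0: "0 <= S n w" using S w by (rule optional_nonneg)
    have "X (S n w) w <= b r" using stop_X_le[OF w r S0] cap_stop_le by (simp add: S_def)
    then show "norm (W (X (S n w) w)) <= W (b r)" by (simp add: W_nonneg W_mono)
  qed
  have 1: "(\<lambda>n. \<integral>w. L (S n w) w \<partial>M) \<longlonglongrightarrow> (\<integral>w. L (\<tau> r w) w \<partial>M)"
    by (rule integral_dominated_convergence[OF LT _ _ evL Lb]) (use os(2) in auto)
  have 2: "(\<lambda>n. \<integral>w. W (X (S n w) w) \<partial>M) \<longlonglongrightarrow> (\<integral>w. W (X (\<tau> r w) w) \<partial>M)"
    by (rule integral_dominated_convergence[OF _ _ _ evW Wb]) (use os(1) in auto)
  show "integrable M (\<lambda>w. L (\<tau> r w) w)"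
    by (rule integrable_dominated_convergence[OF LT _ _ evL Lb]) (use os(2) in auto)
  show "integrable M (\<lambda>w. W (X (\<tau> r w) w))"
    by (rule integrable_dominated_convergence[OF _ _ _ evW Wb]) (use os(1) in auto)
  show "(\<integral>w. W (X (\<tau> r w) w) \<partial>M) = (\<integral>w. L (\<tau> r w) w \<partial>M)"
    using 1 2 unfolding os(3) by (rule LIMSEQ_unique[symmetric])
qed

section \<open>Survival function of the stopped local time\<close>

context
  assumes pos: "AE w in M. 0 < passage b w"
begin

text \<open>For all levels r <= R the stopped quantities are functions of one variable, the local
  time at \<tau> R: either level r is reached first, where W(X) = 0, or the passage comes first and
  then both stops coincide.\<close>

lemma stop_compare:
  assumes r: "0 < r" "r <= R"
  shows "AE w in M. 0 < L (\<tau> R w) w \<and> L (\<tau> r w) w = min (L (\<tau> R w) w) r \<and>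
    W (X (\<tau> r w) w) = indicator {..<r} (L (\<tau> R w) w) * W (b (L (\<tau> R w) w))"
proof -
  have R: "0 < R" using r by simp
  show ?thesis
    using pos L_pos stop_finite[OF r(1)] stop_finite[OF R] passage_value[OF b] AE_space
  proof eventually_elim
    case (elim w)
    note w = elim(6)
    note sr = tau_eq[OF elim(3)] and sR = tau_eq[OF elim(4)]
    have inv_pos: "0 < inv_L R w"
      using inv_L_value(1)[OF w R] inv_L_nonneg[of R w] by (cases "inv_L R w") auto
    have "0 < stop R w" using elim(1) inv_pos by (simp add: stop_def)
    then have "0 < \<tau> R w" by (simp add: sR)
    then have Lpos: "0 < L (\<tau> R w) w" using elim(2) by simp
    show ?case
    proof (cases "inv_L r w <= passage b w")
      case True
      then have i: "inv_L r w = ereal (\<tau> r w)" using sr by (simp add: stop_def min_absorb2)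
      have Lr: "L (\<tau> r w) w = r" by (rule inv_L_value(2)[OF w r(1) i])
      have W0: "W (X (\<tau> r w) w) = 0" by (rule W_nonpos[OF inv_L_X[OF w r(1) i]])
      have "stop r w <= stop R w" unfolding stop_def using inv_L_mono[OF r(2), of w] by (intro min.mono) auto
      then have "\<tau> r w <= \<tau> R w" by (simp add: sr sR)
      then have "r <= L (\<tau> R w) w" using L_mono[OF w tau_nonneg[of r w], of "\<tau> R w"] Lr by simp
      then show ?thesis using Lr W0 Lpos by simp
    next
      case False
      then have lt: "passage b w < inv_L r w" by simp
      then have p: "passage b w = ereal (\<tau> r w)" using sr by (simp add: stop_def min_absorb1)
      have "passage b w < inv_L R w" using lt inv_L_mono[OF r(2), of w] by (rule less_le_trans)
      then have "passage b w = ereal (\<tau> R w)" using sR by (simp add: stop_def min_absorb1)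
      then have eq: "\<tau> R w = \<tau> r w" using p by simp
      have Lr: "L (\<tau> r w) w < r" using lt p by (intro inv_L_before tau_nonneg) simp
      have "X (\<tau> r w) w = b (L (\<tau> r w) w)" using elim(5) p elim(1) by simp
      then show ?thesis using Lr eq Lpos by simp
    qed
  qed
qed

definition survival :: "real => real => real" where
  "survival R s = prob {w\<in>space M. s <= L (\<tau> R w) w}"

lemma survival_bounds: "0 <= survival R s \<and> survival R s <= 1"
  by (simp add: survival_def)

lemma survival_limit:
  assumes R: "0 < R"
  shows "(survival R \<longlongrightarrow> 1) (at_right 0)"
proof -
  have [measurable]: "(\<lambda>w. L (\<tau> R w) w) \<in> borel_measurable M" using stop_expectation(1)[OF R] by auto
  define A where "A n = {w\<in>space M. L (\<tau> R w) w < 1 / real (Suc n)}" for n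
  have [measurable]: "A n \<in> sets M" for n unfolding A_def by measurable
  have "(\<lambda>n. prob (A n)) \<longlonglongrightarrow> 0"
  proof (rule prob_tendsto_zero_if_eventually_notin)
    show "AE w in M. \<forall>\<^sub>F n in sequentially. w \<notin> A n"
      using stop_compare[OF R order_refl]
    proof eventually_elim
      case (elim w)
      then obtain N where N: "1 / real (Suc N) < L (\<tau> R w) w" using nat_approx_posE by blast
      have "w \<notin> A n" if "n >= N" for n
      proof -
        have "1 / real (Suc n) <= 1 / real (Suc N)" using that by (simp add: frac_le)
        then show ?thesis using N by (simp add: A_def)
      qed
      then show ?case by (auto simp: eventually_sequentially)
    qed
  qed simp
  show ?thesis
  proof (rule tendstoI)
    fix e :: real assume e: "0 < e"
    obtain n where n: "prob (A n) < e" using LIMSEQ_D[OF \<open>(\<lambda>n. prob (A n)) \<longlonglongrightarrow> 0\<close> e] by auto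
    have "dist (survival R s) 1 < e" if s: "0 < s" "s < 1 / real (Suc n)" for s
    proof -
      have "survival R s = 1 - prob {w\<in>space M. L (\<tau> R w) w < s}"
      proof -
        have "{w\<in>space M. s <= L (\<tau> R w) w} = space M - {w\<in>space M. L (\<tau> R w) w < s}" by auto
        then show ?thesis unfolding survival_def by (simp add: prob_compl)
      qed
      moreover have "prob {w\<in>space M. L (\<tau> R w) w < s} <= prob (A n)"
        using s by (intro finite_measure_mono) (auto simp: A_def)
      ultimately show ?thesis using n survival_bounds[of R s] by (simp add: dist_real_def)
    qed
    then show "\<forall>\<^sub>F s in at_right 0. dist (survival R s) 1 < e"
      unfolding eventually_at_right_field by (intro exI[of _ "1 / real (Suc n)"]) auto
  qed
qed

text \<open>Subtracting the identities of \<open>stop_expectation\<close> at r and s gives, with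
  \<Lambda> the local time at \<tau> R, that W(b(\<Lambda>)) on s <= \<Lambda> < r and min \<Lambda>
  r - min \<Lambda> s have the same mean. Monotonicity of W and b bounds both by constants times
  survival probabilities.\<close>

lemma survival_increment:
  assumes s: "0 < s" "s < r" "r <= R"
  shows "W (b s) * (survival R s - survival R r) <= (r - s) * survival R s"
    and "(r - s) * survival R r <= W (b r) * (survival R s - survival R r)"
proof -
  have R: "0 < R" and r0: "0 < r" using s by auto
  define \<Lambda> where "\<Lambda> w = L (\<tau> R w) w" for w
  have [measurable]: "\<Lambda> \<in> borel_measurable M" using stop_expectation(1)[OF R] unfolding \<Lambda>_def[abs_def] by auto
  define A where "A u = {w\<in>space M. u <= \<Lambda> w}" for u
  have [measurable]: "A u \<in> sets M" for u unfolding A_def by measurable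
  have surv: "survival R u = prob (A u)" for u by (simp add: survival_def A_def \<Lambda>_def)
  define D where "D = A s - A r"
  have [measurable]: "D \<in> sets M" by (simp add: D_def)
  have probD: "prob D = survival R s - survival R r"
    unfolding D_def surv using s by (intro finite_measure_Diff) (auto simp: A_def)
  have iI: "integrable M (\<lambda>w. k * indicator (A u) w)" "integrable M (\<lambda>w. k * indicator D w)" for k :: real and u
    by (intro integrable_mult_right integrable_real_indicator; simp add: emeasure_eq_measure)+
  have intA: "(\<integral>w. k * indicator (A u) w \<partial>M) = k * survival R u" for k :: real and u
    by (simp add: surv emeasure_eq_measure)
  have intD: "(\<integral>w. k * indicator D w \<partial>M) = k * (survival R s - survival R r)" for k :: real
    by (simp add: probD emeasure_eq_measure)
  have iL: "integrable M (\<lambda>w. L (\<tau> r w) w - L (\<tau> s w) w)"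
    using stop_expectation(1)[OF r0] stop_expectation(1)[OF s(1)] by simp
  have iW: "integrable M (\<lambda>w. W (X (\<tau> r w) w) - W (X (\<tau> s w) w))"
    using stop_expectation(2)[OF r0] stop_expectation(2)[OF s(1)] by simp
  have eq: "(\<integral>w. W (X (\<tau> r w) w) - W (X (\<tau> s w) w) \<partial>M) = (\<integral>w. L (\<tau> r w) w - L (\<tau> s w) w \<partial>M)"
    using stop_expectation[OF r0] stop_expectation[OF s(1)] by simp
  have cmp: "AE w in M. L (\<tau> r w) w - L (\<tau> s w) w = min (\<Lambda> w) r - min (\<Lambda> w) s \<and>
     W (X (\<tau> r w) w) - W (X (\<tau> s w) w) = indicator D w * W (b (\<Lambda> w)) \<and> 0 < \<Lambda> w \<and> w \<in> space M"
    using stop_compare[OF r0 s(3)] stop_compare[OF s(1) order_trans[OF less_imp_le[OF s(2)] s(3)]] AE_space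
  proof eventually_elim
    case (elim w)
    then show ?case using s by (auto simp: \<Lambda>_def D_def A_def indicator_def)
  qed
  have "(\<integral>w. W (b s) * indicator D w \<partial>M) <= (\<integral>w. W (X (\<tau> r w) w) - W (X (\<tau> s w) w) \<partial>M)"
  proof (rule integral_mono_AE[OF iI(2) iW])
    show "AE w in M. W (b s) * indicator D w <= W (X (\<tau> r w) w) - W (X (\<tau> s w) w)"
      using cmp
    proof eventually_elim
      case (elim w)
      have "W (b s) <= W (b (\<Lambda> w))" if "w \<in> D" using that s by (intro W_mono b_mono[OF b]) (auto simp: D_def A_def)
      then show ?case using elim by (auto simp: indicator_def)
    qed
  qed
  also have "... = (\<integral>w. L (\<tau> r w) w - L (\<tau> s w) w \<partial>M)" by (rule eq)
  also have "... <= (\<integral>w. (r - s) * indicator (A s) w \<partial>M)"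
  proof (rule integral_mono_AE[OF iL iI(1)])
    show "AE w in M. L (\<tau> r w) w - L (\<tau> s w) w <= (r - s) * indicator (A s) w"
      using cmp by eventually_elim (use s in \<open>auto simp: A_def indicator_def min_def\<close>)
  qed
  finally show "W (b s) * (survival R s - survival R r) <= (r - s) * survival R s" by (simp only: intA intD)
  have "(\<integral>w. (r - s) * indicator (A r) w \<partial>M) <= (\<integral>w. L (\<tau> r w) w - L (\<tau> s w) w \<partial>M)"
  proof (rule integral_mono_AE[OF iI(1) iL])
    show "AE w in M. (r - s) * indicator (A r) w <= L (\<tau> r w) w - L (\<tau> s w) w"
      using cmp by eventually_elim (use s in \<open>auto simp: A_def indicator_def min_def\<close>)
  qed
  also have "... = (\<integral>w. W (X (\<tau> r w) w) - W (X (\<tau> s w) w) \<partial>M)" by (rule eq[symmetric])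
  also have "... <= (\<integral>w. W (b r) * indicator D w \<partial>M)"
  proof (rule integral_mono_AE[OF iW iI(2)])
    show "AE w in M. W (X (\<tau> r w) w) - W (X (\<tau> s w) w) <= W (b r) * indicator D w"
      using cmp
    proof eventually_elim
      case (elim w)
      have "W (b (\<Lambda> w)) <= W (b r)" if "w \<in> D" using that s by (intro W_mono b_mono[OF b]) (auto simp: D_def A_def)
      then show ?case using elim by (auto simp: indicator_def)
    qed
  qed
  finally show "(r - s) * survival R r <= W (b r) * (survival R s - survival R r)" by (simp only: intA intD)
qed

text \<open>Stated for any rate \<open>c\<close> above 1 / W (b s), so that a raised barrier can be
  compared with the hazard of the original one.\<close>

lemma exp_le_survival_stop:
  assumes hz: "hazard c C" and c: "\<And>s. 0 < s ==> 1 / W (b s) <= c s" and r: "0 < r" "r <= R"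
  shows "exp (- C r) <= survival R r"
proof (rule exp_le_survival[OF hz _ survival_limit _ r])
  show "0 <= survival R s \<and> survival R s <= 1" for s by (rule survival_bounds)
  fix s u assume s: "0 < s" "s < u" "u <= R"
  have Wp: "0 < W (b s)" using W_pos b_pos[OF b s(1)] by simp
  have "survival R s - survival R u <= (u - s) * survival R s / W (b s)"
    using survival_increment(1)[OF s] Wp by (simp add: field_simps)
  also have "... = (u - s) * (1 / W (b s)) * survival R s" by simp
  also have "... <= (u - s) * c s * survival R s"
    using c[OF s(1)] s survival_bounds by (intro mult_right_mono mult_left_mono) auto
  finally show "survival R s - survival R u <= (u - s) * c s * survival R s" .
qed (use r in auto)

lemma survival_stop_le_exp:
  assumes hz: "hazard (\<lambda>s. 1 / W (b s)) C" and r: "0 < r" "r <= R"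
  shows "survival R r <= exp (- C r)"
proof (rule survival_le_exp[OF hz _ survival_limit _ r])
  show "0 <= survival R s \<and> survival R s <= 1" for s by (rule survival_bounds)
  fix s u assume s: "0 < s" "s < u" "u <= R"
  have Wp: "0 < W (b u)" using W_pos b_pos[OF b, of u] s by simp
  show "(u - s) * (1 / W (b u)) * survival R u <= survival R s - survival R u"
    using survival_increment(2)[OF s] Wp by (simp add: field_simps)
qed (use r in auto)

end

end

lemma barrier_max:
  assumes b: "barrier b" and a: "a > 0"
  shows "barrier (\<lambda>l. max (b l) a)"
  using b a unfolding barrier_def
  by (auto intro!: tendsto_max max.mono simp del: max.bounded_iff simp: less_max_iff_disj intro: max.coboundedI2)

lemma passage_pos_if_bounded_below:
  assumes b: "barrier b" and a: "a > 0" and ge: "\<And>l. 0 <= l ==> a <= b l" and w: "w \<in> space M"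
  shows "0 < passage b w"
proof -
  from order_tendstoD(2)[OF right_continuous_X[OF w, of 0], of a] X_0[OF w] a
  obtain d where d: "d > 0" "\<And>s. 0 < s ==> s < d ==> X s w < a"
    by (auto simp: eventually_at_right_field)
  have "ereal d <= passage b w"
    unfolding passage_def
  proof (rule Inf_greatest, safe)
    fix t assume t: "0 < t" "b (L t w) <= X t w"
    have "a <= X t w" using ge[OF L_nonneg[OF w, of t]] t by simp
    then show "ereal d <= ereal t" using d(2)[of t] t by (cases "t < d") auto
  qed
  then show ?thesis using d(1) by (metis less_le_trans ereal_less(2))
qed

text \<open>The survival bounds presuppose a positive passage time, so they are applied to barriers
  \<open>bn\<close> raised to height at least 1 / (n + 1), where positivity follows from X_0 = 0.
  Their rates are at most that of \<open>b\<close>, so \<Lambda> n < r has probability at most 1 -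
  exp (- C r), uniformly in n. If the passage time of \<open>b\<close> were 0, then \<Lambda> n
  would tend to 0.\<close>

lemma passage_pos:
  assumes b: "barrier b" and hz: "hazard (\<lambda>s. 1 / W (b s)) C"
  shows "AE w in M. 0 < passage b w"
proof -
  define bn where "bn n l = max (b l) (1 / real (Suc n))" for n l
  have bn: "barrier (bn n)" for n unfolding bn_def by (rule barrier_max[OF b]) simp
  have pos: "AE w in M. 0 < passage (bn n) w" for n
    by (rule AE_I2, rule passage_pos_if_bounded_below[OF bn, where a="1 / real (Suc n)"]) (auto simp: bn_def)
  define \<Lambda> where "\<Lambda> n w = L (\<tau> (bn n) 1 w) w" for n w
  have [measurable]: "\<Lambda> n \<in> borel_measurable M" for n
    using stop_expectation(1)[OF bn zero_less_one, of n] unfolding \<Lambda>_def[abs_def] by auto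
  have low: "prob {w\<in>space M. \<Lambda> n w < r} <= 1 - exp (- C r)" if r: "0 < r" "r <= 1" for n r
  proof -
    have "exp (- C r) <= survival (bn n) 1 r"
    proof (rule exp_le_survival_stop[OF bn pos hz _ r])
      fix s :: real assume s: "0 < s"
      have "0 < W (b s)" using W_pos b_pos[OF b s] by simp
      moreover have "W (b s) <= W (bn n s)" by (intro W_mono) (simp add: bn_def)
      ultimately show "1 / W (bn n s) <= 1 / W (b s)" by (intro divide_left_mono) auto
    qed
    moreover have "{w\<in>space M. \<Lambda> n w < r} = space M - {w\<in>space M. r <= \<Lambda> n w}" by auto
    then have "prob {w\<in>space M. \<Lambda> n w < r} = 1 - survival (bn n) 1 r"
      unfolding survival_def[OF bn pos] by (simp add: prob_compl \<Lambda>_def[symmetric])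
    ultimately show ?thesis by simp
  qed
  define B where "B r = (\<Union>N. \<Inter>n\<in>{N..}. {w\<in>space M. \<Lambda> n w < r})" for r
  have [measurable]: "B r \<in> sets M" for r unfolding B_def by measurable
  have Ble: "prob (B r) <= 1 - exp (- C r)" if r: "0 < r" "r <= 1" for r
  proof -
    have "(\<lambda>N. prob (\<Inter>n\<in>{N..}. {w\<in>space M. \<Lambda> n w < r})) \<longlonglongrightarrow> prob (B r)"
      unfolding B_def
    proof (rule finite_Lim_measure_incseq)
      show "range (\<lambda>N. \<Inter>n\<in>{N..}. {w\<in>space M. \<Lambda> n w < r}) \<subseteq> sets M"
        by (intro image_subsetI) measurable
      show "incseq (\<lambda>N. \<Inter>n\<in>{N..}. {w\<in>space M. \<Lambda> n w < r})" by (auto simp: incseq_def)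
    qed
    moreover have "prob (\<Inter>n\<in>{N..}. {w\<in>space M. \<Lambda> n w < r}) <= 1 - exp (- C r)" for N
    proof -
      have "prob (\<Inter>n\<in>{N..}. {w\<in>space M. \<Lambda> n w < r}) <= prob {w\<in>space M. \<Lambda> N w < r}"
        by (intro finite_measure_mono) auto
      then show ?thesis using low[OF r, of N] by simp
    qed
    ultimately show ?thesis by (intro LIMSEQ_le_const2) auto
  qed
  have "prob (\<Inter>k. B (1 / real (Suc k))) <= 0"
  proof (rule tendsto_lowerbound)
    have "filterlim (\<lambda>k. 1 / real (Suc k)) (at_right 0) sequentially"
      unfolding filterlim_at
    proof
      show "(\<lambda>n. 1 / real (Suc n)) \<longlonglongrightarrow> 0" by (rule LIMSEQ_Suc[OF lim_1_over_n])
    qed simp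
    then have "(\<lambda>k. C (1 / real (Suc k))) \<longlonglongrightarrow> 0" by (rule filterlim_compose[rotated]) (use hz in \<open>simp add: hazard_def\<close>)
    then have "(\<lambda>k. 1 - exp (- C (1 / real (Suc k)))) \<longlonglongrightarrow> 1 - exp (- 0)" by (intro tendsto_intros)
    then show "(\<lambda>k. 1 - exp (- C (1 / real (Suc k)))) \<longlonglongrightarrow> 0" by simp
    show "\<forall>\<^sub>F k in sequentially. prob (\<Inter>k. B (1 / real (Suc k))) <= 1 - exp (- C (1 / real (Suc k)))"
    proof (intro always_eventually allI)
      fix k
      have "prob (\<Inter>k. B (1 / real (Suc k))) <= prob (B (1 / real (Suc k)))" by (intro finite_measure_mono) auto
      then show "prob (\<Inter>k. B (1 / real (Suc k))) <= 1 - exp (- C (1 / real (Suc k)))" using Ble[of "1 / real (Suc k)"] by simp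
    qed
  qed simp
  then have "prob (\<Inter>k. B (1 / real (Suc k))) = 0" using measure_nonneg[of M "\<Inter>k. B (1 / real (Suc k))"] by linarith
  then have "AE w in M. w \<notin> (\<Inter>k. B (1 / real (Suc k)))"
    by (intro AE_not_in) (auto simp: null_sets_def emeasure_eq_measure)
  then show ?thesis using L_pos AE_space
  proof eventually_elim
    case (elim w)
    note w = elim(3)
    show ?case
    proof (rule ccontr)
      assume "\<not> 0 < passage b w"
      then have z: "passage b w = 0" using passage_nonneg[OF b, of w] by simp
      have "w \<in> B (1 / real (Suc k))" for k
      proof -
        have "\<forall>\<^sub>F t in at_right 0. L t w < 1 / real (Suc k)"
          using order_tendstoD(2)[OF L_right[OF w, of 0]] L_0[OF w] by simp
        then obtain d where d: "d > 0" "\<And>t. 0 < t ==> t < d ==> L t w < 1 / real (Suc k)"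
          by (auto simp: eventually_at_right_field)
        have "passage b w < ereal d" using z d by simp
        then obtain s where s: "0 < s" "s < d" "b (L s w) <= X s w" unfolding passage_def Inf_less_iff by auto
        \<comment> \<open>The path is positive at a crossing \<open>s\<close> of \<open>b\<close>,
          so it also crosses by time \<open>s\<close> every raised barrier with 1 / (n + 1) <=
          X_s.\<close>
        have "0 < X s w" using b_pos[OF b, of "L s w"] elim(2) s by (auto intro: less_le_trans)
        then obtain N where N: "1 / real (Suc N) < X s w" using nat_approx_posE by blast
        have "\<Lambda> n w < 1 / real (Suc k)" if n: "n >= N" for n
        proof -
          have "1 / real (Suc n) <= 1 / real (Suc N)" using n by (simp add: frac_le)
          then have "bn n (L s w) <= X s w" using s N by (simp add: bn_def)
          then have "passage (bn n) w <= ereal s" unfolding passage_def using s by (intro Inf_lower) auto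
          then have "stop (bn n) 1 w <= ereal s" unfolding stop_def[OF bn] by (rule min.coboundedI1)
          then have "\<tau> (bn n) 1 w <= s" proof -
            assume le: "stop (bn n) 1 w <= ereal s"
            have "stop (bn n) 1 w = ereal (\<tau> (bn n) 1 w)" by (rule tau_eq[OF bn le_less_trans[OF le]]) simp
            with le show ?thesis by simp
          qed
          then have "\<Lambda> n w <= L s w" unfolding \<Lambda>_def by (intro L_mono[OF w] tau_nonneg[OF bn])
          then show ?thesis using d(2)[of s] s by simp
        qed
        then show ?thesis unfolding B_def using w by auto
      qed
      then show False using elim(1) by auto
    qed
  qed
qed

text \<open>For each R the stopped local time \<Lambda> R is the local time at passage cut off at R,
  and equals R if there is no passage. The latter for all R has probability at most exp (- C n) for
  every positive integer n, hence probability 0.\<close>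

theorem passage_law:
  assumes b: "barrier b" and hz: "hazard (\<lambda>s. 1 / W (b s)) C" and C: "filterlim C at_top at_top"
  shows "AE w in M. 0 < passage b w \<and> passage b w < \<infinity>"
    and "(\<lambda>w. L (real_of_ereal (passage b w)) w) \<in> borel_measurable M"
    and "\<And>r. 0 < r ==> prob {w\<in>space M. r <= L (real_of_ereal (passage b w)) w} = exp (- C r)"
proof -
  note pos = passage_pos[OF b hz]
  have surv: "survival b R r = exp (- C r)" if "0 < r" "r <= R" for r R
    using exp_le_survival_stop[OF b pos hz _ that] survival_stop_le_exp[OF b pos hz that] by simp
  define \<Lambda> where "\<Lambda> R w = L (\<tau> b R w) w" for R w
  have \<Lambda>m: "\<Lambda> R \<in> borel_measurable M" if "0 < R" for R
    using stop_expectation(1)[OF b that] unfolding \<Lambda>_def[abs_def] by auto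
  have cases_AE: "AE w in M. (passage b w = \<infinity> --> \<Lambda> R w = R) \<and>
      (passage b w < \<infinity> --> \<Lambda> R w = min (L (real_of_ereal (passage b w)) w) R)" if R: "0 < R" for R
    using stop_finite[OF b R] AE_space
  proof eventually_elim
    case (elim w)
    note w = elim(2)
    note s = tau_eq[OF b elim(1)]
    show ?case
    proof (cases "inv_L R w <= passage b w")
      case True
      then have i: "inv_L R w = ereal (\<tau> b R w)" using s by (simp add: stop_def[OF b] min_absorb2)
      have LR: "\<Lambda> R w = R" unfolding \<Lambda>_def by (rule inv_L_value(2)[OF w R i])
      have "R <= L (real_of_ereal (passage b w)) w" if "passage b w < \<infinity>"
      proof -
        have "ereal (real_of_ereal (passage b w)) = passage b w" using that passage_nonneg[OF b, of w] by (cases "passage b w") auto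
        then have "\<tau> b R w <= real_of_ereal (passage b w)" using True i by (metis ereal_less_eq(3))
        then show ?thesis using L_mono[OF w tau_nonneg[OF b, of R w], of "real_of_ereal (passage b w)"] LR by (simp add: \<Lambda>_def)
      qed
      then show ?thesis using LR by simp
    next
      case False
      then have p: "passage b w = ereal (\<tau> b R w)" using s by (simp add: stop_def[OF b] min_absorb1)
      have "L (\<tau> b R w) w < R" using False p by (intro inv_L_before tau_nonneg[OF b]) simp
      then show ?thesis using p by (simp add: \<Lambda>_def)
    qed
  qed
  have "AE w in M. \<not> (\<forall>n. \<Lambda> (real (Suc n)) w = real (Suc n))"
  proof -
    define E where "E = (\<Inter>n. {w\<in>space M. real (Suc n) <= \<Lambda> (real (Suc n)) w})"
    note [measurable] = \<Lambda>m
    have [measurable]: "E \<in> sets M" unfolding E_def by measurable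
    have le: "prob E <= exp (- C (real (Suc n)))" for n
    proof -
      have "prob E <= prob {w\<in>space M. real (Suc n) <= \<Lambda> (real (Suc n)) w}" by (intro finite_measure_mono) (auto simp: E_def)
      also have "... = survival b (real (Suc n)) (real (Suc n))" by (simp add: survival_def[OF b pos] \<Lambda>_def)
      also have "... = exp (- C (real (Suc n)))" by (rule surv) auto
      finally show ?thesis .
    qed
    have "filterlim (\<lambda>n. real (Suc n)) at_top sequentially"
      by (rule filterlim_compose[OF filterlim_real_sequentially filterlim_Suc])
    then have "filterlim (\<lambda>n. C (real (Suc n))) at_top sequentially" by (rule filterlim_compose[OF C])
    then have "(\<lambda>n. exp (- C (real (Suc n)))) \<longlonglongrightarrow> 0"
      by (intro filterlim_compose[OF exp_at_bot] filterlim_compose[OF filterlim_uminus_at_bot_at_top])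
    then have "prob E <= 0" by (rule LIMSEQ_le_const) (use le in auto)
    then have "prob E = 0" using measure_nonneg[of M E] by linarith
    then have "AE w in M. w \<notin> E" by (intro AE_not_in) (auto simp: null_sets_def emeasure_eq_measure)
    then show ?thesis using AE_space
    proof eventually_elim
      case (elim w)
      then obtain n where "\<not> real (Suc n) <= \<Lambda> (real (Suc n)) w" by (auto simp: E_def simp del: of_nat_Suc)
      then show ?case by (metis order_refl)
    qed
  qed
  moreover have "AE w in M. \<forall>n. passage b w = \<infinity> --> \<Lambda> (real (Suc n)) w = real (Suc n)"
    unfolding AE_all_countable
  proof
    fix n show "AE w in M. passage b w = \<infinity> --> \<Lambda> (real (Suc n)) w = real (Suc n)"
      using cases_AE[of "real (Suc n)"] by (auto elim: eventually_mono)
  qed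
  ultimately have fin: "AE w in M. passage b w < \<infinity>" by eventually_elim auto
  then show "AE w in M. 0 < passage b w \<and> passage b w < \<infinity>" using pos by eventually_elim simp
  have LR: "AE w in M. \<Lambda> R w = min (L (real_of_ereal (passage b w)) w) R" if "0 < R" for R
    using cases_AE[OF that] fin by eventually_elim simp
  show meas: "(\<lambda>w. L (real_of_ereal (passage b w)) w) \<in> borel_measurable M"
  proof (rule measurable_M_AE_eq)
    show "(\<lambda>w. lim (\<lambda>n. \<Lambda> (real (Suc n)) w)) \<in> borel_measurable M"
      by (intro borel_measurable_lim_metric \<Lambda>m) simp
    have "AE w in M. \<forall>n. \<Lambda> (real (Suc n)) w = min (L (real_of_ereal (passage b w)) w) (real (Suc n))"
      unfolding AE_all_countable by (intro allI LR) simp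
    then show "AE w in M. L (real_of_ereal (passage b w)) w = lim (\<lambda>n. \<Lambda> (real (Suc n)) w)"
    proof eventually_elim
      case (elim w)
      obtain N :: nat where N: "L (real_of_ereal (passage b w)) w <= real N" using real_arch_simple by blast
      have "(\<lambda>n. \<Lambda> (real (Suc n)) w) \<longlonglongrightarrow> L (real_of_ereal (passage b w)) w"
      proof (rule tendsto_eventually, unfold eventually_sequentially, intro exI allI impI)
        fix n assume "N <= n"
        then show "\<Lambda> (real (Suc n)) w = L (real_of_ereal (passage b w)) w" using elim N by (simp add: min_def)
      qed
      then show ?case by (simp add: limI)
    qed
  qed
  show "prob {w\<in>space M. r <= L (real_of_ereal (passage b w)) w} = exp (- C r)" if r: "0 < r" for r
  proof -
    note [measurable] = meas \<Lambda>m[OF r]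
    have "prob {w\<in>space M. r <= L (real_of_ereal (passage b w)) w} = prob {w\<in>space M. r <= \<Lambda> r w}"
    proof (rule finite_measure_eq_AE)
      show "AE w in M. w \<in> {w\<in>space M. r <= L (real_of_ereal (passage b w)) w} \<longleftrightarrow> w \<in> {w\<in>space M. r <= \<Lambda> r w}"
        using LR[OF r] AE_space by eventually_elim auto
    qed measurable
    also have "... = survival b r r" by (simp add: survival_def[OF b pos] \<Lambda>_def)
    also have "... = exp (- C r)" by (rule surv) (use r in auto)
    finally show ?thesis .
  qed
qed

end

section \<open>The barrier associated with the target law\<close>

lemma measure_eq_if_lessThan_eq:
  fixes M N :: "real measure"
  assumes "sets M = sets borel" "sets N = sets borel"
    and eq: "\<And>z. emeasure M {..<z} = emeasure N {..<z}" and fin: "\<And>z. emeasure M {..<z} \<noteq> \<infinity>"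
  shows "M = N"
proof (rule measure_eqI_generator_eq[where E="range (\<lambda>z::real. {..<z})" and \<Omega>=UNIV and A="\<lambda>i::nat. {..<real i}"])
  have b: "sets (borel :: real measure) = sigma_sets UNIV (range (\<lambda>z::real. {..<z}))"
    unfolding borel_Iio by (rule sets_measure_of) auto
  show "sets M = sigma_sets UNIV (range (\<lambda>z::real. {..<z}))" "sets N = sigma_sets UNIV (range (\<lambda>z::real. {..<z}))"
    using assms b by auto
  show "Int_stable (range (\<lambda>z::real. {..<z}))"
  proof (rule Int_stableI, safe)
    fix a b :: real
    have "{..<a} \<inter> {..<b} = {..<min a b}" by auto
    then show "{..<a} \<inter> {..<b} \<in> range lessThan" by auto
  qed
  show "(\<Union>i. {..<real i}) = UNIV" using reals_Archimedean2 by auto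
qed (use eq fin in auto)

section \<open>The tail of the target law and its inverse\<close>

context
  fixes \<mu> :: "real measure"
  assumes mu: "prob_space \<mu>" and sets_mu: "sets \<mu> = sets borel" and mu_pos: "measure \<mu> {0<..} = 1"
begin

interpretation mu: prob_space \<mu> by (rule mu)

lemma mu_bar_antimono: "s <= t ==> mu_bar \<mu> t <= mu_bar \<mu> s"
  unfolding mu_bar_def by (intro mu.finite_measure_mono) (auto simp: sets_mu)

lemma mu_bar_bounds: "0 <= mu_bar \<mu> s" "mu_bar \<mu> s <= 1"
  unfolding mu_bar_def by simp_all

lemma mu_bar_nonpos: "s <= 0 ==> mu_bar \<mu> s = 1"
proof -
  assume "s <= 0"
  then have "measure \<mu> {0<..} <= mu_bar \<mu> s" unfolding mu_bar_def by (intro mu.finite_measure_mono) (auto simp: sets_mu)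
  then show ?thesis using mu_bar_bounds(2)[of s] mu_pos by simp
qed

lemma mu_bar_left: "(\<lambda>n. mu_bar \<mu> (y - 1 / real (Suc n))) \<longlonglongrightarrow> mu_bar \<mu> y"
proof -
  have "(\<lambda>n. measure \<mu> {y - 1 / real (Suc n)..}) \<longlonglongrightarrow> measure \<mu> (\<Inter>n. {y - 1 / real (Suc n)..})"
  proof (rule mu.finite_Lim_measure_decseq)
    show "decseq (\<lambda>n. {y - 1 / real (Suc n)..})"
    proof (rule decseq_SucI)
      fix n
      have "1 / real (Suc (Suc n)) <= 1 / real (Suc n)" by (simp add: frac_le)
      then show "{y - 1 / real (Suc (Suc n))..} \<subseteq> {y - 1 / real (Suc n)..}" by auto
    qed
  qed (auto simp: sets_mu)
  also have "(\<Inter>n. {y - 1 / real (Suc n)..}) = {y..}"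
  proof (rule set_eqI, rule iffI)
    fix x assume "x \<in> (\<Inter>n. {y - 1 / real (Suc n)..})"
    then have x: "y - 1 / real (Suc n) <= x" for n by blast
    have "y <= x + e" if "0 < e" for e
    proof -
      obtain n where "1 / real (Suc n) < e" using nat_approx_posE[of e] \<open>0 < e\<close> by blast
      then show ?thesis using x[of n] by linarith
    qed
    then have "y <= x" by (rule field_le_epsilon)
    then show "x \<in> {y..}" by simp
  next
    fix x assume "x \<in> {y..}"
    moreover have "0 <= 1 / real (Suc n)" for n by simp
    ultimately show "x \<in> (\<Inter>n. {y - 1 / real (Suc n)..})" by (auto intro: order_trans[of _ y] simp del: of_nat_Suc)
  qed
  finally show ?thesis by (simp add: mu_bar_def)
qed

lemma mu_bar_less_left: "mu_bar \<mu> z < x ==> \<exists>y<z. mu_bar \<mu> y < x"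
proof -
  assume "mu_bar \<mu> z < x"
  then have "\<forall>\<^sub>F n in sequentially. mu_bar \<mu> (z - 1 / real (Suc n)) < x"
    by (rule order_tendstoD(2)[OF mu_bar_left])
  then obtain n where "mu_bar \<mu> (z - 1 / real (Suc n)) < x" by (auto simp: eventually_sequentially)
  then show ?thesis by (intro exI[of _ "z - 1 / real (Suc n)"]) auto
qed

lemma mu_bar_to_zero: "e > 0 ==> \<exists>y>0. mu_bar \<mu> y < e"
proof -
  assume e: "e > 0"
  have "(\<lambda>n. measure \<mu> {real n..}) \<longlonglongrightarrow> measure \<mu> (\<Inter>n. {real n..})"
    by (rule mu.finite_Lim_measure_decseq) (auto simp: sets_mu decseq_def)
  also have "(\<Inter>n. {real n..}) = {}"
  proof -
    have "\<exists>n. \<not> real n <= x" for x using reals_Archimedean2[of x] by (auto simp: not_le)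
    then show ?thesis by auto
  qed
  finally have "\<forall>\<^sub>F n in sequentially. measure \<mu> {real n..} < e" using e by (intro order_tendstoD(2)) auto
  then obtain N where N: "\<And>n. n >= N ==> measure \<mu> {real n..} < e" by (auto simp: eventually_sequentially)
  then show ?thesis using N[of "Suc N"] by (intro exI[of _ "real (Suc N)"]) (simp add: mu_bar_def del: of_nat_Suc)
qed

lemma mu_bar_to_one: "e > 0 ==> \<exists>y>0. 1 - e < mu_bar \<mu> y"
proof -
  assume e: "e > 0"
  have "(\<lambda>n. measure \<mu> {1 / real (Suc n)..}) \<longlonglongrightarrow> measure \<mu> (\<Union>n. {1 / real (Suc n)..})"
  proof (rule mu.finite_Lim_measure_incseq)
    show "incseq (\<lambda>n. {1 / real (Suc n)..})"
    proof (rule incseq_SucI)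
      fix n
      have "1 / real (Suc (Suc n)) <= 1 / real (Suc n)" by (simp add: frac_le)
      then show "{1 / real (Suc n)..} \<subseteq> {1 / real (Suc (Suc n))..}" by auto
    qed
  qed (auto simp: sets_mu)
  also have "(\<Union>n. {1 / real (Suc n)..}) = {0<..}"
  proof (safe, goal_cases)
    case (1 x n) then show ?case by (auto intro: less_le_trans[of 0 "1 / real (Suc n)"])
  next
    case (2 x)
    then obtain n where "1 / real (Suc n) < x" using nat_approx_posE[of x] by auto
    then show ?case by (auto intro!: exI[of _ n])
  qed
  finally have "\<forall>\<^sub>F n in sequentially. 1 - e < measure \<mu> {1 / real (Suc n)..}" using e mu_pos by (intro order_tendstoD(1)) auto
  then obtain n where "1 - e < measure \<mu> {1 / real (Suc n)..}" by (auto simp: eventually_sequentially)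
  then show ?thesis by (intro exI[of _ "1 / real (Suc n)"]) (simp add: mu_bar_def)
qed

text \<open>The right-continuous inverse of - log \<open>mu_bar\<close>, written with exp (- l) so
  that \<open>mu_bar\<close> may take the value 0.\<close>

definition quantile :: "real => real" where
  "quantile l = Inf {y. mu_bar \<mu> y < exp (- l)}"

lemma quantile_set:
  assumes "0 <= l"
  shows "{y. mu_bar \<mu> y < exp (- l)} \<noteq> {}" "bdd_below {y. mu_bar \<mu> y < exp (- l)}"
proof -
  show "{y. mu_bar \<mu> y < exp (- l)} \<noteq> {}" using mu_bar_to_zero[of "exp (- l)"] by auto
  have "0 <= y" if "mu_bar \<mu> y < exp (- l)" for y
  proof (rule ccontr)
    assume "\<not> 0 <= y"
    then have "mu_bar \<mu> y = 1" by (intro mu_bar_nonpos) simp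
    then show False using that assms by simp
  qed
  then show "bdd_below {y. mu_bar \<mu> y < exp (- l)}" by (intro bdd_belowI[of _ 0]) auto
qed

text \<open>Left-continuity of \<open>mu_bar\<close> turns the infimum into an exact equivalence at
  \<open>z\<close> itself.\<close>

lemma quantile_less_iff: "0 <= l ==> quantile l < z \<longleftrightarrow> mu_bar \<mu> z < exp (- l)"
proof -
  assume l: "0 <= l"
  have "quantile l < z \<longleftrightarrow> (\<exists>y<z. mu_bar \<mu> y < exp (- l))"
    unfolding quantile_def using cInf_less_iff[OF quantile_set[OF l]] by auto
  also have "... \<longleftrightarrow> mu_bar \<mu> z < exp (- l)"
    using mu_bar_less_left[of z "exp (- l)"] mu_bar_antimono[of _ z] by (auto intro: le_less_trans less_imp_le)
  finally show ?thesis .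
qed

lemma quantile_mono: "0 <= l ==> l <= l' ==> quantile l <= quantile l'"
proof (rule ccontr)
  assume l: "0 <= l" "l <= l'" and "\<not> quantile l <= quantile l'"
  then have "quantile l' < quantile l" by simp
  then have "mu_bar \<mu> (quantile l) < exp (- l')" using quantile_less_iff[of l'] l by simp
  also have "... <= exp (- l)" using l by simp
  finally have "quantile l < quantile l" by (simp only: quantile_less_iff[OF l(1)])
  then show False by simp
qed

lemma quantile_measurable: "(\<lambda>l. quantile (max 0 l)) \<in> borel_measurable borel"
  by (rule borel_measurable_mono) (auto intro!: monoI quantile_mono)

text \<open>The image of Lebesgue measure under the quantile function realises
  \<open>- d (log mu_bar)\<close> below the right end point of \<open>\<mu>\<close>. Beyond that point both values of
  \<open>neg_log_mu_bar\<close> are infinite and their difference is \<open>\<top> - \<top> = \<top>\<close> in \<open>ennreal\<close>,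
  which the part of the density on the negative half line accounts for.\<close>
lemma neg_log_measure_exists:
  "\<exists>\<nu>. sets \<nu> = sets borel \<and> (\<forall>a b. a < b --> emeasure \<nu> {a..<b} = neg_log_mu_bar \<mu> b - neg_log_mu_bar \<mu> a)"
proof -
  define dens where "dens l = (if 0 <= l then 1 else if mu_bar \<mu> (- l) = 0 then \<top> else (0::ennreal))" for l
  define \<gamma> where "\<gamma> l = (if 0 <= l then quantile (max 0 l) else - l)" for l
  have [measurable]: "mu_bar \<mu> \<in> borel_measurable borel"
  proof -
    have "(\<lambda>s. - mu_bar \<mu> s) \<in> borel_measurable borel" by (rule borel_measurable_mono) (auto intro!: monoI mu_bar_antimono)
    then have "(\<lambda>s. - (- mu_bar \<mu> s)) \<in> borel_measurable borel" by measurable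
    then show ?thesis by simp
  qed
  note [measurable] = quantile_measurable
  have [measurable]: "dens \<in> borel_measurable borel" "\<gamma> \<in> borel_measurable borel"
    unfolding dens_def \<gamma>_def by measurable
  define \<nu> where "\<nu> = distr (density lborel dens) borel \<gamma>"
  have "emeasure \<nu> {a..<b} = neg_log_mu_bar \<mu> b - neg_log_mu_bar \<mu> a" if ab: "a < b" for a b
  proof -
    have "emeasure \<nu> {a..<b} = (\<integral>\<^sup>+l. dens l * indicator (\<gamma> -` {a..<b}) l \<partial>lborel)"
      proof -
      have [measurable]: "\<gamma> -` {a..<b} \<in> sets borel" using measurable_sets[of \<gamma> borel borel "{a..<b}"] by simp
      show ?thesis unfolding \<nu>_def by (subst emeasure_distr) (auto simp: emeasure_density)
    qed
    also have "... = (\<integral>\<^sup>+l. indicator {l. 0 <= l \<and> exp (- l) <= mu_bar \<mu> a \<and> mu_bar \<mu> b < exp (- l)} l +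
        (\<top> * indicator {l. l < 0 \<and> a <= - l \<and> - l < b \<and> mu_bar \<mu> (- l) = 0} l) \<partial>lborel)"
    proof (rule nn_integral_cong)
      fix l :: real
      show "dens l * indicator (\<gamma> -` {a..<b}) l = indicator {l. 0 <= l \<and> exp (- l) <= mu_bar \<mu> a \<and> mu_bar \<mu> b < exp (- l)} l +
        (\<top> * indicator {l. l < 0 \<and> a <= - l \<and> - l < b \<and> mu_bar \<mu> (- l) = 0} l)"
      proof (cases "0 <= l")
        case True
        have "a <= quantile l \<longleftrightarrow> exp (- l) <= mu_bar \<mu> a" "quantile l < b \<longleftrightarrow> mu_bar \<mu> b < exp (- l)"
          using quantile_less_iff[OF True, of a] quantile_less_iff[OF True, of b] by (auto simp: not_less[symmetric])
        then show ?thesis using True by (auto simp: dens_def \<gamma>_def indicator_def)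
      next
        case False
        then show ?thesis by (auto simp: dens_def \<gamma>_def indicator_def)
      qed
    qed
    also have "... = emeasure lborel {l. 0 <= l \<and> exp (- l) <= mu_bar \<mu> a \<and> mu_bar \<mu> b < exp (- l)} +
       \<top> * emeasure lborel {l. l < 0 \<and> a <= - l \<and> - l < b \<and> mu_bar \<mu> (- l) = 0}"
      by (subst nn_integral_add) (auto simp: nn_integral_cmult_indicator)
    also have "... = neg_log_mu_bar \<mu> b - neg_log_mu_bar \<mu> a"
    proof -
      have ln_iff: "exp (- l) <= mu_bar \<mu> s \<longleftrightarrow> - ln (mu_bar \<mu> s) <= l" if "0 < mu_bar \<mu> s" for l s
        using that ln_ge_iff[of "mu_bar \<mu> s" "- l"] by auto
      have ln_nonneg: "0 <= - ln (mu_bar \<mu> s)" if "0 < mu_bar \<mu> s" for s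
        using that mu_bar_bounds(2)[of s] by simp
      consider "mu_bar \<mu> b > 0" | "mu_bar \<mu> b = 0" "mu_bar \<mu> a > 0" | "mu_bar \<mu> b = 0" "mu_bar \<mu> a = 0"
        using mu_bar_bounds(1)[of a] mu_bar_bounds(1)[of b] by fastforce
      then show ?thesis
      proof cases
        case 1
        then have a: "mu_bar \<mu> a > 0" using mu_bar_antimono[of a b] ab by simp
        have "mu_bar \<mu> (- l) \<noteq> 0" if "- l < b" for l using 1 mu_bar_antimono[of "- l" b] that by auto
        then have "{l. l < 0 \<and> a <= - l \<and> - l < b \<and> mu_bar \<mu> (- l) = 0} = {}" by auto
        then have "emeasure lborel {l. l < 0 \<and> a <= - l \<and> - l < b \<and> mu_bar \<mu> (- l) = 0} = 0" by (simp only: emeasure_empty)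
        moreover have "{l. 0 <= l \<and> exp (- l) <= mu_bar \<mu> a \<and> mu_bar \<mu> b < exp (- l)} = {- ln (mu_bar \<mu> a)..< - ln (mu_bar \<mu> b)}"
          using ln_iff[OF a] ln_iff[OF 1] ln_nonneg[OF a] by (force simp: not_le[symmetric])
        moreover have "- ln (mu_bar \<mu> a) <= - ln (mu_bar \<mu> b)" using 1 mu_bar_antimono[of a b] ab by simp
        ultimately show ?thesis using 1 a ln_nonneg[OF a]
          by (simp add: neg_log_mu_bar_def ennreal_minus)
      next
        case 2
        have "{l. 0 <= l \<and> exp (- l) <= mu_bar \<mu> a \<and> mu_bar \<mu> b < exp (- l)} = {- ln (mu_bar \<mu> a)..}"
          using ln_iff[OF 2(2)] ln_nonneg[OF 2(2)] 2(1) by force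
        moreover have "emeasure lborel {- ln (mu_bar \<mu> a)..} = \<top>"
        proof (rule ccontr)
          assume "emeasure lborel {- ln (mu_bar \<mu> a)..} \<noteq> \<top>"
          then obtain q where q: "emeasure lborel {- ln (mu_bar \<mu> a)..} = ennreal q" "0 <= q" by (cases "emeasure lborel {- ln (mu_bar \<mu> a)..}") auto
          have "emeasure lborel {- ln (mu_bar \<mu> a)..- ln (mu_bar \<mu> a) + (q + 1)} <= emeasure lborel {- ln (mu_bar \<mu> a)..}"
            by (intro emeasure_mono) auto
          then show False using q by simp
        qed
        ultimately show ?thesis using 2 by (simp add: neg_log_mu_bar_def)
      next
        case 3
        have a0: "0 < a" using 3(2) mu_bar_nonpos[of a] by (cases "a <= 0") auto
        have "mu_bar \<mu> (- l) = 0" if "a <= - l" for l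
          using mu_bar_antimono[OF that] 3(2) mu_bar_bounds(1)[of "- l"] by simp
        then have "{l. l < 0 \<and> a <= - l \<and> - l < b \<and> mu_bar \<mu> (- l) = 0} = {- b<..- a}"
          using a0 by force
        moreover have "{l. 0 <= l \<and> exp (- l) <= mu_bar \<mu> a \<and> mu_bar \<mu> b < exp (- l)} = {}"
          using 3(2) by (auto simp: not_le)
        ultimately show ?thesis using 3 ab by (simp add: neg_log_mu_bar_def ennreal_top_mult)
      qed
    qed
    finally show ?thesis .
  qed
  then show ?thesis by (intro exI[of _ \<nu>]) (simp add: \<nu>_def)
qed

section \<open>The Lebesgue-Stieltjes measure of - log mu_bar\<close>

abbreviation "\<nu> \<equiv> neg_log_mu_bar_measure \<mu>"

lemma sets_nu: "sets \<nu> = sets borel"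
proof -
  have "sets \<nu> = sigma_sets UNIV ((\<lambda>(a, b). {a..<b}) ` {(a, b). a < b})"
    unfolding neg_log_mu_bar_measure_def by (rule sets_extend_measure) auto
  also have "... = sigma_sets UNIV (range (\<lambda>(a, b). {a..<b :: real}))"
  proof (rule sigma_sets_eqI)
    fix A assume "A \<in> range (\<lambda>(a, b). {a..<b :: real})"
    then obtain a b where A: "A = {a..<b}" by auto
    show "A \<in> sigma_sets UNIV ((\<lambda>(a, b). {a..<b}) ` {(a, b). a < b})"
    proof (cases "a < b")
      case True then show ?thesis unfolding A by (intro sigma_sets.Basic) auto
    next
      case False then have "A = {}" by (simp add: A)
      then show ?thesis by (simp add: sigma_sets.Empty)
    qed
  qed auto
  also have "... = sets borel"
    unfolding borel_eq_atLeastLessThan by (rule sets_measure_of[symmetric]) auto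
  finally show ?thesis .
qed

text \<open>\<open>extend_measure\<close> takes the prescribed values on intervals once some measure
  is known to have them; \<open>neg_log_measure_exists\<close> supplies one.\<close>

lemma emeasure_nu:
  assumes "a < b"
  shows "emeasure \<nu> {a..<b} = neg_log_mu_bar \<mu> b - neg_log_mu_bar \<mu> a"
proof -
  obtain \<nu>0 where n: "sets \<nu>0 = sets borel" "\<And>a b. a < b ==> emeasure \<nu>0 {a..<b} = neg_log_mu_bar \<mu> b - neg_log_mu_bar \<mu> a"
    using neg_log_measure_exists by auto
  have s: "sets \<nu> = sets \<nu>0" using sets_nu n(1) by simp
  show ?thesis
  proof (rule emeasure_extend_measure_Pair[OF neg_log_mu_bar_measure_def])
    show "emeasure \<nu>0 {i..<j} = neg_log_mu_bar \<mu> j - neg_log_mu_bar \<mu> i" if "i < j" for i j using n(2)[OF that] .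
    show "positive (sets \<nu>) (emeasure \<nu>0)" unfolding s by (rule emeasure_positive)
    show "countably_additive (sets \<nu>) (emeasure \<nu>0)" unfolding s by (rule emeasure_countably_additive)
  qed (use assms in auto)
qed

lemma emeasure_nu_finite: "0 < y ==> 0 < mu_bar \<mu> y ==> emeasure \<nu> {0..<y} = ennreal (- ln (mu_bar \<mu> y))"
  using emeasure_nu[of 0 y] by (simp add: neg_log_mu_bar_def mu_bar_nonpos)

lemma emeasure_nu_infinite: "a < y ==> mu_bar \<mu> y = 0 ==> emeasure \<nu> {a..<y} = \<top>"
  using emeasure_nu[of a y] by (simp add: neg_log_mu_bar_def)

text \<open>\<open>mu_bar\<close> tends to 1 at 0 because \<mu> charges only the positive half-line.
  Without mass at 0, the cancellation of W x against 1 / W x, which fails at x = 0, holds almost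
  everywhere.\<close>

lemma emeasure_nu_0: "emeasure \<nu> {0} = 0"
proof -
  have "emeasure \<nu> {0} <= 0 + ennreal e" if e: "e > 0" for e
  proof -
    have "0 < 1 - exp (- e)" using e by simp
    from mu_bar_to_one[OF this] obtain y where y: "y > 0" "exp (- e) < mu_bar \<mu> y" by auto
    then have p: "0 < mu_bar \<mu> y" by (meson exp_gt_zero less_trans)
    have "emeasure \<nu> {0} <= emeasure \<nu> {0..<y}" using y by (intro emeasure_mono) (auto simp: sets_nu)
    also have "... = ennreal (- ln (mu_bar \<mu> y))" by (rule emeasure_nu_finite[OF y(1) p])
    also have "... <= ennreal e" using y p ln_ge_iff[OF p, of "- e"] by (intro ennreal_leI) auto
    finally show ?thesis by simp
  qed
  then have "emeasure \<nu> {0} <= 0" by (rule ennreal_le_epsilon)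
  then show ?thesis by simp
qed

section \<open>The function psi_mu and its inverse\<close>

context
  fixes W :: "real => real"
  assumes W_mono: "\<And>x y. x <= y ==> W x <= W y" and W_nonpos: "\<And>x. x <= 0 ==> W x = 0"
    and W_pos: "\<And>x. 0 < x ==> 0 < W x"
begin

lemma W_nonneg': "0 <= W x"
  using W_nonpos[of x] W_pos[of x] by (cases "x <= 0") auto

lemma W_measurable': "W \<in> borel_measurable borel"
  by (rule borel_measurable_mono) (auto intro!: monoI W_mono)

lemma W_measurable_nu[measurable]: "W \<in> borel_measurable \<nu>"
  using W_measurable' by (simp add: measurable_cong_sets[OF sets_nu refl])

abbreviation "\<psi>m \<equiv> psi_mu W \<mu>"

lemma nu_sets[measurable]: "A \<in> sets borel ==> A \<in> sets \<nu>"
  by (simp add: sets_nu)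

lemma psi_mono: "y <= z ==> \<psi>m y <= \<psi>m z"
  unfolding psi_mu_def by (intro nn_integral_mono) (auto split: split_indicator)

lemma psi_nonpos: "y <= 0 ==> \<psi>m y = 0"
  unfolding psi_mu_def by (subst nn_integral_cong[where v="\<lambda>_. 0"]) (auto split: split_indicator)

lemma psi_le: "0 < y ==> 0 < mu_bar \<mu> y ==> \<psi>m y <= ennreal (W y * - ln (mu_bar \<mu> y))"
proof -
  assume y: "0 < y" "0 < mu_bar \<mu> y"
  have "\<psi>m y <= (\<integral>\<^sup>+s. ennreal (W y) * indicator {0..<y} s \<partial>\<nu>)"
    unfolding psi_mu_def by (intro nn_integral_mono) (auto intro!: ennreal_leI W_mono split: split_indicator)
  also have "... = ennreal (W y) * ennreal (- ln (mu_bar \<mu> y))"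
    by (subst nn_integral_cmult_indicator) (auto simp: emeasure_nu_finite[OF y])
  also have "... = ennreal (W y * - ln (mu_bar \<mu> y))" using y mu_bar_bounds(2)[of y] by (intro ennreal_mult[symmetric] W_nonneg') simp
  finally show ?thesis .
qed

lemma psi_ge: "0 < a ==> a < y ==> ennreal (W a) * emeasure \<nu> {a..<y} <= \<psi>m y"
proof -
  assume a: "0 < a" "a < y"
  have "ennreal (W a) * emeasure \<nu> {a..<y} = (\<integral>\<^sup>+s. ennreal (W a) * indicator {a..<y} s \<partial>\<nu>)"
    by (subst nn_integral_cmult_indicator) auto
  also have "... <= \<psi>m y"
    unfolding psi_mu_def using a by (intro nn_integral_mono) (auto intro!: ennreal_leI W_mono split: split_indicator)
  finally show ?thesis .
qed

lemma psi_finite: "0 < mu_bar \<mu> y ==> \<psi>m y < \<top>"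
  using psi_le[of y] psi_nonpos[of y] by (cases "y <= 0") (auto intro: le_less_trans)

text \<open>Every interval [a, y) has infinite \<nu>-mass for such \<open>y\<close>, and
  \<open>W\<close> is bounded below by W (y / 2) > 0 on [y / 2, y).\<close>

lemma psi_infinite: "mu_bar \<mu> y = 0 ==> \<psi>m y = \<top>"
proof -
  assume y: "mu_bar \<mu> y = 0"
  have y0: "0 < y" using y mu_bar_nonpos[of y] by (cases "y <= 0") auto
  have "ennreal (W (y / 2)) * emeasure \<nu> {y / 2..<y} <= \<psi>m y" using y0 by (intro psi_ge) auto
  moreover have "emeasure \<nu> {y / 2..<y} = \<top>" using y0 y by (intro emeasure_nu_infinite) auto
  moreover have "0 < W (y / 2)" using y0 by (intro W_pos) simp
  ultimately show ?thesis by (simp add: ennreal_mult_top top_unique)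
qed

text \<open>Left-continuity of \<open>psi_mu\<close>, from the half-open domain [0, y) and monotone
  convergence; it gives \<open>bm_less_iff\<close> its exact form.\<close>

lemma psi_left: "l < \<psi>m y ==> \<exists>z\<ge>0. z < y \<and> l < \<psi>m z"
proof -
  assume l: "l < \<psi>m y"
  have y0: "0 < y" using l psi_nonpos[of y] by (cases "y <= 0") auto
  define z where "z n = y - y / real (Suc n)" for n
  have z: "0 <= z n" "z n < y" for n using y0 by (auto simp: z_def field_simps)
  have inc: "z n <= z (Suc n)" for n using y0 by (simp add: z_def frac_le)
  have "\<psi>m y = (\<integral>\<^sup>+s. (SUP n. ennreal (W s) * indicator {0..<z n} s) \<partial>\<nu>)"
    unfolding psi_mu_def
  proof (rule nn_integral_cong)
    fix s
    show "ennreal (W s) * indicator {0..<y} s = (SUP n. ennreal (W s) * indicator {0..<z n} s)"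
    proof (cases "s \<in> {0..<y}")
      case True
      have "(\<lambda>n. y - y * (1 / real (Suc n))) \<longlonglongrightarrow> y - y * 0"
        by (intro tendsto_diff tendsto_mult tendsto_const LIMSEQ_Suc[OF lim_1_over_n])
      then have "\<forall>\<^sub>F n in sequentially. s < y - y * (1 / real (Suc n))" using True by (intro order_tendstoD(1)) auto
      then obtain n where n: "s < z n" by (auto simp: eventually_sequentially z_def)
      show ?thesis
      proof (rule antisym)
        have "ennreal (W s) * indicator {0..<y} s = ennreal (W s) * indicator {0..<z n} s" using True n by simp
        then show "ennreal (W s) * indicator {0..<y} s <= (SUP n. ennreal (W s) * indicator {0..<z n} s)"
          by (simp only:) (rule SUP_upper, simp)
        show "(SUP n. ennreal (W s) * indicator {0..<z n} s) <= ennreal (W s) * indicator {0..<y} s"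
          using True by (intro SUP_least) (auto split: split_indicator)
      qed
    next
      case False
      then have "indicator {0..<z n} s = (0::ennreal)" for n using z(2)[of n] by (auto split: split_indicator)
      then show ?thesis using False by simp
    qed
  qed
  also have "... = (SUP n. \<integral>\<^sup>+s. ennreal (W s) * indicator {0..<z n} s \<partial>\<nu>)"
  proof (rule nn_integral_monotone_convergence_SUP)
    show "incseq (\<lambda>n s. ennreal (W s) * indicator {0..<z n} s)"
      by (rule incseq_SucI) (use inc in \<open>auto simp: le_fun_def intro: less_le_trans split: split_indicator\<close>)
  qed measurable
  finally have "l < (SUP n. \<psi>m (z n))" using l by (simp add: psi_mu_def)
  then obtain n where "l < \<psi>m (z n)" by (auto simp: less_SUP_iff)
  then show ?thesis using z by blast
qed

text \<open>Makes the infimum in \<open>phi_mu\<close> finite. If \<open>mu_bar\<close> reaches 0,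
  then \<open>psi_mu\<close> is infinite there; otherwise it is at least W 1 times the growth of -
  log \<open>mu_bar\<close> beyond 1, which is unbounded.\<close>

lemma psi_unbounded: "\<exists>y\<ge>0. ennreal l < \<psi>m y"
proof (cases "\<exists>y. mu_bar \<mu> y = 0")
  case True
  then obtain y where y: "mu_bar \<mu> y = 0" by blast
  then have "0 < y" using mu_bar_nonpos[of y] by (cases "y <= 0") auto
  then show ?thesis using psi_infinite[OF y] by (intro exI[of _ y]) auto
next
  case False
  then have p: "0 < mu_bar \<mu> y" for y using mu_bar_bounds(1)[of y] by (simp add: less_le)
  have W1: "0 < W 1" by (rule W_pos) simp
  \<comment> \<open>If - log \<open>mu_bar\<close> exceeds \<open>k\<close> at y, its growth from 1
    to y exceeds |l| / W 1.\<close>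
  define k where "k = \<bar>l\<bar> / W 1 + 1 - ln (mu_bar \<mu> 1)"
  obtain y' where y': "y' > 0" "mu_bar \<mu> y' < exp (- k)" using mu_bar_to_zero[of "exp (- k)"] by auto
  define y where "y = max y' 2"
  have y: "1 < y" "mu_bar \<mu> y < exp (- k)" using y' mu_bar_antimono[of y' y] by (auto simp: y_def)
  have "ln (mu_bar \<mu> y) < - k" using y p[of y] by (metis exp_gt_zero ln_exp ln_less_cancel_iff)
  then have k: "k < - ln (mu_bar \<mu> y)" by simp
  have m: "emeasure \<nu> {1..<y} = ennreal (- ln (mu_bar \<mu> y) - - ln (mu_bar \<mu> 1))"
    using emeasure_nu[OF y(1)] p[of y] p[of 1] mu_bar_bounds(2)[of 1] by (simp add: neg_log_mu_bar_def ennreal_minus)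
  have pos: "\<bar>l\<bar> / W 1 < - ln (mu_bar \<mu> y) - - ln (mu_bar \<mu> 1)" using k by (simp add: k_def)
  have "l <= \<bar>l\<bar>" by simp
  also have "\<bar>l\<bar> = W 1 * (\<bar>l\<bar> / W 1)" using W1 by simp
  also have "... < W 1 * (- ln (mu_bar \<mu> y) - - ln (mu_bar \<mu> 1))" using pos W1 by (intro mult_strict_left_mono)
  finally have lt: "l < W 1 * (- ln (mu_bar \<mu> y) - - ln (mu_bar \<mu> 1))" .
  have nn: "0 <= - ln (mu_bar \<mu> y) - - ln (mu_bar \<mu> 1)" using pos W1 by (meson abs_ge_zero divide_nonneg_pos less_imp_le order_trans)
  have "0 < W 1 * (- ln (mu_bar \<mu> y) - - ln (mu_bar \<mu> 1))"
    using W1 le_less_trans[OF _ pos, of 0] by (intro mult_pos_pos) (simp_all add: zero_le_divide_iff)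
  then have "ennreal l < ennreal (W 1 * (- ln (mu_bar \<mu> y) - - ln (mu_bar \<mu> 1)))" using lt by (simp add: ennreal_lessI)
  also have "... = ennreal (W 1) * emeasure \<nu> {1..<y}" unfolding m using W1 nn by (intro ennreal_mult) auto
  also have "... <= \<psi>m y" using y by (intro psi_ge) auto
  finally show ?thesis using y by (intro exI[of _ y]) auto
qed

text \<open>Near 0 the \<nu>-mass is small and \<open>W\<close> is at most W 1; \<open>d\<close>
  makes both the mass and W 1 times the mass small enough.\<close>

lemma psi_small: "e > 0 ==> \<exists>y>0. 0 < mu_bar \<mu> y \<and> - ln (mu_bar \<mu> y) < e \<and> \<psi>m y <= ennreal e"
proof -
  assume e: "e > 0"
  have W1: "0 < W 1" by (rule W_pos) simp
  define d where "d = min e (e / W 1) / 2"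
  have d: "0 < d" "d < e" "W 1 * d <= e"
  proof -
    show "0 < d" using e W1 by (simp add: d_def)
    show "d < e" using e W1 by (auto simp: d_def min_def)
    have "W 1 * d <= W 1 * (e / W 1)" using W1 e by (intro mult_left_mono) (auto simp: d_def min_def field_simps)
    then show "W 1 * d <= e" using W1 by simp
  qed
  have "0 < 1 - exp (- d)" using d by simp
  from mu_bar_to_one[OF this] obtain y' where y': "y' > 0" "exp (- d) < mu_bar \<mu> y'" by auto
  define y where "y = min y' 1"
  have y: "0 < y" "y <= 1" "exp (- d) < mu_bar \<mu> y" using y' mu_bar_antimono[of y y'] by (auto simp: y_def)
  have p: "0 < mu_bar \<mu> y" using y by (meson exp_gt_zero less_trans)
  have "- d < ln (mu_bar \<mu> y)" using y p by (metis exp_gt_zero ln_exp ln_less_cancel_iff)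
  then have l: "- ln (mu_bar \<mu> y) < d" by simp
  have "\<psi>m y <= ennreal (W y * - ln (mu_bar \<mu> y))" by (rule psi_le[OF y(1) p])
  also have "... <= ennreal (W 1 * d)"
    using l W_mono[OF y(2)] W_nonneg' p mu_bar_bounds(2)[of y] by (intro ennreal_leI mult_mono) auto
  also have "... <= ennreal e" using d by (intro ennreal_leI)
  finally show ?thesis using y p l d by (intro exI[of _ y]) auto
qed

definition bm :: "real => real" where
  "bm l = real_of_ereal (phi_mu W \<mu> l)"

lemma phi_eq: "phi_mu W \<mu> l = ereal (bm l)" and bm_nonneg: "0 <= bm l"
proof -
  obtain y where y: "0 <= y" "ennreal l < \<psi>m y" using psi_unbounded by blast
  have "phi_mu W \<mu> l <= ereal y" unfolding phi_mu_def using y by (intro Inf_lower) auto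
  moreover have "0 <= phi_mu W \<mu> l" unfolding phi_mu_def by (intro Inf_greatest) auto
  ultimately show "phi_mu W \<mu> l = ereal (bm l)" "0 <= bm l" unfolding bm_def by (cases "phi_mu W \<mu> l"; simp)+
qed

text \<open>The Galois connection behind what follows: it yields monotonicity and right-continuity
  of \<open>bm\<close> and translates events about \<open>X\<close> at the passage into events about
  \<open>L\<close>.\<close>

lemma bm_less_iff: "bm l < z \<longleftrightarrow> ennreal l < \<psi>m z"
proof -
  have "bm l < z \<longleftrightarrow> phi_mu W \<mu> l < ereal z" by (simp add: phi_eq)
  also have "... \<longleftrightarrow> (\<exists>y\<ge>0. y < z \<and> ennreal l < \<psi>m y)" unfolding phi_mu_def Inf_less_iff by auto
  also have "... \<longleftrightarrow> ennreal l < \<psi>m z"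
    using psi_left[of "ennreal l" z] psi_mono[of _ z] by (auto intro: less_le_trans)
  finally show ?thesis .
qed

lemma bm_mono: "0 <= l ==> l <= l' ==> bm l <= bm l'"
proof (rule ccontr)
  assume l: "0 <= l" "l <= l'" and "\<not> bm l <= bm l'"
  then have "ennreal l' < \<psi>m (bm l)" using bm_less_iff[of l' "bm l"] by simp
  then have "ennreal l < \<psi>m (bm l)" using l by (meson ennreal_leI le_less_trans)
  then show False using bm_less_iff[of l "bm l"] by simp
qed

lemma bm_right: "0 <= l ==> (bm \<longlongrightarrow> bm l) (at_right l)"
proof (rule order_tendstoI)
  fix z assume l: "0 <= l" and z: "z < bm l"
  show "\<forall>\<^sub>F l' in at_right l. z < bm l'"
    by (rule eventually_mono[OF eventually_at_right_less]) (use z bm_mono[OF l] in \<open>auto intro: less_le_trans less_imp_le\<close>)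
next
  fix z assume l: "0 <= l" and z: "bm l < z"
  then have "ennreal l < \<psi>m z" by (simp add: bm_less_iff)
  then obtain m where m: "l < m" "ennreal m < \<psi>m z"
  proof (cases "\<psi>m z")
    case (real p)
    then have "l < p" using \<open>ennreal l < \<psi>m z\<close> l by (simp add: ennreal_less_iff)
    then have "l < (l + p) / 2" "(l + p) / 2 < p" "0 <= (l + p) / 2" using l by auto
    then show ?thesis using that[of "(l + p) / 2"] real by (simp add: ennreal_less_iff)
  next
    case top then show ?thesis using that[of "l + 1"] by simp
  qed
  show "\<forall>\<^sub>F l' in at_right l. bm l' < z"
    unfolding eventually_at_right_field
  proof (intro exI[of _ m] conjI allI impI m(1))
    fix l' assume "l < l'" "l' < m"
    then have "ennreal l' < \<psi>m z" using m(2) by (meson ennreal_leI less_imp_le le_less_trans)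
    then show "bm l' < z" by (simp add: bm_less_iff)
  qed
qed

lemma bm_pos: "0 < l ==> 0 < bm l"
proof -
  assume "0 < l"
  then obtain y where "0 < y" "\<psi>m y <= ennreal l" using psi_small by blast
  then show ?thesis using bm_less_iff[of l y] by (simp add: not_less[symmetric])
qed

lemma bm_measurable: "(\<lambda>l. bm (max 0 l)) \<in> borel_measurable borel"
  by (rule borel_measurable_mono) (auto intro!: monoI bm_mono)

text \<open>The substitution s = psi_mu x: \<open>bm\<close> carries Lebesgue measure on [0, psi_mu
  y) to the measure with \<nu>-density W on [0, y), because by \<open>bm_less_iff\<close> both give
  the half-line below z the mass psi_mu (min z y).\<close>

lemma nn_integral_bm:
  assumes y: "0 < mu_bar \<mu> y" and f[measurable]: "f \<in> borel_measurable borel"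
  shows "(\<integral>\<^sup>+s. indicator {0..<enn2real (\<psi>m y)} s * f (bm s) \<partial>lborel) = (\<integral>\<^sup>+x. indicator {0..<y} x * (ennreal (W x) * f x) \<partial>\<nu>)"
proof -
  define \<Psi> where "\<Psi> = enn2real (\<psi>m y)"
  have \<Psi>: "\<psi>m y = ennreal \<Psi>" "0 <= \<Psi>" using psi_finite[OF y] by (auto simp: \<Psi>_def)
  note [measurable] = bm_measurable W_measurable'
  define m1 where "m1 = distr (density lborel (indicator {0..<\<Psi>})) borel (\<lambda>s. bm (max 0 s))"
  define m2 where "m2 = distr (density \<nu> (\<lambda>x. indicator {0..<y} x * ennreal (W x))) borel (\<lambda>x. x)"
  have idm: "(\<lambda>x. x) \<in> measurable \<nu> borel" by (rule measurable_ident_sets[OF sets_nu])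
  have dm: "(\<lambda>x. indicator {0..<y} x * ennreal (W x)) \<in> borel_measurable \<nu>"
    by (simp add: measurable_cong_sets[OF sets_nu refl])
  have i1: "(\<integral>\<^sup>+x. g x \<partial>m1) = (\<integral>\<^sup>+s. indicator {0..<\<Psi>} s * g (bm s) \<partial>lborel)" if [measurable]: "g \<in> borel_measurable borel" for g
  proof -
    have "(\<integral>\<^sup>+x. g x \<partial>m1) = (\<integral>\<^sup>+s. indicator {0..<\<Psi>} s * g (bm (max 0 s)) \<partial>lborel)"
      unfolding m1_def by (subst nn_integral_distr) (auto simp: nn_integral_density)
    also have "... = (\<integral>\<^sup>+s. indicator {0..<\<Psi>} s * g (bm s) \<partial>lborel)"
      by (intro nn_integral_cong) (auto split: split_indicator)
    finally show ?thesis .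
  qed
  have i2: "(\<integral>\<^sup>+x. g x \<partial>m2) = (\<integral>\<^sup>+x. indicator {0..<y} x * (ennreal (W x) * g x) \<partial>\<nu>)" if g: "g \<in> borel_measurable borel" for g
  proof -
    have g': "g \<in> borel_measurable \<nu>" using g by (simp add: measurable_cong_sets[OF sets_nu refl])
    have "(\<integral>\<^sup>+x. g x \<partial>m2) = (\<integral>\<^sup>+x. g x \<partial>density \<nu> (\<lambda>x. indicator {0..<y} x * ennreal (W x)))"
      unfolding m2_def by (rule nn_integral_distr) (use idm g in auto)
    also have "... = (\<integral>\<^sup>+x. (indicator {0..<y} x * ennreal (W x)) * g x \<partial>\<nu>)" by (rule nn_integral_density[OF dm g'])
    finally show ?thesis by (simp add: mult.assoc)
  qed
  have e1: "emeasure m1 {..<z} = \<psi>m (min z y)" for z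
  proof -
    have "emeasure m1 {..<z} = (\<integral>\<^sup>+x. indicator {..<z} x \<partial>m1)" by (simp add: m1_def)
    also have "... = (\<integral>\<^sup>+s. indicator {0..<\<Psi>} s * indicator {..<z} (bm s) \<partial>lborel)" by (rule i1) simp
    also have "... = (\<integral>\<^sup>+s. indicator {0..<enn2real (\<psi>m (min z y))} s \<partial>lborel)"
    proof (rule nn_integral_cong)
      fix s :: real
      have fin: "\<psi>m (min z y) < \<top>" using psi_mono[of "min z y" y] \<Psi> by (auto intro: le_less_trans)
      have "s < enn2real (\<psi>m (min z y)) \<longleftrightarrow> s < \<Psi> \<and> bm s < z" if s: "0 <= s" for s
      proof -
        have "s < enn2real (\<psi>m (min z y)) \<longleftrightarrow> ennreal s < \<psi>m (min z y)"
          using s fin by (cases "\<psi>m (min z y)") (auto simp: ennreal_less_iff)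
        also have "... \<longleftrightarrow> ennreal s < \<psi>m z \<and> ennreal s < \<psi>m y"
        proof (cases "z <= y")
          case True then show ?thesis using psi_mono[OF True] by (auto simp: min_def intro: less_le_trans)
        next
          case False then have "y <= z" by simp
          then show ?thesis using psi_mono[OF \<open>y <= z\<close>] by (auto simp: min_def intro: less_le_trans)
        qed
        also have "... \<longleftrightarrow> s < \<Psi> \<and> bm s < z" using s \<Psi> by (auto simp: bm_less_iff ennreal_less_iff)
        finally show ?thesis .
      qed
      then show "indicator {0..<\<Psi>} s * indicator {..<z} (bm s) = (indicator {0..<enn2real (\<psi>m (min z y))} s :: ennreal)"
        by (auto split: split_indicator)
    qed
    also have "... = ennreal (enn2real (\<psi>m (min z y)))" by simp
    also have "... = \<psi>m (min z y)" using psi_mono[of "min z y" y] \<Psi> by (intro ennreal_enn2real) (auto intro: le_less_trans)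
    finally show ?thesis .
  qed
  have e2: "emeasure m2 {..<z} = \<psi>m (min z y)" for z
  proof -
    have "emeasure m2 {..<z} = (\<integral>\<^sup>+x. indicator {..<z} x \<partial>m2)" by (simp add: m2_def)
    also have "... = (\<integral>\<^sup>+x. indicator {0..<y} x * (ennreal (W x) * indicator {..<z} x) \<partial>\<nu>)" by (rule i2) simp
    also have "... = \<psi>m (min z y)"
      unfolding psi_mu_def by (intro nn_integral_cong) (auto split: split_indicator)
    finally show ?thesis .
  qed
  have "m1 = m2"
  proof (rule measure_eq_if_lessThan_eq)
    show "emeasure m1 {..<z} \<noteq> \<infinity>" for z
      unfolding e1 using psi_mono[of "min z y" y] \<Psi> by (auto simp: top_unique)
  qed (auto simp: e1 e2, auto simp: m1_def m2_def)
  then show ?thesis using i1[OF f] i2[OF f] by (simp add: \<Psi>_def)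
qed

section \<open>The cumulative hazard\<close>

definition Cm :: "real => ennreal" where
  "Cm r = (\<integral>\<^sup>+s. indicator {0..<r} s * ennreal (1 / W (bm s)) \<partial>lborel)"

lemma Cm_0: "Cm 0 = 0"
  by (simp add: Cm_def)

text \<open>The substitution with f = 1 / W cancels the density W and leaves the \<nu>-mass of [0,
  y).\<close>

lemma Cm_psi:
  assumes y: "0 < mu_bar \<mu> y"
  shows "Cm (enn2real (\<psi>m y)) = ennreal (- ln (mu_bar \<mu> y))"
proof (cases "y <= 0")
  case True
  then show ?thesis by (simp add: psi_nonpos mu_bar_nonpos Cm_def)
next
  case False
  note [measurable] = W_measurable'
  have "Cm (enn2real (\<psi>m y)) = (\<integral>\<^sup>+x. indicator {0..<y} x * (ennreal (W x) * ennreal (1 / W x)) \<partial>\<nu>)"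
    unfolding Cm_def by (rule nn_integral_bm[OF y]) measurable
  also have "... = (\<integral>\<^sup>+x. indicator {0..<y} x \<partial>\<nu>)"
  proof (rule nn_integral_cong_AE)
    have "AE x in \<nu>. x \<notin> {0}" by (rule AE_not_in) (simp add: null_sets_def emeasure_nu_0 sets_nu)
    then show "AE x in \<nu>. indicator {0..<y} x * (ennreal (W x) * ennreal (1 / W x)) = (indicator {0..<y} x :: ennreal)"
    proof eventually_elim
      case (elim x)
      have "ennreal (W x) * ennreal (1 / W x) = 1" if "0 < x"
        using W_pos[OF that] by (simp add: ennreal_mult[symmetric])
      then show ?case using elim by (auto split: split_indicator)
    qed
  qed
  also have "... = ennreal (- ln (mu_bar \<mu> y))" using emeasure_nu_finite[of y] False y by simp
  finally show ?thesis .
qed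

lemma Cm_mono: "r <= r' ==> Cm r <= Cm r'"
  unfolding Cm_def by (intro nn_integral_mono) (auto split: split_indicator)

lemma rate_antimono: "0 < s ==> s <= r ==> 1 / W (bm r) <= 1 / W (bm s)"
  using W_pos[OF bm_pos[of s]] W_mono[OF bm_mono[of s r]] by (intro divide_left_mono) auto

lemma rate_nonneg: "0 <= 1 / W (bm s)"
  by (simp add: W_nonneg')

lemma Cm_split:
  assumes s: "0 < s" "s < r"
  shows "Cm r = Cm s + (\<integral>\<^sup>+u. indicator {s..<r} u * ennreal (1 / W (bm u)) \<partial>lborel)"
    and "(\<integral>\<^sup>+u. indicator {s..<r} u * ennreal (1 / W (bm u)) \<partial>lborel) <= ennreal ((r - s) * (1 / W (bm s)))"
    and "ennreal ((r - s) * (1 / W (bm r))) <= (\<integral>\<^sup>+u. indicator {s..<r} u * ennreal (1 / W (bm u)) \<partial>lborel)"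
proof -
  note [measurable] = bm_measurable W_measurable'
  have "Cm r = (\<integral>\<^sup>+u. indicator {0..<s} u * ennreal (1 / W (bm (max 0 u))) + indicator {s..<r} u * ennreal (1 / W (bm (max 0 u))) \<partial>lborel)"
    unfolding Cm_def using s by (intro nn_integral_cong) (auto split: split_indicator)
  also have "... = (\<integral>\<^sup>+u. indicator {0..<s} u * ennreal (1 / W (bm (max 0 u))) \<partial>lborel) + (\<integral>\<^sup>+u. indicator {s..<r} u * ennreal (1 / W (bm (max 0 u))) \<partial>lborel)"
    by (rule nn_integral_add) measurable
  also have "(\<integral>\<^sup>+u. indicator {0..<s} u * ennreal (1 / W (bm (max 0 u))) \<partial>lborel) = Cm s"
    unfolding Cm_def by (intro nn_integral_cong) (auto split: split_indicator)
  also have "(\<integral>\<^sup>+u. indicator {s..<r} u * ennreal (1 / W (bm (max 0 u))) \<partial>lborel) = (\<integral>\<^sup>+u. indicator {s..<r} u * ennreal (1 / W (bm u)) \<partial>lborel)"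
    using s by (intro nn_integral_cong) (auto split: split_indicator)
  finally show "Cm r = Cm s + (\<integral>\<^sup>+u. indicator {s..<r} u * ennreal (1 / W (bm u)) \<partial>lborel)" .
  have "(\<integral>\<^sup>+u. indicator {s..<r} u * ennreal (1 / W (bm u)) \<partial>lborel) <= (\<integral>\<^sup>+u. ennreal (1 / W (bm s)) * indicator {s..<r} u \<partial>lborel)"
    using s by (intro nn_integral_mono) (auto intro!: ennreal_leI rate_antimono split: split_indicator)
  also have "... = ennreal ((r - s) * (1 / W (bm s)))"
    using s rate_nonneg[of s] by (simp add: nn_integral_cmult_indicator ennreal_mult[symmetric])
  finally show "(\<integral>\<^sup>+u. indicator {s..<r} u * ennreal (1 / W (bm u)) \<partial>lborel) <= ennreal ((r - s) * (1 / W (bm s)))" .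
  have "ennreal ((r - s) * (1 / W (bm r))) = (\<integral>\<^sup>+u. ennreal (1 / W (bm r)) * indicator {s..<r} u \<partial>lborel)"
    using s rate_nonneg[of r] by (simp add: nn_integral_cmult_indicator ennreal_mult[symmetric])
  also have "... <= (\<integral>\<^sup>+u. indicator {s..<r} u * ennreal (1 / W (bm u)) \<partial>lborel)"
    using s by (intro nn_integral_mono) (auto intro!: ennreal_leI rate_antimono split: split_indicator)
  finally show "ennreal ((r - s) * (1 / W (bm r))) <= (\<integral>\<^sup>+u. indicator {s..<r} u * ennreal (1 / W (bm u)) \<partial>lborel)" .
qed

text \<open>If the barrier starts above 0, the rate is bounded. If it starts at 0, the rate may blow
  up and smallness comes from \<open>Cm_psi\<close> at a small y, where psi_mu y > 0 because bm 0 =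
  0 < y.\<close>

lemma Cm_small: "e > 0 ==> \<exists>r>0. Cm r <= ennreal e"
proof (cases "bm 0 = 0")
  case False
  assume e: "e > 0"
  have b0: "0 < bm 0" using False bm_nonneg[of 0] by simp
  define c where "c = 1 / W (bm 0)"
  have c: "c > 0" using W_pos[OF b0] by (simp add: c_def)
  have "Cm (e / c) <= (\<integral>\<^sup>+u. ennreal c * indicator {0..<e / c} u \<partial>lborel)"
    unfolding Cm_def
  proof (rule nn_integral_mono)
    fix u :: real
    have "1 / W (bm u) <= c" if "0 <= u"
      unfolding c_def using W_pos[OF b0] W_mono[OF bm_mono[of 0 u]] that by (intro divide_left_mono) auto
    then show "indicator {0..<e / c} u * ennreal (1 / W (bm u)) <= ennreal c * indicator {0..<e / c} u"
      by (auto intro!: ennreal_leI split: split_indicator)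
  qed
  also have "... = ennreal e" using e c by (simp add: nn_integral_cmult_indicator ennreal_mult[symmetric])
  finally show ?thesis using e c by (intro exI[of _ "e / c"]) auto
next
  case True
  assume e: "e > 0"
  obtain y where y: "y > 0" "0 < mu_bar \<mu> y" "- ln (mu_bar \<mu> y) < e" using psi_small[OF e] by blast
  have "0 < \<psi>m y" using bm_less_iff[of 0 y] True y(1) by simp
  then have "0 < enn2real (\<psi>m y)" using psi_finite[OF y(2)] by (simp add: enn2real_positive_iff)
  moreover have "Cm (enn2real (\<psi>m y)) <= ennreal e" unfolding Cm_psi[OF y(2)] using y by (intro ennreal_leI) simp
  ultimately show ?thesis by blast
qed

lemma Cm_finite: "Cm r < \<top>"
proof -
  obtain r0 where r0: "r0 > 0" "Cm r0 <= ennreal 1" using Cm_small[of 1] by auto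
  have f0: "Cm r0 < \<top>" using r0(2) by (rule le_less_trans) simp
  show ?thesis
  proof (cases "r <= r0")
    case True show ?thesis using Cm_mono[OF True] f0 by (rule le_less_trans)
  next
    case False
    then have "r0 < r" by simp
    note sp = Cm_split[OF r0(1) this]
    have "(\<integral>\<^sup>+u. indicator {r0..<r} u * ennreal (1 / W (bm u)) \<partial>lborel) < \<top>" using sp(2) by (rule le_less_trans) simp
    then show ?thesis unfolding sp(1) using f0 by (simp add: ennreal_add_less_top)
  qed
qed

lemma hazard_Cm: "hazard (\<lambda>s. 1 / W (bm s)) (\<lambda>r. enn2real (Cm r))"
  unfolding hazard_def
proof (intro conjI allI impI)
  have eq: "ennreal (enn2real (Cm r)) = Cm r" for r using Cm_finite by (rule ennreal_enn2real)
  show "0 <= 1 / W (bm s)" for s by (rule rate_nonneg)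
  show "1 / W (bm r) <= 1 / W (bm s)" if "0 < s \<and> s <= r" for s r using that by (intro rate_antimono) auto
  fix s r :: real assume "0 < s \<and> s < r"
  then have s: "0 < s" "s < r" by auto
  define I where "I = (\<integral>\<^sup>+u. indicator {s..<r} u * ennreal (1 / W (bm u)) \<partial>lborel)"
  note sp = Cm_split[OF s, folded I_def]
  have I: "I < \<top>" using sp(2) by (rule le_less_trans) simp
  have d: "enn2real (Cm r) - enn2real (Cm s) = enn2real I"
    unfolding sp(1) using Cm_finite[of s] I by (simp add: enn2real_plus)
  show "(r - s) * (1 / W (bm r)) <= enn2real (Cm r) - enn2real (Cm s)"
    unfolding d using sp(3) I s rate_nonneg[of r] by (metis ennreal_enn2real ennreal_le_iff enn2real_nonneg)
  show "enn2real (Cm r) - enn2real (Cm s) <= (r - s) * (1 / W (bm s))"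
    unfolding d using sp(2) s rate_nonneg[of s] by (intro enn2real_leI) auto
next
  show "((\<lambda>r. enn2real (Cm r)) \<longlongrightarrow> 0) (at_right 0)"
  proof (rule tendstoI)
    fix e :: real assume e: "0 < e"
    obtain r0 where r0: "r0 > 0" "Cm r0 <= ennreal (e / 2)" using Cm_small[of "e / 2"] e by auto
    show "\<forall>\<^sub>F r in at_right 0. dist (enn2real (Cm r)) 0 < e"
      unfolding eventually_at_right_field
    proof (intro exI[of _ r0] conjI allI impI r0(1))
      fix r assume "0 < r" "r < r0"
      then have "Cm r <= ennreal (e / 2)" using Cm_mono[of r r0] r0(2) by (auto intro: order_trans)
      then have "enn2real (Cm r) <= e / 2" using e by (intro enn2real_leI) auto
      then show "dist (enn2real (Cm r)) 0 < e" using e by (simp add: dist_real_def)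
    qed
  qed
qed

text \<open>If \<open>mu_bar\<close> vanishes at some y, the barrier stays below y and the rate is
  at least 1 / W y. Otherwise \<open>Cm_psi\<close> gives the values - log \<open>mu_bar\<close>,
  which are unbounded.\<close>

lemma Cm_at_top: "filterlim (\<lambda>r. enn2real (Cm r)) at_top at_top"
  unfolding filterlim_at_top eventually_at_top_linorder
proof
  fix Z :: real
  have mono: "enn2real (Cm r) <= enn2real (Cm r')" if "r <= r'" for r r'
    using Cm_mono[OF that] Cm_finite[of r'] by (intro enn2real_mono) auto
  show "\<exists>N. \<forall>r\<ge>N. Z <= enn2real (Cm r)"
  proof (cases "\<exists>y. mu_bar \<mu> y = 0")
    case True
    then obtain y where y: "mu_bar \<mu> y = 0" by blast
    have bl: "bm l < y" for l using bm_less_iff[of l y] psi_infinite[OF y] by simp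
    have y0: "0 < y" using bl[of 0] bm_nonneg[of 0] by simp
    have Wy: "0 < W y" by (rule W_pos[OF y0])
    have "Z <= enn2real (Cm r)" if r: "r >= 2 + \<bar>Z\<bar> * W y" for r
    proof -
      have r1: "1 < r" using r Wy by (smt (verit) mult_nonneg_nonneg abs_ge_zero less_imp_le)
      have h: "(r - 1) * (1 / W (bm r)) <= enn2real (Cm r) - enn2real (Cm 1)"
        using hazard_Cm r1 unfolding hazard_def by (auto simp del: times_divide_eq_right)
      have "0 < W (bm r)" using r1 by (intro W_pos bm_pos) simp
      moreover have "W (bm r) <= W y" using bl[of r] by (intro W_mono) simp
      ultimately have "1 / W y <= 1 / W (bm r)" by (intro divide_left_mono) auto
      then have "(r - 1) * (1 / W y) <= (r - 1) * (1 / W (bm r))" using r1 by (intro mult_left_mono) auto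
      moreover have "\<bar>Z\<bar> <= (r - 1) * (1 / W y)" using r Wy by (simp add: field_simps)
      moreover have "0 <= enn2real (Cm 1)" by simp
      ultimately show ?thesis using h by linarith
    qed
    then show ?thesis by blast
  next
    case False
    then have p: "0 < mu_bar \<mu> y" for y using mu_bar_bounds(1)[of y] by (simp add: less_le)
    obtain y where y: "mu_bar \<mu> y < exp (- Z)" using mu_bar_to_zero[of "exp (- Z)"] by auto
    have "ln (mu_bar \<mu> y) < - Z" using y p[of y] by (metis exp_gt_zero ln_exp ln_less_cancel_iff)
    then have "Z <= enn2real (Cm (enn2real (\<psi>m y)))" unfolding Cm_psi[OF p] using mu_bar_bounds(2)[of y] p[of y] by simp
    then show ?thesis using mono by (meson order_trans)
  qed
qed

lemma survival_mu_bar: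
  assumes y: "0 < mu_bar \<mu> y"
  shows "exp (- enn2real (Cm (enn2real (\<psi>m y)))) = mu_bar \<mu> y"
  unfolding Cm_psi[OF y] using mu_bar_bounds(2)[of y] y by (simp add: exp_minus)

end

end

section \<open>The embedding on a regular version\<close>

context sn_levy_local_time
begin

lemma measurable_random_time:
  fixes R :: "'a => ereal"
  assumes R0: "\<And>w. w \<in> space M ==> 0 <= R w" and R: "\<And>t. 0 <= t ==> {w\<in>space M. R w <= ereal t} \<in> sets M"
  shows "(\<lambda>w. real_of_ereal (R w)) \<in> borel_measurable M"
proof -
  have [measurable]: "R \<in> borel_measurable M"
  proof (rule borel_measurableI_le)
    fix y :: ereal
    show "{x \<in> space M. R x <= y} \<in> sets M"
    proof (cases "0 <= y")
      case True
      then show ?thesis using R by (cases y) auto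
    next
      case False
      then have "{x \<in> space M. R x <= y} = {}" using R0 by (auto intro: order_trans)
      then show ?thesis by (simp only: sets.empty_sets)
    qed
  qed
  show ?thesis by measurable
qed

context
  fixes \<mu> :: "real measure"
  assumes mu: "prob_space \<mu>" and sets_mu: "sets \<mu> = sets borel" and mu_pos: "measure \<mu> {0<..} = 1"
begin

abbreviation "\<beta> \<equiv> bm \<mu> W"

lemma beta_less_iff: "\<beta> l < z \<longleftrightarrow> ennreal l < psi_mu W \<mu> z"
  by (rule bm_less_iff[OF mu sets_mu mu_pos W_mono W_nonpos W_pos])

lemma barrier_beta: "barrier \<beta>"
  unfolding barrier_def
proof (intro conjI allI impI)
  show "\<beta> l <= \<beta> l'" if "0 <= l \<and> l <= l'" for l l'
    by (rule bm_mono[OF mu sets_mu mu_pos W_mono W_nonpos W_pos]) (use that in auto)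
  show "(\<beta> \<longlongrightarrow> \<beta> l) (at_right l)" if "0 <= l" for l
    by (rule bm_right[OF mu sets_mu mu_pos W_mono W_nonpos W_pos]) (use that in auto)
  show "0 < \<beta> l" if "0 < l" for l
    by (rule bm_pos[OF mu sets_mu mu_pos W_mono W_nonpos W_pos]) (use that in auto)
  show "0 <= \<beta> 0"
    by (rule bm_nonneg[OF mu sets_mu mu_pos W_mono W_nonpos W_pos])
qed

abbreviation C\<mu> :: "real => real" where "C\<mu> r \<equiv> enn2real (Cm \<mu> W r)"

lemma hazard_C_mu: "hazard (\<lambda>s. 1 / W (\<beta> s)) C\<mu>"
  by (rule hazard_Cm[OF mu sets_mu mu_pos W_mono W_nonpos W_pos])

lemma C_mu_at_top: "filterlim C\<mu> at_top at_top"
  by (rule Cm_at_top[OF mu sets_mu mu_pos W_mono W_nonpos W_pos])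

lemma C_mu_0: "C\<mu> 0 = 0"
  by (subst Cm_0[OF mu sets_mu mu_pos W_mono W_nonpos W_pos]) auto

lemma exp_C_mu: "0 < mu_bar \<mu> y ==> exp (- C\<mu> (enn2real (psi_mu W \<mu> y))) = mu_bar \<mu> y"
  by (rule survival_mu_bar[OF mu sets_mu mu_pos W_mono W_nonpos W_pos])

lemma psi_mu_finite: "0 < mu_bar \<mu> y ==> psi_mu W \<mu> y < \<top>"
  by (rule psi_finite[OF mu sets_mu mu_pos W_mono W_nonpos W_pos])

lemma psi_mu_infinite: "mu_bar \<mu> y = 0 ==> psi_mu W \<mu> y = \<top>"
  by (rule psi_infinite[OF mu sets_mu mu_pos W_mono W_nonpos W_pos])

definition \<sigma> :: "'a => real" where
  "\<sigma> w = real_of_ereal (passage \<beta> w)"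

lemma passage_beta_AE: "AE w in M. passage \<beta> w = ereal (\<sigma> w) \<and> 0 < \<sigma> w \<and> X (\<sigma> w) w = \<beta> (L (\<sigma> w) w)"
  using passage_law(1)[OF barrier_beta hazard_C_mu C_mu_at_top] passage_value[OF barrier_beta]
proof eventually_elim
  case (elim w)
  then have "passage \<beta> w = ereal (\<sigma> w)" unfolding \<sigma>_def by (cases "passage \<beta> w") auto
  then show ?case using elim by simp
qed

lemma X_sigma_measurable: "(\<lambda>w. X (\<sigma> w) w) \<in> borel_measurable M"
proof (rule measurable_M_AE_eq)
  show "(\<lambda>w. \<beta> (max 0 (L (\<sigma> w) w))) \<in> borel_measurable M"
    using passage_law(2)[OF barrier_beta hazard_C_mu C_mu_at_top] unfolding \<sigma>_def
    by (rule measurable_compose[OF _ b_measurable[OF barrier_beta]])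
  show "AE w in M. X (\<sigma> w) w = \<beta> (max 0 (L (\<sigma> w) w))"
    using passage_beta_AE AE_space
  proof eventually_elim
    case (elim w)
    then show ?case using L_nonneg[of w "\<sigma> w"] by simp
  qed
qed

text \<open>By \<open>beta_less_iff\<close>, z <= \<beta>(L) means psi_mu z <= L; the law of L at
  the passage and \<open>exp_C_mu\<close> then give the tail of \<mu>.\<close>

lemma prob_X_sigma: "prob {w\<in>space M. z <= X (\<sigma> w) w} = mu_bar \<mu> z"
proof -
  note law = passage_law[OF barrier_beta hazard_C_mu C_mu_at_top, folded \<sigma>_def]
  note [measurable] = X_sigma_measurable law(2)
  have "prob {w\<in>space M. z <= X (\<sigma> w) w} = prob {w\<in>space M. psi_mu W \<mu> z <= ennreal (L (\<sigma> w) w)}"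
  proof (rule finite_measure_eq_AE)
    show "AE w in M. w \<in> {w\<in>space M. z <= X (\<sigma> w) w} \<longleftrightarrow> w \<in> {w\<in>space M. psi_mu W \<mu> z <= ennreal (L (\<sigma> w) w)}"
      using passage_beta_AE AE_space
    proof eventually_elim
      case (elim w)
      then show ?case using beta_less_iff[of "L (\<sigma> w) w" z] by (simp add: not_less[symmetric])
    qed
  qed measurable
  also have "... = mu_bar \<mu> z"
  proof (cases "mu_bar \<mu> z = 0")
    case True
    have "{w\<in>space M. psi_mu W \<mu> z <= ennreal (L (\<sigma> w) w)} = {}"
      using psi_mu_infinite[OF True] by (auto simp: top_unique)
    then show ?thesis using True by (simp only: measure_empty)
  next
    case False
    then have pos: "0 < mu_bar \<mu> z" by (simp add: mu_bar_def less_le)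
    define \<Psi> where "\<Psi> = enn2real (psi_mu W \<mu> z)"
    have \<Psi>: "psi_mu W \<mu> z = ennreal \<Psi>" "0 <= \<Psi>" using psi_mu_finite[OF pos] by (auto simp: \<Psi>_def)
    have ex: "exp (- C\<mu> \<Psi>) = mu_bar \<mu> z" using exp_C_mu[OF pos] by (simp add: \<Psi>_def)
    have \<sigma>0: "0 <= \<sigma> w" for w
      unfolding \<sigma>_def by (rule real_of_ereal_pos[OF passage_nonneg[OF barrier_beta]])
    have "{w\<in>space M. psi_mu W \<mu> z <= ennreal (L (\<sigma> w) w)} = {w\<in>space M. \<Psi> <= L (\<sigma> w) w}"
      unfolding \<Psi>(1) using L_nonneg \<sigma>0 by (auto simp: ennreal_le_iff)
    moreover have "prob {w\<in>space M. \<Psi> <= L (\<sigma> w) w} = exp (- C\<mu> \<Psi>)"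
    \<comment> \<open>\<open>passage_law\<close> speaks of levels r > 0; at level 0 the event is
      certain.\<close>
    proof (cases "\<Psi> = 0")
      case True
      have "{w\<in>space M. \<Psi> <= L (\<sigma> w) w} = space M" using True L_nonneg \<sigma>0 by auto
      then show ?thesis unfolding True by (simp add: prob_space C_mu_0)
    next
      case False
      then show ?thesis using law(3)[of \<Psi>] \<Psi>(2) by simp
    qed
    ultimately show ?thesis using ex by simp
  qed
  finally show ?thesis .
qed

lemma distr_X_sigma: "distr M borel (\<lambda>w. X (\<sigma> w) w) = \<mu>"
proof (rule measure_eq_if_lessThan_eq)
  note [measurable] = X_sigma_measurable
  interpret mu: prob_space \<mu> by (rule mu)
  have sp: "space \<mu> = UNIV" using sets_eq_imp_space_eq[OF sets_mu] by simp
  show "emeasure (distr M borel (\<lambda>w. X (\<sigma> w) w)) {..<z} = emeasure \<mu> {..<z}" for z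
  proof -
    have "emeasure (distr M borel (\<lambda>w. X (\<sigma> w) w)) {..<z} = ennreal (prob {w\<in>space M. X (\<sigma> w) w < z})"
      by (subst emeasure_distr) (auto simp: emeasure_eq_measure intro!: arg_cong[where f="measure M"])
    also have "{w\<in>space M. X (\<sigma> w) w < z} = space M - {w\<in>space M. z <= X (\<sigma> w) w}" by auto
    also have "prob ... = 1 - mu_bar \<mu> z" by (subst prob_compl) (auto simp: prob_X_sigma)
    also have "... = measure \<mu> (space \<mu> - {z..})" unfolding mu_bar_def by (rule mu.prob_compl[symmetric]) (simp add: sets_mu)
    also have "space \<mu> - {z..} = {..<z}" by (auto simp: sp)
    finally show ?thesis by (simp add: mu.emeasure_eq_measure)
  qed
  show "emeasure (distr M borel (\<lambda>w. X (\<sigma> w) w)) {..<z} \<noteq> \<infinity>" for z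
    by (subst emeasure_distr) (auto simp: emeasure_eq_measure)
qed (auto simp: sets_mu)

text \<open>Strictness comes from the infimum in \<open>passage\<close>. Time 0 is treated apart, as
  that infimum runs over t > 0; there X_0 = 0 lies below the positive value at the passage.\<close>

lemma X_less_before_sigma: "AE w in M. \<forall>t. 0 <= t --> t < \<sigma> w --> X t w < X (\<sigma> w) w"
  using passage_beta_AE L_pos AE_space
proof eventually_elim
  case (elim w)
  note w = elim(3)
  show ?case
  proof (intro allI impI)
    fix t assume t: "0 <= t" "t < \<sigma> w"
    show "X t w < X (\<sigma> w) w"
    proof (cases "t = 0")
      case True
      have "0 < \<beta> (L (\<sigma> w) w)" using elim by (intro b_pos[OF barrier_beta]) auto
      then show ?thesis using True elim(1) X_0[OF w] by simp
    next
      case False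
      then have "X t w < \<beta> (L t w)" using t elim(1) by (intro passage_before[OF barrier_beta]) auto
      also have "... <= \<beta> (L (\<sigma> w) w)" using t by (intro b_mono[OF barrier_beta] L_nonneg[OF w] L_mono[OF w]) auto
      finally show ?thesis using elim(1) by simp
    qed
  qed
qed

lemma Sup_X_sigma: "AE w in M. (SUP t\<in>{0..\<sigma> w}. X t w) = X (\<sigma> w) w"
  using X_less_before_sigma passage_beta_AE
proof eventually_elim
  case (elim w)
  show ?case
  proof (rule cSup_eq_maximum)
    show "X (\<sigma> w) w \<in> (\<lambda>t. X t w) ` {0..\<sigma> w}" using elim(2) by (intro imageI) simp
    fix x assume "x \<in> (\<lambda>t. X t w) ` {0..\<sigma> w}"
    then obtain t where t: "0 <= t" "t <= \<sigma> w" "x = X t w" by auto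
    then show "x <= X (\<sigma> w) w" using elim(1) by (cases "t = \<sigma> w") (auto intro: less_imp_le)
  qed
qed

text \<open>Where R is earlier than the passage, X at R is strictly smaller. Equal laws give equal
  means of \<open>arctan\<close>, which is bounded and strictly increasing, so this happens with
  probability 0.\<close>

lemma passage_minimal:
  assumes R0: "\<And>w. w \<in> space M ==> 0 <= R w" and R: "\<And>t. 0 <= t ==> {w\<in>space M. R w <= ereal t} \<in> sets M"
    and le: "AE w in M. R w <= passage \<beta> w"
    and eq: "distr M borel (\<lambda>w. X (real_of_ereal (R w)) w) = distr M borel (\<lambda>w. X (\<sigma> w) w)"
  shows "AE w in M. R w = passage \<beta> w"
proof -
  define r where "r w = real_of_ereal (R w)" for w
  have r0: "0 <= r w" if "w \<in> space M" for w unfolding r_def by (rule real_of_ereal_pos[OF R0[OF that]])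
  have [measurable]: "r \<in> borel_measurable M" unfolding r_def[abs_def] by (rule measurable_random_time[OF R0 R])
  have [measurable]: "(\<lambda>w. X (r w) w) \<in> borel_measurable M" by (rule measurable_X_at) (auto simp: r0)
  note [measurable] = X_sigma_measurable
  define d where "d w = arctan (X (\<sigma> w) w) - arctan (X (r w) w)" for w
  have b: "\<bar>arctan x\<bar> <= 2" for x using arctan_bounded[of x] pi_less_4 by auto
  have i1: "integrable M (\<lambda>w. arctan (X (\<sigma> w) w))"
    by (rule integrable_const_bound[where B=2]) (auto simp: b)
  have i2: "integrable M (\<lambda>w. arctan (X (r w) w))"
    by (rule integrable_const_bound[where B=2]) (auto simp: b)
  have main: "AE w in M. r w < \<sigma> w \<and> X (r w) w < X (\<sigma> w) w \<or> R w = passage \<beta> w \<and> r w = \<sigma> w"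
    using le passage_beta_AE X_less_before_sigma AE_space
  proof eventually_elim
    case (elim w)
    have "R w = ereal (r w)" using elim(1,2) R0[OF elim(4)] unfolding r_def by (cases "R w") auto
    then show ?case using elim r0[OF elim(4)] by (cases "r w = \<sigma> w") auto
  qed
  have "(\<integral>w. arctan (X (r w) w) \<partial>M) = (\<integral>x. arctan x \<partial>distr M borel (\<lambda>w. X (r w) w))"
    by (rule integral_distr[symmetric]) measurable
  also have "... = (\<integral>x. arctan x \<partial>distr M borel (\<lambda>w. X (\<sigma> w) w))" using eq by (simp add: r_def)
  also have "... = (\<integral>w. arctan (X (\<sigma> w) w) \<partial>M)" by (rule integral_distr) measurable
  finally have "(\<integral>w. d w \<partial>M) = 0" unfolding d_def using i1 i2 by simp
  moreover have "integrable M d" unfolding d_def[abs_def] using i1 i2 by simp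
  moreover have "AE w in M. 0 <= d w" using main by eventually_elim (auto simp: d_def arctan_le_iff)
  ultimately have "AE w in M. d w = 0" using integral_nonneg_eq_0_iff_AE[of M d] by simp
  then show ?thesis using main by eventually_elim (auto simp: d_def arctan_eq_iff)
qed

end

end

section \<open>Regular versions on the completed space\<close>

lemma measurable_completion_AE_eq:
  fixes f g :: "'a => real"
  assumes f: "f \<in> borel_measurable M" and ae: "AE w in M. g w = f w"
  shows "g \<in> borel_measurable (completion M)"
proof (rule measurableI)
  fix C :: "real set" assume C: "C \<in> sets borel"
  have "AE w in completion M. w \<in> f -` C \<inter> space M \<longleftrightarrow> w \<in> g -` C \<inter> space M"
    by (rule AE_completion) (use ae in eventually_elim, simp)
  then have "g -` C \<inter> space M \<in> sets (completion M)"
    by (rule completion.in_sets_AE) (use measurable_sets[OF f C] in auto)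
  then show "g -` C \<inter> space (completion M) \<in> sets (completion M)" by simp
qed simp

lemma distr_completion_AE_eq:
  fixes f g :: "'a => real"
  assumes f: "f \<in> borel_measurable M" and ae: "AE w in M. g w = f w"
  shows "distr (completion M) borel g = distr M borel f"
proof -
  have "distr (completion M) borel g = distr (completion M) borel f"
    by (rule distr_cong_AE[OF refl refl AE_completion[OF ae] measurable_completion_AE_eq[OF f ae] measurable_completion[OF f]])
  also have "... = distr M borel f" by (rule distr_completion[OF f])
  finally show ?thesis .
qed

lemma (in prob_space) indep_vars_completion:
  fixes Y Z :: "'i => 'a => real"
  assumes ind: "indep_vars (\<lambda>_. borel) Y I" and ae: "AE w in M. \<forall>i. Z i w = Y i w"
  shows "prob_space.indep_vars (completion M) (\<lambda>_. borel) Z I"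
proof -
  interpret c: prob_space "completion M" by (rule prob_space_completion)
  have Ym: "Y i \<in> borel_measurable M" if "i \<in> I" for i using ind that by (auto simp: indep_vars_def2)
  have aei: "AE w in M. Z i w = Y i w" for i using ae by eventually_elim simp
  note Zm = measurable_completion_AE_eq[OF Ym aei]
  show ?thesis
    unfolding c.indep_vars_def2
  proof (intro conjI ballI c.indep_setsI)
    show "Z i \<in> borel_measurable (completion M)" if "i \<in> I" for i using Zm[OF that] .
    show "{Z i -` A \<inter> space (completion M) |A. A \<in> sets borel} \<subseteq> sets (completion M)" if "i \<in> I" for i
      using measurable_sets[OF Zm[OF that]] by blast
    fix A J assume J: "J \<noteq> {}" "J \<subseteq> I" "finite J" and A: "\<forall>j\<in>J. A j \<in> {Z j -` A \<inter> space (completion M) |A. A \<in> sets borel}"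
    then have "\<forall>j\<in>J. \<exists>C. C \<in> sets borel \<and> A j = Z j -` C \<inter> space M" by auto
    from bchoice[OF this] obtain C where C: "\<And>j. j \<in> J ==> C j \<in> sets borel \<and> A j = Z j -` C j \<inter> space M" by blast
    define B where "B j = Y j -` C j \<inter> space M" for j
    have Bm: "B j \<in> sets M" if "j \<in> J" for j
      unfolding B_def using C[OF that] J that by (intro measurable_sets[OF Ym]) auto
    have Am: "A j \<in> sets (completion M)" if "j \<in> J" for j
      using C[OF that] J that measurable_sets[OF Zm, of j "C j"] by auto
    have AB: "AE w in completion M. \<forall>j\<in>J. w \<in> A j \<longleftrightarrow> w \<in> B j"
      by (rule AE_completion) (use ae in eventually_elim, use C in \<open>auto simp: B_def\<close>)
    have single: "c.prob (A j) = prob (B j)" if j: "j \<in> J" for j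
    proof -
      have "AE w in completion M. w \<in> A j \<longleftrightarrow> w \<in> B j" using AB by eventually_elim (use j in auto)
      then have "c.prob (A j) = c.prob (B j)"
        by (rule c.finite_measure_eq_AE) (use Am[OF j] Bm[OF j] in auto)
      then show ?thesis using Bm[OF j] by simp
    qed
    have "AE w in completion M. w \<in> (\<Inter>j\<in>J. A j) \<longleftrightarrow> w \<in> (\<Inter>j\<in>J. B j)" using AB by eventually_elim auto
    then have "c.prob (\<Inter>j\<in>J. A j) = c.prob (\<Inter>j\<in>J. B j)"
    proof (rule c.finite_measure_eq_AE)
      show "(\<Inter>j\<in>J. A j) \<in> sets (completion M)" using J Am by (intro sets.finite_INT) auto
      show "(\<Inter>j\<in>J. B j) \<in> sets (completion M)" using J Bm by (intro sets.finite_INT) auto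
    qed
    also have "... = prob (\<Inter>j\<in>J. B j)" using J Bm by (intro measure_completion sets.finite_INT) auto
    also have "... = (\<Prod>j\<in>J. prob (B j))"
    proof (rule indep_setsD)
      show "indep_sets (\<lambda>i. {Y i -` A \<inter> space M |A. A \<in> sets borel}) I" using ind by (simp add: indep_vars_def2)
      show "\<forall>j\<in>J. B j \<in> {Y j -` A \<inter> space M |A. A \<in> sets borel}" using C by (auto simp: B_def)
    qed (use J in auto)
    also have "... = (\<Prod>j\<in>J. c.prob (A j))" by (intro prod.cong refl) (simp add: single)
    finally show "c.prob (\<Inter>j\<in>J. A j) = (\<Prod>j\<in>J. c.prob (A j))" .
  qed
qed

section \<open>Independence of the past\<close>

text \<open>Events fixed by finitely many times up to s generate the past and are stable under
  intersection. As X_0 = 0, such an event is one about increments along a grid from 0 to s, and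
  these are independent of the increment over [s, t].\<close>

lemma natural_filtration_indep:
  fixes X :: "real => 'a => real"
  assumes levy: "levy_process M X" and st: "0 <= s" "s < t"
    and B: "B \<in> natural_filtration M X s" and C: "C \<in> sets borel"
  shows "measure M (B \<inter> {w\<in>space M. X t w - X s w \<in> C}) = measure M B * measure M {w\<in>space M. X t w - X s w \<in> C}"
proof -
  interpret prob_space M using levy by (simp add: levy_process_def)
  have Xm: "X r \<in> borel_measurable M" if "0 <= r" for r using levy that by (simp add: levy_process_def)
  have X0: "AE w in M. X 0 w = 0" using levy by (simp add: levy_process_def)
  have inc: "indep_vars (\<lambda>_. borel) (\<lambda>i w. X (ts (Suc i)) w - X (ts i) w) {..<n}"
    if "0 <= ts 0" "\<And>i. i < n ==> ts i < ts (Suc i)" for n ts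
    using levy that unfolding levy_process_def by blast
  define cyl where "cyl J D = {w\<in>space M. \<forall>r\<in>J. X r w \<in> D r}" for J and D :: "real => real set"
  define \<A> where "\<A> = {cyl J D | J D. finite J \<and> J \<subseteq> {0..s} \<and> (\<forall>r. D r \<in> sets borel)}"
  define \<B> where "\<B> = {{w\<in>space M. X t w - X s w \<in> C} | C. C \<in> sets borel}"
  have cyl_sets: "cyl J D \<in> events" if "finite J" "J \<subseteq> {0..s}" "\<And>r. D r \<in> sets borel" for J D
    unfolding cyl_def
  proof (rule sets.sets_Collect_finite_All[OF _ that(1)])
    fix r assume "r \<in> J"
    then have [measurable]: "X r \<in> borel_measurable M" using that(2) by (intro Xm) auto
    have [measurable]: "D r \<in> sets borel" by (rule that(3))
    show "{w\<in>space M. X r w \<in> D r} \<in> events" by measurable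
  qed
  have inc_sets: "{w\<in>space M. X t w - X s w \<in> C} \<in> events" if [measurable]: "C \<in> sets borel" for C
  proof -
    have [measurable]: "X t \<in> borel_measurable M" "X s \<in> borel_measurable M" using st by (auto intro: Xm)
    show ?thesis by measurable
  qed
  have stA: "Int_stable \<A>"
  proof (rule Int_stableI)
    fix a b assume "a \<in> \<A>" "b \<in> \<A>"
    then obtain J D J' D' where a: "a = cyl J D" "finite J" "J \<subseteq> {0..s}" "\<forall>r. D r \<in> sets borel"
      and b: "b = cyl J' D'" "finite J'" "J' \<subseteq> {0..s}" "\<forall>r. D' r \<in> sets borel" unfolding \<A>_def by blast
    define D'' where "D'' r = (if r \<in> J then D r else UNIV) \<inter> (if r \<in> J' then D' r else UNIV)" for r
    have "a \<inter> b = cyl (J \<union> J') D''" unfolding a b cyl_def D''_def by auto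
    moreover have "D'' r \<in> sets borel" for r unfolding D''_def using a(4) b(4) by auto
    ultimately show "a \<inter> b \<in> \<A>" unfolding \<A>_def using a(2,3) b(2,3) by blast
  qed
  have stB: "Int_stable \<B>"
  proof (rule Int_stableI)
    fix a b assume "a \<in> \<B>" "b \<in> \<B>"
    then obtain C C' where a: "a = {w\<in>space M. X t w - X s w \<in> C}" "C \<in> sets borel"
      and b: "b = {w\<in>space M. X t w - X s w \<in> C'}" "C' \<in> sets borel" unfolding \<B>_def by blast
    have "a \<inter> b = {w\<in>space M. X t w - X s w \<in> C \<inter> C'}" unfolding a b by auto
    moreover have "C \<inter> C' \<in> sets borel" using a b by auto
    ultimately show "a \<inter> b \<in> \<B>" unfolding \<B>_def by blast
  qed
  have key: "prob (cyl J D \<inter> {w\<in>space M. X t w - X s w \<in> C}) = prob (cyl J D) * prob {w\<in>space M. X t w - X s w \<in> C}"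
    if J: "finite J" "J \<subseteq> {0..s}" and D: "\<And>r. D r \<in> sets borel" and C: "C \<in> sets borel" for J D C
  proof -
    define E where "E = {w\<in>space M. X t w - X s w \<in> C}"
    \<comment> \<open>Time 0 lets partial sums of increments recover the values of \<open>X\<close>;
      time \<open>s\<close> makes the last increment X_t - X_s.\<close>
    define K where "K = insert 0 (insert s J)"
    define D' where "D' r = (if r \<in> J then D r else UNIV)" for r
    have cyl_K: "cyl J D = cyl K D'" unfolding cyl_def K_def D'_def by auto
    have K: "finite K" "K \<subseteq> {0..s}" "0 \<in> K" "s \<in> K" using J st by (auto simp: K_def)
    define l where "l = sorted_list_of_set K"
    have l: "set l = K" "sorted_wrt (<) l" using K(1) by (auto simp: l_def)
    have "l \<noteq> []" using l K(3) by auto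
    then obtain m where m: "length l = Suc m" by (cases l) auto
    define ts where "ts i = (if i <= m then l ! i else t)" for i
    have mono: "l ! i < l ! j" if "i < j" "j <= m" for i j using sorted_wrt_nth_less[OF l(2), of i j] that m by simp
    have mem: "l ! i \<in> {0..s}" if "i <= m" for i using nth_mem[of i l] that m l(1) K(2) by auto
    have ts0: "ts 0 = 0"
    proof -
      obtain i where i: "i <= m" "l ! i = 0" using K(3) l(1) m by (metis in_set_conv_nth less_Suc_eq_le)
      then have "i = 0" using mono[of 0 i] mem[of 0] by (cases "i = 0") auto
      then show ?thesis using i by (simp add: ts_def)
    qed
    have tsm: "ts m = s"
    proof -
      obtain i where i: "i <= m" "l ! i = s" using K(4) l(1) m by (metis in_set_conv_nth less_Suc_eq_le)
      then have "i = m" using mono[of i m] mem[of m] by (cases "i = m") auto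
      then show ?thesis using i by (simp add: ts_def)
    qed
    have tst: "ts (Suc m) = t" by (simp add: ts_def)
    have step: "ts i < ts (Suc i)" if "i < Suc m" for i
    proof (cases "i = m")
      case True then show ?thesis using tsm tst st by simp
    next
      case False then show ?thesis using that mono[of i "Suc i"] by (simp add: ts_def)
    qed
    define Y where "Y i w = X (ts (Suc i)) w - X (ts i) w" for i w
    have "indep_vars (\<lambda>_. borel) Y {..<Suc m}" unfolding Y_def[abs_def] by (rule inc) (use ts0 step in auto)
    then have iv: "indep_var (PiM {..<m} (\<lambda>_. borel)) (\<lambda>w. \<lambda>i\<in>{..<m}. Y i w) (PiM {m} (\<lambda>_. borel)) (\<lambda>w. \<lambda>i\<in>{m}. Y i w)"
      by (rule indep_var_restrict) auto
    define P where "P = {f\<in>space (PiM {..<m} (\<lambda>_. borel)). \<forall>k\<in>{..m}. (\<Sum>i<k. f i) \<in> D' (l ! k)}"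
    define Q where "Q = {f\<in>space (PiM {m} (\<lambda>_. borel)). f m \<in> C}"
    have Ps: "P \<in> sets (PiM {..<m} (\<lambda>_. borel :: real measure))"
      unfolding P_def
    proof (rule sets.sets_Collect_finite_All)
      fix k assume "k \<in> {..m}"
      then have [measurable]: "(\<lambda>f. \<Sum>i<k. f i) \<in> borel_measurable (PiM {..<m} (\<lambda>_. borel :: real measure))"
        by (intro borel_measurable_sum measurable_component_singleton) auto
      have [measurable]: "D' (l ! k) \<in> sets borel" using D by (simp add: D'_def)
      show "{f\<in>space (PiM {..<m} (\<lambda>_. borel)). (\<Sum>i<k. f i) \<in> D' (l ! k)} \<in> sets (PiM {..<m} (\<lambda>_. borel :: real measure))"
        by measurable
    qed simp
    have Qs: "Q \<in> sets (PiM {m} (\<lambda>_. borel :: real measure))"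
    proof -
      have [measurable]: "(\<lambda>f. f m) \<in> borel_measurable (PiM {m} (\<lambda>_. borel :: real measure))"
        by (rule measurable_component_singleton) simp
      note [measurable] = C
      show ?thesis unfolding Q_def by measurable
    qed
    have QE: "(\<lambda>w. \<lambda>i\<in>{m}. Y i w) -` Q \<inter> space M = E"
      by (auto simp: Q_def E_def Y_def tsm tst space_PiM)
    have YK: "(\<lambda>i\<in>{..<m}. Y i w) \<in> P \<longleftrightarrow> w \<in> cyl K D'" if z: "X 0 w = 0" and w: "w \<in> space M" for w
    proof -
      have sum: "(\<Sum>i<k. (\<lambda>i\<in>{..<m}. Y i w) i) = X (l ! k) w" if k: "k <= m" for k
      proof -
        have "(\<Sum>i<k. (\<lambda>i\<in>{..<m}. Y i w) i) = (\<Sum>i<k. X (ts (Suc i)) w - X (ts i) w)"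
          using k by (intro sum.cong) (auto simp: Y_def)
        also have "... = X (ts k) w - X (ts 0) w" by (rule sum_lessThan_telescope)
        finally show ?thesis using k ts0 z by (simp add: ts_def)
      qed
      have "(\<lambda>i\<in>{..<m}. Y i w) \<in> P \<longleftrightarrow> (\<forall>k\<le>m. X (l ! k) w \<in> D' (l ! k))"
        using sum by (auto simp: P_def space_PiM)
      also have "... \<longleftrightarrow> (\<forall>r\<in>set l. X r w \<in> D' r)" by (simp add: all_set_conv_all_nth m less_Suc_eq_le)
      finally show ?thesis using w by (simp add: cyl_def l(1))
    qed
    have m1: "(\<lambda>w. \<lambda>i\<in>{..<m}. Y i w) -` P \<inter> space M \<in> events"
      by (rule measurable_sets[OF indep_var_rv1[OF iv] Ps])
    have cm: "cyl K D' \<in> events" unfolding cyl_K[symmetric] by (rule cyl_sets[OF J D])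
    have Em: "E \<in> events" unfolding E_def by (rule inc_sets[OF C])
    have "prob (cyl K D' \<inter> E) = prob ((\<lambda>w. (\<lambda>i\<in>{..<m}. Y i w, \<lambda>i\<in>{m}. Y i w)) -` (P \<times> Q) \<inter> space M)"
    proof (rule finite_measure_eq_AE)
      have eq: "(\<lambda>w. (\<lambda>i\<in>{..<m}. Y i w, \<lambda>i\<in>{m}. Y i w)) -` (P \<times> Q) \<inter> space M
          = ((\<lambda>w. \<lambda>i\<in>{..<m}. Y i w) -` P \<inter> space M) \<inter> E"
        unfolding QE[symmetric] by auto
      show "(\<lambda>w. (\<lambda>i\<in>{..<m}. Y i w, \<lambda>i\<in>{m}. Y i w)) -` (P \<times> Q) \<inter> space M \<in> events"
        unfolding eq using m1 Em by (rule sets.Int)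
      show "AE w in M. w \<in> cyl K D' \<inter> E \<longleftrightarrow> w \<in> (\<lambda>w. (\<lambda>i\<in>{..<m}. Y i w, \<lambda>i\<in>{m}. Y i w)) -` (P \<times> Q) \<inter> space M"
        unfolding eq using X0 AE_space by eventually_elim (use YK in auto)
    qed (use cm Em in auto)
    also have "... = prob ((\<lambda>w. \<lambda>i\<in>{..<m}. Y i w) -` P \<inter> space M) * prob ((\<lambda>w. \<lambda>i\<in>{m}. Y i w) -` Q \<inter> space M)"
      by (rule indep_varD[OF iv Ps Qs])
    also have "prob ((\<lambda>w. \<lambda>i\<in>{..<m}. Y i w) -` P \<inter> space M) = prob (cyl K D')"
    proof (rule finite_measure_eq_AE[OF _ m1 cm])
      show "AE w in M. w \<in> (\<lambda>w. \<lambda>i\<in>{..<m}. Y i w) -` P \<inter> space M \<longleftrightarrow> w \<in> cyl K D'"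
        using X0 AE_space by eventually_elim (use YK in auto)
    qed
    finally show ?thesis unfolding QE E_def[symmetric] cyl_K .
  qed
  have "indep_set \<A> \<B>"
    unfolding indep_sets2_eq
  proof (intro conjI ballI)
    show "\<A> \<subseteq> events" unfolding \<A>_def using cyl_sets by blast
    show "\<B> \<subseteq> events" unfolding \<B>_def using inc_sets by blast
    fix a b assume "a \<in> \<A>" "b \<in> \<B>"
    then show "prob (a \<inter> b) = prob a * prob b" unfolding \<A>_def \<B>_def using key by blast
  qed
  note ind = indep_set_sigma_sets[OF this stA stB]
  have "natural_filtration M X s \<subseteq> sigma_sets (space M) \<A>"
    unfolding natural_filtration_def
  proof (rule sigma_sets_mono, safe)
    fix r B assume r: "r \<in> {0..s}" and B: "B \<in> sets (borel :: real measure)"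
    have "X r -` B \<inter> space M = cyl {r} (\<lambda>_. B)" unfolding cyl_def by auto
    also have "... \<in> \<A>" unfolding \<A>_def using r B by blast
    finally show "X r -` B \<inter> space M \<in> sigma_sets (space M) \<A>" by (rule sigma_sets.Basic)
  qed
  then have "B \<in> sigma_sets (space M) \<A>" using B by blast
  moreover have "{w\<in>space M. X t w - X s w \<in> C} \<in> sigma_sets (space M) \<B>"
    by (rule sigma_sets.Basic) (use C in \<open>auto simp: \<B>_def\<close>)
  ultimately show ?thesis by (rule indep_setD[OF ind])
qed

section \<open>The completed natural filtration and the regular version\<close>

lemma natural_filtration_subset:
  assumes "\<And>t. 0 <= t ==> X t \<in> borel_measurable M"
  shows "natural_filtration M X t \<subseteq> sets M"
  unfolding natural_filtration_def
proof (rule sets.sigma_sets_subset, safe)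
  fix s B assume "s \<in> {0..t}" "B \<in> sets (borel :: real measure)"
  then show "X s -` B \<inter> space M \<in> sets M" by (intro measurable_sets[OF assms]) auto
qed

lemma sigma_algebra_natural_filtration: "sigma_algebra (space M) (natural_filtration M X t)"
  unfolding natural_filtration_def by (rule sigma_algebra_sigma_sets) auto

lemma sigma_algebra_completed_filtration: "sigma_algebra (space M) (completed_filtration M X t)"
  unfolding sigma_algebra_iff2
proof (intro conjI ballI allI impI)
  interpret n: sigma_algebra "space M" "natural_filtration M X t" by (rule sigma_algebra_natural_filtration)
  show "completed_filtration M X t \<subseteq> Pow (space M)" by (auto simp: completed_filtration_def)
  show "{} \<in> completed_filtration M X t" by (auto simp: completed_filtration_def intro!: bexI[of _ "{}"])
  show "space M - A \<in> completed_filtration M X t" if A: "A \<in> completed_filtration M X t" for A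
  proof -
    from A obtain B N where B: "A \<subseteq> space M" "B \<in> natural_filtration M X t" "N \<in> null_sets M" "(A - B) \<union> (B - A) \<subseteq> N"
      by (auto simp: completed_filtration_def)
    have "B \<subseteq> space M" using B(2) n.sets_into_space by blast
    then have "((space M - A) - (space M - B)) \<union> ((space M - B) - (space M - A)) \<subseteq> N" using B by blast
    moreover have "space M - B \<in> natural_filtration M X t" using B(2) by auto
    ultimately show ?thesis using B(3) unfolding completed_filtration_def by blast
  qed
  show "(\<Union>i::nat. A i) \<in> completed_filtration M X t" if A: "range A \<subseteq> completed_filtration M X t" for A
  proof -
    have "\<forall>i. \<exists>B N. A i \<subseteq> space M \<and> B \<in> natural_filtration M X t \<and> N \<in> null_sets M \<and> (A i - B) \<union> (B - A i) \<subseteq> N"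
    proof
      fix i
      have "A i \<in> completed_filtration M X t" using A by blast
      then show "\<exists>B N. A i \<subseteq> space M \<and> B \<in> natural_filtration M X t \<and> N \<in> null_sets M \<and> (A i - B) \<union> (B - A i) \<subseteq> N"
        unfolding completed_filtration_def by blast
    qed
    then obtain B N where B: "\<And>i. A i \<subseteq> space M" "\<And>i. B i \<in> natural_filtration M X t" "\<And>i. N i \<in> null_sets M"
      "\<And>i. (A i - B i) \<union> (B i - A i) \<subseteq> N i" by metis
    have "((\<Union>i. A i) - (\<Union>i. B i)) \<union> ((\<Union>i. B i) - (\<Union>i. A i)) \<subseteq> (\<Union>i. N i)" using B(4) by blast
    moreover have "(\<Union>i. N i) \<in> null_sets M" using B(3) by (rule null_sets_UN)
    moreover have "(\<Union>i. B i) \<in> natural_filtration M X t" using B(2) by auto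
    ultimately show ?thesis using B(1) unfolding completed_filtration_def by blast
  qed
qed

lemma sets_completed_filtration: "sets (sigma (space M) (completed_filtration M X t)) = completed_filtration M X t"
  by (rule sigma_algebra.sets_measure_of_eq[OF sigma_algebra_completed_filtration])

lemma completed_filtration_subset:
  assumes "\<And>t. 0 <= t ==> X t \<in> borel_measurable M"
  shows "completed_filtration M X t \<subseteq> sets (completion M)"
proof
  fix A assume "A \<in> completed_filtration M X t"
  then obtain B N where B: "B \<in> natural_filtration M X t" "N \<in> null_sets M" "(A - B) \<union> (B - A) \<subseteq> N"
    by (auto simp: completed_filtration_def)
  have "B \<in> sets M" by (rule subsetD[OF natural_filtration_subset[OF assms] B(1)])
  then have "B - N \<in> sets M" using B(2) by auto
  moreover have "A = (B - N) \<union> (A \<inter> N)" using B(3) by blast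
  ultimately show "A \<in> sets (completion M)" using B(2) by (intro sets_completionI[of A "B - N" "A \<inter> N" N]) auto
qed

lemma completed_filtrationI_null: "N \<in> null_sets M ==> A \<subseteq> space M ==> B \<in> natural_filtration M X t ==>
    (\<And>w. w \<in> space M - N ==> w \<in> A \<longleftrightarrow> w \<in> B) ==> A \<in> completed_filtration M X t"
proof -
  assume *: "N \<in> null_sets M" "A \<subseteq> space M" "B \<in> natural_filtration M X t" "\<And>w. w \<in> space M - N ==> w \<in> A \<longleftrightarrow> w \<in> B"
  interpret n: sigma_algebra "space M" "natural_filtration M X t" by (rule sigma_algebra_natural_filtration)
  have "B \<subseteq> space M" using *(3) by (rule n.sets_into_space)
  then have "(A - B) \<union> (B - A) \<subseteq> N" using *(2,4) by blast
  then show ?thesis using *(1-3) unfolding completed_filtration_def by blast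
qed

text \<open>Outcomes in the null set of irregular paths are redirected to a fixed good outcome
  \<open>w0\<close>, so every path of \<open>Y\<close> is a regular path of \<open>X\<close>. The
  completed filtration absorbs the change, and all laws are unaffected.\<close>

theorem sn_levy_version:
  assumes sn: "spectrally_negative_levy M X"
  shows "\<exists>Y. sn_levy (completion M) Y (\<lambda>t. sigma (space M) (completed_filtration M X t)) \<and> (AE w in M. \<forall>t. Y t w = X t w)"
proof -
  have levy: "levy_process M X" using sn by (simp add: spectrally_negative_levy_def)
  interpret prob_space M using levy by (simp add: levy_process_def)
  interpret c: prob_space "completion M" by (rule prob_space_completion)
  have Xm: "X t \<in> borel_measurable M" if "0 <= t" for t using levy that by (simp add: levy_process_def)
  have "AE w in M. X 0 w = 0" "AE w in M. cadlag (\<lambda>t. X t w)" "AE w in M. no_positive_jumps (\<lambda>t. X t w)"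
    using sn by (auto simp: spectrally_negative_levy_def levy_process_def)
  then have "AE w in M. X 0 w = 0 \<and> cadlag (\<lambda>t. X t w) \<and> no_positive_jumps (\<lambda>t. X t w)" by eventually_elim auto
  then obtain N where good: "\<And>w. w \<in> space M - N ==> X 0 w = 0 \<and> cadlag (\<lambda>t. X t w) \<and> no_positive_jumps (\<lambda>t. X t w)"
    and N: "N \<in> null_sets M" by (rule AE_E3) blast
  have "space M - N \<noteq> {}"
  proof
    assume "space M - N = {}"
    then have "N = space M" using sets.sets_into_space[of N M] N by auto
    then show False using N emeasure_space_1 by (simp add: null_sets_def)
  qed
  then obtain w0 where w0: "w0 \<in> space M - N" by blast
  define r where "r w = (if w \<in> N then w0 else w)" for w
  have r: "r w \<in> space M - N" if "w \<in> space M" for w using that w0 by (auto simp: r_def)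
  define Y where "Y t w = X t (r w)" for t w
  have YX: "Y t w = X t w" if "w \<notin> N" for t w using that by (simp add: Y_def r_def)
  have ae: "AE w in M. \<forall>t. Y t w = X t w" using AE_not_in[OF N] by eventually_elim (simp add: YX)
  have aed: "AE w in M. Y t w - Y s w = X t w - X s w" for s t using ae by eventually_elim simp
  define F where "F t = sigma (space M) (completed_filtration M X t)" for t
  have sets_F: "sets (F t) = completed_filtration M X t" for t unfolding F_def by (rule sets_completed_filtration)
  have space_F: "space (F t) = space M" for t by (simp add: F_def space_measure_of_conv)
  have "sn_levy (completion M) Y F"
  proof (intro sn_levy.intro sn_levy_axioms.intro c.prob_space_axioms)
    show "A \<in> sets (completion M)" if "N' \<in> null_sets (completion M)" "A \<subseteq> N'" for N' A
      using that by (rule completion.complete[rotated])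
    show "space (F t) = space (completion M)" for t by (simp add: space_F)
    show "sets (F t) \<subseteq> sets (completion M)" for t
      unfolding sets_F by (rule completed_filtration_subset[OF Xm])
    show "sets (F s) \<subseteq> sets (F t)" if "s <= t" for s t
    proof -
      have "natural_filtration M X s \<subseteq> natural_filtration M X t"
        unfolding natural_filtration_def using that by (intro sigma_sets_mono' UN_mono) auto
      then show ?thesis unfolding sets_F completed_filtration_def by blast
    qed
    show "N' \<in> sets (F t)" if N': "N' \<in> null_sets (completion M)" for t N'
    proof -
      from N' obtain N'' where "N'' \<in> null_sets M" "N' \<subseteq> N''" by (auto simp: null_sets_completion_iff2)
      moreover have "N' \<subseteq> space M" using sets.sets_into_space[of N' "completion M"] N' by auto
      moreover have "{} \<in> natural_filtration M X t" unfolding natural_filtration_def by (rule sigma_sets.Empty)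
      ultimately show ?thesis unfolding sets_F by (intro completed_filtrationI_null[of N'' M N' "{}"]) auto
    qed
    show "Y t \<in> borel_measurable (F t)" if t: "0 <= t" for t
    proof (rule measurableI)
      fix C :: "real set" assume C: "C \<in> sets borel"
      have "X t -` C \<inter> space M \<in> natural_filtration M X t"
        unfolding natural_filtration_def using C t by (intro sigma_sets.Basic UN_I[of t]) (simp, blast)
      then have "Y t -` C \<inter> space M \<in> completed_filtration M X t"
        by (rule completed_filtrationI_null[OF N Int_lower2]) (auto simp: YX)
      then show "Y t -` C \<inter> space (F t) \<in> sets (F t)" by (simp add: sets_F space_F)
    qed simp
    show "Y 0 w = 0" "cadlag (\<lambda>t. Y t w)" "no_positive_jumps (\<lambda>t. Y t w)" if "w \<in> space (completion M)" for w
      using good[OF r[of w]] that by (auto simp: Y_def)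
    show "c.prob (B \<inter> {w\<in>space (completion M). Y t w - Y s w \<in> C}) = c.prob B * c.prob {w\<in>space (completion M). Y t w - Y s w \<in> C}"
      if st: "0 <= s" "s <= t" and B: "B \<in> sets (F s)" and C: "C \<in> sets borel" for s t B C
    \<comment> \<open>\<open>natural_filtration_indep\<close> needs s < t; for s = t the increment
      is the constant 0.\<close>
    proof (cases "s = t")
      case True
      have "B \<subseteq> space M" using sets.sets_into_space[OF B] by (simp add: space_F)
      then have "B \<inter> space M = B" by blast
      then show ?thesis using True c.prob_space by (cases "0 \<in> C") simp_all
    next
      case False
      from B obtain B' N' where B': "B \<subseteq> space M" "B' \<in> natural_filtration M X s" "N' \<in> null_sets M" "(B - B') \<union> (B' - B) \<subseteq> N'"
        unfolding sets_F completed_filtration_def by blast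
      have B'm: "B' \<in> sets M" by (rule subsetD[OF natural_filtration_subset[OF Xm] B'(2)])
      have Bm: "B \<in> sets (completion M)" using B unfolding sets_F by (rule subsetD[OF completed_filtration_subset[OF Xm], rotated])
      define E where "E = {w\<in>space M. X t w - X s w \<in> C}"
      define E' where "E' = {w\<in>space M. Y t w - Y s w \<in> C}"
      have Em: "E \<in> sets M"
      proof -
        have [measurable]: "X t \<in> borel_measurable M" "X s \<in> borel_measurable M" using st by (auto intro: Xm)
        note [measurable] = C
        show ?thesis unfolding E_def by measurable
      qed
      have EE': "AE w in completion M. w \<in> E \<longleftrightarrow> w \<in> E'"
        by (rule AE_completion) (use aed[of t s] in eventually_elim, simp add: E_def E'_def)
      have E'm: "E' \<in> sets (completion M)" by (rule completion.in_sets_AE[OF EE']) (use Em in \<open>auto simp: E'_def\<close>)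
      have BB': "AE w in completion M. w \<in> B \<longleftrightarrow> w \<in> B'"
        by (rule AE_completion) (use AE_not_in[OF B'(3)] in eventually_elim, use B'(4) in auto)
      have "c.prob (B \<inter> E') = c.prob (B' \<inter> E)"
        by (rule c.finite_measure_eq_AE) (use BB' EE' in eventually_elim, use Bm B'm Em E'm in auto)
      also have "... = prob (B' \<inter> E)" using B'm Em by (intro measure_completion) auto
      also have "... = prob B' * prob E"
        unfolding E_def by (rule natural_filtration_indep[OF levy _ _ B'(2) C]) (use st False in auto)
      also have "prob B' = c.prob B"
      proof -
        have "c.prob B = c.prob B'" by (rule c.finite_measure_eq_AE[OF BB']) (use Bm B'm in auto)
        then show ?thesis using B'm by simp
      qed
      also have "prob E = c.prob E'"
      proof -
        have "c.prob E = c.prob E'" by (rule c.finite_measure_eq_AE[OF EE']) (use Em E'm in auto)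
        then show ?thesis using Em by simp
      qed
      finally show ?thesis by (simp add: E'_def)
    qed
    show "c.indep_vars (\<lambda>_. borel) (\<lambda>i w. Y (ts (Suc i)) w - Y (ts i) w) {..<n}"
      if "0 <= ts 0" "\<And>i. i < n ==> ts i < ts (Suc i)" for ts :: "nat => real" and n
    proof (rule indep_vars_completion)
      show "indep_vars (\<lambda>_. borel) (\<lambda>i w. X (ts (Suc i)) w - X (ts i) w) {..<n}"
        using levy that unfolding levy_process_def by blast
      show "AE w in M. \<forall>i. Y (ts (Suc i)) w - Y (ts i) w = X (ts (Suc i)) w - X (ts i) w"
        using ae by eventually_elim simp
    qed
    show "distr (completion M) borel (\<lambda>w. Y (s + t) w - Y s w) = distr (completion M) borel (Y t)"
      if "0 <= s" "0 <= t" for s t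
    proof -
      have "distr (completion M) borel (\<lambda>w. Y (s + t) w - Y s w) = distr M borel (\<lambda>w. X (s + t) w - X s w)"
        by (rule distr_completion_AE_eq[OF _ aed]) (use that Xm in auto)
      also have "... = distr M borel (X t)" using levy that unfolding levy_process_def by blast
      also have "... = distr (completion M) borel (Y t)"
        by (rule distr_completion_AE_eq[symmetric]) (use that Xm ae in \<open>auto elim: eventually_mono\<close>)
      finally show ?thesis .
    qed
  qed
  then show ?thesis using ae unfolding F_def[abs_def] by blast
qed

lemma laplace_exponent_completion:
  assumes X: "X 1 \<in> borel_measurable M" and ae: "AE w in M. Y 1 w = X 1 w"
  shows "laplace_exponent (completion M) Y = laplace_exponent M X"
proof
  fix \<theta>
  note [measurable] = X
  have "(\<integral>w. exp (\<theta> * Y 1 w) \<partial>completion M) = (\<integral>w. exp (\<theta> * X 1 w) \<partial>completion M)"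
  proof (rule integral_cong_AE)
    have [measurable]: "Y 1 \<in> borel_measurable (completion M)" by (rule measurable_completion_AE_eq[OF X ae])
    show "(\<lambda>w. exp (\<theta> * Y 1 w)) \<in> borel_measurable (completion M)" by measurable
    show "(\<lambda>w. exp (\<theta> * X 1 w)) \<in> borel_measurable (completion M)" by (rule measurable_completion) measurable
    show "AE w in completion M. exp (\<theta> * Y 1 w) = exp (\<theta> * X 1 w)"
      by (rule AE_completion) (use ae in eventually_elim, simp)
  qed
  also have "... = (\<integral>w. exp (\<theta> * X 1 w) \<partial>M)" by (rule integral_completion) measurable
  finally show "laplace_exponent (completion M) Y \<theta> = laplace_exponent M X \<theta>" by (simp add: laplace_exponent_def)
qed

lemma scale_function_cong:
  assumes "laplace_exponent M' Y = laplace_exponent M X"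
  shows "scale_function M' Y W \<longleftrightarrow> scale_function M X W"
  unfolding scale_function_def largest_root_def assms ..

theorem theorem3:
  fixes M :: "'a measure" and X :: "real \<Rightarrow> 'a \<Rightarrow> real" and W :: "real \<Rightarrow> real"
    and L :: "real \<Rightarrow> 'a \<Rightarrow> real" and \<mu> :: "real measure"
  assumes "spectrally_negative_levy M X"
    and "unbounded_variation M X"
    and "\<not> drifts_to_minus_infinity M X"
    and "scale_function M X W"
    and "local_time_at_zero M X L"
    and "prob_space \<mu>" and "sets \<mu> = sets borel" and "measure \<mu> {0<..} = 1"
  shows "solves_S M X \<mu> (T_mu X W L \<mu>) \<and>
    (AE \<omega> in M. (SUP t\<in>{0..real_of_ereal (T_mu X W L \<mu> \<omega>)}. X t \<omega>) = stopped X (T_mu X W L \<mu>) \<omega>)"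
proof -
  have Xm: "X t \<in> borel_measurable M" if "0 <= t" for t
    using assms(1) that by (simp add: spectrally_negative_levy_def levy_process_def)
  define F where "F t = sigma (space M) (completed_filtration M X t)" for t
  have sets_F: "sets (F t) = completed_filtration M X t" for t unfolding F_def by (rule sets_completed_filtration)
  obtain Y where "sn_levy (completion M) Y F" and YX: "AE w in M. \<forall>t. Y t w = X t w"
    using sn_levy_version[OF assms(1)] unfolding F_def[abs_def] by blast
  then interpret c: sn_levy "completion M" Y F by simp
  \<comment> \<open>Path properties transfer in both directions, since \<open>X\<close> and
    \<open>Y\<close> agree at all times simultaneously outside one null set.\<close>
  have AE_Y: "AE w in M. P (\<lambda>t. X t w) w" if "AE w in completion M. P (\<lambda>t. Y t w) w" for P
    using that[unfolded AE_completion_iff] YX by eventually_elim simp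
  have AE_X: "AE w in completion M. P (\<lambda>t. Y t w) w" if "AE w in M. P (\<lambda>t. X t w) w" for P
    unfolding AE_completion_iff using that YX by eventually_elim simp
  have lap: "laplace_exponent (completion M) Y = laplace_exponent M X"
    by (rule laplace_exponent_completion) (use Xm YX in \<open>auto elim: eventually_mono\<close>)
  have "sn_levy_scale (completion M) Y F W"
  proof (rule c.sn_levy_scale_if_scale_function)
    show "\<not> drifts_to_minus_infinity (completion M) Y"
      using assms(3) AE_Y[of "\<lambda>f _. filterlim f at_bot at_top"] unfolding drifts_to_minus_infinity_def by blast
    show "\<not> (AE w in completion M. antimono_on {0..} (\<lambda>t. Y t w))"
      using assms(1) AE_Y[of "\<lambda>f _. antimono_on {0..} f"] unfolding spectrally_negative_levy_def by blast
    show "unbounded_variation (completion M) Y"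
      using assms(2) AE_X[of "\<lambda>f _. \<forall>t>0. infinite_variation_on f t"] unfolding unbounded_variation_def by blast
    show "scale_function (completion M) Y W" using assms(4) by (simp only: scale_function_cong[OF lap])
  qed
  then interpret s: sn_levy_scale "completion M" Y F W .
  have "local_time_at_zero (completion M) Y L"
    using assms(5) AE_X[of "\<lambda>f w. \<forall>t\<ge>0. ((\<lambda>e. measure lborel {s\<in>{0..t}. \<bar>f s\<bar> < e} / (2 * e)) \<longlongrightarrow> L t w) (at_right 0)"]
    unfolding local_time_at_zero_def by blast
  then obtain L' where "sn_levy_local_time (completion M) Y F W L'" and LL: "AE w in completion M. \<forall>t\<ge>0. L' t w = L t w"
    using s.local_time_version by blast
  then interpret l: sn_levy_local_time "completion M" Y F W L' by simp
  note mu = assms(6-8)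
  define b where "b = bm \<mu> W"
  define \<sigma> where "\<sigma> w = real_of_ereal (l.passage b w)" for w
  have \<sigma>_eq: "l.\<sigma> \<mu> = \<sigma>" by (rule ext) (simp add: l.\<sigma>_def[OF mu] \<sigma>_def b_def)
  note bar = l.barrier_beta[OF mu, folded b_def]
  note fin = l.passage_beta_AE[OF mu, folded b_def, unfolded \<sigma>_eq]
  note Ym = l.X_sigma_measurable[OF mu, unfolded \<sigma>_eq]
  define T where "T = T_mu X W L \<mu>"
  have YXc: "AE w in completion M. \<forall>t. Y t w = X t w" by (rule AE_completion[OF YX])
  have phi: "phi_mu W \<mu> v = ereal (b v)" for v
    unfolding b_def by (rule phi_eq[OF mu s.W_mono s.W_nonpos s.W_pos])
  \<comment> \<open>Both infima run over t > 0, where the processes and their versions agree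
    simultaneously, so they are taken over the same set.\<close>
  have T_eq: "AE w in completion M. T w = l.passage b w"
    using YXc LL
  proof eventually_elim
    case (elim w)
    then show ?case unfolding T_def T_mu_def l.passage_def phi by (intro arg_cong[where f=Inf] Collect_cong ex_cong1) auto
  qed
  have XT: "AE w in completion M. stopped X T w = Y (\<sigma> w) w"
    using T_eq YXc by eventually_elim (simp add: stopped_def \<sigma>_def)
  have T_nonneg: "0 <= T w" for w
    unfolding T_def T_mu_def by (rule Inf_greatest) (auto simp: zero_ereal_def[symmetric])
  have stT: "is_stopping_time M X T"
    unfolding is_stopping_time_def
  proof (intro conjI ballI allI impI T_nonneg)
    fix t :: real assume t: "0 <= t"
    show "{w\<in>space M. T w <= ereal t} \<in> completed_filtration M X t"
      unfolding sets_F[symmetric]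
    \<comment> \<open>At t = 0 the event is null, because the passage time is almost surely
      positive.\<close>
    proof (cases "t = 0")
      case True
      show "{w\<in>space M. T w <= ereal t} \<in> sets (F t)"
      proof (rule s.sets_F_AE_eq[OF t sets.empty_sets])
        show "AE w in completion M. w \<in> {w\<in>space M. T w <= ereal t} \<longleftrightarrow> w \<in> {}"
          using T_eq fin by eventually_elim (simp add: True)
      qed auto
    next
      case False
      then have "0 < t" using t by simp
      from l.passage_le_sets[OF bar this]
      show "{w\<in>space M. T w <= ereal t} \<in> sets (F t)"
      proof (rule s.sets_F_AE_eq[OF t])
        show "AE w in completion M. w \<in> {w\<in>space M. T w <= ereal t} \<longleftrightarrow> w \<in> {w\<in>space (completion M). l.passage b w <= ereal t}"
          using T_eq by eventually_elim simp
      qed auto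
    qed
  qed
  have "AE w in completion M. T w < \<infinity>" using T_eq fin by eventually_elim simp
  then have finT: "AE w in M. T w < \<infinity>" by (simp only: AE_completion_iff)
  have XTm: "stopped X T \<in> borel_measurable (completion M)" by (rule l.measurable_M_AE_eq[OF Ym XT])
  have distrT: "distr (completion M) borel (stopped X T) = distr (completion M) borel (\<lambda>w. Y (\<sigma> w) w)"
    by (rule distr_cong_AE[OF refl refl XT XTm Ym])
  have law: "distr (completion M) borel (stopped X T) = \<mu>"
    unfolding distrT by (rule l.distr_X_sigma[OF mu, unfolded \<sigma>_eq])
  have minimal: "AE w in M. R w = T w"
    if R: "is_stopping_time M X R" and le: "AE w in M. R w <= T w"
      and eq: "distr (completion M) borel (stopped X R) = distr (completion M) borel (stopped X T)" for R
  proof -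
    have R0: "0 <= R w" if "w \<in> space (completion M)" for w using R that by (simp add: is_stopping_time_def)
    have Rs: "{w\<in>space (completion M). R w <= ereal t} \<in> sets (completion M)" if "0 <= t" for t
      using R that c.sets_F[OF that] unfolding is_stopping_time_def sets_F by auto
    have Rm: "(\<lambda>w. real_of_ereal (R w)) \<in> borel_measurable (completion M)"
      by (rule l.measurable_random_time) (use R0 Rs in auto)
    have YRm: "(\<lambda>w. Y (real_of_ereal (R w)) w) \<in> borel_measurable (completion M)"
      by (rule c.measurable_X_at[OF Rm]) (use R0 in \<open>auto intro: real_of_ereal_pos\<close>)
    have XR: "AE w in completion M. stopped X R w = Y (real_of_ereal (R w)) w"
      using YXc by eventually_elim (simp add: stopped_def)
    have "distr (completion M) borel (\<lambda>w. Y (real_of_ereal (R w)) w) = distr (completion M) borel (stopped X R)"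
      by (rule distr_cong_AE[symmetric, OF refl refl XR l.measurable_M_AE_eq[OF YRm XR] YRm])
    also have "... = distr (completion M) borel (\<lambda>w. Y (l.\<sigma> \<mu> w) w)" unfolding eq distrT \<sigma>_eq ..
    finally have eq': "distr (completion M) borel (\<lambda>w. Y (real_of_ereal (R w)) w) = distr (completion M) borel (\<lambda>w. Y (l.\<sigma> \<mu> w) w)" .
    have le': "AE w in completion M. R w <= l.passage (bm \<mu> W) w"
      using AE_completion[OF le] T_eq by eventually_elim (simp add: b_def)
    have "AE w in completion M. R w = l.passage b w"
      unfolding b_def by (rule l.passage_minimal[OF mu R0 Rs le' eq'])
    then have "AE w in completion M. R w = T w" using T_eq by eventually_elim simp
    then show ?thesis by (simp only: AE_completion_iff)
  qed
  have "AE w in completion M. (SUP t\<in>{0..real_of_ereal (T w)}. X t w) = stopped X T w"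
    using l.Sup_X_sigma[OF mu, unfolded \<sigma>_eq] T_eq YXc XT
    by eventually_elim (simp add: \<sigma>_def)
  then have sup: "AE w in M. (SUP t\<in>{0..real_of_ereal (T w)}. X t w) = stopped X T w" by (simp only: AE_completion_iff)
  show ?thesis
    unfolding solves_S_def T_def[symmetric]
    using stT finT XTm law minimal sup by blast
qed

end
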